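(* Under the setting described in the context (with $\Omega$ nonempty), the optimal input distribution $F^*$ achieving $C=\sup_{F\in\Omega}I(F)$ is discrete with a finite number of mass points, i.e. $\mathrm{Supp}(F^* )$ is a finite subset of $[0,A]$.
   Context: Fix constants $A>0$ (peak-power constraint), $\varepsilon>0$ (average-power constraint), $E_{th}\ge 0$ (energy-harvesting threshold), $b>0$, $c>0$, and a gain $\kappa=aR_Ph_{1,l}>0$. Channel: $Y=\kappa H_t X+N$, where $X\ge 0$ is the input, $H_t=e^{2X_l}$ with $X_l\sim\mathcal N(\mu_{X_l},\sigma_{X_l}^2)$, $\mu_{X_l}=-\sigma_{X_l}^2$, $\sigma_{X_l}^2>0$ (lognormal fading), $N\sim\mathcal N(0,\sigma_g^2)$, with $X,H_t,N$ mutually independent. Let $p(y|x)$ denote the conditional density of $Y$ given $X=x$. For a probability distribution $F$ on $[0,A]$, let $p(y;F)=\int_0^A p(y|x)\,dF(x)$, the information density $i(x;F)=\int_{\mathbb R} p(y|x)\log_2\frac{p(y|x)}{p(y;F)}\,dy$, and the mutual information $I(F)=\int_0^A i(x;F)\,dF(x)$. Define $\Omega=\{F$ probability distribution supported on $[0,A]$ : $\int_0^A x\,dF(x)\le\varepsilon,\ \int_0^A b x\ln(1+cx)\,dF(x)\ge E_{th}\}$. $\mathrm{Supp}(F)$ is the support of $F$: the set of $x$ such that every open neighborhood of $x$ has positive $F$-measure. *)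

theory Defs
  imports "HOL-Probability.Probability"
begin

text \<open>Channel Y = kappa * H * X + N with H = exp(2 X_l), X_l ~ N(-s2l, s2l) (s2l = variance),
  N ~ N(0, sg^2) (sg = standard deviation).  Conditional density of Y given X = x:\<close>
definition cond_dens :: "real \<Rightarrow> real \<Rightarrow> real \<Rightarrow> real \<Rightarrow> real \<Rightarrow> real" where
  "cond_dens kappa s2l sg x y =
     (\<integral>t. normal_density (- s2l) (sqrt s2l) t * normal_density 0 sg (y - kappa * x * exp (2 * t)) \<partial>lborel)"

definition out_dens :: "real \<Rightarrow> real \<Rightarrow> real \<Rightarrow> real measure \<Rightarrow> real \<Rightarrow> real" where
  "out_dens kappa s2l sg F y = (\<integral>x. cond_dens kappa s2l sg x y \<partial>F)"

definition info_dens :: "real \<Rightarrow> real \<Rightarrow> real \<Rightarrow> real measure \<Rightarrow> real \<Rightarrow> real" where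
  "info_dens kappa s2l sg F x =
     (\<integral>y. cond_dens kappa s2l sg x y *
          log 2 (cond_dens kappa s2l sg x y / out_dens kappa s2l sg F y) \<partial>lborel)"

definition mutual_info :: "real \<Rightarrow> real \<Rightarrow> real \<Rightarrow> real measure \<Rightarrow> real" where
  "mutual_info kappa s2l sg F = (\<integral>x. info_dens kappa s2l sg F x \<partial>F)"

text \<open>Membership in Omega: F is a Borel probability distribution supported on [0,A]
  satisfying the average-power and energy-harvesting constraints.\<close>
definition admissible :: "real \<Rightarrow> real \<Rightarrow> real \<Rightarrow> real \<Rightarrow> real \<Rightarrow> real measure \<Rightarrow> bool" where
  "admissible A eps Eth b c F \<longleftrightarrow>
     prob_space F \<and> sets F = sets borel \<and> emeasure F {0..A} = 1 \<and>
     (\<integral>x. x \<partial>F) \<le> eps \<and> (\<integral>x. b * x * ln (1 + c * x) \<partial>F) \<ge> Eth"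

definition supp :: "real measure \<Rightarrow> real set" where
  "supp F = {x. \<forall>U. open U \<and> x \<in> U \<longrightarrow> emeasure F U > 0}"

end

theory Submission
  imports Defs "HOL-Complex_Analysis.Complex_Analysis" "HOL-Real_Asymp.Real_Asymp"
begin

text \<open>
  Existence is a compactness argument. For finiteness, let \<open>F\<close> be optimal with output density \<open>q\<close> and
  put \<open>L = - ln q\<close>. After rescaling \<open>x\<close> by \<open>kappa\<close>, first-order optimality says that on the support of \<open>F\<close>
  \<open>NN x + JJ L x = \<alpha> + \<beta> x + \<gamma> x ln (1 + c x)\<close>,
  where \<open>- NN x\<close> is the conditional entropy and \<open>JJ L x\<close> the conditional mean of \<open>L\<close>. If the support is
  infinite, it has a limit point in \<open>[0, A]\<close>. Both sides are real analytic for \<open>x > 0\<close>, so in every case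
  the identity holds along a sequence of positive points that tends to \<open>0\<close>.

  At \<open>0\<close> both sides have asymptotic expansions, so their coefficients agree. The coefficients of \<open>JJ L\<close> are
  \<open>psc L n * mm n\<close>, where \<open>mm n = exp (2 s2 (n\<^sup>2 - n))\<close> is the \<open>n\<close>-th moment of the fading gain and
  \<open>psc L n\<close> are the Taylor coefficients of \<open>\<psi>(v) = \<integral> gau (y - v) L(y) dy\<close>, while those of \<open>NN\<close> grow only like
  \<open>C ^ n * n! * exp (s2 n\<^sup>2)\<close>. Hence \<open>\<psi>\<close> extends to an entire function of order zero. It grows at most linearly on the positive axis,
  because the fading has a heavy right tail, so \<open>\<psi>\<close> is affine by Phragmen-Lindelof. But
  \<open>\<psi>(v) + \<psi>(- v)\<close> is at least of order \<open>ln v\<close>, because \<open>q y\<close> decays at least like \<open>1 / y\<^sup>2\<close>, a contradiction.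
\<close>

text \<open>\<open>NN\<close> and \<open>JJ L\<close> come with asymptotic expansions at
  \<open>0\<close> only, because the moments \<open>mm n\<close> grow like exp (2 s2 n^2). So the
  identity is not continued through \<open>0\<close>; only coefficients are compared, and this is
  informative only if those of \<open>NN\<close> are much smaller than \<open>mm n\<close>. Bounding
  coefficient \<open>n\<close> of \<open>NN\<close> through all moments up to order \<open>n\<close>
  gives exp (2 s2 n^2) again and gains nothing. The gain comes from Hermite orthogonality, which
  discards every moment of order above n / 2 and halves the rate; division by \<open>mm n\<close>
  then leaves a decay like exp (- s2 n^2), against which factorials do not matter. Analyticity for
  \<open>x > 0\<close> is seen in the variable \<open>u\<close> with \<open>x = exp (2 * u)\<close>:
  there the lognormal gain acts as a shift of a Gaussian variable, and such a shift can be made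
  complex. The delicate term is the entropy, since it contains ln \<open>pp\<close>: the continued
  density must have a logarithm on a disc whose radius is the same for all outputs \<open>y\<close>.
  This is why the posterior of the fading variable has to concentrate uniformly in
  \<open>y\<close>.\<close>

section \<open>Gaussian densities and integrals with a parameter\<close>

lemma Fubini_swap:
  fixes f :: "'a \<Rightarrow> 'b \<Rightarrow> 'c :: {banach, second_countable_topology}"
  assumes "sigma_finite_measure M1" "sigma_finite_measure M2"
    and meas: "case_prod f \<in> borel_measurable (M1 \<Otimes>\<^sub>M M2)"
    and int1: "AE x in M1. integrable M2 (f x)"
    and int2: "integrable M1 (\<lambda>x. \<integral>y. norm (f x y) \<partial>M2)"
  shows "(\<integral>y. (\<integral>x. f x y \<partial>M1) \<partial>M2) = (\<integral>x. (\<integral>y. f x y \<partial>M2) \<partial>M1)"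
    and "integrable M2 (\<lambda>y. \<integral>x. f x y \<partial>M1)"
    and "integrable M1 (\<lambda>x. \<integral>y. f x y \<partial>M2)"
proof -
  interpret pair_sigma_finite M1 M2
    by (simp add: assms(1,2) pair_sigma_finite_def)
  have *: "integrable (M1 \<Otimes>\<^sub>M M2) (case_prod f)"
    by (rule Fubini_integrable) (use meas int1 int2 in auto)
  from Fubini_integral[OF *] integrable_snd[OF *] integrable_fst[OF *]
  show "(\<integral>y. (\<integral>x. f x y \<partial>M1) \<partial>M2) = (\<integral>x. (\<integral>y. f x y \<partial>M2) \<partial>M1)"
    "integrable M2 (\<lambda>y. \<integral>x. f x y \<partial>M1)" "integrable M1 (\<lambda>x. \<integral>y. f x y \<partial>M2)" by auto
qed

lemma continuous_on_lebesgue_integral: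
  fixes f :: "'a::metric_space \<Rightarrow> 'b \<Rightarrow> 'c::{banach, second_countable_topology}"
  assumes meas: "\<And>x. x \<in> S \<Longrightarrow> f x \<in> borel_measurable M"
    and cont: "\<And>y. y \<in> space M \<Longrightarrow> continuous_on S (\<lambda>x. f x y)"
    and bound: "\<And>x y. x \<in> S \<Longrightarrow> y \<in> space M \<Longrightarrow> norm (f x y) \<le> w y"
    and w: "integrable M w"
  shows "continuous_on S (\<lambda>x. \<integral>y. f x y \<partial>M)"
  unfolding continuous_on_sequentially
proof safe
  fix X a assume a: "a \<in> S" and X: "\<forall>n. X n \<in> S" "X \<longlonglongrightarrow> a"
  show "((\<lambda>x. \<integral>y. f x y \<partial>M) \<circ> X) \<longlonglongrightarrow> (\<integral>y. f a y \<partial>M)"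
    unfolding o_def
  proof (rule integral_dominated_convergence[OF _ _ w])
    show "AE y in M. (\<lambda>n. f (X n) y) \<longlonglongrightarrow> f a y"
      using cont a X by (auto simp: continuous_on_sequentially o_def)
  qed (use meas a X bound in auto)
qed

lemma integrable_inverse_one_plus_square: "integrable lborel (\<lambda>y::real. 1 / (1 + y\<^sup>2))"
proof -
  have "set_integrable lborel UNIV (\<lambda>x::real. inverse (1 + x^2))"
    using integrable_inverse_1_plus_square by simp
  thus ?thesis by (simp add: set_integrable_def inverse_eq_divide)
qed

text \<open>Completing the square turns an exponential tilt of a Gaussian into a multiple of a
  shifted Gaussian. All exponential moments, and with them the lognormal moments \<open>mm\<close>,
  come from here.\<close>

lemma normal_density_mult_exp:
  assumes "\<sigma> > 0"
  shows "normal_density \<mu> \<sigma> t * exp (c * t)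
       = exp (c * \<mu> + c\<^sup>2 * \<sigma>\<^sup>2 / 2) * normal_density (\<mu> + c * \<sigma>\<^sup>2) \<sigma> t"
proof -
  have "- (t - \<mu>)\<^sup>2 / (2 * \<sigma>\<^sup>2) + c * t
      = c * \<mu> + c\<^sup>2 * \<sigma>\<^sup>2 / 2 + - (t - (\<mu> + c * \<sigma>\<^sup>2))\<^sup>2 / (2 * \<sigma>\<^sup>2)"
    using assms by (simp add: field_simps power2_eq_square)
  hence "exp (- (t - \<mu>)\<^sup>2 / (2 * \<sigma>\<^sup>2)) * exp (c * t)
      = exp (c * \<mu> + c\<^sup>2 * \<sigma>\<^sup>2 / 2) * exp (- (t - (\<mu> + c * \<sigma>\<^sup>2))\<^sup>2 / (2 * \<sigma>\<^sup>2))"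
    by (simp only: exp_add [symmetric])
  thus ?thesis by (simp add: normal_density_def)
qed

lemma has_integral_normal_density_exp:
  assumes "\<sigma> > 0"
  shows "has_bochner_integral lborel (\<lambda>t. normal_density \<mu> \<sigma> t * exp (c * t))
           (exp (c * \<mu> + c\<^sup>2 * \<sigma>\<^sup>2 / 2))"
proof -
  have "has_bochner_integral lborel (normal_density (\<mu> + c * \<sigma>\<^sup>2) \<sigma>) 1"
    using assms by (simp add: has_bochner_integral_iff)
  from this have "has_bochner_integral lborel
      (\<lambda>t. exp (c * \<mu> + c\<^sup>2 * \<sigma>\<^sup>2 / 2) * normal_density (\<mu> + c * \<sigma>\<^sup>2) \<sigma> t)
      (exp (c * \<mu> + c\<^sup>2 * \<sigma>\<^sup>2 / 2) * 1)"
    by (rule has_bochner_integral_mult_right)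
  thus ?thesis using assms by (simp add: normal_density_mult_exp)
qed

lemma integrable_normal_density_exp_abs:
  assumes "\<sigma> > 0" "c \<ge> 0"
  shows "integrable lborel (\<lambda>t. normal_density \<mu> \<sigma> t * exp (c * \<bar>t\<bar>))"
proof (rule Bochner_Integration.integrable_bound)
  show "integrable lborel (\<lambda>t. normal_density \<mu> \<sigma> t * exp (c * t) + normal_density \<mu> \<sigma> t * exp ((-c) * t))"
    using has_integral_normal_density_exp[OF assms(1)]
    by (intro Bochner_Integration.integrable_add) (blast intro: has_bochner_integral_iff[THEN iffD1, THEN conjunct1])+
  show "AE t in lborel. norm (normal_density \<mu> \<sigma> t * exp (c * \<bar>t\<bar>)) \<le>
      norm (normal_density \<mu> \<sigma> t * exp (c * t) + normal_density \<mu> \<sigma> t * exp ((-c) * t))"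
  proof (intro AE_I2)
    fix t
    have "0 \<le> normal_density \<mu> \<sigma> t * exp (c * t)" "0 \<le> normal_density \<mu> \<sigma> t * exp ((-c) * t)"
      "0 \<le> normal_density \<mu> \<sigma> t * exp (c * \<bar>t\<bar>)" by simp_all
    thus "norm (normal_density \<mu> \<sigma> t * exp (c * \<bar>t\<bar>)) \<le>
      norm (normal_density \<mu> \<sigma> t * exp (c * t) + normal_density \<mu> \<sigma> t * exp ((-c) * t))"
      by (cases "t \<ge> 0") (simp_all add: abs_of_nonneg)
  qed
qed simp

lemma normal_density_le:
  assumes "\<sigma> > 0"
  shows "normal_density \<mu> \<sigma> x \<le> normal_density 0 \<sigma> 0"
  using assms by (simp add: normal_density_def field_simps)

lemma power_le_fact_exp:
  fixes x :: real assumes "x \<ge> 0"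
  shows "x ^ n \<le> fact n * exp x"
proof -
  have "(\<Sum>k\<in>{n}. x ^ k /\<^sub>R fact k) \<le> (\<Sum>k. x ^ k /\<^sub>R fact k)"
    using assms by (intro sum_le_suminf summable_exp_generic) auto
  hence "x ^ n / fact n \<le> exp x"
    by (simp add: exp_def divide_inverse mult.commute)
  thus ?thesis by (simp add: field_simps)
qed

text \<open>Averaging over the lognormal gain destroys Gaussian decay but not decay faster than
  every power, so decay is recorded in powers of \<open>1 + u^2\<close>. The bound is
  \<open>power_le_fact_exp\<close> at (1 + u^2) / (2 \<sigma>^2).\<close>

lemma normal_density_polynomial_decay:
  assumes "\<sigma> > 0"
  shows "\<exists>K>0. \<forall>u. normal_density 0 \<sigma> u \<le> K / (1 + u\<^sup>2) ^ k"
proof (intro exI conjI allI)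
  let ?K = "normal_density 0 \<sigma> 0 * exp (1 / (2 * \<sigma>\<^sup>2)) * fact k * (2 * \<sigma>\<^sup>2) ^ k"
  show "?K > 0" using assms by (simp add: normal_density_pos)
  fix u :: real
  have "((1 + u\<^sup>2) / (2 * \<sigma>\<^sup>2)) ^ k \<le> fact k * exp ((1 + u\<^sup>2) / (2 * \<sigma>\<^sup>2))"
    by (intro power_le_fact_exp) simp
  hence "(1 + u\<^sup>2) ^ k \<le> fact k * exp ((1 + u\<^sup>2) / (2 * \<sigma>\<^sup>2)) * (2 * \<sigma>\<^sup>2) ^ k"
    using assms by (simp add: power_divide field_simps)
  hence "normal_density 0 \<sigma> u * (1 + u\<^sup>2) ^ k
      \<le> normal_density 0 \<sigma> u * (fact k * exp ((1 + u\<^sup>2) / (2 * \<sigma>\<^sup>2)) * (2 * \<sigma>\<^sup>2) ^ k)"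
    by (intro mult_left_mono) auto
  also have "\<dots> = ?K"
  proof -
    have "exp (- u\<^sup>2 / (2 * \<sigma>\<^sup>2)) * exp ((1 + u\<^sup>2) / (2 * \<sigma>\<^sup>2)) = exp (1 / (2 * \<sigma>\<^sup>2))"
      by (simp add: exp_add [symmetric] add_divide_distrib)
    thus ?thesis by (simp add: normal_density_def field_simps)
  qed
  finally show "normal_density 0 \<sigma> u \<le> ?K / (1 + u\<^sup>2) ^ k"
    by (subst pos_le_divide_eq) (auto intro!: zero_less_power add_pos_nonneg)
qed

text \<open>The difference of the two sides is the sum of squares in the proof. It trades a weight
  in \<open>y\<close> for a weight in \<open>y - v\<close>, at the price of a polynomial in
  \<open>v\<close> that the lognormal moments absorb.\<close>

lemma Peetre_inequality:
  fixes y v :: real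
  shows "1 + y\<^sup>2 \<le> 2 * (1 + (y - v)\<^sup>2) * (1 + v\<^sup>2)"
proof -
  have "0 \<le> 1 + (y - 2 * v)\<^sup>2 + 2 * ((y - v) * v)\<^sup>2" by simp
  thus ?thesis by (simp add: power2_eq_square algebra_simps)
qed

section \<open>The conditional density\<close>

locale lognormal_fading =
  fixes s2 sg :: real
  assumes s2_pos: "s2 > 0" and sg_pos: "sg > 0"
begin

abbreviation lnd :: "real \<Rightarrow> real" where "lnd \<equiv> normal_density (- s2) (sqrt s2)"
abbreviation gau :: "real \<Rightarrow> real" where "gau \<equiv> normal_density 0 sg"
abbreviation pp :: "real \<Rightarrow> real \<Rightarrow> real" where "pp \<equiv> cond_dens 1 s2 sg"

lemma pp_def: "pp x y = (\<integral>t. lnd t * gau (y - x * exp (2 * t)) \<partial>lborel)"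
  by (simp add: cond_dens_def)

text \<open>The gain merely rescales the input, so the kernel can be studied at gain 1.\<close>

lemma cond_dens_eq: "cond_dens kappa s2 sg x y = pp (kappa * x) y"
  by (simp add: cond_dens_def mult.assoc)

lemma sqrt_s2_pos [simp]: "sqrt s2 > 0" "s2 > 0" "s2 \<noteq> 0" "s2 \<ge> 0" "(sqrt s2)\<^sup>2 = s2"
  using s2_pos by auto

lemma sg_simps [simp]: "sg > 0" "sg \<noteq> 0" "sg \<ge> 0"
  using sg_pos by auto

lemma lnd_pos [simp]: "lnd t > 0" and gau_pos [simp]: "gau t > 0"
  by (auto intro: normal_density_pos)

lemma gau_le: "gau u \<le> gau 0"
  by (rule normal_density_le) simp

lemma pp_kernel_integrable [simp]: "integrable lborel (\<lambda>t. lnd t * gau (y - x * exp (2 * t)))"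
proof (rule Bochner_Integration.integrable_bound)
  show "integrable lborel (\<lambda>t. lnd t * gau 0)" by simp
qed (auto intro!: mult_left_mono gau_le AE_I2)

lemma pp_measurable_pair: "(\<lambda>(x, y). pp x y) \<in> borel_measurable (borel \<Otimes>\<^sub>M borel)"
  unfolding pp_def by measurable

lemma pp_measurable [measurable (raw)]:
  "f \<in> borel_measurable M \<Longrightarrow> g \<in> borel_measurable M \<Longrightarrow> (\<lambda>z. pp (f z) (g z)) \<in> borel_measurable M"
  using measurable_compose[OF measurable_Pair pp_measurable_pair] by auto

lemma pp_pos [simp]: "pp x y > 0"
proof -
  have "pp x y \<noteq> 0"
  proof
    assume "pp x y = 0"
    hence "AE t in lborel. lnd t * gau (y - x * exp (2 * t)) = 0"
      unfolding pp_def by (subst (asm) integral_nonneg_eq_0_iff_AE) auto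
    hence "AE t::real in lborel. False"
      by eventually_elim (use lnd_pos gau_pos in \<open>simp add: less_le\<close>)
    thus False by (simp add: AE_iff_measurable[OF _ refl])
  qed
  moreover have "pp x y \<ge> 0" unfolding pp_def by (intro Bochner_Integration.integral_nonneg) auto
  ultimately show ?thesis by simp
qed

lemma pp_nonneg [simp]: "pp x y \<ge> 0" and pp_nonzero [simp]: "pp x y \<noteq> 0"
  using pp_pos[of x y] by linarith+

lemma pp_le: "pp x y \<le> gau 0"
proof -
  have "pp x y \<le> (\<integral>t. lnd t * gau 0 \<partial>lborel)"
    unfolding pp_def by (intro Bochner_Integration.integral_mono) (auto intro!: mult_left_mono gau_le)
  thus ?thesis by simp
qed

lemma continuous_on_pp: "continuous_on S (\<lambda>x. pp x y)"
  unfolding pp_def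
proof (rule continuous_on_lebesgue_integral)
  show "integrable lborel (\<lambda>t. lnd t * gau 0)" by simp
  fix t show "continuous_on S (\<lambda>x. lnd t * gau (y - x * exp (2 * t)))"
    unfolding normal_density_def by (intro continuous_intros) auto
qed (auto intro!: mult_left_mono gau_le)

lemma gau_shift_integrable [simp]: "integrable lborel (\<lambda>y. gau (y - v))"
  and gau_shift_integral [simp]: "(\<integral>y. gau (y - v) \<partial>lborel) = 1"
proof -
  have "(\<lambda>y. gau (y - v)) = normal_density v sg"
    by (auto simp: normal_density_def)
  thus "integrable lborel (\<lambda>y. gau (y - v))" "(\<integral>y. gau (y - v) \<partial>lborel) = 1"
    by simp_all
qed

lemma pp_integrable [simp]: "integrable lborel (pp x)"
  and pp_integral [simp]: "(\<integral>y. pp x y \<partial>lborel) = 1"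
proof -
  note F = Fubini_swap[of lborel lborel "\<lambda>t y. lnd t * gau (y - x * exp (2 * t))"]
  show "integrable lborel (pp x)"
    using F(2) by (simp add: pp_def[abs_def] sigma_finite_lborel)
  show "(\<integral>y. pp x y \<partial>lborel) = 1"
    using F(1) by (simp add: pp_def[abs_def] sigma_finite_lborel)
qed

text \<open>The Gaussian factor decays in \<open>y - v\<close> with
  \<open>v = x * exp (2 * t)\<close>. \<open>Peetre_inequality\<close> converts this into decay in
  \<open>y\<close> times a power of \<open>1 + v^2\<close>, which is at most a constant times exp (4
  k |t|) and hence integrable against the Gaussian weight of \<open>t\<close>.\<close>

lemma pp_upper:
  assumes "B \<ge> 0"
  shows "\<exists>C>0. \<forall>x\<in>{0..B}. \<forall>y. pp x y \<le> C / (1 + y\<^sup>2) ^ k"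
proof -
  obtain K where K: "K > 0" "\<And>u. gau u \<le> K / (1 + u\<^sup>2) ^ k"
    using normal_density_polynomial_decay[of sg k] by auto
  define D where "D = (\<integral>t. lnd t * exp (real (4 * k) * \<bar>t\<bar>) \<partial>lborel)"
  have int: "integrable lborel (\<lambda>t. lnd t * exp (real (4 * k) * \<bar>t\<bar>))"
    by (intro integrable_normal_density_exp_abs) auto
  have D: "D \<ge> 0" unfolding D_def by (intro Bochner_Integration.integral_nonneg) auto
  define c where "c = K * 2 ^ k * (1 + B\<^sup>2) ^ k"
  have c: "c > 0" using K by (auto simp: c_def intro!: mult_pos_pos zero_less_power add_pos_nonneg)
  have "pp x y \<le> (c * D + 1) / (1 + y\<^sup>2) ^ k" if x: "x \<in> {0..B}" for x y
  proof -
    have pw: "gau (y - x * exp (2 * t)) \<le> c * exp (real (4 * k) * \<bar>t\<bar>) / (1 + y\<^sup>2) ^ k" for t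
    proof -
      let ?v = "x * exp (2 * t)"
      have v: "1 + ?v\<^sup>2 \<le> (1 + B\<^sup>2) * exp (4 * \<bar>t\<bar>)"
      proof -
        have "?v\<^sup>2 \<le> B\<^sup>2 * (exp (2 * \<bar>t\<bar>))\<^sup>2"
          using x by (subst power_mult_distrib [symmetric]) (intro power_mono mult_mono, auto)
        also have "(exp (2 * \<bar>t\<bar>))\<^sup>2 = exp (4 * \<bar>t\<bar>)" by (simp add: exp_double [symmetric])
        finally have "?v\<^sup>2 \<le> B\<^sup>2 * exp (4 * \<bar>t\<bar>)" .
        moreover have "1 \<le> exp (4 * \<bar>t\<bar>)" by simp
        ultimately show ?thesis by (simp only: distrib_right mult_1_left add_mono)
      qed
      have "(1 + y\<^sup>2) ^ k \<le> (2 * (1 + (y - ?v)\<^sup>2) * (1 + ?v\<^sup>2)) ^ k"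
        by (intro power_mono Peetre_inequality) auto
      also have "\<dots> = 2 ^ k * (1 + (y - ?v)\<^sup>2) ^ k * (1 + ?v\<^sup>2) ^ k"
        by (simp only: power_mult_distrib)
      also have "\<dots> \<le> 2 ^ k * (1 + (y - ?v)\<^sup>2) ^ k * ((1 + B\<^sup>2) * exp (4 * \<bar>t\<bar>)) ^ k"
        using v by (intro mult_left_mono power_mono) auto
      also have "\<dots> = 2 ^ k * (1 + (y - ?v)\<^sup>2) ^ k * (1 + B\<^sup>2) ^ k * exp (real (4 * k) * \<bar>t\<bar>)"
        by (simp add: power_mult_distrib exp_of_nat_mult [symmetric] mult_ac)
      finally have *: "(1 + y\<^sup>2) ^ k \<le> 2 ^ k * (1 + (y - ?v)\<^sup>2) ^ k * (1 + B\<^sup>2) ^ k * exp (real (4 * k) * \<bar>t\<bar>)" .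
      have pos: "(1 + (y - ?v)\<^sup>2) ^ k > 0" by (intro zero_less_power add_pos_nonneg) auto
      have pos': "(1 + y\<^sup>2) ^ k > 0" by (intro zero_less_power add_pos_nonneg) auto
      have "gau (y - ?v) * (1 + y\<^sup>2) ^ k \<le> (K / (1 + (y - ?v)\<^sup>2) ^ k) *
              (2 ^ k * (1 + (y - ?v)\<^sup>2) ^ k * (1 + B\<^sup>2) ^ k * exp (real (4 * k) * \<bar>t\<bar>))"
        using K pos by (intro mult_mono K(2) *) auto
      also have "\<dots> = c * exp (real (4 * k) * \<bar>t\<bar>)"
        using pos by (simp only: c_def times_divide_eq_left) (simp add: mult_ac less_imp_neq [symmetric] del: power_eq_0_iff)
      finally show ?thesis using pos' by (simp add: field_simps)
    qed
    have "pp x y \<le> (\<integral>t. (c / (1 + y\<^sup>2) ^ k) * (lnd t * exp (real (4 * k) * \<bar>t\<bar>)) \<partial>lborel)"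
      unfolding pp_def
    proof (intro Bochner_Integration.integral_mono integrable_mult_right int pp_kernel_integrable)
      fix t show "lnd t * gau (y - x * exp (2 * t)) \<le> (c / (1 + y\<^sup>2) ^ k) * (lnd t * exp (real (4 * k) * \<bar>t\<bar>))"
        using mult_left_mono[OF pw[of t], of "lnd t"] by (simp add: mult_ac)
    qed
    also have "\<dots> = c * D / (1 + y\<^sup>2) ^ k" by (simp add: D_def)
    also have "\<dots> \<le> (c * D + 1) / (1 + y\<^sup>2) ^ k" by (intro divide_right_mono) auto
    finally show ?thesis .
  qed
  moreover have "c * D + 1 > 0" using c D by (intro add_nonneg_pos) auto
  ultimately show ?thesis by blast
qed

lemma gau_eq: "gau u = gau 0 * exp (- u\<^sup>2 / (2 * sg\<^sup>2))"
  by (simp add: normal_density_def)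

lemma lnd_eq: "lnd t = lnd (- s2) * exp (- (t + s2)\<^sup>2 / (2 * s2))"
  by (simp add: normal_density_def)

lemma pp_ge_interval:
  assumes "a \<le> b" "c \<ge> 0" "d \<ge> 0"
    and "\<And>t. t \<in> {a..b} \<Longrightarrow> c \<le> lnd t" "\<And>t. t \<in> {a..b} \<Longrightarrow> d \<le> gau (y - x * exp (2 * t))"
  shows "(b - a) * (c * d) \<le> pp x y"
proof -
  have "(b - a) * (c * d) = (\<integral>t. c * d * indicator {a..b} t \<partial>lborel)"
    using assms by simp
  also have "\<dots> \<le> pp x y"
    unfolding pp_def
  proof (intro Bochner_Integration.integral_mono pp_kernel_integrable)
    show "integrable lborel (\<lambda>t. c * d * indicator {a..b} t)"
      using assms by (intro integrable_mult_right) (auto intro!: integrable_real_indicator)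
    show "c * d * indicator {a..b} t \<le> lnd t * gau (y - x * exp (2 * t))" for t
      using assms by (cases "t \<in> {a..b}") (auto intro!: mult_mono)
  qed
  finally show ?thesis .
qed

text \<open>Only fading values \<open>t\<close> in \<open>{0..1}\<close> are kept, so the bound is
  Gaussian and holds for both signs of \<open>y\<close>. Its purpose is that ln \<open>pp\<close>
  grows at most quadratically in \<open>y\<close>.\<close>

lemma pp_lower:
  assumes "B \<ge> 0"
  shows "\<exists>C>0. \<forall>x\<in>{0..B}. \<forall>y. exp (- C * (1 + y\<^sup>2)) \<le> pp x y"
proof -
  define R where "R = B * exp 2"
  define c where "c = lnd 1 * gau 0"
  define C where "C = \<bar>ln c\<bar> + R\<^sup>2 / sg\<^sup>2 + 1 / sg\<^sup>2"
  have c: "c > 0" by (simp add: c_def)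
  have "exp (- C * (1 + y\<^sup>2)) \<le> pp x y" if x: "x \<in> {0..B}" for x y
  proof -
    have "(1 - 0) * (lnd 1 * (gau 0 * exp (- (y\<^sup>2 + R\<^sup>2) / sg\<^sup>2))) \<le> pp x y"
    proof (rule pp_ge_interval)
      fix t :: real assume t: "t \<in> {0..1}"
      have "(t + s2)\<^sup>2 \<le> (1 + s2)\<^sup>2" using t by (intro power_mono) auto
      thus "lnd 1 \<le> lnd t"
        by (subst (1 2) lnd_eq) (auto intro!: mult_left_mono divide_right_mono)
      let ?v = "x * exp (2 * t)"
      have "?v \<le> R" unfolding R_def using t x assms by (intro mult_mono) auto
      hence "?v\<^sup>2 \<le> R\<^sup>2" using x by (intro power_mono) auto
      moreover have "(y - ?v)\<^sup>2 \<le> 2 * (y\<^sup>2 + ?v\<^sup>2)"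
        using zero_le_power2[of "y + ?v"] by (simp add: power2_eq_square algebra_simps)
      ultimately have "(y - ?v)\<^sup>2 / (2 * sg\<^sup>2) \<le> 2 * (y\<^sup>2 + R\<^sup>2) / (2 * sg\<^sup>2)"
        by (intro divide_right_mono) auto
      hence "(y - ?v)\<^sup>2 / (2 * sg\<^sup>2) \<le> (y\<^sup>2 + R\<^sup>2) / sg\<^sup>2" by (simp only: mult_divide_mult_cancel_left)
      hence "exp (- (y\<^sup>2 + R\<^sup>2) / sg\<^sup>2) \<le> exp (- (y - ?v)\<^sup>2 / (2 * sg\<^sup>2))"
        by (simp only: exp_le_cancel_iff minus_divide_left [symmetric] neg_le_iff_le)
      thus "gau 0 * exp (- (y\<^sup>2 + R\<^sup>2) / sg\<^sup>2) \<le> gau (y - ?v)"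
        by (subst (2) gau_eq) (auto intro!: mult_left_mono)
    qed auto
    moreover have "exp (- C * (1 + y\<^sup>2)) \<le> c * exp (- (y\<^sup>2 + R\<^sup>2) / sg\<^sup>2)"
    proof -
      have "(y\<^sup>2 + R\<^sup>2) / sg\<^sup>2 \<le> (R\<^sup>2 / sg\<^sup>2 + 1 / sg\<^sup>2) * (1 + y\<^sup>2)"
        by (simp add: field_simps)
      moreover have "\<bar>ln c\<bar> \<le> \<bar>ln c\<bar> * (1 + y\<^sup>2)" by (simp add: algebra_simps)
      moreover have "- C * (1 + y\<^sup>2) = - (\<bar>ln c\<bar> * (1 + y\<^sup>2)) - (R\<^sup>2 / sg\<^sup>2 + 1 / sg\<^sup>2) * (1 + y\<^sup>2)"
        by (simp add: C_def algebra_simps)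
      moreover have "- (y\<^sup>2 + R\<^sup>2) / sg\<^sup>2 = - ((y\<^sup>2 + R\<^sup>2) / sg\<^sup>2)" by (simp only: minus_divide_left)
      moreover have "- \<bar>ln c\<bar> \<le> ln c" by simp
      ultimately have "- C * (1 + y\<^sup>2) \<le> ln c + - (y\<^sup>2 + R\<^sup>2) / sg\<^sup>2"
        by linarith
      hence "exp (- C * (1 + y\<^sup>2)) \<le> exp (ln c + - (y\<^sup>2 + R\<^sup>2) / sg\<^sup>2)" by simp
      thus ?thesis using c by (simp only: exp_add exp_ln)
    qed
    ultimately show ?thesis by (simp add: c_def mult_ac)
  qed
  moreover have "C > 0" unfolding C_def by (intro add_nonneg_pos add_nonneg_nonneg) auto
  ultimately show ?thesis by blast
qed

lemma ln_squared_le: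
  fixes z :: real assumes "z \<ge> 1"
  shows "(ln z)\<^sup>2 \<le> 4 * z"
proof -
  have "ln z = 2 * ln (sqrt z)" using assms by (simp add: ln_sqrt)
  also have "\<dots> \<le> 2 * sqrt z" using ln_le_minus_one[of "sqrt z"] assms by simp
  finally have "(ln z)\<^sup>2 \<le> (2 * sqrt z)\<^sup>2" using assms by (intro power_mono) auto
  thus ?thesis using assms by (simp add: power_mult_distrib)
qed

text \<open>A large output is best explained by a large gain, not by large noise: let
  \<open>x * exp (2 * t)\<close> range over \<open>{y + 1..y + 2}\<close>. The lognormal weight
  there is of the order of the exponential of a multiple of - (ln y)^2, which
  \<open>ln_squared_le\<close> bounds from below by an exponential in \<open>y\<close>. The constant
  degenerates through \<open>ln a\<close> as \<open>a\<close> tends to \<open>0\<close>.\<close>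

lemma pp_lower_right:
  assumes "0 < a" "a \<le> B"
  shows "\<exists>C>0. \<forall>x\<in>{a..B}. \<forall>y\<ge>0. exp (- C * (1 + y)) \<le> pp x y"
proof -
  define T where "T = s2 + (\<bar>ln a\<bar> + \<bar>ln B\<bar>) / 2"
  define c where "c = lnd (- s2) * gau 2 / 2"
  define C where "C = \<bar>ln c\<bar> + T\<^sup>2 / s2 + 2 / s2 + 2"
  have c: "c > 0" by (simp add: c_def)
  have T: "T \<ge> 0" by (simp add: T_def)
  have "exp (- C * (1 + y)) \<le> pp x y" if x: "x \<in> {a..B}" and y: "y \<ge> 0" for x y
  proof -
    \<comment> \<open>With the offsets 1 and 2, \<open>ln (y + 1)\<close> and
      \<open>ln (y + 2)\<close> are nonnegative down to \<open>y = 0\<close>, and the signal stays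
      within distance 2 of \<open>y\<close>.\<close>
    define t1 where "t1 = ln ((y + 1) / x) / 2"
    define t2 where "t2 = ln ((y + 2) / x) / 2"
    have x0: "x > 0" using x assms by auto
    have lnx: "\<bar>ln x\<bar> \<le> \<bar>ln a\<bar> + \<bar>ln B\<bar>"
    proof -
      have "ln a \<le> ln x" "ln x \<le> ln B" using x x0 assms by auto
      thus ?thesis by linarith
    qed
    have len: "t2 - t1 \<ge> 1 / (2 * (y + 2))"
    proof -
      have "ln ((y + 1) / (y + 2)) \<le> (y + 1) / (y + 2) - 1"
        using y by (intro ln_le_minus_one) auto
      also have "\<dots> = - (1 / (y + 2))" using y by (simp add: field_simps)
      finally have "1 / (y + 2) \<le> ln (y + 2) - ln (y + 1)" using y by (simp add: ln_div)
      hence "1 / (y + 2) / 2 \<le> (ln (y + 2) - ln (y + 1)) / 2" by (intro divide_right_mono) auto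
      moreover have "t2 - t1 = (ln (y + 2) - ln (y + 1)) / 2"
        using y x0 by (simp add: t1_def t2_def ln_div field_simps)
      ultimately show ?thesis by (simp add: mult.commute)
    qed
    have t12: "t1 \<le> t2" using len y by (smt (verit) divide_nonneg_nonneg)
    have *: "(t2 - t1) * (lnd (- s2) * exp (- (T\<^sup>2 + y + 2) / s2) * gau 2) \<le> pp x y"
    proof (rule pp_ge_interval[OF t12])
      fix t :: real assume t: "t \<in> {t1..t2}"
      have "exp (2 * t1) \<le> exp (2 * t)" "exp (2 * t) \<le> exp (2 * t2)" using t by auto
      hence e: "(y + 1) / x \<le> exp (2 * t)" "exp (2 * t) \<le> (y + 2) / x"
        using x0 y by (auto simp: t1_def t2_def)
      hence "y + 1 \<le> x * exp (2 * t)" "x * exp (2 * t) \<le> y + 2"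
        using x0 by (auto simp: field_simps)
      hence "\<bar>y - x * exp (2 * t)\<bar> \<le> \<bar>2\<bar>" by linarith
      hence "(y - x * exp (2 * t))\<^sup>2 \<le> 2\<^sup>2" by (subst (asm) abs_le_square_iff)
      hence "(y - x * exp (2 * t))\<^sup>2 / (2 * sg\<^sup>2) \<le> 2\<^sup>2 / (2 * sg\<^sup>2)" by (intro divide_right_mono) auto
      thus "gau 2 \<le> gau (y - x * exp (2 * t))"
        by (subst (1 2) gau_eq) (auto intro!: mult_left_mono)
      have "\<bar>t\<bar> \<le> (\<bar>ln x\<bar> + ln (y + 2)) / 2"
      proof -
        have "t1 = (ln (y + 1) - ln x) / 2" "t2 = (ln (y + 2) - ln x) / 2"
          using x0 y by (auto simp: t1_def t2_def ln_div)
        moreover have "0 \<le> ln (y + 1)" using y by auto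
        moreover have "0 \<le> ln (y + 2)" using y by auto
        ultimately show ?thesis using t by auto
      qed
      hence "\<bar>t + s2\<bar> \<le> T + ln (y + 2) / 2" using lnx s2_pos abs_triangle_ineq[of t s2] unfolding T_def by argo
      hence "(t + s2)\<^sup>2 \<le> (T + ln (y + 2) / 2)\<^sup>2"
        using T y by (intro power2_le_iff_abs_le[THEN iffD2]) auto
      also have "\<dots> \<le> 2 * T\<^sup>2 + (ln (y + 2))\<^sup>2 / 2"
        using zero_le_power2[of "T - ln (y + 2) / 2"] by (simp add: power2_eq_square algebra_simps)
      also have "\<dots> \<le> 2 * (T\<^sup>2 + y + 2)" using ln_squared_le[of "y + 2"] y by simp
      finally have "(t + s2)\<^sup>2 / (2 * s2) \<le> 2 * (T\<^sup>2 + y + 2) / (2 * s2)"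
        by (intro divide_right_mono) auto
      hence "exp (- (T\<^sup>2 + y + 2) / s2) \<le> exp (- (t + s2)\<^sup>2 / (2 * s2))"
        by (simp only: exp_le_cancel_iff minus_divide_left [symmetric] neg_le_iff_le)
      thus "lnd (- s2) * exp (- (T\<^sup>2 + y + 2) / s2) \<le> lnd t"
        by (subst (2) lnd_eq) (auto intro!: mult_left_mono)
    qed auto
    have "exp (- C * (1 + y)) \<le> exp (ln c + - (T\<^sup>2 + y + 2) / s2 + - (y + 2))"
    proof -
      have "\<bar>ln c\<bar> \<le> \<bar>ln c\<bar> * (1 + y)" using y by (simp add: algebra_simps)
      moreover have "(T\<^sup>2 + y + 2) / s2 \<le> (T\<^sup>2 / s2 + 2 / s2) * (1 + y)"
        using y by (simp add: field_simps)
      moreover have "y + 2 \<le> 2 * (1 + y)" using y by simp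
      moreover have "- C * (1 + y) = - (\<bar>ln c\<bar> * (1 + y)) - (T\<^sup>2 / s2 + 2 / s2) * (1 + y) - 2 * (1 + y)"
        by (simp add: C_def algebra_simps)
      moreover have "- (T\<^sup>2 + y + 2) / s2 = - ((T\<^sup>2 + y + 2) / s2)" by (simp only: minus_divide_left)
      moreover have "- \<bar>ln c\<bar> \<le> ln c" by simp
      ultimately have "- C * (1 + y) \<le> ln c + - (T\<^sup>2 + y + 2) / s2 + - (y + 2)"
        by linarith
      thus ?thesis by simp
    qed
    also have "\<dots> = exp (- (y + 2)) / 2 * (lnd (- s2) * exp (- (T\<^sup>2 + y + 2) / s2) * gau 2)"
      using c by (simp only: exp_add exp_ln) (simp add: c_def)
    also have "\<dots> \<le> (t2 - t1) * (lnd (- s2) * exp (- (T\<^sup>2 + y + 2) / s2) * gau 2)"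
    proof (intro mult_right_mono)
      have "y + 2 \<le> exp (y + 2)" using exp_ge_add_one_self[of "y + 2"] by linarith
      hence "exp (- (y + 2)) \<le> 1 / (y + 2)"
        unfolding exp_minus inverse_eq_divide using y by (intro divide_left_mono) auto
      hence "exp (- (y + 2)) / 2 \<le> 1 / (y + 2) / 2" by (rule divide_right_mono) simp
      also have "\<dots> = 1 / (2 * (y + 2))" by simp
      finally show "exp (- (y + 2)) / 2 \<le> t2 - t1" using len by linarith
    qed auto
    finally show ?thesis using * by linarith
  qed
  moreover have "C > 0" unfolding C_def by (intro add_nonneg_pos add_nonneg_nonneg) auto
  ultimately show ?thesis by blast
qed

end

section \<open>Entropy and the first-order condition\<close>

lemma abs_ln_le:
  fixes u C M y :: real
  assumes "exp (- C * (1 + y\<^sup>2)) \<le> u" "u \<le> M" "C > 0"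
  shows "\<bar>ln u\<bar> \<le> (C + \<bar>ln M\<bar>) * (1 + y\<^sup>2)"
proof -
  have u: "u > 0" using assms(1) exp_gt_zero[of "- C * (1 + y\<^sup>2)"] by linarith
  have "- C * (1 + y\<^sup>2) \<le> ln u" using assms(1) u by (subst ln_ge_iff) auto
  moreover have "ln u \<le> ln M" using u assms(2) by auto
  moreover have "\<bar>ln M\<bar> \<le> \<bar>ln M\<bar> * (1 + y\<^sup>2)" "0 \<le> C * (1 + y\<^sup>2)"
    using assms(3) by (auto simp: algebra_simps)
  moreover have "(C + \<bar>ln M\<bar>) * (1 + y\<^sup>2) = C * (1 + y\<^sup>2) + \<bar>ln M\<bar> * (1 + y\<^sup>2)"
    by (simp add: algebra_simps)
  moreover have "- C * (1 + y\<^sup>2) = - (C * (1 + y\<^sup>2))" by simp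
  ultimately show ?thesis by linarith
qed

context lognormal_fading
begin

definition NN :: "real \<Rightarrow> real" where
  "NN x = (\<integral>y. pp x y * ln (pp x y) \<partial>lborel)"

definition JJ :: "(real \<Rightarrow> real) \<Rightarrow> real \<Rightarrow> real" where
  "JJ L x = (\<integral>y. pp x y * L y \<partial>lborel)"

text \<open>Decay of order two in \<open>1 + y^2\<close> leaves an integrable 1 / (1 + y^2) after
  one factor is spent on \<open>G\<close>. Quadratic growth is exactly what \<open>pp_lower\<close>
  gives for the logarithms of \<open>pp\<close> and of the output density.\<close>

lemma
  assumes B: "B \<ge> 0"
    and meas: "\<And>x. x \<in> {0..B} \<Longrightarrow> G x \<in> borel_measurable borel"
    and bound: "\<And>x y. x \<in> {0..B} \<Longrightarrow> \<bar>G x y\<bar> \<le> D * (1 + y\<^sup>2)"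
  shows integrable_pp_mult: "x \<in> {0..B} \<Longrightarrow> integrable lborel (\<lambda>y. pp x y * G x y)"
    and continuous_on_integral_pp: "(\<And>y. continuous_on {0..B} (\<lambda>x. G x y)) \<Longrightarrow>
          continuous_on {0..B} (\<lambda>x. \<integral>y. pp x y * G x y \<partial>lborel)"
proof -
  obtain C where C: "C > 0" "\<And>x y. x \<in> {0..B} \<Longrightarrow> pp x y \<le> C / (1 + y\<^sup>2) ^ 2"
    using pp_upper[OF B, of 2] by auto
  have w: "integrable lborel (\<lambda>y. (C * D) * (1 / (1 + y\<^sup>2)))"
    by (intro integrable_mult_right integrable_inverse_one_plus_square)
  have bd: "\<bar>pp x y * G x y\<bar> \<le> (C * D) * (1 / (1 + y\<^sup>2))" if x: "x \<in> {0..B}" for x y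
  proof -
    have p: "1 + y\<^sup>2 > 0" by (simp add: add_pos_nonneg)
    have "\<bar>pp x y * G x y\<bar> \<le> C / (1 + y\<^sup>2) ^ 2 * (D * (1 + y\<^sup>2))"
      unfolding abs_mult using C(1) C(2)[OF x] bound[OF x] p by (intro mult_mono) auto
    also have "\<dots> = (C * D) * (1 / (1 + y\<^sup>2))" using p by (simp add: power2_eq_square[of "1 + y\<^sup>2"])
    finally show ?thesis .
  qed
  show "integrable lborel (\<lambda>y. pp x y * G x y)" if x: "x \<in> {0..B}"
  proof (rule Bochner_Integration.integrable_bound[OF w])
    show "AE y in lborel. norm (pp x y * G x y) \<le> norm ((C * D) * (1 / (1 + y\<^sup>2)))"
      using order_trans[OF bd[OF x] abs_ge_self] by (intro AE_I2) (simp only: real_norm_def)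
  qed (use meas[OF x] in measurable)
  show "continuous_on {0..B} (\<lambda>x. \<integral>y. pp x y * G x y \<partial>lborel)"
    if "\<And>y. continuous_on {0..B} (\<lambda>x. G x y)"
  proof (rule continuous_on_lebesgue_integral[OF _ _ _ w])
    show "(\<lambda>y. pp x y * G x y) \<in> borel_measurable lborel" if "x \<in> {0..B}" for x
      using meas[OF that] by measurable
    show "continuous_on {0..B} (\<lambda>x. pp x y * G x y)" for y
      by (intro continuous_intros continuous_on_pp that)
    show "norm (pp x y * G x y) \<le> C * D * (1 / (1 + y\<^sup>2))" if "x \<in> {0..B}" for x y
      using bd[OF that] by simp
  qed
qed

lemma abs_ln_pp_le:
  assumes "B \<ge> 0"
  shows "\<exists>D>0. \<forall>x\<in>{0..B}. \<forall>y. \<bar>ln (pp x y)\<bar> \<le> D * (1 + y\<^sup>2)"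
proof -
  obtain C where C: "C > 0" "\<And>x y. x \<in> {0..B} \<Longrightarrow> exp (- C * (1 + y\<^sup>2)) \<le> pp x y"
    using pp_lower[OF assms] by blast
  have "\<bar>ln (pp x y)\<bar> \<le> (C + \<bar>ln (gau 0)\<bar>) * (1 + y\<^sup>2)" if "x \<in> {0..B}" for x y
    using C that pp_le by (intro abs_ln_le) auto
  thus ?thesis using C(1) by (intro exI[of _ "C + \<bar>ln (gau 0)\<bar>"]) auto
qed

lemma
  assumes "B \<ge> 0"
  shows continuous_on_NN: "continuous_on {0..B} NN"
    and integrable_NN: "x \<in> {0..B} \<Longrightarrow> integrable lborel (\<lambda>y. pp x y * ln (pp x y))"
proof -
  obtain D where D: "\<And>x y. x \<in> {0..B} \<Longrightarrow> \<bar>ln (pp x y)\<bar> \<le> D * (1 + y\<^sup>2)"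
    using abs_ln_pp_le[OF assms] by blast
  have "continuous_on {0..B} (\<lambda>x. ln (pp x y))" for y
    by (intro continuous_intros continuous_on_pp) auto
  thus "continuous_on {0..B} NN" unfolding NN_def[abs_def]
    using D by (intro continuous_on_integral_pp[OF assms, where D = D]) simp_all
  show "x \<in> {0..B} \<Longrightarrow> integrable lborel (\<lambda>y. pp x y * ln (pp x y))"
    using D by (intro integrable_pp_mult[OF assms, where D = D and G = "\<lambda>x y. ln (pp x y)"]) simp_all
qed

lemma
  assumes "B \<ge> 0" "L \<in> borel_measurable borel" "\<And>y. \<bar>L y\<bar> \<le> D * (1 + y\<^sup>2)"
  shows continuous_on_JJ: "continuous_on {0..B} (JJ L)"
    and integrable_JJ: "x \<in> {0..B} \<Longrightarrow> integrable lborel (\<lambda>y. pp x y * L y)"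
  unfolding JJ_def[abs_def]
  using continuous_on_integral_pp[of B "\<lambda>x. L" D] integrable_pp_mult[of B "\<lambda>x. L" D x] assms
  by simp_all

lemma NN_measurable [measurable]: "NN \<in> borel_measurable borel"
  unfolding NN_def[abs_def] by measurable

lemma JJ_measurable [measurable]:
  assumes [measurable]: "L \<in> borel_measurable borel"
  shows "JJ L \<in> borel_measurable borel"
  unfolding JJ_def[abs_def] by measurable

end

section \<open>Mutual information of a fixed input and its first-order condition\<close>

locale fading_input = lognormal_fading +
  fixes kappa A :: real and F :: "real measure"
  assumes kappa_pos: "kappa > 0" and A_pos: "A > 0"
    and prob_F: "prob_space F" and sets_F [measurable_cong]: "sets F = sets borel"
    and supported_F: "AE x in F. x \<in> {0..A}"
begin

sublocale prob_space F by (rule prob_F)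

abbreviation q :: "real \<Rightarrow> real" where "q \<equiv> out_dens kappa s2 sg F"

definition L :: "real \<Rightarrow> real" where "L y = - ln (q y)"

text \<open>The output density of the signed measure that has density \<open>h\<close> with respect
  to \<open>F\<close>, that is, the change of the output density when the input is perturbed in
  direction \<open>h\<close>.\<close>

definition qh :: "(real \<Rightarrow> real) \<Rightarrow> real \<Rightarrow> real" where
  "qh h y = (\<integral>x. h x * pp (kappa * x) y \<partial>F)"

lemma space_F [simp]: "space F = UNIV"
  using sets_eq_imp_space_eq[OF sets_F] by simp

lemma kappa_A_nonneg [simp]: "kappa * A \<ge> 0"
  using kappa_pos A_pos by simp

lemma kappa_mult_mem: "x \<in> {0..A} \<Longrightarrow> kappa * x \<in> {0..kappa * A}"
  using kappa_pos by auto

lemma q_def: "q y = (\<integral>x. pp (kappa * x) y \<partial>F)"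
  by (simp only: out_dens_def cond_dens_eq[of kappa])

lemma q_measurable [measurable]: "q \<in> borel_measurable borel"
  unfolding q_def[abs_def] by measurable

lemma L_measurable [measurable]: "L \<in> borel_measurable borel"
  unfolding L_def[abs_def] by measurable

lemma prob_UNIV [simp]: "prob UNIV = 1"
  using prob_space by simp

lemma integrable_bounded:
  fixes f :: "real \<Rightarrow> real" and K :: real
  assumes "f \<in> borel_measurable borel" "\<And>x. x \<in> {0..A} \<Longrightarrow> \<bar>f x\<bar> \<le> K"
  shows "integrable F f"
  by (rule integrable_const_bound[where B = K])
     (use assms in \<open>auto intro!: eventually_mono[OF supported_F] simp del: atLeastAtMost_iff\<close>)

lemma integrable_pp_F [simp]: "integrable F (\<lambda>x. pp (kappa * x) y)"
  by (rule integrable_bounded[where K = "gau 0"]) (auto intro: pp_le)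

lemma integrable_h_pp:
  assumes "h \<in> borel_measurable borel" "\<And>x. \<bar>h x\<bar> \<le> H"
  shows "integrable F (\<lambda>x. h x * pp (kappa * x) y)"
proof (rule integrable_bounded[where K = "H * gau 0"])
  show "\<bar>h x * pp (kappa * x) y\<bar> \<le> H * gau 0" for x
    unfolding abs_mult using assms(2) order_trans[OF abs_ge_zero assms(2)] pp_le by (intro mult_mono) auto
qed (use assms in measurable)

lemma q_ge:
  assumes "\<And>x. x \<in> {0..kappa * A} \<Longrightarrow> c \<le> pp x y"
  shows "c \<le> q y"
proof -
  have "(\<integral>x. c \<partial>F) \<le> q y" unfolding q_def
    by (intro integral_mono_AE eventually_mono[OF supported_F] assms kappa_mult_mem) simp_all
  thus ?thesis by (simp add: prob_space)
qed

lemma q_le: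
  assumes "\<And>x. x \<in> {0..kappa * A} \<Longrightarrow> pp x y \<le> c"
  shows "q y \<le> c"
proof -
  have "q y \<le> (\<integral>x. c \<partial>F)" unfolding q_def
    by (intro integral_mono_AE eventually_mono[OF supported_F] assms kappa_mult_mem) simp_all
  thus ?thesis by (simp add: prob_space)
qed

lemma q_pos [simp]: "q y > 0"
proof -
  obtain C where "\<And>x y. x \<in> {0..kappa * A} \<Longrightarrow> exp (- C * (1 + y\<^sup>2)) \<le> pp x y"
    using pp_lower[OF kappa_A_nonneg] by blast
  from q_ge[OF this, of y] show ?thesis using exp_gt_zero less_le_trans by blast
qed

lemma q_simps [simp]: "q y \<ge> 0" "q y \<noteq> 0"
  using q_pos[of y] by linarith+

lemma abs_ln_q_le:
  assumes "C > 0" "\<And>x y. x \<in> {0..kappa * A} \<Longrightarrow> exp (- C * (1 + y\<^sup>2)) \<le> pp x y"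
  shows "\<bar>ln (q y)\<bar> \<le> (C + \<bar>ln (gau 0)\<bar>) * (1 + y\<^sup>2)"
  using assms by (intro abs_ln_le q_ge q_le pp_le) auto

lemma abs_L_le: "\<exists>D>0. \<forall>y. \<bar>L y\<bar> \<le> D * (1 + y\<^sup>2)"
proof -
  obtain C where "C > 0" "\<And>x y. x \<in> {0..kappa * A} \<Longrightarrow> exp (- C * (1 + y\<^sup>2)) \<le> pp x y"
    using pp_lower[OF kappa_A_nonneg] by blast
  from abs_ln_q_le[OF this] this(1) show ?thesis
    by (intro exI[of _ "C + \<bar>ln (gau 0)\<bar>"]) (auto simp: L_def)
qed

text \<open>Fubini carries a pairing with the output function \<open>G\<close> back to the input,
  where \<open>JJ G\<close> is the conditional mean of \<open>G\<close>. With \<open>G = L\<close>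
  this is the directional derivative of the output entropy.\<close>

lemma
  fixes G :: "real \<Rightarrow> real"
  assumes h [measurable]: "h \<in> borel_measurable borel" and hb: "\<And>x. \<bar>h x\<bar> \<le> H"
    and G [measurable]: "G \<in> borel_measurable borel" and Gb: "\<And>y. \<bar>G y\<bar> \<le> D * (1 + y\<^sup>2)"
  shows integral_qh: "(\<integral>y. qh h y * G y \<partial>lborel) = (\<integral>x. h x * JJ G (kappa * x) \<partial>F)"
    and integrable_qh: "integrable lborel (\<lambda>y. qh h y * G y)"
proof -
  let ?f = "\<lambda>x y. h x * pp (kappa * x) y * G y"
  have int: "AE x in F. integrable lborel (?f x)"
    using supported_F
  proof eventually_elim
    case (elim x)
    from integrable_JJ[OF kappa_A_nonneg G Gb kappa_mult_mem[OF elim]]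
    show ?case by (simp add: mult.assoc)
  qed
  have "continuous_on {0..kappa * A} (JJ (\<lambda>y. \<bar>G y\<bar>))"
    using Gb by (intro continuous_on_JJ[where D = D]) auto
  then obtain K where K: "\<And>x. x \<in> {0..kappa * A} \<Longrightarrow> \<bar>JJ (\<lambda>y. \<bar>G y\<bar>) x\<bar> \<le> K"
    using compact_imp_bounded[OF compact_continuous_image[OF _ compact_Icc]]
    by (fastforce simp: bounded_iff)
  have eq: "(\<integral>y. norm (?f x y) \<partial>lborel) = \<bar>h x\<bar> * JJ (\<lambda>y. \<bar>G y\<bar>) (kappa * x)" for x
    by (simp add: JJ_def abs_mult mult.assoc)
  have "integrable F (\<lambda>x. \<bar>h x\<bar> * JJ (\<lambda>y. \<bar>G y\<bar>) (kappa * x))"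
  proof (rule integrable_bounded)
    fix x assume x: "x \<in> {0..A}"
    have "H \<ge> 0" using hb[of 0] by linarith
    thus "\<bar>\<bar>h x\<bar> * JJ (\<lambda>y. \<bar>G y\<bar>) (kappa * x)\<bar> \<le> H * K"
      using hb K[OF kappa_mult_mem[OF x]] unfolding abs_mult by (intro mult_mono) auto
  qed measurable
  hence int2: "integrable F (\<lambda>x. \<integral>y. norm (?f x y) \<partial>lborel)" by (simp only: eq)
  have meas: "case_prod ?f \<in> borel_measurable (F \<Otimes>\<^sub>M lborel)" by measurable
  note Fub = Fubini_swap[OF sigma_finite_measure_axioms sigma_finite_lborel meas int int2]
  have eq1: "(\<integral>x. ?f x y \<partial>F) = qh h y * G y" for y
    by (simp add: qh_def)
  have eq2: "(\<integral>y. ?f x y \<partial>lborel) = h x * JJ G (kappa * x)" for x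
    by (simp add: JJ_def mult.assoc)
  show "(\<integral>y. qh h y * G y \<partial>lborel) = (\<integral>x. h x * JJ G (kappa * x) \<partial>F)"
    using Fub(1) by (simp only: eq1 eq2)
  show "integrable lborel (\<lambda>y. qh h y * G y)"
    using Fub(2) by (simp only: eq1)
qed

lemma qh_1: "qh (\<lambda>_. 1) = q"
  by (simp add: qh_def q_def fun_eq_iff)

lemma JJ_1: "JJ (\<lambda>_. 1) x = 1"
  by (simp add: JJ_def)

lemma
  shows integral_q_L: "(\<integral>y. q y * ln (q y) \<partial>lborel) = - (\<integral>x. JJ L (kappa * x) \<partial>F)"
    and integrable_q_L: "integrable lborel (\<lambda>y. q y * ln (q y))"
    and integrable_q: "integrable lborel q" and integral_q: "(\<integral>y. q y \<partial>lborel) = 1"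
proof -
  obtain D where D: "\<And>y. \<bar>L y\<bar> \<le> D * (1 + y\<^sup>2)" using abs_L_le by blast
  note * = integral_qh[of "\<lambda>_. 1" 1 L D] integrable_qh[of "\<lambda>_. 1" 1 L D]
  have eq: "(\<lambda>y. q y * ln (q y)) = (\<lambda>y. - (q y * L y))" by (simp add: L_def)
  show "(\<integral>y. q y * ln (q y) \<partial>lborel) = - (\<integral>x. JJ L (kappa * x) \<partial>F)"
    unfolding eq using *(1) D by (simp add: qh_1)
  show "integrable lborel (\<lambda>y. q y * ln (q y))"
    unfolding eq using *(2) D by (simp add: qh_1)
  note ** = integral_qh[of "\<lambda>_. 1" 1 "\<lambda>_. 1" 1] integrable_qh[of "\<lambda>_. 1" 1 "\<lambda>_. 1" 1]
  show "integrable lborel q" "(\<integral>y. q y \<partial>lborel) = 1" using ** by (simp_all add: qh_1 JJ_1 prob_space)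
qed

lemma integrable_NN_F: "integrable F (\<lambda>x. NN (kappa * x))"
  and integrable_JJ_F: "integrable F (\<lambda>x. JJ L (kappa * x))"
proof -
  have *: "\<exists>K. \<forall>x\<in>{0..kappa * A}. \<bar>f x\<bar> \<le> K" if "continuous_on {0..kappa * A} f" for f :: "real \<Rightarrow> real"
    using compact_imp_bounded[OF compact_continuous_image[OF that compact_Icc]]
    by (fastforce simp: bounded_iff)
  obtain D where D: "\<And>y. \<bar>L y\<bar> \<le> D * (1 + y\<^sup>2)" using abs_L_le by blast
  obtain K1 where "\<And>x. x \<in> {0..kappa * A} \<Longrightarrow> \<bar>NN x\<bar> \<le> K1"
    using *[OF continuous_on_NN[OF kappa_A_nonneg]] by blast
  thus "integrable F (\<lambda>x. NN (kappa * x))"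
    by (intro integrable_bounded[where K = K1]) (auto intro: kappa_mult_mem simp del: atLeastAtMost_iff)
  obtain K2 where "\<And>x. x \<in> {0..kappa * A} \<Longrightarrow> \<bar>JJ L x\<bar> \<le> K2"
    using *[OF continuous_on_JJ[OF kappa_A_nonneg L_measurable D]] by blast
  thus "integrable F (\<lambda>x. JJ L (kappa * x))"
    by (intro integrable_bounded[where K = K2]) (auto intro: kappa_mult_mem simp del: atLeastAtMost_iff)
qed

lemma info_dens_eq:
  assumes "x \<in> {0..A}"
  shows "info_dens kappa s2 sg F x = (NN (kappa * x) + JJ L (kappa * x)) / ln 2"
proof -
  obtain D where D: "\<And>y. \<bar>L y\<bar> \<le> D * (1 + y\<^sup>2)" using abs_L_le by blast
  note int = integrable_NN[OF kappa_A_nonneg kappa_mult_mem[OF assms]]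
    integrable_JJ[OF kappa_A_nonneg L_measurable D kappa_mult_mem[OF assms]]
  have "info_dens kappa s2 sg F x
      = (\<integral>y. (pp (kappa * x) y * ln (pp (kappa * x) y) + pp (kappa * x) y * L y) / ln 2 \<partial>lborel)"
    unfolding info_dens_def cond_dens_eq[of kappa]
    by (intro Bochner_Integration.integral_cong refl) (simp add: log_def L_def ln_div field_simps)
  also have "\<dots> = (NN (kappa * x) + JJ L (kappa * x)) / ln 2"
    using int by (simp add: NN_def JJ_def)
  finally show ?thesis .
qed

lemma mutual_info_eq:
  "mutual_info kappa s2 sg F * ln 2 = (\<integral>x. NN (kappa * x) \<partial>F) - (\<integral>y. q y * ln (q y) \<partial>lborel)"
proof -
  have "mutual_info kappa s2 sg F = (\<integral>x. (NN (kappa * x) + JJ L (kappa * x)) / ln 2 \<partial>F)"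
    unfolding mutual_info_def
  proof (rule integral_cong_AE)
    show "info_dens kappa s2 sg F \<in> borel_measurable F"
      unfolding info_dens_def[abs_def] cond_dens_eq[of kappa] by measurable
    show "AE x in F. info_dens kappa s2 sg F x = (NN (kappa * x) + JJ L (kappa * x)) / ln 2"
      using supported_F by eventually_elim (rule info_dens_eq)
  qed measurable
  thus ?thesis using integrable_NN_F integrable_JJ_F integral_q_L by simp
qed

text \<open>Concavity of mutual information is not needed: perturbing \<open>F\<close> by a bounded density
  \<open>1 + \<theta> h\<close> costs at most \<open>\<theta>\<^sup>2\<close> beyond the first-order term.\<close>

lemma fading_input_density:
  assumes h [measurable]: "h \<in> borel_measurable borel" and hb: "\<And>x. \<bar>h x\<bar> \<le> 1 / 2"
    and h0: "(\<integral>x. h x \<partial>F) = 0" and \<theta>: "0 \<le> \<theta>" "\<theta> \<le> 1"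
  defines "G \<equiv> density F (\<lambda>x. ennreal (1 + \<theta> * h x))"
  shows "fading_input s2 sg kappa A G"
    and "f \<in> borel_measurable borel \<Longrightarrow> integrable F f \<Longrightarrow>
           (\<integral>x. f x \<partial>G) = (\<integral>x. f x \<partial>F) + \<theta> * (\<integral>x. h x * f x \<partial>F)"
proof -
  have pos: "1 + \<theta> * h x \<ge> 0" for x
  proof -
    have "\<bar>\<theta> * h x\<bar> \<le> 1 * (1 / 2)" unfolding abs_mult using \<theta> hb[of x] by (intro mult_mono) auto
    thus ?thesis by linarith
  qed
  have int: "(\<integral>x. f x \<partial>G) = (\<integral>x. f x \<partial>F) + \<theta> * (\<integral>x. h x * f x \<partial>F)"
    if [measurable]: "f \<in> borel_measurable borel" and f: "integrable F f" for f :: "real \<Rightarrow> real"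
  proof -
    have hf: "integrable F (\<lambda>x. h x * f x)"
    proof (rule Bochner_Integration.integrable_bound[OF f])
      show "AE x in F. norm (h x * f x) \<le> norm (f x)"
        using hb by (intro AE_I2) (auto simp: abs_mult intro!: mult_left_le_one_le order_trans[OF hb])
    qed measurable
    have "(\<integral>x. f x \<partial>G) = (\<integral>x. (1 + \<theta> * h x) * f x \<partial>F)"
      unfolding G_def using pos by (subst integral_real_density) auto
    also have "\<dots> = (\<integral>x. f x + \<theta> * (h x * f x) \<partial>F)" by (simp add: algebra_simps)
    finally show ?thesis using f hf by simp
  qed
  show "f \<in> borel_measurable borel \<Longrightarrow> integrable F f \<Longrightarrow>
           (\<integral>x. f x \<partial>G) = (\<integral>x. f x \<partial>F) + \<theta> * (\<integral>x. h x * f x \<partial>F)"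
    by (rule int)
  show "fading_input s2 sg kappa A G"
  proof (rule fading_input.intro[OF lognormal_fading_axioms], unfold fading_input_axioms_def, intro conjI)
    have hi: "integrable F h" by (rule integrable_bounded[where K = "1/2"]) (use hb in auto)
    have "emeasure G (space G) = (\<integral>\<^sup>+x. ennreal (1 + \<theta> * h x) \<partial>F)"
      unfolding G_def by (subst emeasure_density) (auto simp: sets_eq_imp_space_eq[OF sets_F])
    also have "\<dots> = ennreal (\<integral>x. 1 + \<theta> * h x \<partial>F)"
      using hi pos by (intro nn_integral_eq_integral) auto
    also have "(\<integral>x. 1 + \<theta> * h x \<partial>F) = 1" using hi h0 by (simp add: prob_space)
    finally show "prob_space G" by (intro prob_spaceI) simp
    show "AE x in G. x \<in> {0..A}" unfolding G_def
      by (subst AE_density) (auto intro!: eventually_mono[OF supported_F] simp del: atLeastAtMost_iff)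
  qed (auto simp: kappa_pos A_pos G_def sets_F)
qed

text \<open>This bounds the convex function u ln u from above, the direction that convexity does not
  give: it is ln (1 + v / u) \<le> v / u, and the price is the quadratic term. It bounds the output
  entropy of a perturbed input from below.\<close>

lemma xlnx_tangent_upper:
  fixes u v :: real assumes "u > 0" "u + v > 0"
  shows "(u + v) * ln (u + v) \<le> u * ln u + v * ln u + v + v\<^sup>2 / u"
proof -
  have "ln ((u + v) / u) \<le> (u + v) / u - 1" using assms by (intro ln_le_minus_one) auto
  also have "\<dots> = v / u" using assms by (simp add: field_simps)
  finally have "ln (u + v) \<le> ln u + v / u" using assms by (simp add: ln_div)
  hence "(u + v) * ln (u + v) \<le> (u + v) * (ln u + v / u)" using assms by (intro mult_left_mono) auto
  also have "\<dots> = u * ln u + v * ln u + v + v\<^sup>2 / u"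
    using assms by (simp add: field_simps power2_eq_square)
  finally show ?thesis .
qed

text \<open>In nats, the perturbed mutual information is at least the original one plus \<theta> (a
  + b) - \<theta>^2 / 4, where \<open>a\<close> and \<open>b\<close> are the derivatives of the
  conditional and of the output part. Optimality gives a + b \<le> \<theta> / 4 for all small
  \<theta>, hence a + b \<le> 0.\<close>

lemma first_order_condition:
  assumes h [measurable]: "h \<in> borel_measurable borel" and hb: "\<And>x. \<bar>h x\<bar> \<le> 1 / 2"
    and h0: "(\<integral>x. h x \<partial>F) = 0"
    and opt: "\<And>\<theta>. 0 < \<theta> \<Longrightarrow> \<theta> \<le> 1 \<Longrightarrow>
      mutual_info kappa s2 sg (density F (\<lambda>x. ennreal (1 + \<theta> * h x))) \<le> mutual_info kappa s2 sg F"
  shows "(\<integral>x. h x * (NN (kappa * x) + JJ L (kappa * x)) \<partial>F) \<le> 0"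
proof -
  obtain D where D: "\<And>y. \<bar>L y\<bar> \<le> D * (1 + y\<^sup>2)" using abs_L_le by blast
  define a where "a = (\<integral>x. h x * NN (kappa * x) \<partial>F)"
  define b where "b = (\<integral>x. h x * JJ L (kappa * x) \<partial>F)"
  have hmul: "integrable F (\<lambda>x. h x * f x)" if f: "integrable F f" for f :: "real \<Rightarrow> real"
  proof (rule Bochner_Integration.integrable_bound[OF f])
    show "AE x in F. norm (h x * f x) \<le> norm (f x)"
      using hb by (intro AE_I2) (auto simp: abs_mult intro!: mult_left_le_one_le order_trans[OF hb])
    show "(\<lambda>x. h x * f x) \<in> borel_measurable F" using f by measurable
  qed
  have qhL: "(\<integral>y. qh h y * ln (q y) \<partial>lborel) = - b" "integrable lborel (\<lambda>y. qh h y * ln (q y))"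
  proof -
    have eq: "(\<lambda>y. qh h y * ln (q y)) = (\<lambda>y. - (qh h y * L y))" by (simp add: L_def)
    show "(\<integral>y. qh h y * ln (q y) \<partial>lborel) = - b"
      unfolding eq using integral_qh[OF h hb L_measurable D] by (simp add: b_def)
    show "integrable lborel (\<lambda>y. qh h y * ln (q y))"
      unfolding eq using integrable_qh[OF h hb L_measurable D] by simp
  qed
  have qh1: "(\<integral>y. qh h y \<partial>lborel) = 0" "integrable lborel (qh h)"
    using integral_qh[OF h hb, of "\<lambda>_. 1" 1] integrable_qh[OF h hb, of "\<lambda>_. 1" 1]
    by (auto simp: JJ_1 h0)
  \<comment> \<open>The bound 1 / 2 on \<open>h\<close> keeps the perturbed output density positive
    and bounds the quadratic term by \<theta>^2 / 4 times \<open>q y\<close>, which integrates to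
    \<theta>^2 / 4.\<close>
  have qhb: "\<bar>qh h y\<bar> \<le> q y / 2" for y
  proof -
    have "\<bar>qh h y\<bar> \<le> (\<integral>x. \<bar>h x * pp (kappa * x) y\<bar> \<partial>F)"
      unfolding qh_def by (rule integral_abs_bound)
    also have "\<dots> \<le> (\<integral>x. 1 / 2 * pp (kappa * x) y \<partial>F)"
    proof (intro Bochner_Integration.integral_mono integrable_abs integrable_h_pp[OF h hb] integrable_mult_right integrable_pp_F)
      show "\<bar>h x * pp (kappa * x) y\<bar> \<le> 1 / 2 * pp (kappa * x) y" for x
        unfolding abs_mult using hb by (intro mult_mono) auto
    qed
    also have "\<dots> = q y / 2" by (simp add: q_def)
    finally show ?thesis .
  qed
  have key: "a + b \<le> \<theta> / 4" if \<theta>: "0 < \<theta>" "\<theta> \<le> 1" for \<theta>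
  proof -
    let ?G = "density F (\<lambda>x. ennreal (1 + \<theta> * h x))"
    interpret G: fading_input s2 sg kappa A ?G
      using \<theta> by (intro fading_input_density h hb h0) auto
    have qG: "out_dens kappa s2 sg ?G y = q y + \<theta> * qh h y" for y
      using \<theta> fading_input_density(2)[OF h hb h0, of \<theta> "\<lambda>x. pp (kappa * x) y"]
      by (simp add: G.q_def q_def qh_def)
    have NG: "(\<integral>x. NN (kappa * x) \<partial>?G) = (\<integral>x. NN (kappa * x) \<partial>F) + \<theta> * a"
      using \<theta> fading_input_density(2)[OF h hb h0, of \<theta> "\<lambda>x. NN (kappa * x)"] integrable_NN_F
      by (simp add: a_def)
    have "(\<integral>y. out_dens kappa s2 sg ?G y * ln (out_dens kappa s2 sg ?G y) \<partial>lborel)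
        \<le> (\<integral>y. q y * ln (q y) + \<theta> * (qh h y * ln (q y)) + \<theta> * qh h y + \<theta>\<^sup>2 / 4 * q y \<partial>lborel)"
    proof (intro Bochner_Integration.integral_mono G.integrable_q_L Bochner_Integration.integrable_add
        integrable_mult_right integrable_q_L qhL qh1 integrable_q)
      fix y
      have "\<bar>\<theta> * qh h y\<bar> \<le> 1 * (q y / 2)" unfolding abs_mult using \<theta> qhb[of y] by (intro mult_mono) auto
      hence "q y + \<theta> * qh h y > 0" using q_pos[of y] by linarith
      hence "(q y + \<theta> * qh h y) * ln (q y + \<theta> * qh h y)
          \<le> q y * ln (q y) + (\<theta> * qh h y) * ln (q y) + \<theta> * qh h y + (\<theta> * qh h y)\<^sup>2 / q y"
        by (intro xlnx_tangent_upper) auto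
      moreover have "(\<theta> * qh h y)\<^sup>2 / q y \<le> \<theta>\<^sup>2 / 4 * q y"
      proof -
        have "(qh h y)\<^sup>2 \<le> (q y / 2)\<^sup>2" using qhb[of y] by (subst abs_le_square_iff [symmetric]) auto
        hence "\<theta>\<^sup>2 * (qh h y)\<^sup>2 \<le> \<theta>\<^sup>2 * (q y / 2)\<^sup>2" by (intro mult_left_mono) auto
        thus ?thesis by (simp add: field_simps power2_eq_square)
      qed
      ultimately show "out_dens kappa s2 sg ?G y * ln (out_dens kappa s2 sg ?G y)
        \<le> q y * ln (q y) + \<theta> * (qh h y * ln (q y)) + \<theta> * qh h y + \<theta>\<^sup>2 / 4 * q y"
        unfolding qG mult.assoc by linarith
    qed
    also have "\<dots> = (\<integral>y. q y * ln (q y) \<partial>lborel) - \<theta> * b + \<theta>\<^sup>2 / 4"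
      using qhL qh1 integrable_q_L integrable_q integral_q by simp
    finally have "(\<integral>y. out_dens kappa s2 sg ?G y * ln (out_dens kappa s2 sg ?G y) \<partial>lborel)
      \<le> (\<integral>y. q y * ln (q y) \<partial>lborel) - \<theta> * b + \<theta>\<^sup>2 / 4" .
    moreover have "mutual_info kappa s2 sg ?G * ln 2 \<le> mutual_info kappa s2 sg F * ln 2"
      using opt[OF \<theta>] by (intro mult_right_mono) auto
    ultimately have "\<theta> * (a + b) \<le> \<theta> * (\<theta> / 4)"
      unfolding mutual_info_eq G.mutual_info_eq NG by (simp add: algebra_simps power2_eq_square)
    thus ?thesis using \<theta> by (simp only: mult_le_cancel_left_pos)
  qed
  have "a + b \<le> 0"
  proof (rule ccontr)
    assume "\<not> a + b \<le> 0"
    hence p: "a + b > 0" by simp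
    have "a + b \<le> min 1 (a + b) / 4" using p by (intro key) auto
    with p show False by (auto simp: min_def split: if_splits)
  qed
  moreover have "(\<integral>x. h x * (NN (kappa * x) + JJ L (kappa * x)) \<partial>F) = a + b"
    unfolding a_def b_def distrib_left
    by (intro Bochner_Integration.integral_add hmul integrable_NN_F integrable_JJ_F)
  ultimately show ?thesis by simp
qed

end

section \<open>Lagrange multipliers and existence\<close>

text \<open>A Gram-Schmidt coefficient that exists even if \<open>e\<close> vanishes almost
  everywhere, so the functions to be orthogonalised may be linearly dependent, as they are when
  \<open>F\<close> has few mass points.\<close>

lemma (in prob_space) residual_coefficient:
  fixes f e :: "'a \<Rightarrow> real"
  assumes [measurable]: "f \<in> borel_measurable M" "e \<in> borel_measurable M"
    and f: "\<And>x. \<bar>f x\<bar> \<le> Kf" and e: "\<And>x. \<bar>e x\<bar> \<le> Ke"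
  shows "\<exists>c. (\<integral>x. f x * e x \<partial>M) = c * (\<integral>x. e x * e x \<partial>M)"
proof (cases "(\<integral>x. e x * e x \<partial>M) = 0")
  case True
  have "integrable M (\<lambda>x. e x * e x)"
    by (rule integrable_const_bound[where B = "Ke * Ke"])
       (intro AE_I2, simp only: real_norm_def abs_mult, intro mult_mono e order_trans[OF abs_ge_zero e] abs_ge_zero, measurable)
  with True have "AE x in M. e x * e x = 0"
    by (subst (asm) integral_nonneg_eq_0_iff_AE) auto
  hence "(\<integral>x. f x * e x \<partial>M) = (\<integral>x. 0 \<partial>M)"
    by (intro integral_cong_AE) auto
  thus ?thesis using True by simp
qed (auto intro!: exI[of _ "(\<integral>x. f x * e x \<partial>M) / (\<integral>x. e x * e x \<partial>M)"])

text \<open>Lagrange multipliers by linear algebra. Gram-Schmidt in the space of bounded functions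
  subtracts from \<open>j\<close> its projection onto the span of \<open>e1\<close>,
  \<open>e2\<close>, \<open>e3\<close>. The residual \<open>h\<close> is bounded, so it may serve as
  a test function itself: it annihilates the three functions, hence \<open>j\<close>, hence
  itself.\<close>

lemma (in prob_space) span_of_annihilator:
  fixes e1 e2 e3 j :: "'a \<Rightarrow> real"
  assumes meas: "e1 \<in> borel_measurable M" "e2 \<in> borel_measurable M" "e3 \<in> borel_measurable M"
      "j \<in> borel_measurable M"
    and bnd: "\<And>x. \<bar>e1 x\<bar> \<le> K" "\<And>x. \<bar>e2 x\<bar> \<le> K" "\<And>x. \<bar>e3 x\<bar> \<le> K" "\<And>x. \<bar>j x\<bar> \<le> K"
    and ann: "\<And>h K. h \<in> borel_measurable M \<Longrightarrow> (\<And>x. \<bar>h x\<bar> \<le> K) \<Longrightarrow> (\<integral>x. h x * e1 x \<partial>M) = 0 \<Longrightarrow>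
      (\<integral>x. h x * e2 x \<partial>M) = 0 \<Longrightarrow> (\<integral>x. h x * e3 x \<partial>M) = 0 \<Longrightarrow> (\<integral>x. h x * j x \<partial>M) = 0"
  shows "\<exists>\<alpha> \<beta> \<gamma>. AE x in M. j x = \<alpha> * e1 x + \<beta> * e2 x + \<gamma> * e3 x"
proof -
  define V where "V = {f :: 'a \<Rightarrow> real. f \<in> borel_measurable M \<and> (\<exists>K. \<forall>x. \<bar>f x\<bar> \<le> K)}"
  define ip where "ip f g = (\<integral>x. f x * g x \<partial>M)" for f g :: "'a \<Rightarrow> real"
  have Vdiff: "(\<lambda>x. f x - c * g x) \<in> V" if "f \<in> V" "g \<in> V" for f g c
  proof -
    from that obtain K1 K2 where "\<And>x. \<bar>f x\<bar> \<le> K1" "\<And>x. \<bar>g x\<bar> \<le> K2" unfolding V_def by blast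
    hence "\<bar>f x - c * g x\<bar> \<le> K1 + \<bar>c\<bar> * K2" for x
      by (intro order_trans[OF abs_triangle_ineq4] add_mono) (auto simp: abs_mult intro!: mult_left_mono)
    with that show ?thesis unfolding V_def by auto
  qed
  have int: "integrable M (\<lambda>x. f x * g x)" if "f \<in> V" "g \<in> V" for f g
  proof -
    from that obtain K1 K2 where K: "\<And>x. \<bar>f x\<bar> \<le> K1" "\<And>x. \<bar>g x\<bar> \<le> K2" unfolding V_def by blast
    show ?thesis
      by (rule integrable_const_bound[where B = "K1 * K2"])
         (use that in \<open>auto simp: V_def real_norm_def abs_mult intro!: mult_mono K order_trans[OF abs_ge_zero K(1)] AE_I2\<close>)
  qed
  have ip_diff: "ip (\<lambda>x. f x - c * g x) u = ip f u - c * ip g u" if "f \<in> V" "g \<in> V" "u \<in> V" for f g u c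
  proof -
    have "ip (\<lambda>x. f x - c * g x) u = (\<integral>x. f x * u x - c * (g x * u x) \<partial>M)"
      unfolding ip_def by (simp add: algebra_simps)
    thus ?thesis using int that by (simp add: ip_def)
  qed
  have ip_comm: "ip f g = ip g f" for f g by (simp add: ip_def mult.commute)
  have coeff: "\<exists>c. ip f e = c * ip e e" if "f \<in> V" "e \<in> V" for f e
    using that residual_coefficient unfolding V_def ip_def by blast
  have V: "e1 \<in> V" "e2 \<in> V" "e3 \<in> V" "j \<in> V" using meas bnd unfolding V_def by blast+
  obtain c1 where c1: "ip e2 e1 = c1 * ip e1 e1" using coeff V by blast
  define u2 where "u2 = (\<lambda>x. e2 x - c1 * e1 x)"
  have u2V: "u2 \<in> V" unfolding u2_def by (intro Vdiff V)
  have u21: "ip u2 e1 = 0" unfolding u2_def using V c1 by (simp add: ip_diff)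
  obtain c2 where c2: "ip e3 e1 = c2 * ip e1 e1" using coeff V by blast
  obtain c3 where c3: "ip e3 u2 = c3 * ip u2 u2" using coeff V u2V by blast
  define w3 where "w3 = (\<lambda>x. e3 x - c2 * e1 x)"
  have w3V: "w3 \<in> V" unfolding w3_def by (intro Vdiff V)
  define u3 where "u3 = (\<lambda>x. w3 x - c3 * u2 x)"
  have u3V: "u3 \<in> V" unfolding u3_def by (intro Vdiff w3V u2V)
  have u31: "ip u3 e1 = 0" unfolding u3_def ip_diff[OF w3V u2V V(1)] u21
    unfolding w3_def ip_diff[OF V(3,1,1)] c2 by simp
  have u32: "ip u3 u2 = 0" unfolding u3_def ip_diff[OF w3V u2V u2V]
    unfolding w3_def ip_diff[OF V(3,1) u2V] ip_comm[of e1 u2] u21 c3 by simp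
  obtain d1 where d1: "ip j e1 = d1 * ip e1 e1" using coeff V by blast
  obtain d2 where d2: "ip j u2 = d2 * ip u2 u2" using coeff V u2V by blast
  obtain d3 where d3: "ip j u3 = d3 * ip u3 u3" using coeff V u3V by blast
  define h1 where "h1 = (\<lambda>x. j x - d1 * e1 x)"
  define h2 where "h2 = (\<lambda>x. h1 x - d2 * u2 x)"
  define h where "h = (\<lambda>x. h2 x - d3 * u3 x)"
  have h1V: "h1 \<in> V" unfolding h1_def by (intro Vdiff V)
  have h2V: "h2 \<in> V" unfolding h2_def by (intro Vdiff h1V u2V)
  have hV: "h \<in> V" unfolding h_def by (intro Vdiff h2V u3V)
  have hip: "ip h v = ip j v - d1 * ip e1 v - d2 * ip u2 v - d3 * ip u3 v" if "v \<in> V" for v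
    unfolding h_def ip_diff[OF h2V u3V that] unfolding h2_def ip_diff[OF h1V u2V that]
    unfolding h1_def ip_diff[OF V(4,1) that] by simp
  have he1: "ip h e1 = 0" using hip[OF V(1)] d1 u21 u31 by simp
  have hu2: "ip h u2 = 0" using hip[OF u2V] d2 u21 u32 by (simp add: ip_comm[of e1 u2])
  have hu3: "ip h u3 = 0" using hip[OF u3V] d3 u31 u32 by (simp add: ip_comm[of e1 u3] ip_comm[of u2 u3])
  have he2: "ip h e2 = 0"
    using hu2 he1 ip_diff[OF V(2,1) hV, of c1] by (simp add: ip_comm[of h] u2_def [symmetric])
  have hw3: "ip h w3 = 0"
    using hu3 hu2 ip_diff[OF w3V u2V hV, of c3] by (simp add: ip_comm[of h] u3_def [symmetric])
  have he3: "ip h e3 = 0"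
    using hw3 he1 ip_diff[OF V(3,1) hV, of c2] by (simp add: ip_comm[of h] w3_def [symmetric])
  have hj: "ip h j = 0"
  proof -
    from hV obtain K' where "h \<in> borel_measurable M" "\<And>x. \<bar>h x\<bar> \<le> K'" unfolding V_def by blast
    from ann[OF this] he1 he2 he3 show ?thesis by (simp add: ip_def)
  qed
  have "ip h h = 0" using hip[OF hV] hj he1 hu2 hu3 by (simp add: ip_comm[of j h] ip_comm[of e1 h] ip_comm[of u2 h] ip_comm[of u3 h])
  hence "AE x in M. h x * h x = 0"
    using integral_nonneg_eq_0_iff_AE[OF int[OF hV hV]] by (simp add: ip_def)
  hence "AE x in M. h x = 0" by eventually_elim simp
  hence "AE x in M. j x = (d1 - d2 * c1 - d3 * c2 + d3 * c3 * c1) * e1 x + (d2 - d3 * c3) * e2 x + d3 * e3 x"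
    by eventually_elim (simp add: h_def h2_def h1_def u3_def w3_def u2_def algebra_simps)
  thus ?thesis by blast
qed

definition energy :: "real \<Rightarrow> real \<Rightarrow> real \<Rightarrow> real" where
  "energy b c x = b * x * ln (1 + c * x)"

lemma continuous_on_energy:
  assumes "c > 0" shows "continuous_on {0..A} (energy b c)"
proof -
  have "1 + c * x > 0" if "x \<ge> 0" for x using that assms by (intro add_pos_nonneg) auto
  thus ?thesis unfolding energy_def[abs_def] by (intro continuous_intros) (auto simp: less_imp_neq [symmetric])
qed

lemma energy_measurable [measurable]: "energy b c \<in> borel_measurable borel"
  unfolding energy_def[abs_def] by measurable

lemma supp_subset:
  assumes "sets F = sets borel" "AE x in F. x \<in> {0..A::real}"
  shows "supp F \<subseteq> {0..A}"
proof
  fix x assume x: "x \<in> supp F"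
  show "x \<in> {0..A}"
  proof (rule ccontr)
    assume "x \<notin> {0..A}"
    hence "emeasure F (- {0..A}) > 0"
      using x unfolding supp_def by (auto simp: open_Compl closed_atLeastAtMost)
    moreover have "emeasure F (- {0..A}) = 0"
      using assms(2) by (subst (asm) AE_iff_measurable[where N = "- {0..A}"])
        (use assms(1) sets_eq_imp_space_eq[OF assms(1)] in auto)
    ultimately show False by simp
  qed
qed

text \<open>A nonzero value of a continuous function persists nearby, and every open neighbourhood
  of a support point carries mass.\<close>

lemma AE_zero_imp_zero_on_supp:
  fixes D :: "real \<Rightarrow> real"
  assumes F: "sets F = sets borel" "AE x in F. x \<in> {0..A}"
    and cont: "continuous_on {0..A} D" and ae: "AE x in F. x \<in> {0..A} \<longrightarrow> D x = 0"
    and x: "x \<in> supp F"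
  shows "D x = 0"
proof (rule ccontr)
  assume nz: "D x \<noteq> 0"
  have xA: "x \<in> {0..A}" using supp_subset[OF F] x by blast
  obtain U where U: "open U" "U \<inter> {0..A} = D -` (- {0}) \<inter> {0..A}"
    using continuous_on_open_invariant[THEN iffD1, OF cont, rule_format, of "- {0}"] by auto
  have "x \<in> U" using U(2) nz xA by blast
  hence "emeasure F U > 0" using x U(1) unfolding supp_def by blast
  moreover have "AE y in F. y \<notin> U"
    using F(2) ae by eventually_elim (use U(2) in blast)
  hence "emeasure F U = 0"
    using U(1) F(1) sets_eq_imp_space_eq[OF F(1)] by (subst (asm) AE_iff_measurable[where N = U]) auto
  ultimately show False by simp
qed

lemma admissible_iff_fading_input:
  assumes "lognormal_fading s2 sg" "kappa > 0" "A > 0"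
  shows "admissible A eps Eth b c F \<longleftrightarrow> fading_input s2 sg kappa A F \<and>
           (\<integral>x. x \<partial>F) \<le> eps \<and> (\<integral>x. energy b c x \<partial>F) \<ge> Eth"
proof -
  have "emeasure F {0..A} = 1 \<longleftrightarrow> (AE x in F. x \<in> {0..A})" if "prob_space F" "sets F = sets borel"
  proof -
    interpret prob_space F by fact
    show ?thesis using that(2)
      by (subst AE_in_set_eq_1) (auto simp: emeasure_eq_measure)
  qed
  thus ?thesis using assms
    by (auto simp: admissible_def fading_input_def fading_input_axioms_def energy_def simp del: atLeastAtMost_iff)
qed

text \<open>A perturbation orthogonal to \<open>1\<close>, \<open>x\<close> and
  \<open>energy b c\<close> changes neither the total mass nor the two constraint integrals, so
  \<open>h\<close> and \<open>- h\<close> are both allowed and the first-order inequality becomes an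
  equality. \<open>span_of_annihilator\<close> then supplies the multipliers, and continuity extends
  the identity to the whole support.\<close>

lemma (in fading_input) optimal_affine_on_supp:
  assumes c: "c > 0"
    and adm: "admissible A eps Eth b c F"
    and opt: "\<And>G. admissible A eps Eth b c G \<Longrightarrow> mutual_info kappa s2 sg G \<le> mutual_info kappa s2 sg F"
  shows "\<exists>\<alpha> \<beta> \<gamma>. \<forall>x\<in>supp F. NN (kappa * x) + JJ L (kappa * x) = \<alpha> + \<beta> * x + \<gamma> * energy b c x"
proof -
  note adm_iff = admissible_iff_fading_input[OF lognormal_fading_axioms kappa_pos A_pos]
  obtain D where D: "\<And>y. \<bar>L y\<bar> \<le> D * (1 + y\<^sup>2)" using abs_L_le by blast
  define i where "i x = NN (kappa * x) + JJ L (kappa * x)" for x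
  have i_meas [measurable]: "i \<in> borel_measurable borel" unfolding i_def[abs_def] by measurable
  have cont_k: "continuous_on {0..A} (\<lambda>x. f (kappa * x))" if "continuous_on {0..kappa * A} f" for f :: "real \<Rightarrow> real"
    by (rule continuous_on_compose2[OF that]) (auto intro!: continuous_intros kappa_mult_mem simp del: atLeastAtMost_iff)
  have i_cont: "continuous_on {0..A} i" unfolding i_def
    by (intro continuous_intros cont_k continuous_on_NN continuous_on_JJ[OF _ _ D]) auto
  have e_cont: "continuous_on {0..A} (energy b c)" by (rule continuous_on_energy[OF c])
  have bounded: "\<exists>K. \<forall>x\<in>{0..A}. \<bar>f x\<bar> \<le> K" if "continuous_on {0..A} f" for f :: "real \<Rightarrow> real"
    using compact_imp_bounded[OF compact_continuous_image[OF that compact_Icc]]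
    by (fastforce simp: bounded_iff)
  obtain K1 where K1: "\<And>x. x \<in> {0..A} \<Longrightarrow> \<bar>energy b c x\<bar> \<le> K1" using bounded[OF e_cont] by blast
  obtain K2 where K2: "\<And>x. x \<in> {0..A} \<Longrightarrow> \<bar>i x\<bar> \<le> K2" using bounded[OF i_cont] by blast
  define K where "K = 1 + A + \<bar>K1\<bar> + \<bar>K2\<bar>"
  \<comment> \<open>The functions involved are bounded on \<open>{0..A}\<close> only; multiplying by
    this indicator makes them bounded everywhere and changes no integral against
    \<open>F\<close>.\<close>
  define I where "I = (indicator {0..A} :: real \<Rightarrow> real)"
  have I_meas [measurable]: "I \<in> borel_measurable borel" unfolding I_def by measurable
  have AEI: "(\<integral>x. h x * (f x * I x) \<partial>F) = (\<integral>x. h x * f x \<partial>F)"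
    if [measurable]: "h \<in> borel_measurable borel" "f \<in> borel_measurable borel" for h f :: "real \<Rightarrow> real"
    by (rule integral_cong_AE) (auto intro!: eventually_mono[OF supported_F] simp: I_def simp del: atLeastAtMost_iff)
  have F_meas: "borel_measurable F = (borel_measurable borel :: (real \<Rightarrow> real) set)"
    by (rule measurable_cong_sets) (auto simp: sets_F)
  have le: "(\<integral>x. h x * i x \<partial>F) \<le> 0"
    if h [measurable]: "h \<in> borel_measurable borel" and hb: "\<And>x. \<bar>h x\<bar> \<le> 1 / 2"
      and h0: "(\<integral>x. h x \<partial>F) = 0" and h1: "(\<integral>x. h x * x \<partial>F) = 0" and h2: "(\<integral>x. h x * energy b c x \<partial>F) = 0"
    for h
    unfolding i_def
  proof (rule first_order_condition[OF h hb h0])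
    fix \<theta> :: real assume \<theta>: "0 < \<theta>" "\<theta> \<le> 1"
    let ?G = "density F (\<lambda>x. ennreal (1 + \<theta> * h x))"
    note dens = fading_input_density[OF h hb h0 less_imp_le[OF \<theta>(1)] \<theta>(2)]
    have i1: "integrable F (\<lambda>x. x)" by (rule integrable_bounded[where K = A]) auto
    have i2: "integrable F (energy b c)" by (rule integrable_bounded[OF _ K1]) auto
    have e1: "(\<integral>x. x \<partial>?G) = (\<integral>x. x \<partial>F)"
      using dens(2)[OF measurable_ident_sets[OF refl] i1] by (simp only: h1 mult_zero_right add_0_right)
    have e2: "(\<integral>x. energy b c x \<partial>?G) = (\<integral>x. energy b c x \<partial>F)"
      using dens(2)[OF energy_measurable i2] by (simp only: h2 mult_zero_right add_0_right)
    have "admissible A eps Eth b c ?G"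
      using adm dens(1) unfolding adm_iff e1 e2 by blast
    thus "mutual_info kappa s2 sg ?G \<le> mutual_info kappa s2 sg F" by (rule opt)
  qed
  have "\<exists>\<alpha> \<beta> \<gamma>. AE x in F. i x * I x = \<alpha> * (1 * I x) + \<beta> * (x * I x) + \<gamma> * (energy b c x * I x)"
  proof (rule span_of_annihilator[where K = K])
    fix x show "\<bar>1 * I x\<bar> \<le> K" "\<bar>x * I x\<bar> \<le> K" "\<bar>energy b c x * I x\<bar> \<le> K" "\<bar>i x * I x\<bar> \<le> K"
      using K1[of x] K2[of x] A_pos by (auto simp: I_def K_def indicator_def)
  next
    fix h K' assume hF: "h \<in> borel_measurable F" and hb: "\<And>x. \<bar>h x\<bar> \<le> K'"
      and orth: "(\<integral>x. h x * (1 * I x) \<partial>F) = 0" "(\<integral>x. h x * (x * I x) \<partial>F) = 0"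
        "(\<integral>x. h x * (energy b c x * I x) \<partial>F) = 0"
    have h [measurable]: "h \<in> borel_measurable borel" using hF by (simp add: F_meas)
    \<comment> \<open>Rescales a bounded test function to the size 1 / 2 that the perturbation
      argument requires.\<close>
    define K3 where "K3 = 2 * (\<bar>K'\<bar> + 1)"
    have K3: "K3 > 0" "\<bar>h x\<bar> / K3 \<le> 1 / 2" for x
      using hb[of x] by (auto simp: K3_def field_simps)
    have o: "(\<integral>x. h x \<partial>F) = 0" "(\<integral>x. h x * x \<partial>F) = 0" "(\<integral>x. h x * energy b c x \<partial>F) = 0"
      using trans[OF AEI[OF h borel_measurable_const, symmetric] orth(1)]
        trans[OF AEI[OF h measurable_ident_sets[OF refl], symmetric] orth(2)]
        trans[OF AEI[OF h energy_measurable, symmetric] orth(3)]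
      by (simp_all only: mult_1_right)
    have "(\<integral>x. (h x / K3) * i x \<partial>F) \<le> 0"
      using K3 o by (intro le) auto
    moreover have "(\<integral>x. (- h x / K3) * i x \<partial>F) \<le> 0"
      using K3 o by (intro le) auto
    ultimately have "(\<integral>x. h x * i x \<partial>F) = 0"
      using K3(1) by (auto simp: divide_le_0_iff zero_le_divide_iff intro: antisym)
    thus "(\<integral>x. h x * (i x * I x) \<partial>F) = 0" by (simp only: AEI[OF h i_meas])
  qed (auto simp: F_meas)
  then obtain \<alpha> \<beta> \<gamma> where ae: "AE x in F. i x * I x = \<alpha> * (1 * I x) + \<beta> * (x * I x) + \<gamma> * (energy b c x * I x)"
    by blast
  have "i x - (\<alpha> + \<beta> * x + \<gamma> * energy b c x) = 0" if "x \<in> supp F" for x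
  proof (rule AE_zero_imp_zero_on_supp[OF sets_F supported_F _ _ that])
    show "continuous_on {0..A} (\<lambda>x. i x - (\<alpha> + \<beta> * x + \<gamma> * energy b c x))"
      by (intro continuous_intros i_cont e_cont)
    show "AE x in F. x \<in> {0..A} \<longrightarrow> i x - (\<alpha> + \<beta> * x + \<gamma> * energy b c x) = 0"
      using ae by eventually_elim (auto simp: I_def)
  qed
  thus ?thesis unfolding i_def by (intro exI[of _ \<alpha>] exI[of _ \<beta>] exI[of _ \<gamma>]) auto
qed

section \<open>Existence of an optimal input\<close>

text \<open>Compactness is shown for the set \<open>T\<close> of attained values, so no topology on
  measures is needed beyond convergent subsequences. The common bounded support gives tightness, the
  constraints and the conditional part pass to the limit as integrals of continuous functions, and
  the output part passes by dominated convergence.\<close>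

theorem (in lognormal_fading) optimum_exists:
  assumes kappa: "kappa > 0" and A: "A > 0" and c: "c > 0" and ne: "\<exists>F. admissible A eps Eth b c F"
  shows "\<exists>F. admissible A eps Eth b c F \<and>
    (\<forall>G. admissible A eps Eth b c G \<longrightarrow> mutual_info kappa s2 sg G \<le> mutual_info kappa s2 sg F)"
proof -
  note adm_iff = admissible_iff_fading_input[OF lognormal_fading_axioms kappa A]
  have kA: "kappa * A \<ge> 0" using kappa A by simp
  define T where "T = mutual_info kappa s2 sg ` {F. admissible A eps Eth b c F}"
  have "compact T"
    unfolding compact_def
  proof (intro allI impI)
    fix t :: "nat \<Rightarrow> real" assume "\<forall>n. t n \<in> T"
    hence "\<forall>n. \<exists>F. admissible A eps Eth b c F \<and> t n = mutual_info kappa s2 sg F" unfolding T_def by auto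
    then obtain F where F: "\<And>n. admissible A eps Eth b c (F n)" "\<And>n. t n = mutual_info kappa s2 sg (F n)"
      by metis
    have fi: "fading_input s2 sg kappa A (F n)" for n using F(1) unfolding adm_iff by simp
    have rd: "real_distribution (F n)" for n
    proof -
      interpret fading_input s2 sg kappa A "F n" by (rule fi)
      show ?thesis by unfold_locales (auto simp: sets_F)
    qed
    have "tight F" unfolding tight_def
    proof (intro conjI allI impI rd)
      fix e :: real assume e: "e > 0"
      \<comment> \<open>\<open>tight\<close> speaks of half-open intervals; the left end
        \<open>- 1\<close> retains a possible atom at \<open>0\<close>.\<close>
      have "measure (F n) {- 1<..A} = 1" for n
      proof -
        interpret fading_input s2 sg kappa A "F n" by (rule fi)
        show ?thesis
          by (subst prob_eq_1) (auto intro!: eventually_mono[OF supported_F] simp: sets_F)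
      qed
      thus "\<exists>a b. a < b \<and> (\<forall>n. 1 - e < measure (F n) {a<..b})"
        using e A by (intro exI[of _ "- 1"] exI[of _ A]) auto
    qed
    from tight_imp_convergent_subsubsequence[OF this, of "\<lambda>n. n"]
    obtain r M where r: "strict_mono r" and M: "real_distribution M" and conv: "weak_conv_m (\<lambda>n. F (r n)) M"
      by (auto simp: strict_mono_def o_def)
    have lim_bdd: "(\<lambda>n. \<integral>x. f x \<partial>F (r n)) \<longlonglongrightarrow> (\<integral>x. f x \<partial>M)"
      if "\<And>x. isCont f x" "\<And>x. \<bar>f x\<bar> \<le> K" for f :: "real \<Rightarrow> real" and K
      by (rule weak_conv_imp_integral_bdd_continuous_conv[OF rd M conv]) (use that in auto)
    have setsM: "sets M = sets borel" using M by (simp add: real_distribution_def real_distribution_axioms_def)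
    interpret M: prob_space M using M by (simp add: real_distribution_def)
    \<comment> \<open>A bounded continuous function that vanishes exactly on \<open>{0..A}\<close>:
      its integral is zero along the sequence, hence for the limit, which is therefore supported
      there.\<close>
    define d where "d x = min 1 (max 0 (max (- x) (x - A)))" for x
    have d_meas [measurable]: "d \<in> borel_measurable borel" unfolding d_def[abs_def] by measurable
    have "(\<integral>x. d x \<partial>F (r n)) = 0" for n
    proof -
      interpret fading_input s2 sg kappa A "F (r n)" by (rule fi)
      have "(\<integral>x. d x \<partial>F (r n)) = (\<integral>x. 0 \<partial>F (r n))"
        by (rule integral_cong_AE) (auto intro!: eventually_mono[OF supported_F] simp: d_def)
      thus ?thesis by simp
    qed
    moreover have "(\<lambda>n. \<integral>x. d x \<partial>F (r n)) \<longlonglongrightarrow> (\<integral>x. d x \<partial>M)"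
      by (rule lim_bdd[where K = 1]) (auto simp: d_def[abs_def] intro!: continuous_intros)
    ultimately have "(\<integral>x. d x \<partial>M) = 0" using LIMSEQ_unique[OF _ tendsto_const] by auto
    moreover have "integrable M d"
      by (rule M.integrable_const_bound[where B = 1])
         (auto simp: d_def measurable_cong_sets[OF setsM refl] intro!: AE_I2)
    ultimately have "AE x in M. d x = 0"
      by (subst (asm) integral_nonneg_eq_0_iff_AE) (auto simp: d_def)
    hence suppM: "AE x in M. x \<in> {0..A}"
      by eventually_elim (auto simp: d_def min_def max_def split: if_splits)
    interpret M: fading_input s2 sg kappa A M
      by (rule fading_input.intro[OF lognormal_fading_axioms])
         (use kappa A M.prob_space_axioms setsM suppM in \<open>simp add: fading_input_axioms_def\<close>)
    have lim: "(\<lambda>n. \<integral>x. f x \<partial>F (r n)) \<longlonglongrightarrow> (\<integral>x. f x \<partial>M)"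
      if f: "continuous_on {0..A} f" and [measurable]: "f \<in> borel_measurable borel" for f :: "real \<Rightarrow> real"
    proof -
      \<comment> \<open>Clamping the argument extends a function continuous on \<open>{0..A}\<close>
        to a bounded continuous function on the line, as weak convergence requires.\<close>
      define g where "g x = f (max 0 (min A x))" for x
      have g_cont: "continuous_on UNIV g" unfolding g_def
        by (rule continuous_on_compose2[OF f]) (use A in \<open>auto intro!: continuous_intros\<close>)
      have g_meas [measurable]: "g \<in> borel_measurable borel" using g_cont by (rule borel_measurable_continuous_onI)
      obtain K where K: "\<And>x. x \<in> {0..A} \<Longrightarrow> \<bar>f x\<bar> \<le> K"
        using compact_imp_bounded[OF compact_continuous_image[OF f compact_Icc]]
        by (fastforce simp: bounded_iff)
      have "(\<lambda>n. \<integral>x. g x \<partial>F (r n)) \<longlonglongrightarrow> (\<integral>x. g x \<partial>M)"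
        using g_cont A by (intro lim_bdd[where K = K])
          (auto simp: g_def[of "_::real"] continuous_on_eq_continuous_at intro!: K)
      moreover have "(\<integral>x. g x \<partial>F n) = (\<integral>x. f x \<partial>F n)" for n
      proof -
        interpret fading_input s2 sg kappa A "F n" by (rule fi)
        show ?thesis by (rule integral_cong_AE) (auto intro!: eventually_mono[OF supported_F] simp: g_def)
      qed
      moreover have "(\<integral>x. g x \<partial>M) = (\<integral>x. f x \<partial>M)"
        by (rule integral_cong_AE) (auto intro!: eventually_mono[OF suppM] simp: g_def)
      ultimately show ?thesis by simp
    qed
    have "(\<integral>x. x \<partial>M) \<le> eps"
    proof (rule LIMSEQ_le_const2[OF lim])
      show "\<exists>N. \<forall>n\<ge>N. (\<integral>x. x \<partial>F (r n)) \<le> eps" using F(1) unfolding adm_iff by blast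
    qed (auto intro!: continuous_intros)
    moreover have "(\<integral>x. energy b c x \<partial>M) \<ge> Eth"
    proof (rule LIMSEQ_le_const[OF lim])
      show "\<exists>N. \<forall>n\<ge>N. Eth \<le> (\<integral>x. energy b c x \<partial>F (r n))" using F(1) unfolding adm_iff by blast
    qed (auto intro!: continuous_on_energy c)
    ultimately have admM: "admissible A eps Eth b c M"
      unfolding adm_iff using M.fading_input_axioms by simp
    have kc: "continuous_on {0..A} (\<lambda>x. f (kappa * x))" if "continuous_on {0..kappa * A} f" for f :: "real \<Rightarrow> real"
      by (rule continuous_on_compose2[OF that])
         (auto intro!: continuous_intros M.kappa_mult_mem simp del: atLeastAtMost_iff)
    obtain C1 where C1: "C1 > 0" "\<And>x y. x \<in> {0..kappa * A} \<Longrightarrow> exp (- C1 * (1 + y\<^sup>2)) \<le> pp x y"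
      using pp_lower[OF kA] by blast
    obtain C2 where C2: "C2 > 0" "\<And>x y. x \<in> {0..kappa * A} \<Longrightarrow> pp x y \<le> C2 / (1 + y\<^sup>2) ^ 2"
      using pp_upper[OF kA, of 2] by blast
    define C3 where "C3 = C1 + \<bar>ln (gau 0)\<bar>"
    have q_lim: "(\<lambda>n. out_dens kappa s2 sg (F (r n)) y) \<longlonglongrightarrow> out_dens kappa s2 sg M y" for y
    proof -
      have "out_dens kappa s2 sg (F n) y = (\<integral>x. pp (kappa * x) y \<partial>F n)" for n
        by (rule fading_input.q_def[OF fi])
      thus ?thesis unfolding M.q_def by (simp only:) (intro lim kc continuous_on_pp, measurable)
    qed
    \<comment> \<open>The output densities converge pointwise, and all of them share the order-two
      decay and the quadratic bound on the logarithm, so one dominating function serves the whole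
      sequence.\<close>
    have "(\<lambda>n. \<integral>y. out_dens kappa s2 sg (F (r n)) y * ln (out_dens kappa s2 sg (F (r n)) y) \<partial>lborel)
      \<longlonglongrightarrow> (\<integral>y. out_dens kappa s2 sg M y * ln (out_dens kappa s2 sg M y) \<partial>lborel)"
    proof (rule integral_dominated_convergence)
      show "integrable lborel (\<lambda>y. (C2 * C3) * (1 / (1 + y\<^sup>2)))"
        by (intro integrable_mult_right integrable_inverse_one_plus_square)
      show "AE y in lborel. (\<lambda>n. out_dens kappa s2 sg (F (r n)) y * ln (out_dens kappa s2 sg (F (r n)) y))
          \<longlonglongrightarrow> out_dens kappa s2 sg M y * ln (out_dens kappa s2 sg M y)"
        by (intro AE_I2 tendsto_intros q_lim) auto
      fix n
      interpret F: fading_input s2 sg kappa A "F (r n)" by (rule fi)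
      show "AE y in lborel. norm (out_dens kappa s2 sg (F (r n)) y * ln (out_dens kappa s2 sg (F (r n)) y))
          \<le> (C2 * C3) * (1 / (1 + y\<^sup>2))"
      proof (intro AE_I2)
        fix y :: real
        have p: "1 + y\<^sup>2 > 0" by (simp add: add_pos_nonneg)
        have "norm (F.q y * ln (F.q y)) \<le> C2 / (1 + y\<^sup>2) ^ 2 * (C3 * (1 + y\<^sup>2))"
          unfolding real_norm_def abs_mult
        proof (intro mult_mono)
          show "\<bar>F.q y\<bar> \<le> C2 / (1 + y\<^sup>2) ^ 2" using F.q_le[of y, OF C2(2)] by simp
          show "\<bar>ln (F.q y)\<bar> \<le> C3 * (1 + y\<^sup>2)" unfolding C3_def by (rule F.abs_ln_q_le[OF C1(1) C1(2)])
        qed (use C2(1) p in auto)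
        also have "\<dots> = (C2 * C3) * (1 / (1 + y\<^sup>2))" using p by (simp add: power2_eq_square[of "1 + y\<^sup>2"])
        finally show "norm (F.q y * ln (F.q y)) \<le> (C2 * C3) * (1 / (1 + y\<^sup>2))" .
      qed
      show "(\<lambda>y. F.q y * ln (F.q y)) \<in> borel_measurable lborel" by measurable
    qed measurable
    moreover have "(\<lambda>n. \<integral>x. NN (kappa * x) \<partial>F (r n)) \<longlonglongrightarrow> (\<integral>x. NN (kappa * x) \<partial>M)"
      by (intro lim kc continuous_on_NN kA) measurable
    ultimately have "(\<lambda>n. mutual_info kappa s2 sg (F (r n)) * ln 2 / ln 2)
        \<longlonglongrightarrow> mutual_info kappa s2 sg M * ln 2 / ln 2"
      unfolding M.mutual_info_eq fading_input.mutual_info_eq[OF fi] by (intro tendsto_intros) auto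
    hence "(t \<circ> r) \<longlonglongrightarrow> mutual_info kappa s2 sg M" by (simp add: F(2) o_def)
    thus "\<exists>l\<in>T. \<exists>r. strict_mono r \<and> (t \<circ> r) \<longlonglongrightarrow> l"
      using admM r unfolding T_def by blast
  qed
  moreover have "T \<noteq> {}" using ne unfolding T_def by auto
  ultimately obtain m where m: "m \<in> T" "\<forall>t\<in>T. t \<le> m"
    using compact_attains_sup[of T] by blast
  from m(1) obtain F where "admissible A eps Eth b c F" "m = mutual_info kappa s2 sg F"
    unfolding T_def by blast
  with m(2) show ?thesis unfolding T_def by blast
qed

section \<open>Analyticity away from the origin\<close>

text \<open>Differentiation under the integral. Cauchy's inequality on discs of radius
  \<open>r\<close> bounds the derivative, and hence the difference quotients, by the majorant
  divided by \<open>r\<close>; no bound on derivatives has to be assumed.\<close>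

lemma holomorphic_on_lebesgue_integral:
  fixes f :: "complex \<Rightarrow> 'a \<Rightarrow> complex"
  assumes S: "open S"
    and hol: "\<And>y. y \<in> space M \<Longrightarrow> (\<lambda>w. f w y) holomorphic_on S"
    and meas: "\<And>w. w \<in> S \<Longrightarrow> f w \<in> borel_measurable M"
    and bound: "\<And>w y. w \<in> S \<Longrightarrow> y \<in> space M \<Longrightarrow> norm (f w y) \<le> B y"
    and B: "integrable M B"
  shows "(\<lambda>w. \<integral>y. f w y \<partial>M) holomorphic_on S"
proof (rule holomorphic_onI, rule field_differentiable_at_within)
  fix w0 assume w0: "w0 \<in> S"
  obtain R where R: "R > 0" "cball w0 R \<subseteq> S" using S w0 open_contains_cball by blast
  define r where "r = R / 2"
  have r: "r > 0" using R by (simp add: r_def)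
  have sub: "cball w r \<subseteq> S" if "w \<in> ball w0 r" for w
  proof -
    have "cball w r \<subseteq> cball w0 R"
    proof
      fix z assume "z \<in> cball w r"
      thus "z \<in> cball w0 R" using that dist_triangle[of w0 z w] by (simp add: r_def)
    qed
    with R(2) show ?thesis by blast
  qed
  have ball_sub: "ball w0 r \<subseteq> S" using sub r by force
  have int: "integrable M (f w)" if "w \<in> S" for w
    by (rule Bochner_Integration.integrable_bound[OF B])
       (use meas bound that in \<open>auto intro!: AE_I2 order_trans[OF bound[OF that] abs_ge_self]\<close>)
  have deriv_bound: "norm (deriv (\<lambda>w. f w y) w) \<le> B y / r" if w: "w \<in> ball w0 r" and y: "y \<in> space M" for w y
  proof -
    have "norm ((deriv ^^ 1) (\<lambda>w. f w y) w) \<le> fact 1 * B y / r ^ 1"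
    proof (rule Cauchy_inequality)
      show "(\<lambda>w. f w y) holomorphic_on ball w r"
        using hol[OF y] sub[OF w] by (meson ball_subset_cball holomorphic_on_subset subset_trans)
      show "continuous_on (cball w r) (\<lambda>w. f w y)"
        using hol[OF y] sub[OF w] by (meson holomorphic_on_imp_continuous_on holomorphic_on_subset)
      fix x assume "norm (w - x) = r"
      hence "x \<in> cball w r" by (simp add: dist_norm)
      thus "norm (f x y) \<le> B y" using sub[OF w] bound y by blast
    qed (rule r)
    thus ?thesis by simp
  qed
  have der: "((\<lambda>w. f w y) has_field_derivative deriv (\<lambda>w. f w y) w) (at w)" if "w \<in> S" "y \<in> space M" for w y
    using hol[OF that(2)] S that(1) by (rule holomorphic_derivI)
  have quot: "norm ((f w y - f w0 y) / (w - w0)) \<le> B y / r" if w: "w \<in> ball w0 r" "w \<noteq> w0" and y: "y \<in> space M" for w y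
  proof -
    have "norm (f w y - f w0 y) \<le> B y / r * norm (w - w0)"
    proof (rule field_differentiable_bound)
      show "convex (ball w0 r)" by simp
      fix z assume z: "z \<in> ball w0 r"
      show "((\<lambda>w. f w y) has_field_derivative deriv (\<lambda>w. f w y) z) (at z within ball w0 r)"
        using der ball_sub z y by (blast intro: has_field_derivative_at_within)
      show "norm (deriv (\<lambda>w. f w y) z) \<le> B y / r" by (rule deriv_bound[OF z y])
    qed (use w r in auto)
    thus ?thesis using w by (simp add: norm_divide divide_le_eq)
  qed
  have lim: "(\<lambda>n. (f (X n) y - f w0 y) / (X n - w0)) \<longlonglongrightarrow> deriv (\<lambda>w. f w y) w0"
    if X: "\<And>n. X n \<in> ball w0 r - {w0}" "X \<longlonglongrightarrow> w0" and y: "y \<in> space M" for X y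
  proof -
    have "((\<lambda>w. (f w y - f w0 y) / (w - w0)) \<longlongrightarrow> deriv (\<lambda>w. f w y) w0) (at w0)"
      using der[OF w0 y] by (simp add: has_field_derivative_iff)
    from this[unfolded tendsto_at_iff_sequentially, rule_format, of X] X show ?thesis
      by (auto simp: o_def)
  qed
  \<comment> \<open>One fixed sequence tending to \<open>w0\<close>: it exhibits the derivative as a
    limit of measurable difference quotients.\<close>
  define X0 where "X0 n = w0 + of_real (r / (real n + 2))" for n
  have X0: "X0 n \<in> ball w0 r - {w0}" for n
  proof -
    have "X0 n - w0 = complex_of_real (r / (real n + 2))" by (simp add: X0_def)
    hence "norm (X0 n - w0) = \<bar>r / (real n + 2)\<bar>" by (simp only: norm_of_real)
    hence "dist w0 (X0 n) = r / (real n + 2)" using r by (simp add: dist_norm norm_minus_commute)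
    moreover have "r / (real n + 2) < r" "r / (real n + 2) > 0" using r by (auto simp: divide_less_eq)
    ultimately show ?thesis by auto
  qed
  have X0_lim: "X0 \<longlonglongrightarrow> w0"
  proof -
    have "(\<lambda>n. r / (real n + 2)) \<longlonglongrightarrow> 0" by real_asymp
    hence "(\<lambda>n. w0 + of_real (r / (real n + 2))) \<longlonglongrightarrow> w0 + of_real 0" by (intro tendsto_intros)
    thus ?thesis by (simp add: X0_def[abs_def])
  qed
  have der_meas: "(\<lambda>y. deriv (\<lambda>w. f w y) w0) \<in> borel_measurable M"
  proof (rule borel_measurable_LIMSEQ_metric)
    show "(\<lambda>y. (f (X0 n) y - f w0 y) / (X0 n - w0)) \<in> borel_measurable M" for n
      using meas[of "X0 n"] meas[OF w0] X0[of n] ball_sub by (intro borel_measurable_divide borel_measurable_diff) auto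
    show "(\<lambda>n. (f (X0 n) y - f w0 y) / (X0 n - w0)) \<longlonglongrightarrow> deriv (\<lambda>w. f w y) w0" if "y \<in> space M" for y
      using lim[OF X0 X0_lim that] .
  qed
  have "((\<lambda>w. ((\<integral>y. f w y \<partial>M) - (\<integral>y. f w0 y \<partial>M)) / (w - w0)) \<longlongrightarrow> (\<integral>y. deriv (\<lambda>w. f w y) w0 \<partial>M)) (at w0 within ball w0 r)"
    unfolding tendsto_at_iff_sequentially
  proof (intro allI impI)
    fix X :: "nat \<Rightarrow> complex" assume X: "\<forall>i. X i \<in> ball w0 r - {w0}" "X \<longlonglongrightarrow> w0"
    have XS: "X n \<in> S" for n using X ball_sub by blast
    have "(\<lambda>n. \<integral>y. (f (X n) y - f w0 y) / (X n - w0) \<partial>M) \<longlonglongrightarrow> (\<integral>y. deriv (\<lambda>w. f w y) w0 \<partial>M)"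
    proof (rule integral_dominated_convergence[OF der_meas])
      show "integrable M (\<lambda>y. B y / r)" using B by simp
      show "(\<lambda>y. (f (X n) y - f w0 y) / (X n - w0)) \<in> borel_measurable M" for n
        using meas[OF XS] meas[OF w0] by measurable
      show "AE y in M. (\<lambda>n. (f (X n) y - f w0 y) / (X n - w0)) \<longlonglongrightarrow> deriv (\<lambda>w. f w y) w0"
        using X by (intro AE_I2 lim) auto
      show "AE y in M. norm ((f (X n) y - f w0 y) / (X n - w0)) \<le> B y / r" for n
        using X by (intro AE_I2 quot) auto
    qed
    thus "((\<lambda>w. ((\<integral>y. f w y \<partial>M) - (\<integral>y. f w0 y \<partial>M)) / (w - w0)) \<circ> X) \<longlonglongrightarrow> (\<integral>y. deriv (\<lambda>w. f w y) w0 \<partial>M)"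
      using int[OF XS] int[OF w0] by (simp add: o_def)
  qed
  hence "((\<lambda>w. \<integral>y. f w y \<partial>M) has_field_derivative (\<integral>y. deriv (\<lambda>w. f w y) w0 \<partial>M)) (at w0)"
    using r by (simp add: has_field_derivative_iff at_within_open[of w0 "ball w0 r"])
  thus "(\<lambda>w. \<integral>y. f w y \<partial>M) field_differentiable at w0" by (auto simp: field_differentiable_def)
qed

text \<open>Each real point has its own holomorphic extension on its own disc, so the
  one-dimensional identity theorem is combined with connectedness: the set of points near which
  \<open>f\<close> vanishes is open, closed and nonempty.\<close>

lemma real_analytic_identity:
  fixes f :: "real \<Rightarrow> real"
  assumes loc: "\<And>u. \<exists>r>0. \<exists>\<phi>. \<phi> holomorphic_on ball (complex_of_real u) r \<and>
      (\<forall>v. \<bar>v - u\<bar> < r \<longrightarrow> \<phi> (of_real v) = of_real (f v))"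
    and lim: "u0 islimpt {u. f u = 0}"
  shows "f u = 0"
proof -
  define E where "E = {u. \<exists>r>0. \<forall>v. \<bar>v - u\<bar> < r \<longrightarrow> f v = 0}"
  have loc_zero: "u \<in> E" if u: "u islimpt {u. f u = 0}" for u
  proof -
    obtain r \<phi> where r: "r > 0" and \<phi>: "\<phi> holomorphic_on ball (complex_of_real u) r"
      and eq: "\<And>v. \<bar>v - u\<bar> < r \<Longrightarrow> \<phi> (of_real v) = of_real (f v)"
      using loc[of u] by blast
    define U where "U = complex_of_real ` {v. \<bar>v - u\<bar> < r \<and> f v = 0}"
    have dist_eq: "dist (complex_of_real u) (of_real v) = \<bar>v - u\<bar>" for v
      by (simp add: dist_norm flip: of_real_diff)
    have limU: "of_real u islimpt U"
      unfolding islimpt_approachable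
    proof (intro allI impI)
      fix e :: real assume "e > 0"
      then obtain v where "f v = 0" "v \<noteq> u" "dist v u < min e r"
        using u r unfolding islimpt_approachable by (metis (mono_tags) mem_Collect_eq min_less_iff_conj)
      thus "\<exists>x'\<in>U. x' \<noteq> complex_of_real u \<and> dist x' (of_real u) < e"
        unfolding U_def by (intro bexI[of _ "of_real v"]) (auto simp: dist_eq dist_commute dist_real_def)
    qed
    have "f v = 0" if "\<bar>v - u\<bar> < r" for v
    proof -
      have "\<phi> (of_real v) = 0"
        by (rule analytic_continuation[OF \<phi> _ _ _ _ limU])
           (use r that eq in \<open>auto simp: U_def dist_real_def abs_minus_commute connected_ball\<close>)
      thus ?thesis using eq[OF that] by simp
    qed
    thus ?thesis using r unfolding E_def by blast
  qed
  have "open E" unfolding open_dist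
  proof
    fix u assume "u \<in> E"
    then obtain r where r: "r > 0" "\<And>v. \<bar>v - u\<bar> < r \<Longrightarrow> f v = 0" unfolding E_def by blast
    show "\<exists>e>0. \<forall>y. dist y u < e \<longrightarrow> y \<in> E"
    proof (intro exI[of _ "r / 2"] conjI allI impI)
      fix y assume "dist y u < r / 2"
      hence "f v = 0" if "\<bar>v - y\<bar> < r / 2" for v
        using that unfolding dist_real_def by (intro r(2)) linarith
      thus "y \<in> E" unfolding E_def using r(1) by (auto intro!: exI[of _ "r / 2"])
    qed (use r in auto)
  qed
  moreover have "closed E" unfolding closed_limpt
  proof (intro allI impI)
    fix u assume u: "u islimpt E"
    have "E \<subseteq> {u. f u = 0}" unfolding E_def by auto
    with u show "u \<in> E" by (intro loc_zero) (rule islimpt_subset)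
  qed
  moreover have "E \<noteq> {}" using loc_zero[OF lim] by blast
  ultimately have "u \<in> E" using clopen by blast
  then obtain r where "r > 0" "\<forall>v. \<bar>v - u\<bar> < r \<longrightarrow> f v = 0" unfolding E_def by blast
  thus ?thesis by (metis abs_zero diff_self)
qed

section \<open>Uniform concentration of the posterior of the fading variable\<close>

text \<open>Outside \<open>{- 1..1}\<close> the factor \<open>g\<close> is at most
  \<open>g 1 + g (- 1)\<close>, and each of these two values is controlled by the mass of the unit
  interval between that point and \<open>0\<close>. The constant depends on \<open>s\<close> alone
  and not on \<open>g\<close>; this is the source of the uniformity in the output.\<close>

lemma concentrated_near_mode:
  fixes g :: "real \<Rightarrow> real" and s :: real
  assumes s: "s > 0" and g [measurable]: "g \<in> borel_measurable borel" and g0: "\<And>r. g r \<ge> 0"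
    and right: "\<And>r r'. 0 \<le> r \<Longrightarrow> r \<le> r' \<Longrightarrow> g r' \<le> g r"
    and left: "\<And>r r'. r \<le> r' \<Longrightarrow> r' \<le> 0 \<Longrightarrow> g r \<le> g r'"
  defines "K \<equiv> (\<integral>r. exp (- r\<^sup>2 / (2 * s)) * exp \<bar>r\<bar> \<partial>lborel)"
  shows "(\<integral>r. exp (- r\<^sup>2 / (2 * s)) * g r * exp \<bar>r\<bar> \<partial>lborel)
           \<le> (exp 1 + 2 * exp (1 / (2 * s)) * K) * (\<integral>r. exp (- r\<^sup>2 / (2 * s)) * g r \<partial>lborel)"
proof -
  have g_le: "g r \<le> g 0" for r using right[of 0 r] left[of r 0] by (cases "r \<ge> 0") auto
  have nd: "exp (- r\<^sup>2 / (2 * s)) = sqrt (2 * pi * s) * normal_density 0 (sqrt s) r" for r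
    using s by (simp add: normal_density_def)
  have int0: "integrable lborel (\<lambda>r. exp (- r\<^sup>2 / (2 * s)))"
    unfolding nd using s by (intro integrable_mult_right integrable_normal_density) auto
  have int1: "integrable lborel (\<lambda>r. exp (- r\<^sup>2 / (2 * s)) * exp \<bar>r\<bar>)"
    using integrable_normal_density_exp_abs[of "sqrt s" 1 0] s
    unfolding nd mult.assoc by (intro integrable_mult_right) auto
  have int2: "integrable lborel (\<lambda>r. exp (- r\<^sup>2 / (2 * s)) * g r)"
    by (rule Bochner_Integration.integrable_bound[OF integrable_mult_right[OF int0, of "g 0"]])
       (use g0 g_le in \<open>auto intro!: AE_I2 mult_right_mono simp: abs_mult mult.commute\<close>)
  have int3: "integrable lborel (\<lambda>r. exp (- r\<^sup>2 / (2 * s)) * g r * exp \<bar>r\<bar>)"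
  proof (rule Bochner_Integration.integrable_bound[OF integrable_mult_right[OF int1, of "g 0"]])
    show "AE r in lborel. norm (exp (- r\<^sup>2 / (2 * s)) * g r * exp \<bar>r\<bar>) \<le> norm (g 0 * (exp (- r\<^sup>2 / (2 * s)) * exp \<bar>r\<bar>))"
    proof (intro AE_I2)
      fix r
      have "g r * (exp (- r\<^sup>2 / (2 * s)) * exp \<bar>r\<bar>) \<le> g 0 * (exp (- r\<^sup>2 / (2 * s)) * exp \<bar>r\<bar>)"
        by (intro mult_right_mono g_le) auto
      thus "norm (exp (- r\<^sup>2 / (2 * s)) * g r * exp \<bar>r\<bar>) \<le> norm (g 0 * (exp (- r\<^sup>2 / (2 * s)) * exp \<bar>r\<bar>))"
        using g0 by (simp add: abs_mult mult_ac)
    qed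
  qed measurable
  define J where "J = (\<integral>r. exp (- r\<^sup>2 / (2 * s)) * g r \<partial>lborel)"
  have K0: "K \<ge> 0" unfolding K_def by (intro Bochner_Integration.integral_nonneg) auto
  \<comment> \<open>The Gaussian weight is at least exp (- 1 / (2 s)) where |r| \<le> 1, so a lower
    bound for \<open>g\<close> on a unit interval in that range becomes a lower bound for the
    mass.\<close>
  have window: "g c \<le> exp (1 / (2 * s)) * J" if c: "\<And>r. r \<in> {a..a + 1} \<Longrightarrow> g c \<le> g r \<and> \<bar>r\<bar> \<le> 1" for a c
  proof -
    have "exp (- 1 / (2 * s)) * g c = (\<integral>r. exp (- 1 / (2 * s)) * g c * indicator {a..a + 1} r \<partial>lborel)"
      by simp
    also have "\<dots> \<le> J" unfolding J_def
    proof (intro Bochner_Integration.integral_mono int2)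
      show "integrable lborel (\<lambda>r. exp (- 1 / (2 * s)) * g c * indicator {a..a + 1} r)"
        by (intro integrable_mult_right) (auto intro!: integrable_real_indicator)
      fix r show "exp (- 1 / (2 * s)) * g c * indicator {a..a + 1} r \<le> exp (- r\<^sup>2 / (2 * s)) * g r"
      proof (cases "r \<in> {a..a + 1}")
        case True
        hence "r\<^sup>2 \<le> 1" using c[OF True] by (simp add: abs_square_le_1)
        hence "exp (- 1 / (2 * s)) \<le> exp (- r\<^sup>2 / (2 * s))" using s by (simp add: divide_right_mono)
        thus ?thesis using c[OF True] True g0 by (auto intro!: mult_mono)
      qed (use g0 in auto)
    qed
    finally have "exp (1 / (2 * s)) * (exp (- 1 / (2 * s)) * g c) \<le> exp (1 / (2 * s)) * J"
      by (intro mult_left_mono) auto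
    thus ?thesis by (simp add: mult.assoc [symmetric] exp_add [symmetric])
  qed
  have w1: "g 1 \<le> exp (1 / (2 * s)) * J" by (rule window[of 0]) (auto intro: right)
  have w2: "g (- 1) \<le> exp (1 / (2 * s)) * J" by (rule window[of "- 1"]) (auto intro: left)
  have "(\<integral>r. exp (- r\<^sup>2 / (2 * s)) * g r * exp \<bar>r\<bar> \<partial>lborel)
      \<le> (\<integral>r. exp 1 * (exp (- r\<^sup>2 / (2 * s)) * g r) + (g 1 + g (- 1)) * (exp (- r\<^sup>2 / (2 * s)) * exp \<bar>r\<bar>) \<partial>lborel)"
  proof (intro Bochner_Integration.integral_mono int3 Bochner_Integration.integrable_add integrable_mult_right int1 int2)
    fix r :: real
    let ?e = "exp (- r\<^sup>2 / (2 * s))"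
    show "?e * g r * exp \<bar>r\<bar> \<le> exp 1 * (?e * g r) + (g 1 + g (- 1)) * (?e * exp \<bar>r\<bar>)"
    proof (cases "\<bar>r\<bar> \<le> 1")
      case True
      hence "(?e * g r) * exp \<bar>r\<bar> \<le> (?e * g r) * exp 1" using g0 by (intro mult_left_mono) auto
      moreover have "0 \<le> (g 1 + g (- 1)) * (?e * exp \<bar>r\<bar>)" using g0 by (intro mult_nonneg_nonneg add_nonneg_nonneg) auto
      ultimately show ?thesis by (simp add: mult.commute)
    next
      case False
      hence "g r \<le> g 1 + g (- 1)"
        using right[of 1 r] left[of r "- 1"] g0[of 1] g0[of "- 1"] by (cases "r \<ge> 0") auto
      hence "g r * (?e * exp \<bar>r\<bar>) \<le> (g 1 + g (- 1)) * (?e * exp \<bar>r\<bar>)" by (intro mult_right_mono) auto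
      hence "?e * g r * exp \<bar>r\<bar> \<le> (g 1 + g (- 1)) * (?e * exp \<bar>r\<bar>)" by (simp only: mult_ac)
      moreover have "0 \<le> exp 1 * (?e * g r)" using g0 by simp
      ultimately show ?thesis by linarith
    qed
  qed
  also have "\<dots> = exp 1 * J + (g 1 + g (- 1)) * K" using int1 int2 by (simp add: J_def K_def)
  also have "\<dots> \<le> exp 1 * J + (2 * (exp (1 / (2 * s)) * J)) * K"
    using w1 w2 K0 by (intro add_left_mono mult_right_mono) auto
  finally show ?thesis by (simp add: J_def algebra_simps)
qed

context lognormal_fading
begin

text \<open>The integrand of \<open>pp (exp (2 * v)) y\<close> after the shift \<open>t \<mapsto> t - v\<close>, which moves the
  dependence on \<open>v\<close> into the Gaussian weight.\<close>
definition nu :: "real \<Rightarrow> real \<Rightarrow> real \<Rightarrow> real" where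
  "nu v y t = normal_density (v - s2) (sqrt s2) t * gau (y - exp (2 * t))"

lemma nu_measurable [measurable]: "(\<lambda>(y, t). nu v y t) \<in> borel_measurable (borel \<Otimes>\<^sub>M borel)"
  unfolding nu_def by measurable

lemma nu_nonneg [simp]: "nu v y t \<ge> 0"
  by (simp add: nu_def)

lemma nu_le: "nu v y t \<le> gau 0 * normal_density (v - s2) (sqrt s2) t"
  unfolding nu_def by (subst mult.commute) (intro mult_right_mono gau_le normal_density_nonneg)

lemma pp_exp: "pp (exp (2 * v)) y = (\<integral>t. nu v y t \<partial>lborel)"
proof -
  have "(\<integral>t. nu v y t \<partial>lborel) = (\<integral>t. nu v y (v + 1 * t) \<partial>lborel)"
    by (subst lborel_integral_real_affine[of 1 _ v]) auto
  also have "\<dots> = pp (exp (2 * v)) y"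
    unfolding pp_def nu_def
    by (intro Bochner_Integration.integral_cong refl)
       (simp add: normal_density_def exp_add [symmetric] algebra_simps)
  finally show ?thesis by simp
qed

lemma nu_exp_integrable: "c \<ge> 0 \<Longrightarrow> integrable lborel (\<lambda>t. nu v y t * exp (c * \<bar>t - a\<bar>))"
proof -
  assume c: "c \<ge> 0"
  have int: "integrable lborel (\<lambda>t. gau 0 * exp (c * \<bar>a\<bar>) * (normal_density (v - s2) (sqrt s2) t * exp (c * \<bar>t\<bar>)))"
    using c by (intro integrable_mult_right integrable_normal_density_exp_abs) auto
  show ?thesis
  proof (rule Bochner_Integration.integrable_bound[OF int])
    show "AE t in lborel. norm (nu v y t * exp (c * \<bar>t - a\<bar>)) \<le>
      norm (gau 0 * exp (c * \<bar>a\<bar>) * (normal_density (v - s2) (sqrt s2) t * exp (c * \<bar>t\<bar>)))"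
    proof (intro AE_I2)
      fix t
      have "exp (c * \<bar>t - a\<bar>) \<le> exp (c * \<bar>a\<bar>) * exp (c * \<bar>t\<bar>)"
        unfolding exp_add [symmetric] distrib_left [symmetric] exp_le_cancel_iff
        using c by (intro mult_left_mono) auto
      hence "nu v y t * exp (c * \<bar>t - a\<bar>) \<le>
          (gau 0 * normal_density (v - s2) (sqrt s2) t) * (exp (c * \<bar>a\<bar>) * exp (c * \<bar>t\<bar>))"
        by (intro mult_mono nu_le) auto
      thus "norm (nu v y t * exp (c * \<bar>t - a\<bar>)) \<le>
          norm (gau 0 * exp (c * \<bar>a\<bar>) * (normal_density (v - s2) (sqrt s2) t * exp (c * \<bar>t\<bar>)))"
        by (simp add: abs_mult mult_ac)
    qed
  qed measurable
qed

lemma nu_integrable [simp]: "integrable lborel (nu v y)"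
  using nu_exp_integrable[of 0 v y 0] by simp

text \<open>For \<open>y <= 0\<close> the potential (y - exp (2 t))^2 / (2 sg^2) is convex in
  \<open>t\<close>, so the posterior has one mode \<open>a\<close>. Recentred there it is a Gaussian
  weight of variance \<open>s2\<close> times a factor unimodal about \<open>0\<close>, and
  \<open>concentrated_near_mode\<close> applies with a constant free of \<open>y\<close>. For
  positive \<open>y\<close> convexity fails.\<close>

lemma concentration_nonpos:
  "\<exists>V>0. \<forall>y\<le>0. \<exists>a. \<bar>a\<bar> \<le> V * (1 + \<bar>y\<bar>) \<and>
     (\<integral>t. nu v y t * exp \<bar>t - a\<bar> \<partial>lborel) \<le> V * (\<integral>t. nu v y t \<partial>lborel)"
proof -
  define m where "m = v - s2"
  define K where "K = (\<integral>r. exp (- r\<^sup>2 / (2 * s2)) * exp \<bar>r\<bar> \<partial>lborel)"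
  define V1 where "V1 = exp 1 + 2 * exp (1 / (2 * s2)) * K"
  define V where "V = V1 + \<bar>m\<bar> + s2 * (2 * exp (2 * m) * (exp (2 * m) + 1) / sg\<^sup>2)"
  have K0: "K \<ge> 0" unfolding K_def by (intro Bochner_Integration.integral_nonneg) auto
  have V1: "V1 > 0" unfolding V1_def using K0 by (intro add_pos_nonneg) auto
  have pos: "0 \<le> s2 * (2 * exp (2 * m) * (exp (2 * m) + 1) / sg\<^sup>2)"
    by (intro mult_nonneg_nonneg divide_nonneg_nonneg add_nonneg_nonneg) auto
  have V: "V > 0" "V1 \<le> V" using V1 pos unfolding V_def by linarith+
  have "\<exists>a. \<bar>a\<bar> \<le> V * (1 + \<bar>y\<bar>) \<and>
     (\<integral>t. nu v y t * exp \<bar>t - a\<bar> \<partial>lborel) \<le> V * (\<integral>t. nu v y t \<partial>lborel)" if y: "y \<le> 0" for y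
  proof -
    \<comment> \<open>The derivative of that potential; it is nonnegative and increasing because
      \<open>y\<close> is not positive.\<close>
    define W where "W t = 2 * exp (2 * t) * (exp (2 * t) - y) / sg\<^sup>2" for t
    have W_mono: "W t \<le> W t'" if "t \<le> t'" for t t'
      unfolding W_def using that order_trans[OF y exp_ge_zero[of "2 * t"]]
      by (intro divide_right_mono mult_mono) auto
    have W_nonneg: "W t \<ge> 0" for t
      unfolding W_def using y exp_ge_zero[of "2 * t"] by (intro divide_nonneg_nonneg mult_nonneg_nonneg) (auto intro: order_trans)
    \<comment> \<open>The mode is the zero of the derivative of the negative log-density.
      Monotonicity of \<open>W\<close> brackets it within \<open>s2 * W m\<close> below the prior
      mean \<open>m\<close>, which is linear in |y|.\<close>
    have "\<exists>a\<ge>m - s2 * W m. a \<le> m \<and> (a - m) / s2 + W a = 0"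
    proof (rule IVT')
      show "(m - s2 * W m - m) / s2 + W (m - s2 * W m) \<le> 0"
        using W_mono[of "m - s2 * W m" m] W_nonneg[of m] by simp
      show "0 \<le> (m - m) / s2 + W m" using W_nonneg by simp
      show "m - s2 * W m \<le> m" using W_nonneg by simp
      show "continuous_on {m - s2 * W m..m} (\<lambda>a. (a - m) / s2 + W a)"
        unfolding W_def by (intro continuous_intros) auto
    qed
    then obtain a where a: "m - s2 * W m \<le> a" "a \<le> m" "(a - m) / s2 + W a = 0" by blast
    have "\<bar>a\<bar> \<le> V * (1 + \<bar>y\<bar>)"
    proof -
      have "W m \<le> 2 * exp (2 * m) * ((exp (2 * m) + 1) * (1 + \<bar>y\<bar>)) / sg\<^sup>2"
      proof -
        have "(exp (2 * m) + 1) * (1 + \<bar>y\<bar>) = exp (2 * m) + exp (2 * m) * \<bar>y\<bar> + 1 + \<bar>y\<bar>"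
          by (simp add: algebra_simps)
        moreover have "0 \<le> exp (2 * m) * \<bar>y\<bar>" by simp
        ultimately have "exp (2 * m) - y \<le> (exp (2 * m) + 1) * (1 + \<bar>y\<bar>)" by linarith
        thus ?thesis unfolding W_def by (intro divide_right_mono mult_left_mono) auto
      qed
      hence "s2 * W m \<le> s2 * (2 * exp (2 * m) * ((exp (2 * m) + 1) * (1 + \<bar>y\<bar>)) / sg\<^sup>2)"
        by (intro mult_left_mono) auto
      also have "\<dots> = s2 * (2 * exp (2 * m) * (exp (2 * m) + 1) / sg\<^sup>2) * (1 + \<bar>y\<bar>)" by simp
      finally have "\<bar>a\<bar> \<le> \<bar>m\<bar> + s2 * (2 * exp (2 * m) * (exp (2 * m) + 1) / sg\<^sup>2) * (1 + \<bar>y\<bar>)"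
        using a by linarith
      also have "\<dots> \<le> V * (1 + \<bar>y\<bar>)"
      proof -
        have "\<bar>m\<bar> \<le> \<bar>m\<bar> * (1 + \<bar>y\<bar>)" "0 \<le> V1 * (1 + \<bar>y\<bar>)" using V1 by (auto simp: algebra_simps)
        thus ?thesis unfolding V_def distrib_right by linarith
      qed
      finally show ?thesis .
    qed
    moreover have "(\<integral>t. nu v y t * exp \<bar>t - a\<bar> \<partial>lborel) \<le> V * (\<integral>t. nu v y t \<partial>lborel)"
    proof -
      \<comment> \<open>What remains of the exponent once the recentred Gaussian weight is split
        off. Its derivative \<open>W (a + r) - W a\<close> changes sign at \<open>r = 0\<close>, so
        \<open>g\<close> is unimodal there.\<close>
      define h where "h r = (a - m) * r / s2 + (y - exp (2 * (a + r)))\<^sup>2 / (2 * sg\<^sup>2)" for r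
      define c where "c = normal_density 0 (sqrt s2) 0 * gau 0 * exp (- (a - m)\<^sup>2 / (2 * s2))"
      define g where "g r = c * exp (- h r)" for r
      have c: "c > 0" unfolding c_def by (intro mult_pos_pos normal_density_pos) auto
      have h_deriv: "(h has_real_derivative W (a + r) - W a) (at r)" for r
      proof -
        have "(h has_real_derivative (a - m) / s2 + W (a + r)) (at r)"
          unfolding h_def[abs_def] W_def
          by (auto intro!: derivative_eq_intros simp: field_simps power2_eq_square exp_add)
        thus ?thesis using a(3) by (simp add: eq_neg_iff_add_eq_0 [symmetric])
      qed
      have eq: "nu v y (a + r) = exp (- r\<^sup>2 / (2 * s2)) * g r" for r
      proof -
        have "- (a + r - m)\<^sup>2 / (2 * s2) = - (a - m)\<^sup>2 / (2 * s2) + - r\<^sup>2 / (2 * s2) - (a - m) * r / s2"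
          by (simp add: field_simps power2_eq_square)
        hence e: "exp (- (a + r - m)\<^sup>2 / (2 * s2))
          = exp (- (a - m)\<^sup>2 / (2 * s2)) * exp (- r\<^sup>2 / (2 * s2)) * exp (- ((a - m) * r / s2))"
          by (simp only: exp_add [symmetric] diff_conv_add_uminus)
        have "nu v y (a + r) = normal_density 0 (sqrt s2) 0 * exp (- (a + r - m)\<^sup>2 / (2 * s2)) *
             (gau 0 * exp (- (y - exp (2 * (a + r)))\<^sup>2 / (2 * sg\<^sup>2)))"
          unfolding nu_def gau_eq[of "y - exp (2 * (a + r))"] by (simp add: normal_density_def m_def)
        also have "\<dots> = exp (- r\<^sup>2 / (2 * s2)) * g r"
          unfolding e g_def c_def h_def minus_add_distrib exp_add by (simp add: mult_ac)
        finally show ?thesis .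
      qed
      have g_meas: "g \<in> borel_measurable borel" unfolding g_def[abs_def] h_def by measurable
      have right: "g r' \<le> g r" if "0 \<le> r" "r \<le> r'" for r r'
      proof -
        have "h r \<le> h r'"
        proof (rule DERIV_nonneg_imp_nondecreasing[OF that(2)])
          fix x assume "r \<le> x" "x \<le> r'"
          thus "\<exists>z. (h has_real_derivative z) (at x) \<and> 0 \<le> z"
            using h_deriv[of x] W_mono[of a "a + x"] that by (intro exI[of _ "W (a + x) - W a"]) auto
        qed
        thus ?thesis using c by (simp add: g_def)
      qed
      have left: "g r \<le> g r'" if "r \<le> r'" "r' \<le> 0" for r r'
      proof -
        have "h r' \<le> h r"
        proof (rule DERIV_nonpos_imp_nonincreasing[OF that(1)])
          fix x assume "r \<le> x" "x \<le> r'"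
          thus "\<exists>z. (h has_real_derivative z) (at x) \<and> z \<le> 0"
            using h_deriv[of x] W_mono[of "a + x" a] that by (intro exI[of _ "W (a + x) - W a"]) auto
        qed
        thus ?thesis using c by (simp add: g_def)
      qed
      have "(\<integral>t. nu v y t * exp \<bar>t - a\<bar> \<partial>lborel) = (\<integral>r. exp (- r\<^sup>2 / (2 * s2)) * g r * exp \<bar>r\<bar> \<partial>lborel)"
        by (subst lborel_integral_real_affine[of 1 _ a]) (auto simp: eq)
      also have "\<dots> \<le> V1 * (\<integral>r. exp (- r\<^sup>2 / (2 * s2)) * g r \<partial>lborel)"
        unfolding V1_def K_def
        by (rule concentrated_near_mode[OF _ g_meas _ right left]) (use c in \<open>auto simp: g_def\<close>)
      also have "(\<integral>r. exp (- r\<^sup>2 / (2 * s2)) * g r \<partial>lborel) = (\<integral>t. nu v y t \<partial>lborel)"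
        by (subst (2) lborel_integral_real_affine[of 1 _ a]) (auto simp: eq)
      also have "V1 * (\<integral>t. nu v y t \<partial>lborel) \<le> V * (\<integral>t. nu v y t \<partial>lborel)"
        using V by (intro mult_right_mono Bochner_Integration.integral_nonneg) auto
      finally show ?thesis .
    qed
    ultimately show ?thesis by blast
  qed
  with V show ?thesis by blast
qed

text \<open>For \<open>y \<ge> 1\<close> the posterior sits near \<open>ln y / 2\<close>: away from it the Gaussian factor is
  \<open>exp (- c y\<^sup>2)\<close>, while the output density is only exponentially small.\<close>

lemma concentration_nonneg:
  "\<exists>V>0. \<forall>y\<ge>0. \<exists>a. \<bar>a\<bar> \<le> V * (1 + \<bar>y\<bar>) \<and>
     (\<integral>t. nu v y t * exp \<bar>t - a\<bar> \<partial>lborel) \<le> V * (\<integral>t. nu v y t \<partial>lborel)"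
proof -
  define x0 where "x0 = exp (2 * v)"
  obtain C where C: "C > 0" "\<And>y. y \<ge> 0 \<Longrightarrow> exp (- C * (1 + y)) \<le> pp x0 y"
    using pp_lower_right[of x0 x0] by (auto simp: x0_def)
  let ?N = "normal_density (v - s2) (sqrt s2)"
  define K where "K = (\<integral>t. ?N t * exp \<bar>t\<bar> \<partial>lborel)"
  have intK: "integrable lborel (\<lambda>t. ?N t * exp \<bar>t\<bar>)"
    using integrable_normal_density_exp_abs[of "sqrt s2" 1 "v - s2"] by simp
  have K0: "K \<ge> 0" unfolding K_def by (intro Bochner_Integration.integral_nonneg) auto
  define V1 where "V1 = exp (C + 2 * sg\<^sup>2 * (1 + C)\<^sup>2)"
  define V where "V = 1 + exp 1 + K * gau 0 * V1 + K * gau 0 * exp (2 * C)"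
  have nonneg: "0 \<le> K * gau 0 * V1" "0 \<le> K * gau 0 * exp (2 * C)" using K0 by (auto simp: V1_def)
  have V: "V \<ge> 1" using nonneg exp_ge_zero[of "1 :: real"] unfolding V_def by linarith
  have int: "integrable lborel (\<lambda>t. nu v y t * exp \<bar>t - a\<bar>)" for y a
    using nu_exp_integrable[of 1 v y a] by simp
  have p0: "(\<integral>t. nu v y t \<partial>lborel) = pp x0 y" for y by (simp add: x0_def pp_exp)
  have "\<exists>a. \<bar>a\<bar> \<le> V * (1 + \<bar>y\<bar>) \<and>
     (\<integral>t. nu v y t * exp \<bar>t - a\<bar> \<partial>lborel) \<le> V * (\<integral>t. nu v y t \<partial>lborel)" if y: "y \<ge> 0" for y
  proof (cases "y \<ge> 1")
    case True
    define a where "a = ln y / 2"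
    define b where "b = gau 0 * exp (- y\<^sup>2 / (8 * sg\<^sup>2)) * exp a"
    have a0: "0 \<le> a" "a \<le> y" using True ln_le_minus_one[of y] by (auto simp: a_def)
    have ea: "exp (2 * a) = y" using True by (simp add: a_def)
    have pw: "nu v y t * exp \<bar>t - a\<bar> \<le> exp 1 * nu v y t + b * (?N t * exp \<bar>t\<bar>)" for t
    proof (cases "\<bar>t - a\<bar> \<le> 1")
      case True
      hence "nu v y t * exp \<bar>t - a\<bar> \<le> nu v y t * exp 1" by (intro mult_left_mono) auto
      moreover have "0 \<le> b * (?N t * exp \<bar>t\<bar>)" by (auto simp: b_def)
      ultimately show ?thesis by (simp only: mult.commute[of _ "exp 1"])
    next
      case False
      have e2: "2 \<le> exp (2 :: real)" using exp_ge_add_one_self[of "2 :: real"] by linarith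
      have "\<bar>y - exp (2 * t)\<bar> \<ge> y / 2"
      proof (cases "t \<ge> a")
        case True
        hence "exp (2 * a + 2) \<le> exp (2 * t)" using False by auto
        hence "y * 2 \<le> exp (2 * t)" using e2 y mult_left_mono[OF e2 y] by (simp add: exp_add ea)
        thus ?thesis using y by linarith
      next
        case f: False
        hence "exp (2 * t + 2) \<le> exp (2 * a)" using False by auto
        hence "exp (2 * t) * exp 2 \<le> y" by (simp only: exp_add ea)
        moreover have "exp (2 * t) * 2 \<le> exp (2 * t) * exp 2" by (intro mult_left_mono e2) simp
        ultimately have "exp (2 * t) * 2 \<le> y" by linarith
        thus ?thesis using y by linarith
      qed
      hence "(y / 2)\<^sup>2 \<le> (y - exp (2 * t))\<^sup>2" using y by (subst abs_le_square_iff [symmetric]) auto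
      hence "(y / 2)\<^sup>2 / (2 * sg\<^sup>2) \<le> (y - exp (2 * t))\<^sup>2 / (2 * sg\<^sup>2)" by (intro divide_right_mono) auto
      hence "y\<^sup>2 / (8 * sg\<^sup>2) \<le> (y - exp (2 * t))\<^sup>2 / (2 * sg\<^sup>2)" by (simp add: power_divide)
      hence "gau (y - exp (2 * t)) \<le> gau 0 * exp (- y\<^sup>2 / (8 * sg\<^sup>2))"
        unfolding gau_eq[of "y - exp (2 * t)"] by (intro mult_left_mono) auto
      moreover have "exp \<bar>t - a\<bar> \<le> exp a * exp \<bar>t\<bar>" using a0 by (simp add: exp_add [symmetric])
      ultimately have "nu v y t * exp \<bar>t - a\<bar> \<le> (?N t * (gau 0 * exp (- y\<^sup>2 / (8 * sg\<^sup>2)))) * (exp a * exp \<bar>t\<bar>)"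
        unfolding nu_def by (intro mult_mono mult_left_mono) auto
      also have "\<dots> = b * (?N t * exp \<bar>t\<bar>)" by (simp add: b_def mult_ac)
      also have "\<dots> \<le> exp 1 * nu v y t + b * (?N t * exp \<bar>t\<bar>)" by simp
      finally show ?thesis .
    qed
    have "(\<integral>t. nu v y t * exp \<bar>t - a\<bar> \<partial>lborel)
        \<le> (\<integral>t. exp 1 * nu v y t + b * (?N t * exp \<bar>t\<bar>) \<partial>lborel)"
      by (intro Bochner_Integration.integral_mono int Bochner_Integration.integrable_add
          integrable_mult_right nu_integrable intK pw)
    also have "\<dots> = exp 1 * pp x0 y + b * K"
      using intK by (simp add: K_def p0)
    also have "b * K \<le> (K * gau 0 * V1) * pp x0 y"
    proof -
      \<comment> \<open>The linear exponent collects exp \<open>a\<close> with \<open>a <= y\<close>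
        and the lower bound exp (- C (1 + y)) of the density; the Gaussian loss beats it, and
        \<open>V1\<close> contains the maximum over \<open>y\<close>.\<close>
      have "(1 + C) * y - y\<^sup>2 / (8 * sg\<^sup>2) \<le> 2 * sg\<^sup>2 * (1 + C)\<^sup>2"
      proof -
        have "0 \<le> (y / sg - 4 * sg * (1 + C))\<^sup>2 / 8" by simp
        also have "\<dots> = y\<^sup>2 / (8 * sg\<^sup>2) + 2 * sg\<^sup>2 * (1 + C)\<^sup>2 - (1 + C) * y"
          by (simp add: field_simps power2_eq_square)
        finally show ?thesis by simp
      qed
      hence "a + - y\<^sup>2 / (8 * sg\<^sup>2) \<le> (C + 2 * sg\<^sup>2 * (1 + C)\<^sup>2) + - C * (1 + y)"
        using a0 by (simp add: algebra_simps)
      hence "exp (a + - y\<^sup>2 / (8 * sg\<^sup>2)) \<le> exp ((C + 2 * sg\<^sup>2 * (1 + C)\<^sup>2) + - C * (1 + y))" by simp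
      hence "exp a * exp (- y\<^sup>2 / (8 * sg\<^sup>2)) \<le> V1 * exp (- C * (1 + y))"
        unfolding exp_add V1_def .
      also have "\<dots> \<le> V1 * pp x0 y" using C(2)[OF y] by (intro mult_left_mono) (auto simp: V1_def)
      finally have "(K * gau 0) * (exp a * exp (- y\<^sup>2 / (8 * sg\<^sup>2))) \<le> (K * gau 0) * (V1 * pp x0 y)"
        using K0 by (intro mult_left_mono) auto
      thus ?thesis by (simp add: b_def mult_ac)
    qed
    also have "exp 1 * pp x0 y + (K * gau 0 * V1) * pp x0 y = (exp 1 + K * gau 0 * V1) * pp x0 y"
      by (simp only: distrib_right)
    also have "\<dots> \<le> V * pp x0 y" using nonneg unfolding V_def by (intro mult_right_mono) auto
    finally have "(\<integral>t. nu v y t * exp \<bar>t - a\<bar> \<partial>lborel) \<le> V * pp x0 y" by simp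
    moreover have "\<bar>a\<bar> \<le> V * (1 + \<bar>y\<bar>)"
    proof -
      have "\<bar>a\<bar> \<le> 1 * (1 + \<bar>y\<bar>)" using a0 by simp
      also have "\<dots> \<le> V * (1 + \<bar>y\<bar>)" using V by (intro mult_right_mono) auto
      finally show ?thesis .
    qed
    ultimately show ?thesis unfolding p0 by blast
  next
    case False
    \<comment> \<open>For \<open>y\<close> below 1 the density is at least exp (- 2 C), so the
      centre \<open>0\<close> and the prior exponential moment suffice.\<close>
    have "(\<integral>t. nu v y t * exp \<bar>t - 0\<bar> \<partial>lborel) \<le> (\<integral>t. gau 0 * (?N t * exp \<bar>t\<bar>) \<partial>lborel)"
    proof (intro Bochner_Integration.integral_mono int integrable_mult_right intK)
      show "nu v y t * exp \<bar>t - 0\<bar> \<le> gau 0 * (?N t * exp \<bar>t\<bar>)" for t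
        using mult_right_mono[OF nu_le, of "exp \<bar>t\<bar>" v y t] by (simp add: mult.assoc)
    qed
    also have "\<dots> = (K * gau 0 * exp (2 * C)) * exp (- C * (1 + 1))"
    proof -
      have "exp (2 * C) * exp (- C * (1 + 1)) = 1" by (simp add: exp_add [symmetric])
      thus ?thesis by (simp add: K_def mult.assoc)
    qed
    also have "\<dots> \<le> (K * gau 0 * exp (2 * C)) * pp x0 y"
    proof (intro mult_left_mono nonneg)
      have "exp (- C * (1 + 1)) \<le> exp (- C * (1 + y))" using False C(1) by simp
      thus "exp (- C * (1 + 1)) \<le> pp x0 y" using C(2)[OF y] by linarith
    qed
    also have "\<dots> \<le> V * pp x0 y" using nonneg unfolding V_def by (intro mult_right_mono) auto
    finally show ?thesis using V unfolding p0 by (intro exI[of _ 0]) auto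
  qed
  thus ?thesis using V by (intro exI[of _ V]) auto
qed

text \<open>The centres found so far are chosen separately for each \<open>y\<close> and need not be
  measurable. The posterior mean is measurable and lies within \<open>V\<close> of any such centre,
  because |t - a| \<le> exp |t - a|; moving the centre costs a factor exp \<open>V\<close>.\<close>

lemma concentration:
  "\<exists>V>0. \<exists>a\<in>borel_measurable borel. \<forall>y. \<bar>a y\<bar> \<le> V * (1 + \<bar>y\<bar>) \<and>
     (\<integral>t. nu v y t * exp \<bar>t - a y\<bar> \<partial>lborel) \<le> V * (\<integral>t. nu v y t \<partial>lborel)"
proof -
  obtain V1 where V1: "V1 > 0" "\<And>y. y \<le> 0 \<Longrightarrow> \<exists>a. \<bar>a\<bar> \<le> V1 * (1 + \<bar>y\<bar>) \<and>
     (\<integral>t. nu v y t * exp \<bar>t - a\<bar> \<partial>lborel) \<le> V1 * (\<integral>t. nu v y t \<partial>lborel)"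
    using concentration_nonpos by blast
  obtain V2 where V2: "V2 > 0" "\<And>y. y \<ge> 0 \<Longrightarrow> \<exists>a. \<bar>a\<bar> \<le> V2 * (1 + \<bar>y\<bar>) \<and>
     (\<integral>t. nu v y t * exp \<bar>t - a\<bar> \<partial>lborel) \<le> V2 * (\<integral>t. nu v y t \<partial>lborel)"
    using concentration_nonneg by blast
  define V where "V = V1 + V2"
  have V: "V > 0" using V1 V2 by (simp add: V_def)
  have p_pos: "(\<integral>t. nu v y t \<partial>lborel) > 0" for y by (simp flip: pp_exp)
  have ex: "\<exists>a. \<bar>a\<bar> \<le> V * (1 + \<bar>y\<bar>) \<and>
     (\<integral>t. nu v y t * exp \<bar>t - a\<bar> \<partial>lborel) \<le> V * (\<integral>t. nu v y t \<partial>lborel)" for y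
  proof -
    have le: "V1 * (1 + \<bar>y\<bar>) \<le> V * (1 + \<bar>y\<bar>)" "V2 * (1 + \<bar>y\<bar>) \<le> V * (1 + \<bar>y\<bar>)"
      "V1 * (\<integral>t. nu v y t \<partial>lborel) \<le> V * (\<integral>t. nu v y t \<partial>lborel)"
      "V2 * (\<integral>t. nu v y t \<partial>lborel) \<le> V * (\<integral>t. nu v y t \<partial>lborel)"
      using V1 V2 p_pos[of y] unfolding V_def by (auto intro!: mult_right_mono)
    show ?thesis
    proof (cases "y \<le> 0")
      case True
      then obtain a where "\<bar>a\<bar> \<le> V1 * (1 + \<bar>y\<bar>)"
        "(\<integral>t. nu v y t * exp \<bar>t - a\<bar> \<partial>lborel) \<le> V1 * (\<integral>t. nu v y t \<partial>lborel)" using V1(2) by blast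
      thus ?thesis using le by (intro exI[of _ a] conjI) linarith+
    next
      case False
      then obtain a where "\<bar>a\<bar> \<le> V2 * (1 + \<bar>y\<bar>)"
        "(\<integral>t. nu v y t * exp \<bar>t - a\<bar> \<partial>lborel) \<le> V2 * (\<integral>t. nu v y t \<partial>lborel)" using V2(2)[of y] by auto
      thus ?thesis using le by (intro exI[of _ a] conjI) linarith+
    qed
  qed
  define am where "am y = (\<integral>t. nu v y t * t \<partial>lborel) / (\<integral>t. nu v y t \<partial>lborel)" for y
  have "am \<in> borel_measurable borel" unfolding am_def[abs_def] by measurable
  moreover have "\<bar>am y\<bar> \<le> (2 * V + V * exp V) * (1 + \<bar>y\<bar>) \<and>
     (\<integral>t. nu v y t * exp \<bar>t - am y\<bar> \<partial>lborel) \<le> (2 * V + V * exp V) * (\<integral>t. nu v y t \<partial>lborel)" for y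
  proof -
    obtain a where a: "\<bar>a\<bar> \<le> V * (1 + \<bar>y\<bar>)"
      "(\<integral>t. nu v y t * exp \<bar>t - a\<bar> \<partial>lborel) \<le> V * (\<integral>t. nu v y t \<partial>lborel)" using ex by blast
    let ?p = "\<integral>t. nu v y t \<partial>lborel"
    have int: "integrable lborel (\<lambda>t. nu v y t * exp \<bar>t - a\<bar>)" for a
      using nu_exp_integrable[of 1 v y a] by simp
    have le: "\<bar>t - a\<bar> \<le> exp \<bar>t - a\<bar>" for t using exp_ge_add_one_self[of "\<bar>t - a\<bar>"] by linarith
    have int1: "integrable lborel (\<lambda>t. nu v y t * (t - a))"
      by (rule Bochner_Integration.integrable_bound[OF int[of a]])
         (auto intro!: AE_I2 mult_left_mono le simp: abs_mult)
    have eq: "am y - a = (\<integral>t. nu v y t * (t - a) \<partial>lborel) / ?p"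
    proof -
      have "(\<lambda>t. nu v y t * t) = (\<lambda>t. nu v y t * (t - a) + a * nu v y t)" by (simp add: algebra_simps)
      hence "(\<integral>t. nu v y t * t \<partial>lborel) = (\<integral>t. nu v y t * (t - a) \<partial>lborel) + a * ?p"
        using int1 by simp
      thus ?thesis using p_pos[of y] unfolding am_def by (simp add: field_simps)
    qed
    have "\<bar>\<integral>t. nu v y t * (t - a) \<partial>lborel\<bar> \<le> (\<integral>t. nu v y t * exp \<bar>t - a\<bar> \<partial>lborel)"
      by (rule order_trans[OF integral_abs_bound])
         (intro Bochner_Integration.integral_mono integrable_abs int1 int, auto simp: abs_mult intro!: mult_left_mono le)
    hence d: "\<bar>am y - a\<bar> \<le> V"
      unfolding eq abs_divide using a(2) p_pos[of y] by (simp add: divide_le_eq)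
    have "\<bar>am y\<bar> \<le> V * (1 + \<bar>y\<bar>) + V" using d a(1) by linarith
    also have "\<dots> \<le> (2 * V + V * exp V) * (1 + \<bar>y\<bar>)"
    proof -
      have "V \<le> V * (1 + \<bar>y\<bar>)" "0 \<le> V * exp V * (1 + \<bar>y\<bar>)" using V by (auto simp: algebra_simps)
      moreover have "(2 * V + V * exp V) * (1 + \<bar>y\<bar>) = 2 * (V * (1 + \<bar>y\<bar>)) + V * exp V * (1 + \<bar>y\<bar>)"
        by (simp add: algebra_simps)
      ultimately show ?thesis by linarith
    qed
    finally have 1: "\<bar>am y\<bar> \<le> (2 * V + V * exp V) * (1 + \<bar>y\<bar>)" .
    have "(\<integral>t. nu v y t * exp \<bar>t - am y\<bar> \<partial>lborel) \<le> (\<integral>t. exp V * (nu v y t * exp \<bar>t - a\<bar>) \<partial>lborel)"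
    proof (intro Bochner_Integration.integral_mono int integrable_mult_right)
      fix t
      have "exp \<bar>t - am y\<bar> \<le> exp V * exp \<bar>t - a\<bar>" using d by (simp add: exp_add [symmetric])
      thus "nu v y t * exp \<bar>t - am y\<bar> \<le> exp V * (nu v y t * exp \<bar>t - a\<bar>)"
        using mult_left_mono[of "exp \<bar>t - am y\<bar>" "exp V * exp \<bar>t - a\<bar>" "nu v y t"] by (simp add: mult_ac)
    qed
    also have "\<dots> \<le> exp V * (V * ?p)" using a(2) by (simp add: mult_left_mono)
    also have "\<dots> \<le> (2 * V + V * exp V) * ?p" using V p_pos[of y] by (simp add: algebra_simps)
    finally show ?thesis using 1 by blast
  qed
  moreover have "2 * V + V * exp V > 0" using V by (simp add: add_pos_pos)
  ultimately show ?thesis by blast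
qed

end

section \<open>Analytic continuation of the density and of its logarithm\<close>

context lognormal_fading
begin

text \<open>The moment generating function of the unnormalised posterior about the centre
  \<open>a\<close>. The division by \<open>s2\<close> makes a tilt by \<xi> correspond to moving the
  Gaussian mean by \<xi>.\<close>

definition Nc :: "real \<Rightarrow> real \<Rightarrow> real \<Rightarrow> complex \<Rightarrow> complex" where
  "Nc v a y \<xi> = (\<integral>t. of_real (nu v y t) * exp (\<xi> * of_real ((t - a) / s2)) \<partial>lborel)"

text \<open>The analytic continuation of \<open>x \<mapsto> pp (exp (2 * (v + x))) y\<close>.\<close>
definition Pc :: "real \<Rightarrow> real \<Rightarrow> complex \<Rightarrow> complex" where
  "Pc v y \<xi> = exp (- \<xi>\<^sup>2 / of_real (2 * s2)) * Nc v (v - s2) y \<xi>"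

lemma norm_exp_real_mult: "norm (exp (\<xi> * complex_of_real r)) = exp (Re \<xi> * r)"
  by simp

lemma Nc_integrand_bound:
  fixes \<xi> :: complex
  assumes "norm \<xi> \<le> R"
  shows "norm (of_real (nu v y t) * exp (\<xi> * of_real ((t - a) / s2))) \<le> nu v y t * exp (R / s2 * \<bar>t - a\<bar>)"
proof -
  have "Re \<xi> * ((t - a) / s2) \<le> \<bar>Re \<xi>\<bar> * (\<bar>t - a\<bar> / s2)"
    by (rule order_trans[OF abs_ge_self]) (simp add: abs_mult)
  also have "\<dots> \<le> R * (\<bar>t - a\<bar> / s2)"
    using assms abs_Re_le_cmod[of \<xi>] by (intro mult_right_mono) auto
  finally have "exp (Re \<xi> * ((t - a) / s2)) \<le> exp (R / s2 * \<bar>t - a\<bar>)" by simp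
  thus ?thesis unfolding norm_mult norm_exp_real_mult by (intro mult_mono) auto
qed

lemma Nc_integrable: "integrable lborel (\<lambda>t. of_real (nu v y t) * exp (\<xi> * of_real ((t - a) / s2)) :: complex)"
  by (rule Bochner_Integration.integrable_bound[OF nu_exp_integrable[of "norm \<xi> / s2" v y a]])
     (measurable, intro AE_I2 order_trans[OF Nc_integrand_bound[OF order_refl]], simp)

lemma Nc_holomorphic: "(\<lambda>\<xi>. Nc v a y \<xi>) holomorphic_on ball 0 R"
  unfolding Nc_def
proof (rule holomorphic_on_lebesgue_integral)
  show "integrable lborel (\<lambda>t. nu v y t * exp (\<bar>R\<bar> / s2 * \<bar>t - a\<bar>))"
    by (rule nu_exp_integrable) auto
  show "norm (of_real (nu v y t) * exp (\<xi> * of_real ((t - a) / s2)) :: complex)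
      \<le> nu v y t * exp (\<bar>R\<bar> / s2 * \<bar>t - a\<bar>)" if "\<xi> \<in> ball 0 R" for \<xi> t
    using that by (intro Nc_integrand_bound) auto
qed (auto intro!: holomorphic_intros)

lemma Nc_measurable:
  assumes [measurable]: "a \<in> borel_measurable borel"
  shows "(\<lambda>y. Nc v (a y) y \<xi>) \<in> borel_measurable borel"
  unfolding Nc_def by measurable

lemma Pc_measurable [measurable]: "(\<lambda>y. Pc v y \<xi>) \<in> borel_measurable borel"
  unfolding Pc_def using Nc_measurable[of "\<lambda>_. v - s2"] by measurable

lemma Pc_holomorphic: "(\<lambda>\<xi>. Pc v y \<xi>) holomorphic_on ball 0 R"
  unfolding Pc_def by (intro holomorphic_intros Nc_holomorphic) auto

text \<open>A change of centre only contributes the exponential of an explicit polynomial in \<xi>,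
  whose logarithm is known. So the centre may be adapted to each \<open>y\<close>, and only
  \<open>Nc\<close> needs a branch of the logarithm.\<close>

lemma Pc_eq_Nc: "Pc v y \<xi> = exp (- \<xi>\<^sup>2 / of_real (2 * s2) + \<xi> * of_real ((a - (v - s2)) / s2)) * Nc v a y \<xi>"
proof -
  have "Nc v (v - s2) y \<xi> = (\<integral>t. exp (\<xi> * of_real ((a - (v - s2)) / s2)) *
      (of_real (nu v y t) * exp (\<xi> * of_real ((t - a) / s2))) \<partial>lborel)"
    unfolding Nc_def
  proof (intro Bochner_Integration.integral_cong refl)
    fix t
    have "\<xi> * of_real ((t - (v - s2)) / s2) = \<xi> * of_real ((a - (v - s2)) / s2) + \<xi> * of_real ((t - a) / s2)"
      unfolding distrib_left [symmetric] of_real_add [symmetric] by (simp add: diff_divide_distrib)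
    thus "of_real (nu v y t) * exp (\<xi> * of_real ((t - (v - s2)) / s2)) =
      exp (\<xi> * of_real ((a - (v - s2)) / s2)) * (of_real (nu v y t) * exp (\<xi> * of_real ((t - a) / s2)))"
      by (simp only: exp_add mult_ac)
  qed
  also have "\<dots> = exp (\<xi> * of_real ((a - (v - s2)) / s2)) * Nc v a y \<xi>"
    unfolding Nc_def by (rule Bochner_Integration.integral_mult_right) (rule Nc_integrable)
  finally show ?thesis unfolding Pc_def by (simp only: exp_add mult.assoc)
qed

lemma nu_shift: "nu (v + x) y t = exp (- x\<^sup>2 / (2 * s2)) * (nu v y t * exp (x * ((t - (v - s2)) / s2)))"
proof -
  have "- (t - (v + x - s2))\<^sup>2 / (2 * s2)
      = - x\<^sup>2 / (2 * s2) + - (t - (v - s2))\<^sup>2 / (2 * s2) + x * ((t - (v - s2)) / s2)"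
    by (simp add: field_simps power2_eq_square)
  hence "exp (- (t - (v + x - s2))\<^sup>2 / (2 * s2))
      = exp (- x\<^sup>2 / (2 * s2)) * exp (- (t - (v - s2))\<^sup>2 / (2 * s2)) * exp (x * ((t - (v - s2)) / s2))"
    by (simp only: exp_add)
  thus ?thesis by (simp add: nu_def normal_density_def mult_ac)
qed

lemma nu_tilt_integral:
  "(\<integral>t. nu v y t * exp (x * ((t - (v - s2)) / s2)) \<partial>lborel) = exp (x\<^sup>2 / (2 * s2)) * pp (exp (2 * (v + x))) y"
proof -
  have "exp (x\<^sup>2 / (2 * s2)) * pp (exp (2 * (v + x))) y = (\<integral>t. exp (x\<^sup>2 / (2 * s2)) * nu (v + x) y t \<partial>lborel)"
    unfolding pp_exp by simp
  also have "\<dots> = (\<integral>t. nu v y t * exp (x * ((t - (v - s2)) / s2)) \<partial>lborel)"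
    unfolding nu_shift mult.assoc [symmetric] exp_add [symmetric] by simp
  finally show ?thesis ..
qed

lemma Pc_of_real: "Pc v y (of_real x) = of_real (pp (exp (2 * (v + x))) y)"
proof -
  have "Nc v (v - s2) y (of_real x) = (\<integral>t. of_real (nu v y t * exp (x * ((t - (v - s2)) / s2))) \<partial>lborel)"
    unfolding Nc_def by (intro Bochner_Integration.integral_cong refl) (simp add: exp_of_real [symmetric])
  also have "\<dots> = of_real (exp (x\<^sup>2 / (2 * s2)) * pp (exp (2 * (v + x))) y)"
    by (simp only: integral_complex_of_real nu_tilt_integral)
  finally have "Pc v y (of_real x) = of_real (exp (- x\<^sup>2 / (2 * s2)) * (exp (x\<^sup>2 / (2 * s2)) * pp (exp (2 * (v + x))) y))"
    unfolding Pc_def by (simp add: exp_of_real [symmetric])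
  thus ?thesis by (simp add: mult.assoc [symmetric] exp_add [symmetric])
qed

text \<open>The imaginary part of the shift costs no more than exp ((Im \<xi>)^2 / (2 s2)), since
  the tilting factor has modulus depending on \<open>Re\<close> \<xi> alone. The decay of
  \<open>pp\<close> in \<open>y\<close> thus carries over to the continuation.\<close>

lemma norm_Pc_le:
  assumes "norm \<xi> < 1"
  shows "norm (Pc v y \<xi>) \<le> exp (1 / (2 * s2)) * pp (exp (2 * (v + Re \<xi>))) y"
proof -
  have "norm (Nc v (v - s2) y \<xi>) \<le> (\<integral>t. norm (of_real (nu v y t) * exp (\<xi> * of_real ((t - (v - s2)) / s2)) :: complex) \<partial>lborel)"
    unfolding Nc_def by (rule integral_norm_bound)
  also have "\<dots> = (\<integral>t. nu v y t * exp (Re \<xi> * ((t - (v - s2)) / s2)) \<partial>lborel)"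
    by (simp add: norm_mult)
  also have "\<dots> = exp ((Re \<xi>)\<^sup>2 / (2 * s2)) * pp (exp (2 * (v + Re \<xi>))) y" by (rule nu_tilt_integral)
  finally have 1: "norm (Nc v (v - s2) y \<xi>) \<le> exp ((Re \<xi>)\<^sup>2 / (2 * s2)) * pp (exp (2 * (v + Re \<xi>))) y" .
  have 2: "norm (exp (- \<xi>\<^sup>2 / of_real (2 * s2))) = exp (((Im \<xi>)\<^sup>2 - (Re \<xi>)\<^sup>2) / (2 * s2))"
    by (simp add: norm_exp_eq_Re Re_power2 Re_divide_of_real del: of_real_mult)
      (simp only: minus_divide_left minus_diff_eq)
  have "norm (Pc v y \<xi>) \<le> exp (((Im \<xi>)\<^sup>2 - (Re \<xi>)\<^sup>2) / (2 * s2)) * (exp ((Re \<xi>)\<^sup>2 / (2 * s2)) * pp (exp (2 * (v + Re \<xi>))) y)"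
    unfolding Pc_def norm_mult 2 by (intro mult_left_mono 1) auto
  also have "\<dots> = exp ((Im \<xi>)\<^sup>2 / (2 * s2)) * pp (exp (2 * (v + Re \<xi>))) y"
    by (simp add: mult.assoc [symmetric] exp_add [symmetric] diff_divide_distrib)
  also have "\<dots> \<le> exp (1 / (2 * s2)) * pp (exp (2 * (v + Re \<xi>))) y"
  proof -
    have "\<bar>Im \<xi>\<bar> \<le> 1" using assms abs_Im_le_cmod[of \<xi>] by linarith
    hence "(Im \<xi>)\<^sup>2 \<le> 1" by (simp add: abs_square_le_1)
    thus ?thesis by (intro mult_right_mono) (auto intro!: divide_right_mono)
  qed
  finally show ?thesis .
qed

lemma Pc_bound:
  "\<exists>C>0. \<forall>\<xi>\<in>ball 0 1. \<forall>y. norm (Pc v y \<xi>) \<le> C / (1 + y\<^sup>2) ^ 2"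
proof -
  obtain C where C: "C > 0" "\<And>x y. x \<in> {0..exp (2 * (v + 1))} \<Longrightarrow> pp x y \<le> C / (1 + y\<^sup>2) ^ 2"
    using pp_upper[of "exp (2 * (v + 1))" 2] by auto
  have "norm (Pc v y \<xi>) \<le> exp (1 / (2 * s2)) * C / (1 + y\<^sup>2) ^ 2" if "\<xi> \<in> ball 0 1" for \<xi> y
  proof -
    have "norm (Pc v y \<xi>) \<le> exp (1 / (2 * s2)) * pp (exp (2 * (v + Re \<xi>))) y"
      using that by (intro norm_Pc_le) auto
    also have "\<dots> \<le> exp (1 / (2 * s2)) * (C / (1 + y\<^sup>2) ^ 2)"
    proof (intro mult_left_mono C)
      have "norm \<xi> < 1" using that by simp
      hence "\<bar>Re \<xi>\<bar> \<le> 1" using abs_Re_le_cmod[of \<xi>] by linarith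
      thus "exp (2 * (v + Re \<xi>)) \<in> {0..exp (2 * (v + 1))}" by auto
    qed auto
    finally show ?thesis by simp
  qed
  thus ?thesis using C(1) by (intro exI[of _ "exp (1 / (2 * s2)) * C"]) auto
qed

lemma norm_exp_minus_one_le: "norm (exp z - 1) \<le> norm z * exp (norm z)" for z :: complex
proof -
  have "norm (exp z - exp 0) \<le> exp (norm z) * norm (z - 0)"
  proof (rule field_differentiable_bound[of "cball 0 (norm z)"])
    show "(exp has_field_derivative exp w) (at w within cball 0 (norm z))" for w :: complex
      by (auto intro!: derivative_eq_intros)
    show "norm (exp w) \<le> exp (norm z)" if "w \<in> cball 0 (norm z)" for w :: complex
      using that norm_exp[of w] by (auto intro: order_trans)
  qed auto
  thus ?thesis by (simp add: mult.commute)
qed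

text \<open>A logarithm of \<open>Pc v y\<close> on a disc whose radius does not depend on \<open>y\<close>:
  \<open>Nc v (a y) y \<xi>\<close> stays within half of its value at \<open>\<xi> = 0\<close> because the posterior is concentrated near \<open>a y\<close>.\<close>

lemma log_Pc:
  "\<exists>r>0. r \<le> 1 \<and> (\<exists>l D. (\<forall>\<xi>. (\<lambda>y. l y \<xi>) \<in> borel_measurable borel) \<and>
     (\<forall>y. l y holomorphic_on ball 0 r) \<and>
     (\<forall>y. \<forall>\<xi>\<in>ball 0 r. norm (l y \<xi>) \<le> D * (1 + y\<^sup>2)) \<and>
     (\<forall>y x. \<bar>x\<bar> < r \<longrightarrow> l y (of_real x) = of_real (ln (pp (exp (2 * (v + x))) y))))"
proof -
  obtain V a where V: "V > 0" and a_meas [measurable]: "a \<in> borel_measurable borel"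
    and a: "\<And>y. \<bar>a y\<bar> \<le> V * (1 + \<bar>y\<bar>)"
    and conc: "\<And>y. (\<integral>t. nu v y t * exp \<bar>t - a y\<bar> \<partial>lborel) \<le> V * (\<integral>t. nu v y t \<partial>lborel)"
    using concentration[of v] by blast
  define p where "p y = (\<integral>t. nu v y t \<partial>lborel)" for y
  have p_eq: "p y = pp (exp (2 * v)) y" for y by (simp add: p_def pp_exp)
  have p_pos: "p y > 0" for y by (simp add: p_eq)
  \<comment> \<open>With r / s2 \<le> 1 / 2 the exponent \<xi> (t - a) / s2 is at most half of |t -
    a|, leaving the other half to absorb the linear factor. With r V / s2 \<le> 1 / 4 the deviation
    of \<open>Nc\<close> from \<open>p y\<close> is at most half of \<open>p y\<close>.\<close>
  define r where "r = min 1 (min (s2 / 2) (s2 / (4 * V)))"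
  have r: "r > 0" "r \<le> 1" "r / s2 \<le> 1 / 2" "r / s2 * V \<le> 1 / 4"
  proof -
    show "r > 0" "r \<le> 1" using V by (auto simp: r_def)
    have "r \<le> s2 / 2" "r \<le> s2 / (4 * V)" by (auto simp: r_def)
    thus "r / s2 \<le> 1 / 2" "r / s2 * V \<le> 1 / 4" using V by (auto simp: field_simps)
  qed
  have near: "norm (Nc v (a y) y \<xi> - of_real (p y)) \<le> p y / 2" if \<xi>: "\<xi> \<in> ball 0 r" for y \<xi>
  proof -
    have eqN: "Nc v (a y) y \<xi> - of_real (p y) =
        (\<integral>t. of_real (nu v y t) * exp (\<xi> * of_real ((t - a y) / s2)) - of_real (nu v y t) \<partial>lborel)"
      by (simp only: Nc_def p_def integral_complex_of_real [symmetric]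
          Bochner_Integration.integral_diff[OF Nc_integrable integrable_of_real[OF nu_integrable]])
    have "norm (Nc v (a y) y \<xi> - of_real (p y)) \<le> (\<integral>t. (2 * (r / s2)) * (nu v y t * exp \<bar>t - a y\<bar>) \<partial>lborel)"
      unfolding eqN
    proof (rule order_trans[OF integral_norm_bound], intro Bochner_Integration.integral_mono)
      show "integrable lborel (\<lambda>t. norm (of_real (nu v y t) * exp (\<xi> * of_real ((t - a y) / s2)) - of_real (nu v y t) :: complex))"
        by (intro integrable_norm Bochner_Integration.integrable_diff Nc_integrable integrable_of_real nu_integrable)
      show "integrable lborel (\<lambda>t. (2 * (r / s2)) * (nu v y t * exp \<bar>t - a y\<bar>))"
        using nu_exp_integrable[of 1 v y "a y"] by (intro integrable_mult_right) auto
      fix t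
      let ?z = "\<xi> * of_real ((t - a y) / s2)" and ?d = "\<bar>t - a y\<bar>"
      have z: "norm ?z \<le> r / s2 * ?d"
      proof -
        have "norm ?z = norm \<xi> * (?d / s2)" by (simp add: norm_mult norm_divide del: of_real_diff)
        also have "\<dots> \<le> r * (?d / s2)" using \<xi> by (intro mult_right_mono) auto
        finally show ?thesis by simp
      qed
      have z2: "norm ?z \<le> ?d / 2" using order_trans[OF z mult_right_mono[OF r(3) abs_ge_zero[of "t - a y"]]] by simp
      have d: "?d / 2 \<le> exp (?d / 2)" using exp_ge_add_one_self[of "?d / 2"] by linarith
      have "norm (exp ?z - 1) \<le> norm ?z * exp (norm ?z)" by (rule norm_exp_minus_one_le)
      also have "\<dots> \<le> (r / s2 * ?d) * exp (?d / 2)" using z z2 r by (intro mult_mono) auto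
      also have "\<dots> = (2 * (r / s2)) * ((?d / 2) * exp (?d / 2))" by simp
      also have "\<dots> \<le> (2 * (r / s2)) * (exp (?d / 2) * exp (?d / 2))"
        using d r by (intro mult_left_mono mult_right_mono) auto
      also have "\<dots> = (2 * (r / s2)) * exp ?d" by (simp only: exp_add [symmetric] field_sum_of_halves)
      finally have "nu v y t * norm (exp ?z - 1) \<le> nu v y t * ((2 * (r / s2)) * exp ?d)"
        by (intro mult_left_mono) auto
      moreover have "of_real (nu v y t) * exp ?z - of_real (nu v y t) = of_real (nu v y t) * (exp ?z - 1)"
        by (simp add: algebra_simps)
      hence "norm (of_real (nu v y t) * exp ?z - of_real (nu v y t)) = nu v y t * norm (exp ?z - 1)"
        by (simp only: norm_mult norm_of_real) simp
      ultimately show "norm (of_real (nu v y t) * exp ?z - of_real (nu v y t)) \<le> (2 * (r / s2)) * (nu v y t * exp ?d)"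
        by (simp add: mult_ac)
    qed
    also have "\<dots> = (2 * (r / s2)) * (\<integral>t. nu v y t * exp \<bar>t - a y\<bar> \<partial>lborel)"
      by (rule integral_mult_right_zero)
    also have "\<dots> \<le> (2 * (r / s2)) * (V * p y)"
      unfolding p_def using conc r by (intro mult_left_mono) auto
    also have "\<dots> = 2 * (r / s2 * V) * p y" by simp
    also have "\<dots> \<le> 2 * (1 / 4) * p y" using r(4) p_pos[of y] by (intro mult_right_mono mult_left_mono) auto
    finally show ?thesis by simp
  qed
  have Re_pos: "Re (Nc v (a y) y \<xi>) \<ge> p y / 2" if "\<xi> \<in> ball 0 r" for y \<xi>
    using near[OF that, of y] abs_Re_le_cmod[of "Nc v (a y) y \<xi> - of_real (p y)"] by simp
  have Re_pos': "Re (Nc v (a y) y \<xi>) > 0" if "\<xi> \<in> ball 0 r" for y \<xi>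
    using Re_pos[OF that, of y] p_pos[of y] by linarith
  \<comment> \<open>The explicit exponent of \<open>Pc_eq_Nc\<close> plus the principal logarithm of
    \<open>Nc\<close>, which is holomorphic because the real part of \<open>Nc\<close> stays
    positive on the disc.\<close>
  define l where "l y \<xi> = - \<xi>\<^sup>2 / of_real (2 * s2) + \<xi> * of_real ((a y - (v - s2)) / s2) + Ln (Nc v (a y) y \<xi>)" for y \<xi>
  obtain D0 where "\<forall>x\<in>{0..exp (2 * v)}. \<forall>y. \<bar>ln (pp x y)\<bar> \<le> D0 * (1 + y\<^sup>2)"
    using abs_ln_pp_le[OF exp_ge_zero] by blast
  hence D0: "\<bar>ln (p y)\<bar> \<le> D0 * (1 + y\<^sup>2)" for y by (simp add: p_eq)
  define D where "D = 1 / (2 * s2) + 2 * (V + \<bar>v - s2\<bar>) / s2 + D0 + 1 + pi"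
  have bound: "norm (l y \<xi>) \<le> D * (1 + y\<^sup>2)" if \<xi>: "\<xi> \<in> ball 0 r" for y \<xi>
  proof -
    have n1: "norm \<xi> \<le> 1" using \<xi> r by auto
    have y1: "\<bar>y\<bar> \<le> 1 + y\<^sup>2"
    proof -
      have "0 \<le> (\<bar>y\<bar> - 1)\<^sup>2" by simp
      hence "2 * \<bar>y\<bar> \<le> 1 + y\<^sup>2" by (simp add: power2_eq_square algebra_simps)
      thus ?thesis using abs_ge_zero[of y] by linarith
    qed
    have t1: "norm (- \<xi>\<^sup>2 / of_real (2 * s2)) \<le> 1 / (2 * s2) * (1 + y\<^sup>2)"
    proof -
      have "(norm \<xi>)\<^sup>2 \<le> 1" using n1 by (simp add: power_le_one)
      hence "norm (- \<xi>\<^sup>2 / of_real (2 * s2)) \<le> 1 / (2 * s2) * 1"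
        by (simp add: norm_divide norm_power norm_mult divide_right_mono)
      also have "\<dots> \<le> 1 / (2 * s2) * (1 + y\<^sup>2)" by (intro mult_left_mono) auto
      finally show ?thesis .
    qed
    have t2: "norm (\<xi> * of_real ((a y - (v - s2)) / s2)) \<le> 2 * (V + \<bar>v - s2\<bar>) / s2 * (1 + y\<^sup>2)"
    proof -
      have "norm (\<xi> * of_real ((a y - (v - s2)) / s2)) = norm \<xi> * (\<bar>a y - (v - s2)\<bar> / s2)"
        by (simp only: norm_mult norm_of_real abs_divide) simp
      also have "\<dots> \<le> 1 * (\<bar>a y - (v - s2)\<bar> / s2)" using n1 by (intro mult_right_mono) auto
      also have "\<dots> \<le> (2 * (V + \<bar>v - s2\<bar>) * (1 + y\<^sup>2)) / s2"
      proof -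
        have "\<bar>a y - (v - s2)\<bar> \<le> V * (1 + \<bar>y\<bar>) + \<bar>v - s2\<bar>" using a[of y] by linarith
        also have "V * (1 + \<bar>y\<bar>) \<le> V * (2 * (1 + y\<^sup>2))"
        proof (intro mult_left_mono)
          show "1 + \<bar>y\<bar> \<le> 2 * (1 + y\<^sup>2)" using y1 by (smt (verit) zero_le_power2)
        qed (use V in simp)
        also have "\<bar>v - s2\<bar> \<le> 2 * \<bar>v - s2\<bar> * (1 + y\<^sup>2)"
        proof -
          have "\<bar>v - s2\<bar> * 1 \<le> (2 * \<bar>v - s2\<bar>) * (1 + y\<^sup>2)" by (intro mult_mono) auto
          thus ?thesis by simp
        qed
        finally have "\<bar>a y - (v - s2)\<bar> \<le> 2 * (V + \<bar>v - s2\<bar>) * (1 + y\<^sup>2)" by (simp add: algebra_simps)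
        thus ?thesis by (simp add: divide_right_mono)
      qed
      finally show ?thesis by simp
    qed
    have t3: "norm (Ln (Nc v (a y) y \<xi>)) \<le> (D0 + 1 + pi) * (1 + y\<^sup>2)"
    proof -
      let ?N = "Nc v (a y) y \<xi>"
      have N0: "?N \<noteq> 0" using Re_pos'[OF \<xi>, of y] by auto
      have lo: "p y / 2 \<le> norm ?N" using Re_pos[OF \<xi>, of y] complex_Re_le_cmod[of ?N] by linarith
      have hi: "norm ?N \<le> p y * 2"
        using norm_triangle_ineq2[of ?N "of_real (p y)"] near[OF \<xi>, of y] p_pos[of y] by simp
      have "ln (p y / 2) \<le> ln (norm ?N)" "ln (norm ?N) \<le> ln (p y * 2)"
        using lo hi p_pos[of y] N0 by (auto intro: ln_mono)
      hence "\<bar>ln (norm ?N)\<bar> \<le> \<bar>ln (p y)\<bar> + ln 2" using p_pos[of y] by (auto simp: ln_div ln_mult)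
      moreover have "ln 2 \<le> (1::real)" using ln_le_minus_one[of "2::real"] by simp
      moreover have "\<bar>Im (Ln ?N)\<bar> \<le> pi" using mpi_less_Im_Ln[OF N0] Im_Ln_le_pi[OF N0] by linarith
      moreover have "norm (Ln ?N) \<le> \<bar>ln (norm ?N)\<bar> + \<bar>Im (Ln ?N)\<bar>"
        using cmod_le[of "Ln ?N"] N0 by simp
      ultimately have "norm (Ln ?N) \<le> D0 * (1 + y\<^sup>2) + 1 + pi" using D0[of y] by linarith
      also have "\<dots> \<le> (D0 + 1 + pi) * (1 + y\<^sup>2)"
      proof -
        have "1 * 1 \<le> 1 * (1 + y\<^sup>2)" "pi * 1 \<le> pi * (1 + y\<^sup>2)" by (intro mult_left_mono, auto)+
        thus ?thesis by (simp only: distrib_right)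
      qed
      finally show ?thesis .
    qed
    have "norm (l y \<xi>) \<le> norm (- \<xi>\<^sup>2 / of_real (2 * s2)) + norm (\<xi> * of_real ((a y - (v - s2)) / s2)) + norm (Ln (Nc v (a y) y \<xi>))"
      unfolding l_def by (intro norm_triangle_le add_mono norm_triangle_ineq order_refl)
    also have "\<dots> \<le> 1 / (2 * s2) * (1 + y\<^sup>2) + 2 * (V + \<bar>v - s2\<bar>) / s2 * (1 + y\<^sup>2) + (D0 + 1 + pi) * (1 + y\<^sup>2)"
      using t1 t2 t3 by linarith
    also have "\<dots> = D * (1 + y\<^sup>2)" by (simp only: D_def distrib_right add.assoc)
    finally show ?thesis .
  qed
  have hol: "l y holomorphic_on ball 0 r" for y
    unfolding l_def
    by (intro holomorphic_intros Nc_holomorphic) (use Re_pos' in \<open>auto simp: complex_nonpos_Reals_iff not_le\<close>)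
  have real: "l y (of_real x) = of_real (ln (pp (exp (2 * (v + x))) y))" if x: "\<bar>x\<bar> < r" for x y
  proof -
    have xr: "complex_of_real x \<in> ball 0 r" using x by simp
    have N_real: "Nc v (a y) y (of_real x) = of_real (\<integral>t. nu v y t * exp (x * ((t - a y) / s2)) \<partial>lborel)"
      unfolding Nc_def integral_complex_of_real [symmetric]
      by (intro Bochner_Integration.integral_cong refl) (simp add: exp_of_real [symmetric])
    define n where "n = (\<integral>t. nu v y t * exp (x * ((t - a y) / s2)) \<partial>lborel)"
    have n: "n > 0" using Re_pos'[OF xr, of y] unfolding N_real n_def by simp
    define e where "e = - x\<^sup>2 / (2 * s2) + x * ((a y - (v - s2)) / s2)"
    have e: "- (of_real x)\<^sup>2 / of_real (2 * s2) + of_real x * of_real ((a y - (v - s2)) / s2) = complex_of_real e"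
      by (simp add: e_def)
    have "complex_of_real (pp (exp (2 * (v + x))) y) = of_real (exp e * n)"
      unfolding Pc_of_real [symmetric] Pc_eq_Nc[of v y _ "a y"] e N_real n_def by (simp add: exp_of_real)
    hence "pp (exp (2 * (v + x))) y = exp e * n" by (simp only: of_real_eq_iff)
    hence "ln (pp (exp (2 * (v + x))) y) = e + ln n" using n by (simp add: ln_mult)
    thus ?thesis unfolding l_def e N_real n_def [symmetric] using n by (simp add: Ln_of_real)
  qed
  have meas: "(\<lambda>y. l y \<xi>) \<in> borel_measurable borel" for \<xi>
    unfolding l_def using Nc_measurable[OF a_meas] by measurable
  show ?thesis using r meas hol bound real by blast
qed

lemma integral_Pc_holomorphic:
  fixes l :: "real \<Rightarrow> complex \<Rightarrow> complex"
  assumes r: "r \<le> 1" and meas: "\<And>\<xi>. (\<lambda>y. l y \<xi>) \<in> borel_measurable borel"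
    and hol: "\<And>y. l y holomorphic_on ball 0 r"
    and bnd: "\<And>y \<xi>. \<xi> \<in> ball 0 r \<Longrightarrow> norm (l y \<xi>) \<le> D * (1 + y\<^sup>2)"
  shows "(\<lambda>\<xi>. \<integral>y. Pc v y \<xi> * l y \<xi> \<partial>lborel) holomorphic_on ball 0 r"
proof -
  obtain C where C: "C > 0" "\<And>\<xi> y. \<xi> \<in> ball 0 1 \<Longrightarrow> norm (Pc v y \<xi>) \<le> C / (1 + y\<^sup>2) ^ 2"
    using Pc_bound[of v] by blast
  show ?thesis
  proof (rule holomorphic_on_lebesgue_integral)
    show "integrable lborel (\<lambda>y. (C * D) * (1 / (1 + y\<^sup>2)))"
      by (intro integrable_mult_right integrable_inverse_one_plus_square)
    fix \<xi> :: complex and y :: real assume \<xi>: "\<xi> \<in> ball 0 r"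
    have p: "1 + y\<^sup>2 > 0" by (simp add: add_pos_nonneg)
    have "norm (Pc v y \<xi> * l y \<xi>) \<le> C / (1 + y\<^sup>2) ^ 2 * (D * (1 + y\<^sup>2))"
      unfolding norm_mult using \<xi> r C(1) p by (intro mult_mono C(2) bnd) auto
    also have "\<dots> = (C * D) * (1 / (1 + y\<^sup>2))" using p by (simp add: power2_eq_square[of "1 + y\<^sup>2"])
    finally show "norm (Pc v y \<xi> * l y \<xi>) \<le> (C * D) * (1 / (1 + y\<^sup>2))" .
  next
    show "(\<lambda>y. Pc v y \<xi> * l y \<xi>) \<in> borel_measurable lborel" for \<xi>
      using meas[of \<xi>] by measurable
    show "(\<lambda>\<xi>. Pc v y \<xi> * l y \<xi>) holomorphic_on ball 0 r" for y
      by (intro holomorphic_intros Pc_holomorphic hol)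
  qed simp
qed

lemma holomorphic_recenter:
  assumes "\<Phi> holomorphic_on ball 0 r"
  shows "(\<lambda>w. \<Phi> (w - c)) holomorphic_on ball c r"
proof -
  have "(\<lambda>w. w - c) holomorphic_on ball c r" by (intro holomorphic_intros)
  moreover have "(\<lambda>w. w - c) ` ball c r \<subseteq> ball 0 r" by (auto simp: dist_norm norm_minus_commute)
  ultimately show ?thesis using holomorphic_on_compose_gen[OF _ assms] by (force simp: o_def)
qed

lemma NN_real_analytic:
  "\<exists>r>0. \<exists>\<phi>. \<phi> holomorphic_on ball (complex_of_real v) r \<and>
     (\<forall>w. \<bar>w - v\<bar> < r \<longrightarrow> \<phi> (of_real w) = of_real (NN (exp (2 * w))))"
proof -
  obtain r l D where r: "r > 0" "r \<le> 1"
    and l: "\<And>\<xi>. (\<lambda>y. l y \<xi>) \<in> borel_measurable borel" "\<And>y. l y holomorphic_on ball 0 r"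
      "\<And>y \<xi>. \<xi> \<in> ball 0 r \<Longrightarrow> norm (l y \<xi>) \<le> D * (1 + y\<^sup>2)"
      "\<And>y x. \<bar>x\<bar> < r \<Longrightarrow> l y (of_real x) = of_real (ln (pp (exp (2 * (v + x))) y))"
    using log_Pc[of v] by blast
  define \<Phi> where "\<Phi> \<xi> = (\<integral>y. Pc v y \<xi> * l y \<xi> \<partial>lborel)" for \<xi>
  have "\<Phi> (of_real (w - v)) = of_real (NN (exp (2 * w)))" if "\<bar>w - v\<bar> < r" for w
  proof -
    have "\<Phi> (of_real (w - v)) = (\<integral>y. of_real (pp (exp (2 * w)) y * ln (pp (exp (2 * w)) y)) \<partial>lborel)"
      unfolding \<Phi>_def Pc_of_real l(4)[OF that] by simp
    thus ?thesis by (simp only: integral_complex_of_real NN_def)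
  qed
  moreover have "(\<lambda>w. \<Phi> (w - of_real v)) holomorphic_on ball (of_real v) r"
    unfolding \<Phi>_def by (rule holomorphic_recenter, rule integral_Pc_holomorphic[OF r(2) l(1) l(2) l(3)])
  ultimately show ?thesis using r(1) by (intro exI[of _ r] exI[of _ "\<lambda>w. \<Phi> (w - of_real v)"]) auto
qed

lemma JJ_real_analytic:
  assumes [measurable]: "L \<in> borel_measurable borel" and L: "\<And>y. \<bar>L y\<bar> \<le> D * (1 + y\<^sup>2)"
  shows "\<exists>r>0. \<exists>\<phi>. \<phi> holomorphic_on ball (complex_of_real v) r \<and>
     (\<forall>w. \<bar>w - v\<bar> < r \<longrightarrow> \<phi> (of_real w) = of_real (JJ L (exp (2 * w))))"
proof -
  define \<Phi> where "\<Phi> \<xi> = (\<integral>y. Pc v y \<xi> * of_real (L y) \<partial>lborel)" for \<xi>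
  have "\<Phi> (of_real (w - v)) = of_real (JJ L (exp (2 * w)))" for w
  proof -
    have "\<Phi> (of_real (w - v)) = (\<integral>y. of_real (pp (exp (2 * w)) y * L y) \<partial>lborel)"
      unfolding \<Phi>_def Pc_of_real by simp
    thus ?thesis by (simp only: integral_complex_of_real JJ_def)
  qed
  moreover have "(\<lambda>w. \<Phi> (w - of_real v)) holomorphic_on ball (of_real v) 1"
    unfolding \<Phi>_def
    by (rule holomorphic_recenter, rule integral_Pc_holomorphic[where l = "\<lambda>y _. of_real (L y)" and D = D])
       (use L in simp_all)
  ultimately show ?thesis by (intro exI[of _ 1] exI[of _ "\<lambda>w. \<Phi> (w - of_real v)"]) auto
qed

text \<open>Within distance 1 / 2 of a real point, 2 |Im w| stays below pi / 2, so exp (2 w) has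
  positive real part and the principal logarithm is holomorphic there.\<close>

lemma energy_real_analytic:
  assumes "c > 0"
  shows "(\<lambda>w. exp (2 * w) * Ln (1 + of_real c * exp (2 * w))) holomorphic_on ball (complex_of_real v) (1 / 2)"
    and "exp (2 * of_real w) * Ln (1 + of_real c * exp (2 * of_real w)) = complex_of_real (exp (2 * w) * ln (1 + c * exp (2 * w)))"
proof -
  have "Re (1 + of_real c * exp (2 * w)) > 0" if "w \<in> ball (complex_of_real v) (1 / 2)" for w
  proof -
    have "\<bar>Im (w - of_real v)\<bar> < 1 / 2"
      using that abs_Im_le_cmod[of "w - of_real v"] by (simp add: dist_norm norm_minus_commute)
    hence "\<bar>2 * Im w\<bar> < pi / 2" using pi_gt3 by simp
    hence "cos (2 * Im w) > 0" by (intro cos_gt_zero_pi) auto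
    thus ?thesis using assms by (auto simp: Re_exp intro!: add_pos_nonneg)
  qed
  thus "(\<lambda>w. exp (2 * w) * Ln (1 + of_real c * exp (2 * w))) holomorphic_on ball (complex_of_real v) (1 / 2)"
    by (intro holomorphic_intros) (auto simp: complex_nonpos_Reals_iff not_le)
  have p: "1 + c * exp (2 * w) > 0" using assms by (intro add_pos_pos mult_pos_pos) auto
  have "1 + of_real c * exp (2 * of_real w) = complex_of_real (1 + c * exp (2 * w))"
    by (simp add: exp_of_real [symmetric])
  thus "exp (2 * of_real w) * Ln (1 + of_real c * exp (2 * of_real w)) = complex_of_real (exp (2 * w) * ln (1 + c * exp (2 * w)))"
    using Ln_of_real[OF p] by (simp only:) (simp add: exp_of_real [symmetric])
qed

text \<open>The substitution \<open>x = exp (2 * u)\<close> maps the line onto the positive inputs,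
  and in \<open>u\<close> all terms are analytic at every real point. Zeros accumulating at one
  positive input therefore spread to all of them, but not to \<open>0\<close>, which corresponds to
  minus infinity.\<close>

theorem zeros_accumulate_at_pos:
  assumes L: "L \<in> borel_measurable borel" "\<And>y. \<bar>L y\<bar> \<le> D * (1 + y\<^sup>2)" and c: "c > 0"
    and x0: "x0 > 0"
    and lim: "x0 islimpt {x. NN x + JJ L x = \<alpha> + \<beta> * x + \<gamma> * (x * ln (1 + c * x))}"
    and x: "x > 0"
  shows "NN x + JJ L x = \<alpha> + \<beta> * x + \<gamma> * (x * ln (1 + c * x))"
proof -
  define f where "f u = NN (exp (2 * u)) + JJ L (exp (2 * u))
    - (\<alpha> + \<beta> * exp (2 * u) + \<gamma> * (exp (2 * u) * ln (1 + c * exp (2 * u))))" for u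
  have "f u = 0" for u
  proof (rule real_analytic_identity[of f "ln x0 / 2"])
    fix v
    obtain r1 \<phi>1 where 1: "r1 > 0" "\<phi>1 holomorphic_on ball (complex_of_real v) r1"
      "\<And>w. \<bar>w - v\<bar> < r1 \<Longrightarrow> \<phi>1 (of_real w) = of_real (NN (exp (2 * w)))"
      using NN_real_analytic[of v] by blast
    obtain r2 \<phi>2 where 2: "r2 > 0" "\<phi>2 holomorphic_on ball (complex_of_real v) r2"
      "\<And>w. \<bar>w - v\<bar> < r2 \<Longrightarrow> \<phi>2 (of_real w) = of_real (JJ L (exp (2 * w)))"
      using JJ_real_analytic[OF L, of v] by blast
    define r where "r = min (min r1 r2) (1 / 2)"
    define \<phi> where "\<phi> w = \<phi>1 w + \<phi>2 w - (of_real \<alpha> + of_real \<beta> * exp (2 * w)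
      + of_real \<gamma> * (exp (2 * w) * Ln (1 + of_real c * exp (2 * w))))" for w
    have sub: "ball (complex_of_real v) r \<subseteq> ball (of_real v) r1" "ball (complex_of_real v) r \<subseteq> ball (of_real v) r2"
      "ball (complex_of_real v) r \<subseteq> ball (of_real v) (1 / 2)" by (auto simp: r_def)
    have "\<phi> holomorphic_on ball (of_real v) r"
      unfolding \<phi>_def
      by (intro holomorphic_intros holomorphic_on_subset[OF 1(2) sub(1)] holomorphic_on_subset[OF 2(2) sub(2)]
        holomorphic_on_subset[OF energy_real_analytic(1)[OF c] sub(3)])
    moreover have "\<phi> (of_real w) = of_real (f w)" if "\<bar>w - v\<bar> < r" for w
      unfolding \<phi>_def f_def energy_real_analytic(2)[OF c] using that 1(3) 2(3)
      by (simp add: r_def exp_of_real [symmetric])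
    moreover have "r > 0" using 1 2 by (simp add: r_def)
    ultimately show "\<exists>r>0. \<exists>\<phi>. \<phi> holomorphic_on ball (complex_of_real v) r \<and>
      (\<forall>w. \<bar>w - v\<bar> < r \<longrightarrow> \<phi> (of_real w) = of_real (f w))" by blast
  next
    show "(ln x0 / 2) islimpt {u. f u = 0}"
      unfolding islimpt_approachable
    proof (intro allI impI)
      fix e :: real assume e: "e > 0"
      have "isCont (\<lambda>x. ln x / 2) x0" using x0 by (intro continuous_intros) auto
      then obtain d where d: "d > 0" "\<And>x. dist x x0 < d \<Longrightarrow> dist (ln x / 2) (ln x0 / 2) < e"
        using e unfolding continuous_at_eps_delta by blast
      obtain z where z: "NN z + JJ L z = \<alpha> + \<beta> * z + \<gamma> * (z * ln (1 + c * z))" "z \<noteq> x0" "dist z x0 < min d x0"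
        using lim d(1) x0 unfolding islimpt_approachable by (metis (mono_tags) mem_Collect_eq min_less_iff_conj)
      have z0: "z > 0" using z(3) by (auto simp: dist_real_def)
      have "f (ln z / 2) = 0" using z(1) z0 by (simp add: f_def)
      moreover have "ln z / 2 \<noteq> ln x0 / 2" using z(2) z0 x0 by simp
      ultimately show "\<exists>x'\<in>{u. f u = 0}. x' \<noteq> ln x0 / 2 \<and> dist x' (ln x0 / 2) < e"
        using d(2)[of z] z(3) by (intro bexI[of _ "ln z / 2"]) auto
    qed
  qed
  from this[of "ln x / 2"] x show ?thesis by (simp add: f_def)
qed

end

section \<open>Asymptotic expansions at the origin\<close>

text \<open>Cauchy's estimates. Within half the radius the remainder is dominated by a geometric
  series of ratio at most 1 / 2, whence the factor 2.\<close>

lemma Taylor_bounds: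
  fixes f :: "complex \<Rightarrow> complex"
  assumes hol: "f holomorphic_on U" "open U" "cball 0 r \<subseteq> U" and r: "r > 0"
    and B: "\<And>z. norm z \<le> r \<Longrightarrow> norm (f z) \<le> B"
  shows Taylor_coeff_bound: "norm ((deriv ^^ k) f 0 / fact k) \<le> B / r ^ k"
    and Taylor_remainder_bound: "norm z \<le> r / 2 \<Longrightarrow>
      norm (f z - (\<Sum>k\<le>n. (deriv ^^ k) f 0 / fact k * z ^ k)) \<le> 2 * B * (norm z / r) ^ (n + 1)"
proof -
  define c where "c k = (deriv ^^ k) f 0 / fact k" for k
  have hol_ball: "f holomorphic_on ball 0 r"
    using hol by (meson ball_subset_cball holomorphic_on_subset subset_trans)
  have c: "norm (c k) \<le> B / r ^ k" for k
  proof -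
    have "norm ((deriv ^^ k) f 0) \<le> fact k * B / r ^ k"
    proof (rule Cauchy_inequality[OF hol_ball _ r])
      show "continuous_on (cball 0 r) f"
        using hol by (meson holomorphic_on_imp_continuous_on holomorphic_on_subset)
    qed (use B in simp)
    thus ?thesis by (simp add: c_def norm_divide field_simps)
  qed
  thus "norm ((deriv ^^ k) f 0 / fact k) \<le> B / r ^ k" by (simp add: c_def)
  have B0: "B \<ge> 0" using B[of 0] r order_trans[OF norm_ge_zero] by simp
  show "norm (f z - (\<Sum>k\<le>n. (deriv ^^ k) f 0 / fact k * z ^ k)) \<le> 2 * B * (norm z / r) ^ (n + 1)"
    if z: "norm z \<le> r / 2"
  proof -
    define q where "q = norm z / r"
    have q: "0 \<le> q" "q \<le> 1 / 2" using z r by (auto simp: q_def divide_le_eq)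
    have sums: "(\<lambda>k. c k * z ^ k) sums f z"
    proof -
      have "z \<in> ball 0 r" using z r by simp
      from holomorphic_power_series[OF hol_ball this] show ?thesis by (simp add: c_def)
    qed
    have "(\<lambda>k. c (k + (n + 1)) * z ^ (k + (n + 1))) sums (f z - (\<Sum>k<n + 1. c k * z ^ k))"
      using sums_split_initial_segment[OF sums, of "n + 1"] .
    hence eq: "f z - (\<Sum>k\<le>n. c k * z ^ k) = (\<Sum>k. c (k + (n + 1)) * z ^ (k + (n + 1)))"
      by (simp add: sums_iff lessThan_Suc_atMost)
    have geo: "(\<lambda>k. B * q ^ (n + 1) * q ^ k) sums (B * q ^ (n + 1) * (1 / (1 - q)))"
      using q by (intro sums_mult geometric_sums) auto
    have "norm (\<Sum>k. c (k + (n + 1)) * z ^ (k + (n + 1))) \<le> (\<Sum>k. B * q ^ (n + 1) * q ^ k)"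
    proof (rule norm_suminf_le[OF _ sums_summable[OF geo]])
      fix k
      have "norm (c (k + (n + 1)) * z ^ (k + (n + 1))) \<le> B / r ^ (k + (n + 1)) * norm z ^ (k + (n + 1))"
        unfolding norm_mult norm_power by (intro mult_right_mono c) auto
      also have "\<dots> = B * q ^ (k + (n + 1))" by (simp only: q_def power_divide) simp
      also have "\<dots> = B * q ^ (n + 1) * q ^ k" by (simp only: power_add mult_ac)
      finally show "norm (c (k + (n + 1)) * z ^ (k + (n + 1))) \<le> B * q ^ (n + 1) * q ^ k" .
    qed
    also have "\<dots> = B * q ^ (n + 1) * (1 / (1 - q))" using geo by (rule sums_unique [symmetric])
    also have "\<dots> \<le> B * q ^ (n + 1) * 2" using q B0 by (intro mult_left_mono) (auto simp: field_simps)
    finally show ?thesis unfolding c_def [symmetric] eq by (simp add: q_def mult_ac)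
  qed
qed

lemma Taylor_coeff_zero:
  fixes f :: "complex \<Rightarrow> complex"
  assumes hol: "f holomorphic_on U" "open U" "cball 0 r \<subseteq> U" and r: "r > 0"
    and B: "\<And>z. norm z \<le> r \<Longrightarrow> norm (f z) \<le> C * norm z ^ (n + 1)"
  shows "(deriv ^^ n) f 0 / fact n = 0"
proof -
  have bound: "norm ((deriv ^^ n) f 0 / fact n) \<le> C * \<rho>" if \<rho>: "0 < \<rho>" "\<rho> \<le> r" for \<rho>
  proof -
    have "norm ((deriv ^^ n) f 0 / fact n) \<le> (\<bar>C\<bar> * \<rho> ^ (n + 1)) / \<rho> ^ n"
    proof (rule Taylor_coeff_bound[OF hol(1,2) _ \<rho>(1)])
      show "cball 0 \<rho> \<subseteq> U" using hol(3) \<rho> by (meson subset_cball subset_trans)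
      show "norm (f z) \<le> \<bar>C\<bar> * \<rho> ^ (n + 1)" if "norm z \<le> \<rho>" for z
      proof -
        have "norm (f z) \<le> C * norm z ^ (n + 1)" using that \<rho> by (intro B) auto
        also have "\<dots> \<le> \<bar>C\<bar> * \<rho> ^ (n + 1)" using that by (intro mult_mono power_mono) auto
        finally show ?thesis .
      qed
    qed
    moreover have "0 \<le> C * r ^ (n + 1)" using B[of "of_real r"] r by (auto intro: order_trans[OF norm_ge_zero])
    hence "C \<ge> 0" using r by (meson mult_neg_pos not_le zero_less_power)
    ultimately show ?thesis using \<rho> by simp
  qed
  have "norm ((deriv ^^ n) f 0 / fact n) \<le> 0"
  proof (rule tendsto_lowerbound)
    show "((\<lambda>\<rho>. C * \<rho>) \<longlongrightarrow> 0) (at_right 0)" by (auto intro!: tendsto_eq_intros)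
    show "\<forall>\<^sub>F \<rho> in at_right 0. norm ((deriv ^^ n) f 0 / fact n) \<le> C * \<rho>"
      using eventually_at_right_less[of 0] eventually_at_right_field[of "\<lambda>\<rho>. \<rho> < r" 0] r bound
      by (auto simp: eventually_at_right_field intro!: exI[of _ r])
  qed simp
  thus ?thesis by simp
qed

text \<open>Uniqueness of asymptotic coefficients, known only along a null sequence: once the lower
  ones vanish, division by the power \<open>k\<close> isolates \<open>e k\<close>. The extra square
  root makes the remainder small even against the top term.\<close>

lemma coeffs_zero_of_small:
  fixes e :: "nat \<Rightarrow> complex" and X :: "nat \<Rightarrow> real"
  assumes X: "\<And>i. X i > 0" "X \<longlonglongrightarrow> 0"
    and small: "\<And>i. norm (\<Sum>k\<le>n. e k * of_real (X i) ^ k) \<le> C * X i ^ n * sqrt (X i)"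
    and k: "k \<le> n"
  shows "e k = 0"
  using k
proof (induction k rule: less_induct)
  case (less k)
  have lim: "(\<lambda>i. (\<Sum>j\<in>{k<..n}. e j * of_real (X i) ^ (j - k))) \<longlonglongrightarrow> (\<Sum>j\<in>{k<..n}. e j * of_real 0 ^ (j - k))"
    by (intro tendsto_intros X)
  have "(\<Sum>j\<in>{k<..n}. e j * of_real 0 ^ (j - k)) = 0" by (rule sum.neutral) auto
  with lim have lim0: "(\<lambda>i. (\<Sum>j\<in>{k<..n}. e j * of_real (X i) ^ (j - k))) \<longlonglongrightarrow> 0" by (simp only:)
  have lim1: "(\<lambda>i. C * X i ^ (n - k) * sqrt (X i)) \<longlonglongrightarrow> C * 0 ^ (n - k) * sqrt 0"
    by (intro tendsto_intros X)
  have "(\<lambda>i. e k + (\<Sum>j\<in>{k<..n}. e j * of_real (X i) ^ (j - k))) \<longlonglongrightarrow> 0"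
  proof (rule Lim_null_comparison)
    show "(\<lambda>i. C * X i ^ (n - k) * sqrt (X i)) \<longlonglongrightarrow> 0" using lim1 by simp
    show "\<forall>\<^sub>F i in sequentially. norm (e k + (\<Sum>j\<in>{k<..n}. e j * of_real (X i) ^ (j - k))) \<le> C * X i ^ (n - k) * sqrt (X i)"
    proof (intro always_eventually allI)
      fix i
      have "(\<Sum>j\<le>n. e j * of_real (X i) ^ j) = (\<Sum>j\<in>{k..n}. e j * of_real (X i) ^ j)"
        using less by (intro sum.mono_neutral_right) auto
      also have "\<dots> = of_real (X i) ^ k * (\<Sum>j\<in>{k..n}. e j * of_real (X i) ^ (j - k))"
        by (auto simp: sum_distrib_left power_add [symmetric] intro!: sum.cong)
      also have "(\<Sum>j\<in>{k..n}. e j * of_real (X i) ^ (j - k)) = e k + (\<Sum>j\<in>{k<..n}. e j * of_real (X i) ^ (j - k))"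
        using less.prems by (subst sum.head) auto
      finally have "X i ^ k * norm (e k + (\<Sum>j\<in>{k<..n}. e j * of_real (X i) ^ (j - k))) \<le> C * X i ^ n * sqrt (X i)"
        using small[of i] X(1)[of i] by (simp add: norm_mult norm_power)
      also have "X i ^ n = X i ^ k * X i ^ (n - k)" using less.prems by (simp flip: power_add)
      finally have "X i ^ k * norm (e k + (\<Sum>j\<in>{k<..n}. e j * of_real (X i) ^ (j - k))) \<le> X i ^ k * (C * X i ^ (n - k) * sqrt (X i))"
        by (simp add: mult_ac)
      thus "norm (e k + (\<Sum>j\<in>{k<..n}. e j * of_real (X i) ^ (j - k))) \<le> C * X i ^ (n - k) * sqrt (X i)"
        using X(1)[of i] by simp
    qed
  qed
  from tendsto_diff[OF this lim0] have "(\<lambda>i::nat. e k) \<longlonglongrightarrow> 0" by simp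
  thus ?case by (simp add: tendsto_const_iff)
qed

text \<open>A Phragmen-Lindelof argument: \<open>\<zeta> \<mapsto> \<Psi> (- \<zeta>\<^sup>2)\<close> has order at most \<open>1/2\<close> in the right
  half-plane, whose boundary it maps to the ray where \<open>\<Psi>\<close> is controlled.\<close>

lemma affine_of_small_order:
  fixes \<Psi> :: "complex \<Rightarrow> complex"
  assumes hol: "\<Psi> holomorphic_on UNIV"
    and order: "\<And>z. norm (\<Psi> z) \<le> C * exp (norm z powr (1 / 4))"
    and ray: "\<And>v::real. v \<ge> 0 \<Longrightarrow> norm (\<Psi> (of_real v)) \<le> C' * (1 + v)"
  shows "\<exists>c0 c1. \<forall>z. \<Psi> z = c0 + c1 * z"
proof -
  have C'0: "C' \<ge> 0" using ray[of 0] by (auto intro: order_trans[OF norm_ge_zero])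
  have C0: "C \<ge> 0" using order_trans[OF norm_ge_zero order[of 0]] by (simp add: zero_le_mult_iff)
  \<comment> \<open>\<open>C'\<close> bounds the auxiliary function on the imaginary axis, and 1
    bounds it on the large arc.\<close>
  define M where "M = C' + 1"
  have half_plane: "norm (\<Psi> (- \<zeta>\<^sup>2)) \<le> M * norm (1 + \<zeta>) ^ 2" if \<zeta>: "Re \<zeta> > 0" for \<zeta>
  proof -
    \<comment> \<open>For imaginary \<open>w\<close> the number - w^2 lies on the controlled ray and
      |1 + w|^2 = 1 + |w|^2, so the quotient is bounded there. The exponent 2 / 3 exceeds the order
      1 / 2 of the quotient, and it keeps the argument of the power within pi / 3, where the cosine
      is at least 1 / 2.\<close>
    define g where "g \<epsilon> w = \<Psi> (- w\<^sup>2) / (1 + w)\<^sup>2 * exp (- of_real \<epsilon> * (1 + w) powr of_real (2 / 3))" for \<epsilon> :: real and w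
    have g_le: "norm (g \<epsilon> \<zeta>) \<le> M" if \<epsilon>: "\<epsilon> > 0" for \<epsilon>
    proof -
      have "((\<lambda>R::real. C * exp (R powr (1 / 2) - \<epsilon> / 2 * R powr (2 / 3))) \<longlongrightarrow> 0) at_top"
        using \<epsilon> by real_asymp
      hence "\<forall>\<^sub>F R::real in at_top. C * exp (R powr (1 / 2) - \<epsilon> / 2 * R powr (2 / 3)) < 1"
        by (rule order_tendstoD) simp
      then obtain R0 where R0: "\<And>R. R \<ge> R0 \<Longrightarrow> C * exp (R powr (1 / 2) - \<epsilon> / 2 * R powr (2 / 3)) < 1"
        by (auto simp: eventually_at_top_linorder)
      define R where "R = max R0 (norm \<zeta> + 1)"
      have R: "R \<ge> R0" "R > norm \<zeta>" "R > 0" by (auto simp: R_def less_max_iff_disj intro: add_nonneg_pos)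
      define S where "S = ball 0 R \<inter> {w. Re w > 0}"
      have open_S: "open S" unfolding S_def by (intro open_Int open_ball open_halfspace_Re_gt)
      have clS: "closure S \<subseteq> cball 0 R \<inter> {w. Re w \<ge> 0}"
        by (rule closure_minimal) (auto simp: S_def closed_halfspace_Re_ge closed_Int)
      have one_plus: "1 + w \<noteq> 0" "Re (1 + w) \<ge> 1" if "Re w \<ge> 0" for w using that by (auto simp: complex_eq_iff)
      have nz2: "1 + w \<noteq> 0" if "Re w > - 1" for w
      proof
        assume "1 + w = 0"
        hence "Re (1 + w) = 0" by simp
        with that show False by simp
      qed
      have cont: "continuous_on (closure S) (g \<epsilon>)"
      proof (rule continuous_on_subset[OF _ clS])
        have "g \<epsilon> holomorphic_on {w. Re w > - 1}"
          unfolding g_def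
          by (intro holomorphic_intros holomorphic_on_compose_gen[OF _ hol, unfolded o_def])
             (use nz2 in \<open>auto simp: complex_nonpos_Reals_iff not_le intro!: holomorphic_intros\<close>)
        thus "continuous_on (cball 0 R \<inter> {w. 0 \<le> Re w}) (g \<epsilon>)"
          by (rule continuous_on_subset[OF holomorphic_on_imp_continuous_on]) auto
      qed
      have hol_S: "g \<epsilon> holomorphic_on interior S"
      proof -
        have "g \<epsilon> holomorphic_on S"
          unfolding g_def
          by (intro holomorphic_intros holomorphic_on_compose_gen[OF _ hol, unfolded o_def])
             (use nz2 in \<open>auto simp: S_def complex_nonpos_Reals_iff not_le intro!: holomorphic_intros\<close>)
        thus ?thesis using open_S by (simp add: interior_open)
      qed
      have exp_bound: "norm (exp (- of_real \<epsilon> * (1 + w) powr of_real (2 / 3))) \<le> exp (- (\<epsilon> / 2) * norm (1 + w) powr (2 / 3))"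
        if w: "Re w \<ge> 0" for w
      proof -
        have nz: "1 + w \<noteq> 0" using one_plus[OF w] by simp
        have arg: "\<bar>Im (Ln (1 + w))\<bar> \<le> pi / 2"
          using Re_Ln_pos_le[OF nz] one_plus[OF w] by linarith
        have "Re ((1 + w) powr of_real (2 / 3)) = norm (1 + w) powr (2 / 3) * cos (2 / 3 * Im (Ln (1 + w)))"
          using nz by (simp add: powr_def Re_exp exp_of_real)
        moreover have "cos (2 / 3 * Im (Ln (1 + w))) \<ge> 1 / 2"
        proof -
          have "cos (pi / 3) \<le> cos \<bar>2 / 3 * Im (Ln (1 + w))\<bar>"
            using arg by (intro cos_monotone_0_pi_le) (auto simp: abs_mult)
          thus ?thesis by (simp only: cos_abs_real cos_60)
        qed
        ultimately have "norm (1 + w) powr (2 / 3) * (1 / 2) \<le> Re ((1 + w) powr of_real (2 / 3))"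
          by (simp only:) (intro mult_left_mono, auto)
        hence "\<epsilon> * (norm (1 + w) powr (2 / 3) * (1 / 2)) \<le> \<epsilon> * Re ((1 + w) powr of_real (2 / 3))"
          using \<epsilon> by (intro mult_left_mono) auto
        thus ?thesis by (simp add: norm_exp_eq_Re)
      qed
      have "norm (g \<epsilon> \<zeta>) \<le> M"
      proof (rule maximum_modulus_frontier[OF hol_S cont])
        show "bounded S" unfolding S_def by (intro bounded_Int) auto
        show "\<zeta> \<in> S" using \<zeta> R by (simp add: S_def)
        fix w assume "w \<in> frontier S"
        hence w: "w \<in> closure S" "w \<notin> S" using open_S by (auto simp: frontier_def interior_open)
        hence wR: "norm w \<le> R" "Re w \<ge> 0" using clS by auto
        have one_plus_sq: "(norm (1 + w))\<^sup>2 = 1 + 2 * Re w + (norm w)\<^sup>2"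
          by (simp add: cmod_power2) (simp add: power2_eq_square algebra_simps)
        have ge1: "norm (1 + w) \<ge> 1" using one_plus[OF wR(2)] complex_Re_le_cmod[of "1 + w"] by linarith
        have gew: "norm (1 + w) \<ge> norm w" 
        proof (rule power2_le_imp_le)
          show "(norm w)\<^sup>2 \<le> (norm (1 + w))\<^sup>2" using one_plus_sq wR(2) by linarith
        qed simp
        have ge1_sq: "(norm (1 + w))\<^sup>2 \<ge> 1" using ge1 by (rule one_le_power)
        show "norm (g \<epsilon> w) \<le> M"
        proof (cases "Re w = 0")
          case True
          hence "- w\<^sup>2 = of_real ((Im w)\<^sup>2)" "norm w ^ 2 = (Im w)\<^sup>2"
            by (auto simp: complex_eq_iff power2_eq_square cmod_def)
          hence "norm (\<Psi> (- w\<^sup>2)) \<le> C' * (norm (1 + w))\<^sup>2"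
            using ray[of "(Im w)\<^sup>2"] one_plus_sq True by simp
          hence "norm (\<Psi> (- w\<^sup>2)) / (norm (1 + w))\<^sup>2 \<le> C'"
            using ge1_sq by (subst pos_divide_le_eq) linarith+
          moreover have "exp (- (\<epsilon> / 2) * norm (1 + w) powr (2 / 3)) \<le> 1" using \<epsilon> by simp
          ultimately have "norm (g \<epsilon> w) \<le> C' * 1"
            unfolding g_def norm_mult norm_divide norm_power
            using C'0 by (intro mult_mono order_trans[OF exp_bound[OF wR(2)]]) auto
          thus ?thesis by (simp add: M_def)
        next
          case False
          hence nw: "norm w = R" using wR w(2) by (auto simp: S_def)
          have "norm (\<Psi> (- w\<^sup>2)) \<le> C * exp (R powr (1 / 2))"
          proof -
            have "norm (- w\<^sup>2) powr (1 / 4) = (R powr 2) powr (1 / 4)"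
              using R nw by (simp add: norm_power)
            also have "\<dots> = R powr (1 / 2)" by (simp add: powr_powr)
            finally show ?thesis using order[of "- w\<^sup>2"] by simp
          qed
          moreover have "norm (\<Psi> (- w\<^sup>2)) / (norm (1 + w))\<^sup>2 \<le> norm (\<Psi> (- w\<^sup>2)) / 1"
            using ge1_sq by (intro divide_left_mono) auto
          ultimately have "norm (\<Psi> (- w\<^sup>2)) / (norm (1 + w))\<^sup>2 \<le> C * exp (R powr (1 / 2))" by linarith
          moreover have "exp (- (\<epsilon> / 2) * norm (1 + w) powr (2 / 3)) \<le> exp (- (\<epsilon> / 2) * R powr (2 / 3))"
            using gew \<epsilon> R nw by (auto intro!: mult_left_mono powr_mono2)
          ultimately have "norm (g \<epsilon> w) \<le> C * exp (R powr (1 / 2)) * exp (- (\<epsilon> / 2) * R powr (2 / 3))"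
            unfolding g_def norm_mult norm_divide norm_power
            using C0 by (intro mult_mono order_trans[OF exp_bound[OF wR(2)]]) auto
          also have "\<dots> = C * exp (R powr (1 / 2) - \<epsilon> / 2 * R powr (2 / 3))"
            by (simp only: mult.assoc exp_add [symmetric] diff_conv_add_uminus mult_minus_left)
          also have "\<dots> < 1" by (rule R0[OF R(1)])
          finally show ?thesis using C'0 by (simp add: M_def)
        qed
      qed
      thus ?thesis .
    qed
    have nz: "1 + \<zeta> \<noteq> 0" using \<zeta> by (auto simp: complex_eq_iff)
    have "((\<lambda>\<epsilon>. norm (g \<epsilon> \<zeta>)) \<longlongrightarrow> norm (\<Psi> (- \<zeta>\<^sup>2) / (1 + \<zeta>)\<^sup>2 * exp (- of_real 0 * (1 + \<zeta>) powr of_real (2 / 3)))) (at_right 0)"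
      unfolding g_def by (intro tendsto_intros) (use nz in auto)
    hence "norm (\<Psi> (- \<zeta>\<^sup>2) / (1 + \<zeta>)\<^sup>2 * exp (- of_real 0 * (1 + \<zeta>) powr of_real (2 / 3))) \<le> M"
      by (rule tendsto_upperbound) (auto intro!: eventually_at_rightI[of 0 1] g_le)
    thus ?thesis using nz by (simp add: norm_mult norm_divide norm_power divide_le_eq)
  qed
  have all: "norm (\<Psi> z) \<le> 4 * M * norm z ^ 1" if z: "1 \<le> norm z" for z
  proof -
    \<comment> \<open>The principal root has nonnegative real part. It is purely imaginary exactly
      when \<open>z\<close> is on the ray, where the bound is a hypothesis.\<close>
    define \<zeta> where "\<zeta> = csqrt (- z)"
    have \<zeta>2: "- \<zeta>\<^sup>2 = z" by (simp add: \<zeta>_def)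
    have nz: "norm \<zeta> ^ 2 = norm z" using \<zeta>2 by (metis norm_minus_cancel norm_power)
    consider "Re \<zeta> > 0" | "Re \<zeta> = 0" using csqrt_principal[of "- z"] by (auto simp: \<zeta>_def)
    thus ?thesis
    proof cases
      case 1
      have "norm (1 + \<zeta>) ^ 2 \<le> (1 + norm \<zeta>)\<^sup>2"
        using norm_triangle_ineq[of 1 \<zeta>] by (intro power_mono) auto
      also have "\<dots> \<le> 2 * (1 + norm \<zeta> ^ 2)"
        using zero_le_power2[of "1 - norm \<zeta>"] by (simp add: power2_eq_square algebra_simps)
      also have "\<dots> \<le> 4 * norm z" using nz z by simp
      finally have "M * norm (1 + \<zeta>) ^ 2 \<le> M * (4 * norm z)"
        using C'0 by (intro mult_left_mono) (auto simp: M_def)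
      thus ?thesis using half_plane[OF 1] \<zeta>2 by simp
    next
      case 2
      hence "- \<zeta>\<^sup>2 = of_real ((Im \<zeta>)\<^sup>2)" by (auto simp: complex_eq_iff power2_eq_square)
      hence zv: "z = of_real ((Im \<zeta>)\<^sup>2)" using \<zeta>2 by simp
      hence nv: "norm z = (Im \<zeta>)\<^sup>2" by (simp only: norm_of_real) simp
      have "norm (\<Psi> z) \<le> C' * (1 + norm z)" using ray[of "(Im \<zeta>)\<^sup>2"] zv nv by simp
      also have "\<dots> \<le> C' * (2 * norm z)" using z C'0 by (intro mult_left_mono) auto
      also have "\<dots> = (2 * C') * norm z" by simp
      also have "\<dots> \<le> (4 * M) * norm z" using C'0 by (intro mult_right_mono) (auto simp: M_def)
      finally show ?thesis by simp
    qed
  qed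
  have "\<Psi> z = \<Psi> 0 + deriv \<Psi> 0 * z" for z
    using Liouville_polynomial[OF hol all, where \<xi> = z] by simp
  thus ?thesis by blast
qed

section \<open>Hermite expansion of the Gaussian kernel, and the expansion of
  \<open>JJ\<close>\<close>

text \<open>The Taylor coefficients in \<open>z\<close> of exp (a z + b z^2), obtained as a Cauchy
  product: Hermite polynomials up to scaling. Keeping \<open>a\<close> and \<open>b\<close> explicit
  gives a majorant by taking absolute values of both.\<close>

definition expq_coeff :: "'a \<Rightarrow> 'a \<Rightarrow> nat \<Rightarrow> 'a :: {real_normed_field, banach}" where
  "expq_coeff a b j = (\<Sum>i\<le>j. a ^ i / fact i * (if even (j - i) then b ^ ((j - i) div 2) / fact ((j - i) div 2) else 0))"

lemma expq_coeff_sums: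
  fixes a b z :: "'a :: {real_normed_field, banach}"
  shows "(\<lambda>j. expq_coeff a b j * z ^ j) sums exp (a * z + b * z\<^sup>2)"
proof -
  have exp_sums: "(\<lambda>k. x ^ k / fact k) sums exp x" and exp_abs: "summable (\<lambda>k. norm (x ^ k / fact k))" for x :: 'a
    using exp_converges[of x] summable_norm_exp[of x]
    by (simp_all add: scaleR_conv_of_real divide_inverse mult.commute)
  define A where "A i = (a * z) ^ i / fact i" for i
  define B where "B k = (if even k then (b * z\<^sup>2) ^ (k div 2) / fact (k div 2) else 0)" for k
  have A: "A sums exp (a * z)" "summable (\<lambda>k. norm (A k))"
    unfolding A_def by (rule exp_sums exp_abs)+
  have sm: "strict_mono (\<lambda>n::nat. 2 * n)" by (auto simp: strict_mono_def)
  have B0: "B k = 0" if "k \<notin> range (\<lambda>n. 2 * n)" for k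
    using that by (auto simp: B_def elim: evenE)
  have B2: "B (2 * n) = (b * z\<^sup>2) ^ n / fact n" for n by (simp add: B_def)
  have B: "B sums exp (b * z\<^sup>2)"
    using sums_mono_reindex[OF sm, of B] B0 exp_sums[of "b * z\<^sup>2"] by (simp add: B2)
  have B': "summable (\<lambda>k. norm (B k))"
    using summable_mono_reindex[OF sm, of "\<lambda>k. norm (B k)"] B0 exp_abs[of "b * z\<^sup>2"] by (simp add: B2)
  have "(\<lambda>k. \<Sum>i\<le>k. A i * B (k - i)) sums ((\<Sum>k. A k) * (\<Sum>k. B k))"
    by (rule Cauchy_product_sums[OF A(2) B'])
  hence "(\<lambda>k. \<Sum>i\<le>k. A i * B (k - i)) sums exp (a * z + b * z\<^sup>2)"
    using A(1) B by (simp add: sums_iff exp_add)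
  moreover have "(\<Sum>i\<le>k. A i * B (k - i)) = expq_coeff a b k * z ^ k" for k
    unfolding expq_coeff_def sum_distrib_right
  proof (intro sum.cong refl)
    fix i assume i: "i \<in> {..k}"
    show "A i * B (k - i) = a ^ i / fact i * (if even (k - i) then b ^ ((k - i) div 2) / fact ((k - i) div 2) else 0) * z ^ k"
    proof (cases "even (k - i)")
      case True
      hence "i + 2 * ((k - i) div 2) = k" using i by simp
      hence "z ^ k = z ^ i * (z\<^sup>2) ^ ((k - i) div 2)" by (metis power_add power_mult)
      thus ?thesis using True by (simp add: A_def B_def power_mult_distrib)
    qed (simp add: B_def)
  qed
  ultimately show ?thesis by simp
qed

lemma abs_expq_coeff_le: "\<bar>expq_coeff a b j\<bar> \<le> expq_coeff \<bar>a\<bar> \<bar>b\<bar> (j::nat)" for a b :: real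
  unfolding expq_coeff_def
  by (rule order_trans[OF sum_abs], rule sum_mono) (simp add: abs_mult power_abs)

lemma expq_coeff_nonneg: "a \<ge> 0 \<Longrightarrow> b \<ge> 0 \<Longrightarrow> expq_coeff a b j \<ge> (0::real)"
  unfolding expq_coeff_def by (intro sum_nonneg) auto

lemma expq_partial_sum_le:
  fixes a b r :: real
  assumes "a \<ge> 0" "b \<ge> 0" "r \<ge> 0" "finite J"
  shows "(\<Sum>j\<in>J. expq_coeff a b j * r ^ j) \<le> exp (a * r + b * r\<^sup>2)"
proof -
  have "(\<Sum>j\<in>J. expq_coeff a b j * r ^ j) \<le> (\<Sum>j. expq_coeff a b j * r ^ j)"
    using assms sums_summable[OF expq_coeff_sums]
    by (intro sum_le_suminf) (auto intro!: mult_nonneg_nonneg expq_coeff_nonneg)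
  thus ?thesis using sums_unique[OF expq_coeff_sums[of a b r]] by simp
qed

lemma powser_zero_imp_coeff_zero:
  fixes e :: "nat \<Rightarrow> real"
  assumes "\<And>v. (\<lambda>j. e j * v ^ j) sums 0" and "m > 0"
  shows "e m = 0"
proof (rule ccontr)
  assume m: "e m \<noteq> 0"
  have "(\<lambda>j. e j * (x - 0) ^ j) sums (\<lambda>_. 0) x" for x :: real using assms(1) by simp
  then obtain s where "0 < s" "\<And>z :: real. z \<in> cball 0 s - {0} \<Longrightarrow> (0::real) \<noteq> 0"
    using powser_0_nonzero[of 1 0 e "\<lambda>_. 0" m] m assms(2) by auto
  from this(2)[of s] this(1) show False by simp
qed

context lognormal_fading
begin

text \<open>Rescaled Hermite polynomials: \<open>gau (y - v) = gau y * (\<Sum>j. hh j y * v ^ j)\<close>.\<close>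
definition hh :: "nat \<Rightarrow> real \<Rightarrow> real" where
  "hh j y = expq_coeff (y / sg\<^sup>2) (- 1 / (2 * sg\<^sup>2)) j"

definition Bh :: real where "Bh = exp (3 / (2 * sg\<^sup>2))"

lemma Bh_ge: "Bh \<ge> 1"
  by (simp add: Bh_def)

lemma gau_shift: "gau (y - v) = gau y * exp ((y / sg\<^sup>2) * v + (- 1 / (2 * sg\<^sup>2)) * v\<^sup>2)"
proof -
  have "- (y - v)\<^sup>2 / (2 * sg\<^sup>2) = - y\<^sup>2 / (2 * sg\<^sup>2) + ((y / sg\<^sup>2) * v + (- 1 / (2 * sg\<^sup>2)) * v\<^sup>2)"
    by (simp add: field_simps power2_eq_square)
  thus ?thesis unfolding gau_eq[of "y - v"] gau_eq[of y] by (simp only: exp_add mult.assoc)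
qed

lemma hh_sums: "(\<lambda>j. gau y * (hh j y * v ^ j)) sums gau (y - v)"
  unfolding hh_def gau_shift by (intro sums_mult expq_coeff_sums)

lemma hh_0: "hh 0 y = 1"
  by (simp add: hh_def expq_coeff_def)

lemma abs_hh_le_coeff: "\<bar>hh j y\<bar> \<le> expq_coeff (\<bar>y\<bar> / sg\<^sup>2) (1 / (2 * sg\<^sup>2)) j"
  using abs_expq_coeff_le[of "y / sg\<^sup>2" "- 1 / (2 * sg\<^sup>2)" j] by (simp add: hh_def)

lemma sum_abs_hh_le:
  assumes "r \<ge> 0" "finite J"
  shows "(\<Sum>j\<in>J. \<bar>hh j y\<bar> * r ^ j) \<le> exp (\<bar>y\<bar> / sg\<^sup>2 * r + 1 / (2 * sg\<^sup>2) * r\<^sup>2)"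
proof -
  have "(\<Sum>j\<in>J. \<bar>hh j y\<bar> * r ^ j) \<le> (\<Sum>j\<in>J. expq_coeff (\<bar>y\<bar> / sg\<^sup>2) (1 / (2 * sg\<^sup>2)) j * r ^ j)"
    using assms by (intro sum_mono mult_right_mono abs_hh_le_coeff) auto
  also have "\<dots> \<le> exp (\<bar>y\<bar> / sg\<^sup>2 * r + 1 / (2 * sg\<^sup>2) * r\<^sup>2)"
    using assms by (intro expq_partial_sum_le) auto
  finally show ?thesis .
qed

text \<open>A Cauchy estimate at radius 1 / (1 + |y|): there the generating function of the absolute
  values is at most exp (1 / sg^2 + 1 / (2 sg^2)), which is \<open>Bh\<close>.\<close>

lemma abs_hh_le: "\<bar>hh j y\<bar> \<le> Bh * (1 + \<bar>y\<bar>) ^ j"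
proof -
  define r where "r = 1 / (1 + \<bar>y\<bar>)"
  have r: "0 < r" "r \<le> 1" "\<bar>y\<bar> * r \<le> 1" by (auto simp: r_def field_simps)
  have "\<bar>hh j y\<bar> * r ^ j \<le> exp (\<bar>y\<bar> / sg\<^sup>2 * r + 1 / (2 * sg\<^sup>2) * r\<^sup>2)"
    using sum_abs_hh_le[of r "{j}" y] r by simp
  also have "\<dots> \<le> Bh"
  proof -
    have "\<bar>y\<bar> / sg\<^sup>2 * r \<le> 1 / sg\<^sup>2" using r(3) by (simp add: divide_right_mono)
    moreover have "r\<^sup>2 \<le> 1" using r by (simp add: power_le_one)
    hence "1 / (2 * sg\<^sup>2) * r\<^sup>2 \<le> 1 / (2 * sg\<^sup>2)" by (simp add: divide_right_mono)
    moreover have "1 / sg\<^sup>2 + 1 / (2 * sg\<^sup>2) = 3 / (2 * sg\<^sup>2)" by (simp add: field_simps)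
    ultimately show ?thesis unfolding Bh_def exp_le_cancel_iff by linarith
  qed
  finally have "\<bar>hh j y\<bar> * r ^ j / r ^ j \<le> Bh / r ^ j" using r by (intro divide_right_mono) auto
  thus ?thesis using r by (simp add: r_def power_divide)
qed

lemma hh_poly: "\<exists>p. degree p \<le> j \<and> (\<forall>y. hh j y = poly p y)"
proof -
  define c where "c i = (1 / sg\<^sup>2) ^ i / fact i *
    (if even (j - i) then (- 1 / (2 * sg\<^sup>2)) ^ ((j - i) div 2) / fact ((j - i) div 2) else 0)" for i
  define p where "p = (\<Sum>i\<le>j. monom (c i) i)"
  have "degree p \<le> j" unfolding p_def
    by (rule degree_sum_le) (auto intro: order_trans[OF degree_monom_le])
  moreover have "hh j y = poly p y" for y
    by (auto simp: hh_def expq_coeff_def p_def poly_sum poly_monom c_def power_divide intro!: sum.cong)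
  ultimately show ?thesis by blast
qed

lemma hh_measurable [measurable]: "hh j \<in> borel_measurable borel"
  unfolding hh_def[abs_def] expq_coeff_def by measurable

lemma gau_exp_abs_integrable: "c \<ge> 0 \<Longrightarrow> integrable lborel (\<lambda>y. gau y * exp (c * \<bar>y\<bar>))"
  by (rule integrable_normal_density_exp_abs) auto

definition psi :: "(real \<Rightarrow> real) \<Rightarrow> real \<Rightarrow> real" where
  "psi L v = (\<integral>y. gau (y - v) * L y \<partial>lborel)"

definition psc :: "(real \<Rightarrow> real) \<Rightarrow> nat \<Rightarrow> real" where
  "psc L j = (\<integral>y. gau y * hh j y * L y \<partial>lborel)"

text \<open>Replacing \<open>hh j y\<close> and \<open>v\<close> by absolute values, all partial
  sums stay below a Gaussian times an exponential, so the Hermite series may be integrated term by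
  term. Exponential growth of \<open>L\<close> is allowed so that monomials and functions of
  quadratic growth are both covered.\<close>

lemma
  assumes [measurable]: "L \<in> borel_measurable borel" and L: "\<And>y. \<bar>L y\<bar> \<le> D * exp \<bar>y\<bar>"
  shows psi_sums: "(\<lambda>j. psc L j * v ^ j) sums psi L v"
    and psc_summable: "summable (\<lambda>j. \<bar>psc L j * v ^ j\<bar>)"
    and psc_integrable: "integrable lborel (\<lambda>y. gau y * hh j y * L y)"
    and psi_integrable: "integrable lborel (\<lambda>y. gau (y - v) * L y)"
proof -
  define w where "w y = D * (exp (v\<^sup>2 / (2 * sg\<^sup>2)) * (gau y * exp ((1 + \<bar>v\<bar> / sg\<^sup>2) * \<bar>y\<bar>)))" for y
  have D0: "D \<ge> 0" using L[of 0] by auto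
  have w: "integrable lborel w" unfolding w_def
    by (intro integrable_mult_right gau_exp_abs_integrable) auto
  have w_eq: "w y = gau y * exp (\<bar>y\<bar> / sg\<^sup>2 * \<bar>v\<bar> + 1 / (2 * sg\<^sup>2) * \<bar>v\<bar>\<^sup>2) * (D * exp \<bar>y\<bar>)" for y
    unfolding w_def by (simp add: exp_add [symmetric] mult_ac) (simp add: algebra_simps exp_add [symmetric])
  define f where "f j y = gau y * (hh j y * v ^ j) * L y" for j y
  have f_abs: "\<bar>f j y\<bar> \<le> gau y * (\<bar>hh j y\<bar> * \<bar>v\<bar> ^ j) * (D * exp \<bar>y\<bar>)" for j y
    unfolding f_def abs_mult power_abs using L by (intro mult_mono) auto
  have f_sum: "(\<Sum>j\<in>J. \<bar>f j y\<bar>) \<le> w y" if "finite J" for J y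
  proof -
    have "(\<Sum>j\<in>J. \<bar>f j y\<bar>) \<le> (\<Sum>j\<in>J. gau y * (\<bar>hh j y\<bar> * \<bar>v\<bar> ^ j) * (D * exp \<bar>y\<bar>))"
      by (intro sum_mono f_abs)
    also have "\<dots> = gau y * (\<Sum>j\<in>J. \<bar>hh j y\<bar> * \<bar>v\<bar> ^ j) * (D * exp \<bar>y\<bar>)"
      by (simp only: sum_distrib_left sum_distrib_right)
    also have "\<dots> \<le> w y" unfolding w_eq
      using that D0 by (intro mult_right_mono mult_left_mono sum_abs_hh_le) auto
    finally show ?thesis .
  qed
  have f_int: "integrable lborel (f j)" for j
  proof (rule Bochner_Integration.integrable_bound[OF w])
    show "AE y in lborel. norm (f j y) \<le> norm (w y)"
      using f_sum[of "{j}"] by (intro AE_I2) (auto intro: order_trans[OF _ abs_ge_self])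
  qed (unfold f_def, measurable)
  have f_integral: "(\<integral>y. f j y \<partial>lborel) = psc L j * v ^ j" for j
  proof -
    have "f j = (\<lambda>y. (gau y * hh j y * L y) * v ^ j)" by (auto simp: f_def)
    thus ?thesis unfolding psc_def by (simp only:) simp
  qed
  have f_sums: "(\<lambda>j. f j y) sums (gau (y - v) * L y)" for y
    unfolding f_def by (intro sums_mult2 hh_sums)
  have f_summ: "summable (\<lambda>j. norm (f j y))" for y
    by (rule summableI_nonneg_bounded[where x = "w y"]) (use f_sum in auto)
  have f_isumm: "summable (\<lambda>j. \<integral>y. norm (f j y) \<partial>lborel)"
  proof (rule summableI_nonneg_bounded[where x = "\<integral>y. w y \<partial>lborel"])
    fix n
    have "(\<Sum>j<n. \<integral>y. norm (f j y) \<partial>lborel) = (\<integral>y. (\<Sum>j<n. norm (f j y)) \<partial>lborel)"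
      by (rule Bochner_Integration.integral_sum [symmetric]) (intro integrable_norm f_int)
    also have "\<dots> \<le> (\<integral>y. w y \<partial>lborel)"
      using f_sum[of "{..<n}"]
      by (intro Bochner_Integration.integral_mono w Bochner_Integration.integrable_sum integrable_norm f_int) auto
    finally show "(\<Sum>j<n. \<integral>y. norm (f j y) \<partial>lborel) \<le> (\<integral>y. w y \<partial>lborel)" .
  qed simp
  have "(\<lambda>j. \<integral>y. f j y \<partial>lborel) sums (\<integral>y. (\<Sum>j. f j y) \<partial>lborel)"
    by (rule sums_integral) (use f_int f_summ f_isumm in auto)
  thus "(\<lambda>j. psc L j * v ^ j) sums psi L v"
    unfolding f_integral psi_def using f_sums by (simp add: sums_iff)
  show "summable (\<lambda>j. \<bar>psc L j * v ^ j\<bar>)"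
    by (rule summable_comparison_test'[OF f_isumm]) (simp flip: f_integral)
  have "integrable lborel (\<lambda>y. \<Sum>j. f j y)"
    by (rule integrable_suminf) (use f_int f_summ f_isumm in auto)
  thus "integrable lborel (\<lambda>y. gau (y - v) * L y)" using f_sums by (simp add: sums_iff)
next
  show "integrable lborel (\<lambda>y. gau y * hh j y * L y)"
  proof (rule Bochner_Integration.integrable_bound)
    show "integrable lborel (\<lambda>y. Bh * D * fact j * exp 1 * (gau y * exp (2 * \<bar>y\<bar>)))"
      by (intro integrable_mult_right gau_exp_abs_integrable) auto
    show "AE y in lborel. norm (gau y * hh j y * L y) \<le> norm (Bh * D * fact j * exp 1 * (gau y * exp (2 * \<bar>y\<bar>)))"
    proof (intro AE_I2)
      fix y :: real
      have D0: "D \<ge> 0" using L[of 0] by auto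
      have "(1 + \<bar>y\<bar>) ^ j \<le> fact j * exp (1 + \<bar>y\<bar>)" by (intro power_le_fact_exp) auto
      hence "\<bar>hh j y\<bar> \<le> Bh * (fact j * exp (1 + \<bar>y\<bar>))"
        using Bh_ge by (intro order_trans[OF abs_hh_le] mult_left_mono) auto
      hence "\<bar>gau y * hh j y * L y\<bar> \<le> gau y * (Bh * (fact j * exp (1 + \<bar>y\<bar>))) * (D * exp \<bar>y\<bar>)"
        unfolding abs_mult using L[of y] Bh_ge D0 by (intro mult_mono) auto
      also have "\<dots> = Bh * D * fact j * exp 1 * (gau y * exp (2 * \<bar>y\<bar>))"
        by (simp add: exp_add exp_double power2_eq_square)
      finally show "norm (gau y * hh j y * L y) \<le> norm (Bh * D * fact j * exp 1 * (gau y * exp (2 * \<bar>y\<bar>)))"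
        using Bh_ge D0 by (simp add: abs_mult)
    qed
  qed measurable
qed

lemma abs_power_le_exp: "\<bar>y ^ i\<bar> \<le> fact i * exp \<bar>y\<bar>" for y :: real
  using power_le_fact_exp[of "\<bar>y\<bar>" i] by (simp add: power_abs)

text \<open>Orthogonality of Hermite polynomials to lower degrees: smoothing a monomial of degree
  \<open>i\<close> by the Gaussian yields a polynomial of degree at most \<open>i\<close> in the
  shift, whose higher Taylor coefficients vanish.\<close>

lemma psc_power_eq_0:
  assumes "i < j"
  shows "psc (\<lambda>y. y ^ i) j = 0"
proof -
  have meas: "(\<lambda>y::real. y ^ i) \<in> borel_measurable borel" for i :: nat by measurable
  have int: "integrable lborel (\<lambda>u. gau u * u ^ k)" for k
    using psi_integrable[of "\<lambda>y. y ^ k" "fact k" 0] abs_power_le_exp by simp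
  define d where "d k = (if k \<le> i then of_nat (i choose k) * (\<integral>u. gau u * u ^ (i - k) \<partial>lborel) else 0)" for k
  have d_sums: "(\<lambda>k. d k * v ^ k) sums psi (\<lambda>y. y ^ i) v" for v
  proof -
    have "psi (\<lambda>y. y ^ i) v = (\<integral>u. gau u * (v + u) ^ i \<partial>lborel)"
      unfolding psi_def by (subst lborel_integral_real_affine[of 1 _ v]) auto
    also have "\<dots> = (\<integral>u. (\<Sum>k\<le>i. (of_nat (i choose k) * v ^ k) * (gau u * u ^ (i - k))) \<partial>lborel)"
      by (simp add: binomial_ring sum_distrib_left mult_ac)
    also have "\<dots> = (\<Sum>k\<le>i. d k * v ^ k)"
      using int by (subst Bochner_Integration.integral_sum) (auto simp: d_def intro!: sum.cong)
    finally have eq: "psi (\<lambda>y. y ^ i) v = (\<Sum>k\<le>i. d k * v ^ k)" .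
    show ?thesis unfolding eq by (rule sums_finite) (auto simp: d_def)
  qed
  have "psc (\<lambda>y. y ^ i) j - d j = 0"
  proof (rule powser_zero_imp_coeff_zero)
    fix v
    have "(\<lambda>j. psc (\<lambda>y. y ^ i) j * v ^ j) sums psi (\<lambda>y. y ^ i) v"
      by (rule psi_sums[OF meas abs_power_le_exp])
    from sums_diff[OF this d_sums[of v]]
    show "(\<lambda>j. (psc (\<lambda>y. y ^ i) j - d j) * v ^ j) sums 0" by (simp add: algebra_simps)
  qed (use assms in simp)
  thus ?thesis using assms by (simp add: d_def)
qed

lemma hh_orthogonal:
  fixes p :: "complex poly"
  assumes "degree p < j"
  shows "(\<integral>y. of_real (gau y * hh j y) * poly p (of_real y) \<partial>lborel) = (0::complex)"
proof -
  have int: "integrable lborel (\<lambda>y. gau y * hh j y * y ^ i)" for i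
    by (rule psc_integrable[OF _ abs_power_le_exp]) measurable
  have eq: "(\<lambda>y. of_real (gau y * hh j y) * poly p (of_real y))
      = (\<lambda>y. \<Sum>i\<le>degree p. coeff p i * of_real (gau y * hh j y * y ^ i))"
    by (simp add: poly_altdef sum_distrib_left mult_ac)
  have "(\<integral>y. of_real (gau y * hh j y) * poly p (of_real y) \<partial>lborel)
      = (\<Sum>i\<le>degree p. coeff p i * of_real (psc (\<lambda>y. y ^ i) j))"
    unfolding eq
    by (subst Bochner_Integration.integral_sum)
       (auto simp: psc_def integral_complex_of_real intro!: sum.cong integrable_mult_right integrable_of_real int simp del: of_real_mult of_real_power)
  also have "\<dots> = 0" using assms by (intro sum.neutral) (auto simp: psc_power_eq_0)
  finally show ?thesis .
qed

definition mm :: "nat \<Rightarrow> real" where "mm j = exp (2 * s2 * (real j ^ 2 - real j))"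

lemma mm_pos [simp]: "mm j > 0" and mm_0: "mm 0 = 1"
  by (simp_all add: mm_def)

lemma lnd_moment:
  shows lnd_moment_integrable: "integrable lborel (\<lambda>t. lnd t * exp (2 * t) ^ j)"
    and lnd_moment_integral: "(\<integral>t. lnd t * exp (2 * t) ^ j \<partial>lborel) = mm j"
proof -
  have eq: "exp (2 * t) ^ j = exp ((2 * real j) * t)" for t
    by (simp add: exp_of_nat_mult [symmetric] mult_ac)
  have "has_bochner_integral lborel (\<lambda>t. lnd t * exp ((2 * real j) * t))
      (exp ((2 * real j) * (- s2) + (2 * real j)\<^sup>2 * (sqrt s2)\<^sup>2 / 2))"
    by (rule has_integral_normal_density_exp) simp
  moreover have "(2 * real j) * (- s2) + (2 * real j)\<^sup>2 * (sqrt s2)\<^sup>2 / 2 = 2 * s2 * (real j ^ 2 - real j)"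
    by (simp add: algebra_simps power2_eq_square)
  ultimately show "integrable lborel (\<lambda>t. lnd t * exp (2 * t) ^ j)"
    "(\<integral>t. lnd t * exp (2 * t) ^ j \<partial>lborel) = mm j"
    unfolding eq mm_def by (simp_all add: has_bochner_integral_iff)
qed

text \<open>The gain is unbounded, so the remainder must be controlled for every
  \<open>v >= 0\<close>. With u = v (1 + |y|), the tail is geometric for \<open>u <= 1/2\<close>;
  beyond that each term is estimated separately, since any power of 2 u is at least 1.\<close>

lemma gau_expansion:
  assumes "v \<ge> 0"
  shows "\<bar>gau (y - v) - gau y * (\<Sum>j\<le>n. hh j y * v ^ j)\<bar>
      \<le> (gau 0 * 2 ^ (n + 1) * (real n + 2) * Bh) * (v * (1 + \<bar>y\<bar>)) ^ (n + 1)"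
proof -
  define u where "u = v * (1 + \<bar>y\<bar>)"
  have u0: "u \<ge> 0" using assms by (simp add: u_def)
  have tm: "\<bar>hh j y * v ^ j\<bar> \<le> Bh * u ^ j" for j
  proof -
    have "\<bar>hh j y * v ^ j\<bar> \<le> (Bh * (1 + \<bar>y\<bar>) ^ j) * v ^ j"
      unfolding abs_mult power_abs using assms Bh_ge by (intro mult_mono abs_hh_le) auto
    thus ?thesis by (simp add: u_def power_mult_distrib mult_ac)
  qed
  have gy: "gau y \<le> gau 0" "0 \<le> gau 0" by (auto intro: gau_le)
  show ?thesis
  proof (cases "u \<le> 1 / 2")
    case True
    have sums: "(\<lambda>j. hh j y * v ^ j) sums (gau (y - v) / gau y)"
      using sums_divide[OF hh_sums[of y v], of "gau y"] by (simp add: less_imp_neq[OF gau_pos, symmetric])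
    have "(\<lambda>j. hh (j + (n + 1)) y * v ^ (j + (n + 1))) sums (gau (y - v) / gau y - (\<Sum>j<n + 1. hh j y * v ^ j))"
      by (rule sums_split_initial_segment[OF sums])
    hence eq: "gau (y - v) / gau y - (\<Sum>j\<le>n. hh j y * v ^ j) = (\<Sum>j. hh (j + (n + 1)) y * v ^ (j + (n + 1)))"
      by (simp add: sums_iff lessThan_Suc_atMost)
    have geo: "(\<lambda>j. Bh * u ^ (n + 1) * u ^ j) sums (Bh * u ^ (n + 1) * (1 / (1 - u)))"
      using True u0 by (intro sums_mult geometric_sums) auto
    have "norm (\<Sum>j. hh (j + (n + 1)) y * v ^ (j + (n + 1))) \<le> (\<Sum>j. Bh * u ^ (n + 1) * u ^ j)"
      using tm[of "_ + (n + 1)"]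
      by (intro norm_suminf_le sums_summable[OF geo]) (auto simp: power_add mult_ac)
    also have "\<dots> = Bh * u ^ (n + 1) * (1 / (1 - u))" using geo by (rule sums_unique [symmetric])
    also have "\<dots> \<le> Bh * u ^ (n + 1) * 2" using True u0 Bh_ge by (intro mult_left_mono) (auto simp: field_simps)
    finally have r: "\<bar>gau (y - v) / gau y - (\<Sum>j\<le>n. hh j y * v ^ j)\<bar> \<le> Bh * u ^ (n + 1) * 2"
      unfolding eq by simp
    have "gau (y - v) - gau y * (\<Sum>j\<le>n. hh j y * v ^ j) = gau y * (gau (y - v) / gau y - (\<Sum>j\<le>n. hh j y * v ^ j))"
      by (simp add: right_diff_distrib less_imp_neq[OF gau_pos, symmetric])
    hence "\<bar>gau (y - v) - gau y * (\<Sum>j\<le>n. hh j y * v ^ j)\<bar> \<le> gau 0 * (Bh * u ^ (n + 1) * 2)"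
      using r gy by (simp only: abs_mult) (intro mult_mono, auto)
    also have "\<dots> \<le> (gau 0 * 2 ^ (n + 1) * (real n + 2) * Bh) * u ^ (n + 1)"
    proof -
      have "1 * 2 \<le> (2::real) ^ (n + 1) * (real n + 2)" by (intro mult_mono one_le_power) auto
      hence "(gau 0 * Bh * u ^ (n + 1)) * 2 \<le> (gau 0 * Bh * u ^ (n + 1)) * (2 ^ (n + 1) * (real n + 2))"
        using u0 Bh_ge by (intro mult_left_mono) auto
      thus ?thesis by (simp add: mult_ac)
    qed
    finally show ?thesis by (simp add: u_def)
  next
    case False
    hence u: "2 * u \<ge> 1" by simp
    have pw: "u ^ j \<le> 2 ^ (n + 1) * u ^ (n + 1)" if "j \<le> n + 1" for j
    proof -
      have "u ^ j * 1 \<le> u ^ j * (2 * u) ^ (n + 1 - j)" using u u0 by (intro mult_left_mono one_le_power) auto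
      also have "\<dots> = 2 ^ (n + 1 - j) * u ^ (n + 1)"
        using that by (simp add: power_mult_distrib power_add [symmetric] del: power_Suc)
      also have "\<dots> \<le> 2 ^ (n + 1) * u ^ (n + 1)" using u0 by (intro mult_right_mono power_increasing) auto
      finally show ?thesis by simp
    qed
    have "\<bar>\<Sum>j\<le>n. hh j y * v ^ j\<bar> \<le> (\<Sum>j\<le>n. Bh * (2 ^ (n + 1) * u ^ (n + 1)))"
    proof (rule order_trans[OF sum_abs], rule sum_mono)
      fix j assume "j \<in> {..n}"
      thus "\<bar>hh j y * v ^ j\<bar> \<le> Bh * (2 ^ (n + 1) * u ^ (n + 1))"
        using Bh_ge by (intro order_trans[OF tm] mult_left_mono pw) auto
    qed
    also have "\<dots> = (real n + 1) * Bh * (2 ^ (n + 1) * u ^ (n + 1))" by simp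
    finally have "\<bar>gau y * (\<Sum>j\<le>n. hh j y * v ^ j)\<bar> \<le> gau 0 * ((real n + 1) * Bh * (2 ^ (n + 1) * u ^ (n + 1)))"
      unfolding abs_mult using gy by (intro mult_mono) auto
    moreover have "\<bar>gau (y - v)\<bar> \<le> gau 0 * (Bh * (2 ^ (n + 1) * u ^ (n + 1)))"
    proof -
      have "1 \<le> (2 * u) ^ (n + 1)" using u by (rule one_le_power)
      hence "1 \<le> 2 ^ (n + 1) * u ^ (n + 1)" by (simp only: power_mult_distrib)
      hence "1 * 1 \<le> Bh * (2 ^ (n + 1) * u ^ (n + 1))"
        using Bh_ge by (intro mult_mono) auto
      hence "gau 0 * 1 \<le> gau 0 * (Bh * (2 ^ (n + 1) * u ^ (n + 1)))" by (intro mult_left_mono) auto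
      thus ?thesis using gau_le[of "y - v"] unfolding abs_of_pos[OF gau_pos] by linarith
    qed
    ultimately have "\<bar>gau (y - v) - gau y * (\<Sum>j\<le>n. hh j y * v ^ j)\<bar>
        \<le> gau 0 * (Bh * (2 ^ (n + 1) * u ^ (n + 1))) + gau 0 * ((real n + 1) * Bh * (2 ^ (n + 1) * u ^ (n + 1)))"
      by (intro order_trans[OF abs_triangle_ineq4] add_mono) auto
    also have "\<dots> = (gau 0 * 2 ^ (n + 1) * (real n + 2) * Bh) * u ^ (n + 1)" by (simp add: algebra_simps)
    finally show ?thesis by (simp add: u_def)
  qed
qed

lemma pp_expansion:
  "\<exists>C>0. \<forall>x\<ge>0. \<forall>y. \<bar>pp x y - gau y * (\<Sum>j\<le>n. hh j y * mm j * x ^ j)\<bar> \<le> C * (x * (1 + \<bar>y\<bar>)) ^ (n + 1)"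
proof -
  define C where "C = gau 0 * 2 ^ (n + 1) * (real n + 2) * Bh"
  have C: "C > 0" unfolding C_def using Bh_ge by (intro mult_pos_pos) auto
  have "\<bar>pp x y - gau y * (\<Sum>j\<le>n. hh j y * mm j * x ^ j)\<bar> \<le> (C * mm (n + 1)) * (x * (1 + \<bar>y\<bar>)) ^ (n + 1)"
    if x: "x \<ge> 0" for x y
  proof -
    define f where "f t = lnd t * (gau y * (\<Sum>j\<le>n. hh j y * (x * exp (2 * t)) ^ j))" for t
    have f_eq: "f = (\<lambda>t. \<Sum>j\<le>n. (gau y * hh j y * x ^ j) * (lnd t * exp (2 * t) ^ j))"
      by (auto simp: f_def sum_distrib_left power_mult_distrib mult_ac)
    have f_int: "integrable lborel f" unfolding f_eq
      by (intro Bochner_Integration.integrable_sum integrable_mult_right lnd_moment_integrable)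
    have f_integral: "(\<integral>t. f t \<partial>lborel) = gau y * (\<Sum>j\<le>n. hh j y * mm j * x ^ j)"
    proof -
      have "(\<integral>t. f t \<partial>lborel) = (\<Sum>j\<le>n. \<integral>t. (gau y * hh j y * x ^ j) * (lnd t * exp (2 * t) ^ j) \<partial>lborel)"
        unfolding f_eq
        by (intro Bochner_Integration.integral_sum integrable_mult_right lnd_moment_integrable)
      also have "\<dots> = (\<Sum>j\<le>n. (gau y * hh j y * x ^ j) * mm j)"
        by (simp only: integral_mult_right_zero lnd_moment_integral)
      finally show ?thesis by (simp only: sum_distrib_left mult_ac)
    qed
    let ?g = "\<lambda>t. (C * (x * (1 + \<bar>y\<bar>)) ^ (n + 1)) * (lnd t * exp (2 * t) ^ (n + 1))"
    have "\<bar>pp x y - (\<integral>t. f t \<partial>lborel)\<bar> = \<bar>\<integral>t. lnd t * gau (y - x * exp (2 * t)) - f t \<partial>lborel\<bar>"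
      unfolding pp_def using f_int by (subst Bochner_Integration.integral_diff) auto
    also have "\<dots> \<le> (\<integral>t. \<bar>lnd t * gau (y - x * exp (2 * t)) - f t\<bar> \<partial>lborel)"
      by (rule integral_abs_bound)
    also have "\<dots> \<le> (\<integral>t. ?g t \<partial>lborel)"
    proof (intro Bochner_Integration.integral_mono integrable_abs Bochner_Integration.integrable_diff pp_kernel_integrable f_int
        integrable_mult_right lnd_moment_integrable)
      fix t
      let ?v = "x * exp (2 * t)"
      have "\<bar>lnd t * gau (y - ?v) - f t\<bar> = lnd t * \<bar>gau (y - ?v) - gau y * (\<Sum>j\<le>n. hh j y * ?v ^ j)\<bar>"
        unfolding f_def right_diff_distrib [symmetric] abs_mult by simp
      also have "\<dots> \<le> lnd t * (C * (?v * (1 + \<bar>y\<bar>)) ^ (n + 1))"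
        unfolding C_def using x by (intro mult_left_mono gau_expansion) auto
      also have "\<dots> = ?g t" by (simp only: power_mult_distrib mult_ac)
      finally show "\<bar>lnd t * gau (y - ?v) - f t\<bar> \<le> ?g t" .
    qed
    also have "\<dots> = (C * mm (n + 1)) * (x * (1 + \<bar>y\<bar>)) ^ (n + 1)"
      unfolding integral_mult_right_zero lnd_moment_integral by (simp only: mult_ac)
    finally show ?thesis unfolding f_integral .
  qed
  thus ?thesis using C by (intro exI[of _ "C * mm (n + 1)"]) auto
qed

lemma one_plus_sq_le_exp: "1 + y\<^sup>2 \<le> 2 * exp \<bar>y\<bar>" for y :: real
  using exp_lower_Taylor_quadratic[of "\<bar>y\<bar>"] by simp

lemma abs_psi_le:
  assumes L: "L \<in> borel_measurable borel" "\<And>y. \<bar>L y\<bar> \<le> D * (1 + y\<^sup>2)"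
  shows "(\<integral>y. \<bar>gau (y - v) * L y\<bar> \<partial>lborel) \<le> 2 * D * (\<integral>u. gau u * (1 + u\<^sup>2) \<partial>lborel) * (1 + v\<^sup>2)"
    and "\<bar>psi L v\<bar> \<le> 2 * D * (\<integral>u. gau u * (1 + u\<^sup>2) \<partial>lborel) * (1 + v\<^sup>2)"
proof -
  have D0: "D \<ge> 0" using L(2)[of 0] by auto
  have LD: "\<bar>L y\<bar> \<le> (2 * D) * exp \<bar>y\<bar>" for y
    using order_trans[OF L(2) mult_left_mono[OF one_plus_sq_le_exp D0]] by (simp add: mult_ac)
  have i1: "integrable lborel (\<lambda>u. gau (u - v) * (1 + u\<^sup>2))" for v
    by (rule psi_integrable[where D = 2]) (use one_plus_sq_le_exp in auto)
  have i2: "integrable lborel (\<lambda>y. gau (y - v) * (1 + (y - v)\<^sup>2))"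
    using lborel_integrable_real_affine[of "\<lambda>u. gau u * (1 + u\<^sup>2)" 1 "- v"] i1[of 0] by simp
  have e2: "(\<integral>y. gau (y - v) * (1 + (y - v)\<^sup>2) \<partial>lborel) = (\<integral>u. gau u * (1 + u\<^sup>2) \<partial>lborel)"
    using lborel_integral_real_affine[of 1 "\<lambda>u. gau u * (1 + u\<^sup>2)" "- v"] by simp
  have i3: "integrable lborel (\<lambda>y. gau (y - v) * L y)" by (rule psi_integrable[OF L(1) LD])
  have "(\<integral>y. \<bar>gau (y - v) * L y\<bar> \<partial>lborel) \<le> (\<integral>y. (2 * D * (1 + v\<^sup>2)) * (gau (y - v) * (1 + (y - v)\<^sup>2)) \<partial>lborel)"
  proof (intro Bochner_Integration.integral_mono integrable_abs i3 integrable_mult_right i2)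
    fix y
    have "\<bar>L y\<bar> \<le> D * (2 * (1 + (y - v)\<^sup>2) * (1 + v\<^sup>2))"
      by (rule order_trans[OF L(2) mult_left_mono[OF Peetre_inequality D0]])
    hence "gau (y - v) * \<bar>L y\<bar> \<le> gau (y - v) * (D * (2 * (1 + (y - v)\<^sup>2) * (1 + v\<^sup>2)))"
      by (intro mult_left_mono) auto
    thus "\<bar>gau (y - v) * L y\<bar> \<le> (2 * D * (1 + v\<^sup>2)) * (gau (y - v) * (1 + (y - v)\<^sup>2))"
      by (simp only: abs_mult abs_of_pos[OF gau_pos] mult_ac)
  qed
  also have "\<dots> = 2 * D * (\<integral>u. gau u * (1 + u\<^sup>2) \<partial>lborel) * (1 + v\<^sup>2)"
    unfolding integral_mult_right_zero e2 by (simp only: mult_ac)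
  finally show *: "(\<integral>y. \<bar>gau (y - v) * L y\<bar> \<partial>lborel) \<le> 2 * D * (\<integral>u. gau u * (1 + u\<^sup>2) \<partial>lborel) * (1 + v\<^sup>2)" .
  show "\<bar>psi L v\<bar> \<le> 2 * D * (\<integral>u. gau u * (1 + u\<^sup>2) \<partial>lborel) * (1 + v\<^sup>2)"
    unfolding psi_def by (rule order_trans[OF integral_abs_bound *])
qed

text \<open>By Fubini the noise is integrated first and the gain last. A power \<open>v ^ j\<close>
  in \<open>psi\<close> then acquires the moment \<open>mm j\<close>.\<close>

lemma JJ_eq_psi:
  assumes L: "L \<in> borel_measurable borel" "\<And>y. \<bar>L y\<bar> \<le> D * (1 + y\<^sup>2)"
  shows "JJ L x = (\<integral>t. lnd t * psi L (x * exp (2 * t)) \<partial>lborel)"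
    and "integrable lborel (\<lambda>t. lnd t * psi L (x * exp (2 * t)))"
proof -
  note [measurable] = L(1)
  have D0: "D \<ge> 0" using L(2)[of 0] by auto
  have LD: "\<bar>L y\<bar> \<le> (2 * D) * exp \<bar>y\<bar>" for y
    using order_trans[OF L(2) mult_left_mono[OF one_plus_sq_le_exp D0]] by (simp add: mult_ac)
  let ?f = "\<lambda>t y. lnd t * (gau (y - x * exp (2 * t)) * L y)"
  define K where "K = 2 * D * (\<integral>u. gau u * (1 + u\<^sup>2) \<partial>lborel)"
  have meas: "case_prod ?f \<in> borel_measurable (lborel \<Otimes>\<^sub>M lborel)" by measurable
  have int2: "integrable lborel (\<lambda>t. \<integral>y. norm (?f t y) \<partial>lborel)"
  proof (rule Bochner_Integration.integrable_bound)
    show "integrable lborel (\<lambda>t. K * (lnd t * exp (2 * t) ^ 0 + x\<^sup>2 * (lnd t * exp (2 * t) ^ 2)))"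
      by (intro integrable_mult_right Bochner_Integration.integrable_add lnd_moment_integrable)
    show "AE t in lborel. norm (\<integral>y. norm (?f t y) \<partial>lborel)
        \<le> norm (K * (lnd t * exp (2 * t) ^ 0 + x\<^sup>2 * (lnd t * exp (2 * t) ^ 2)))"
    proof (intro AE_I2)
      fix t
      have "(\<integral>y. norm (?f t y) \<partial>lborel) = lnd t * (\<integral>y. \<bar>gau (y - x * exp (2 * t)) * L y\<bar> \<partial>lborel)"
        by (simp add: abs_mult)
      also have "\<dots> \<le> lnd t * (K * (1 + (x * exp (2 * t))\<^sup>2))"
        unfolding K_def using L by (intro mult_left_mono abs_psi_le(1)) auto
      also have "\<dots> = K * (lnd t * exp (2 * t) ^ 0 + x\<^sup>2 * (lnd t * exp (2 * t) ^ 2))"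
        by (simp add: power_mult_distrib algebra_simps)
      finally have "(\<integral>y. norm (?f t y) \<partial>lborel) \<le> K * (lnd t * exp (2 * t) ^ 0 + x\<^sup>2 * (lnd t * exp (2 * t) ^ 2))" .
      moreover have "0 \<le> (\<integral>y. norm (?f t y) \<partial>lborel)" by (intro Bochner_Integration.integral_nonneg) auto
      ultimately show "norm (\<integral>y. norm (?f t y) \<partial>lborel)
        \<le> norm (K * (lnd t * exp (2 * t) ^ 0 + x\<^sup>2 * (lnd t * exp (2 * t) ^ 2)))"
        unfolding real_norm_def by linarith
    qed
  qed measurable
  have int1: "AE t in lborel. integrable lborel (?f t)"
    by (intro AE_I2 integrable_mult_right psi_integrable[OF L(1) LD])
  note Fub = Fubini_swap[OF sigma_finite_lborel sigma_finite_lborel meas int1 int2]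
  have e1: "(\<integral>y. ?f t y \<partial>lborel) = lnd t * psi L (x * exp (2 * t))" for t
    unfolding psi_def by (rule integral_mult_right_zero)
  have e2: "(\<integral>t. ?f t y \<partial>lborel) = pp x y * L y" for y
    unfolding pp_def by (simp flip: mult.assoc)
  show "JJ L x = (\<integral>t. lnd t * psi L (x * exp (2 * t)) \<partial>lborel)"
    using Fub(1) unfolding JJ_def e1 e2 by simp
  show "integrable lborel (\<lambda>t. lnd t * psi L (x * exp (2 * t)))"
    using Fub(3) unfolding e1 .
qed

text \<open>The power series handles \<open>v <= 1\<close> and the quadratic growth of
  \<open>psi\<close> handles the rest. The factor \<open>1 + v^2\<close> is harmless: averaged over
  the gain it only brings in the moment two orders higher.\<close>

lemma psi_expansion:
  assumes L: "L \<in> borel_measurable borel" "\<And>y. \<bar>L y\<bar> \<le> D * (1 + y\<^sup>2)"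
  shows "\<exists>C\<ge>0. \<forall>v\<ge>0. \<bar>psi L v - (\<Sum>j\<le>n. psc L j * v ^ j)\<bar> \<le> C * (v ^ (n + 1) * (1 + v\<^sup>2))"
proof -
  have D0: "D \<ge> 0" using L(2)[of 0] by auto
  have LD: "\<bar>L y\<bar> \<le> (2 * D) * exp \<bar>y\<bar>" for y
    using order_trans[OF L(2) mult_left_mono[OF one_plus_sq_le_exp D0]] by (simp add: mult_ac)
  define A where "A = (\<Sum>j. \<bar>psc L j\<bar>)"
  have A_summ: "summable (\<lambda>j. \<bar>psc L j\<bar>)" using psc_summable[OF L(1) LD, of 1] by simp
  define K where "K = 2 * D * (\<integral>u. gau u * (1 + u\<^sup>2) \<partial>lborel)"
  have K0: "K \<ge> 0" unfolding K_def using D0 by (intro mult_nonneg_nonneg Bochner_Integration.integral_nonneg) auto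
  have A_part: "(\<Sum>j\<in>J. \<bar>psc L j\<bar>) \<le> A" if "finite J" for J
    unfolding A_def using A_summ that by (intro sum_le_suminf) auto
  have A0: "A \<ge> 0" using A_part[of "{}"] by simp
  have "\<bar>psi L v - (\<Sum>j\<le>n. psc L j * v ^ j)\<bar> \<le> (A + K) * (v ^ (n + 1) * (1 + v\<^sup>2))" if v: "v \<ge> 0" for v
  proof (cases "v \<le> 1")
    case True
    have "(\<lambda>j. psc L (j + (n + 1)) * v ^ (j + (n + 1))) sums (psi L v - (\<Sum>j<n + 1. psc L j * v ^ j))"
      by (rule sums_split_initial_segment[OF psi_sums[OF L(1) LD]])
    hence eq: "psi L v - (\<Sum>j\<le>n. psc L j * v ^ j) = (\<Sum>j. psc L (j + (n + 1)) * v ^ (j + (n + 1)))"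
      by (simp add: sums_iff lessThan_Suc_atMost)
    have summ: "summable (\<lambda>j. \<bar>psc L (j + (n + 1))\<bar> * v ^ (n + 1))"
      by (intro summable_mult2 summable_ignore_initial_segment A_summ)
    have "norm (\<Sum>j. psc L (j + (n + 1)) * v ^ (j + (n + 1))) \<le> (\<Sum>j. \<bar>psc L (j + (n + 1))\<bar> * v ^ (n + 1))"
    proof (rule norm_suminf_le[OF _ summ])
      fix j
      have "v ^ (j + (n + 1)) \<le> v ^ (n + 1)" using v True by (intro power_decreasing) auto
      thus "norm (psc L (j + (n + 1)) * v ^ (j + (n + 1))) \<le> \<bar>psc L (j + (n + 1))\<bar> * v ^ (n + 1)"
        using v by (auto simp: abs_mult intro!: mult_left_mono)
    qed
    also have "\<dots> = (\<Sum>j. \<bar>psc L (j + (n + 1))\<bar>) * v ^ (n + 1)"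
      by (rule suminf_mult2 [symmetric]) (intro summable_ignore_initial_segment A_summ)
    also have "\<dots> \<le> A * v ^ (n + 1)"
    proof (intro mult_right_mono)
      show "(\<Sum>j. \<bar>psc L (j + (n + 1))\<bar>) \<le> A"
        unfolding A_def using suminf_split_initial_segment[OF A_summ, of "n + 1"]
        by (simp add: sum_nonneg)
    qed (use v in simp)
    also have "\<dots> \<le> (A + K) * (v ^ (n + 1) * (1 + v\<^sup>2))"
    proof (intro mult_mono)
      show "v ^ (n + 1) \<le> v ^ (n + 1) * (1 + v\<^sup>2)" using v by (simp add: algebra_simps)
    qed (use A0 K0 v in auto)
    finally show ?thesis unfolding eq by simp
  next
    case False
    have "\<bar>\<Sum>j\<le>n. psc L j * v ^ j\<bar> \<le> (\<Sum>j\<le>n. \<bar>psc L j\<bar> * v ^ (n + 1))"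
    proof (rule order_trans[OF sum_abs], rule sum_mono)
      fix j assume "j \<in> {..n}"
      hence "v ^ j \<le> v ^ (n + 1)" using False by (intro power_increasing) auto
      thus "\<bar>psc L j * v ^ j\<bar> \<le> \<bar>psc L j\<bar> * v ^ (n + 1)" using v by (auto simp: abs_mult intro!: mult_left_mono)
    qed
    also have "\<dots> \<le> A * v ^ (n + 1)"
      unfolding sum_distrib_right [symmetric] using v by (intro mult_right_mono A_part) auto
    also have "\<dots> \<le> A * (v ^ (n + 1) * (1 + v\<^sup>2))"
      using A0 v by (intro mult_left_mono) (auto simp: algebra_simps)
    finally have 1: "\<bar>\<Sum>j\<le>n. psc L j * v ^ j\<bar> \<le> A * (v ^ (n + 1) * (1 + v\<^sup>2))" .
    have "\<bar>psi L v\<bar> \<le> K * (1 + v\<^sup>2)" unfolding K_def by (rule abs_psi_le(2)[OF L])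
    also have "\<dots> \<le> K * (v ^ (n + 1) * (1 + v\<^sup>2))"
    proof -
      have "1 \<le> v ^ (n + 1)" using False by (intro one_le_power) auto
      hence "1 * (1 + v\<^sup>2) \<le> v ^ (n + 1) * (1 + v\<^sup>2)" by (intro mult_right_mono) auto
      thus ?thesis using K0 by (intro mult_left_mono) auto
    qed
    finally show ?thesis using 1 by (simp only: distrib_right)
  qed
  thus ?thesis using A0 K0 by (intro exI[of _ "A + K"]) auto
qed

lemma JJ_expansion:
  assumes L: "L \<in> borel_measurable borel" "\<And>y. \<bar>L y\<bar> \<le> D * (1 + y\<^sup>2)"
  shows "\<exists>C. \<forall>x\<in>{0..1}. \<bar>JJ L x - (\<Sum>j\<le>n. psc L j * mm j * x ^ j)\<bar> \<le> C * x ^ (n + 1)"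
proof -
  obtain C where C: "C \<ge> 0" "\<And>v. v \<ge> 0 \<Longrightarrow> \<bar>psi L v - (\<Sum>j\<le>n. psc L j * v ^ j)\<bar> \<le> C * (v ^ (n + 1) * (1 + v\<^sup>2))"
    using psi_expansion[OF L, of n] by blast
  have "\<bar>JJ L x - (\<Sum>j\<le>n. psc L j * mm j * x ^ j)\<bar> \<le> (C * (mm (n + 1) + mm (n + 3))) * x ^ (n + 1)"
    if x: "x \<in> {0..1}" for x
  proof -
    define f where "f t = lnd t * (\<Sum>j\<le>n. psc L j * (x * exp (2 * t)) ^ j)" for t
    have f_eq: "f = (\<lambda>t. \<Sum>j\<le>n. (psc L j * x ^ j) * (lnd t * exp (2 * t) ^ j))"
      by (auto simp: f_def sum_distrib_left power_mult_distrib mult_ac)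
    have f_int: "integrable lborel f" unfolding f_eq
      by (intro Bochner_Integration.integrable_sum integrable_mult_right lnd_moment_integrable)
    have f_integral: "(\<integral>t. f t \<partial>lborel) = (\<Sum>j\<le>n. psc L j * mm j * x ^ j)"
    proof -
      have "(\<integral>t. f t \<partial>lborel) = (\<Sum>j\<le>n. \<integral>t. (psc L j * x ^ j) * (lnd t * exp (2 * t) ^ j) \<partial>lborel)"
        unfolding f_eq
        by (intro Bochner_Integration.integral_sum integrable_mult_right lnd_moment_integrable)
      also have "\<dots> = (\<Sum>j\<le>n. (psc L j * x ^ j) * mm j)"
        by (simp only: integral_mult_right_zero lnd_moment_integral)
      finally show ?thesis by (simp only: mult_ac)
    qed
    let ?g = "\<lambda>t. (C * x ^ (n + 1)) * (lnd t * exp (2 * t) ^ (n + 1) + lnd t * exp (2 * t) ^ (n + 3))"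
    have "\<bar>JJ L x - (\<integral>t. f t \<partial>lborel)\<bar> = \<bar>\<integral>t. lnd t * psi L (x * exp (2 * t)) - f t \<partial>lborel\<bar>"
      unfolding JJ_eq_psi(1)[OF L] using f_int JJ_eq_psi(2)[OF L] by (subst Bochner_Integration.integral_diff) auto
    also have "\<dots> \<le> (\<integral>t. \<bar>lnd t * psi L (x * exp (2 * t)) - f t\<bar> \<partial>lborel)"
      by (rule integral_abs_bound)
    also have "\<dots> \<le> (\<integral>t. ?g t \<partial>lborel)"
    proof (intro Bochner_Integration.integral_mono integrable_abs Bochner_Integration.integrable_diff JJ_eq_psi(2)[OF L] f_int
        integrable_mult_right lnd_moment_integrable Bochner_Integration.integrable_add)
      fix t
      let ?v = "x * exp (2 * t)"
      have "\<bar>lnd t * psi L ?v - f t\<bar> = lnd t * \<bar>psi L ?v - (\<Sum>j\<le>n. psc L j * ?v ^ j)\<bar>"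
        unfolding f_def right_diff_distrib [symmetric] abs_mult by simp
      also have "\<dots> \<le> lnd t * (C * (?v ^ (n + 1) * (1 + ?v\<^sup>2)))"
        using x by (intro mult_left_mono C) auto
      also have "\<dots> \<le> lnd t * (C * (?v ^ (n + 1) * (1 + exp (2 * t) ^ 2)))"
      proof (intro mult_left_mono add_left_mono)
        show "?v\<^sup>2 \<le> exp (2 * t) ^ 2" using x by (intro power_mono) auto
      qed (use x C in auto)
      also have "\<dots> = ?g t" by (simp add: power_mult_distrib algebra_simps power_add numeral_3_eq_3 power2_eq_square)
      finally show "\<bar>lnd t * psi L ?v - f t\<bar> \<le> ?g t" .
    qed
    also have "\<dots> = (C * (mm (n + 1) + mm (n + 3))) * x ^ (n + 1)"
      unfolding integral_mult_right_zero
        Bochner_Integration.integral_add[OF lnd_moment_integrable lnd_moment_integrable] lnd_moment_integral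
      by (simp only: mult_ac)
    finally show ?thesis unfolding f_integral .
  qed
  thus ?thesis by blast
qed

end

section \<open>Expansion of the conditional entropy at zero input\<close>

lemma xlnx_diff_le:
  fixes a b :: real
  assumes "a > 0" "b > 0"
  shows "\<bar>a * ln a - b * ln b\<bar> \<le> \<bar>a - b\<bar> * (1 + \<bar>ln a\<bar> + \<bar>ln b\<bar>)"
proof -
  have *: "\<bar>a * ln a - b * ln b\<bar> \<le> \<bar>a - b\<bar> * (1 + \<bar>ln a\<bar> + \<bar>ln b\<bar>)" if "b \<le> a" "a > 0" "b > 0" for a b :: real
  proof -
    have "ln (a / b) \<le> a / b - 1" using that by (intro ln_le_minus_one) auto
    hence "b * ln (a / b) \<le> b * (a / b - 1)" using that by (intro mult_left_mono) auto
    hence 1: "b * (ln a - ln b) \<le> a - b" using that by (simp add: ln_div right_diff_distrib)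
    have "0 \<le> b * (ln a - ln b)" using that by simp
    have "\<bar>a * ln a - b * ln b\<bar> = \<bar>(a - b) * ln a + b * (ln a - ln b)\<bar>" by (simp add: algebra_simps)
    also have "\<dots> \<le> \<bar>(a - b) * ln a\<bar> + \<bar>b * (ln a - ln b)\<bar>" by (rule abs_triangle_ineq)
    also have "\<dots> \<le> \<bar>a - b\<bar> * \<bar>ln a\<bar> + \<bar>a - b\<bar>"
      using 1 \<open>0 \<le> b * (ln a - ln b)\<close> by (simp only: abs_mult[of "a - b"])
    also have "\<dots> \<le> \<bar>a - b\<bar> * (1 + \<bar>ln a\<bar> + \<bar>ln b\<bar>)"
      by (simp add: algebra_simps)
    finally show ?thesis .
  qed
  show ?thesis using *[of b a] *[of a b] assms
    by (cases "b \<le> a") (auto simp: abs_minus_commute add_ac)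
qed

lemma norm_Ln_near_one:
  fixes w :: complex
  assumes "norm (w - 1) \<le> 1 / 2"
  shows "Re w > 0" "norm w \<le> 3 / 2" "norm (Ln w) \<le> 5" "w \<noteq> 0" "norm w \<ge> 1 / 2"
proof -
  show Re: "Re w > 0" using assms abs_Re_le_cmod[of "w - 1"] by simp
  show hi: "norm w \<le> 3 / 2" using assms norm_triangle_ineq2[of w 1] by simp
  show lo: "norm w \<ge> 1 / 2" using assms norm_triangle_ineq2[of 1 w] by (simp add: norm_minus_commute)
  show nz: "w \<noteq> 0" using Re by auto
  have "ln (1 / 2) \<le> ln (norm w)" "ln (norm w) \<le> ln 2" using lo hi nz by (auto intro: ln_mono)
  moreover have "ln (1 / 2) = - ln (2::real)" by (simp add: ln_div)
  moreover have "ln 2 \<le> (1::real)" using ln_le_minus_one[of "2::real"] by simp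
  ultimately have "\<bar>ln (norm w)\<bar> \<le> 1" by linarith
  moreover have "\<bar>Im (Ln w)\<bar> \<le> pi" using mpi_less_Im_Ln[OF nz] Im_Ln_le_pi[OF nz] by linarith
  moreover have "norm (Ln w) \<le> \<bar>ln (norm w)\<bar> + \<bar>Im (Ln w)\<bar>" using cmod_le[of "Ln w"] nz by simp
  ultimately show "norm (Ln w) \<le> 5" using pi_less_4 by linarith
qed

text \<open>Taylor's formula for w Ln w at \<open>a\<close>, whose derivative is 1 + Ln
  \<open>a\<close>; the constant 2 is the Lipschitz constant of \<open>Ln\<close> on the disc, where
  |w| is at least 1 / 2. The quadratic error is what allows half of the moments to be dropped
  later.\<close>

lemma xLnx_second_order:
  fixes a b :: complex
  assumes a: "norm (a - 1) \<le> 1 / 2" and b: "norm (b - 1) \<le> 1 / 2"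
  shows "norm (b * Ln b - a * Ln a - (b - a) * (1 + Ln a)) \<le> 2 * norm (b - a) ^ 2"
proof -
  have B: "w \<notin> \<real>\<^sub>\<le>\<^sub>0" "w \<noteq> 0" "norm w \<ge> 1 / 2" if "w \<in> cball 1 (1 / 2)" for w :: complex
    using norm_Ln_near_one[of w] that by (auto simp: dist_norm norm_minus_commute complex_nonpos_Reals_iff)
  have mem: "a \<in> cball 1 (1 / 2)" "b \<in> cball 1 (1 / 2)"
    using a b by (auto simp: dist_norm norm_minus_commute)
  have seg: "closed_segment a b \<subseteq> cball 1 (1 / 2)" using mem by (intro closed_segment_subset) auto
  have Ln_diff: "norm (Ln w - Ln a) \<le> 2 * norm (w - a)" if "w \<in> cball 1 (1 / 2)" for w
  proof (rule field_differentiable_bound[of "cball 1 (1 / 2)"])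
    show "(Ln has_field_derivative inverse z) (at z within cball 1 (1 / 2))" if "z \<in> cball 1 (1 / 2)" for z
      using B(1)[OF that] by (intro has_field_derivative_at_within[OF has_field_derivative_Ln])
    show "norm (inverse z) \<le> 2" if "z \<in> cball 1 (1 / 2)" for z :: complex
      using le_imp_inverse_le[OF B(3)[OF that]] by (simp add: norm_inverse)
  qed (use that mem in auto)
  define g where "g w = w * Ln w - w * (1 + Ln a)" for w
  have "norm (g b - g a) \<le> (2 * norm (b - a)) * norm (b - a)"
  proof (rule field_differentiable_bound[of "closed_segment a b"])
    fix z assume z: "z \<in> closed_segment a b"
    hence zB: "z \<in> cball 1 (1 / 2)" using seg by blast
    show "(g has_field_derivative (Ln z - Ln a)) (at z within closed_segment a b)"
      unfolding g_def[abs_def] using B[OF zB] by (auto intro!: derivative_eq_intros simp: field_simps)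
    have "norm (z - a) \<le> norm (b - a)" using z by (rule segment_bound1)
    thus "norm (Ln z - Ln a) \<le> 2 * norm (b - a)" using Ln_diff[OF zB] by linarith
  qed auto
  moreover have "g b - g a = b * Ln b - a * Ln a - (b - a) * (1 + Ln a)" by (simp add: g_def algebra_simps)
  ultimately show ?thesis by (simp add: power2_eq_square)
qed

text \<open>Tracks the degree in \<open>y\<close> of coefficients that are never written out as
  polynomials; only the degree matters for orthogonality to \<open>hh j\<close>.\<close>

definition poly_deg_le :: "nat \<Rightarrow> (real \<Rightarrow> complex) \<Rightarrow> bool" where
  "poly_deg_le l f \<longleftrightarrow> (\<exists>p. degree p \<le> l \<and> (\<forall>y. f y = poly p (of_real y)))"

lemma poly_deg_le_const: "poly_deg_le l (\<lambda>_. c)"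
  unfolding poly_deg_le_def by (intro exI[of _ "[:c:]"]) auto

lemma poly_deg_le_diff: "poly_deg_le l f \<Longrightarrow> poly_deg_le l g \<Longrightarrow> poly_deg_le l (\<lambda>y. f y - g y)"
  unfolding poly_deg_le_def by (metis degree_diff_le poly_diff)

lemma poly_deg_le_add: "poly_deg_le l f \<Longrightarrow> poly_deg_le l g \<Longrightarrow> poly_deg_le l (\<lambda>y. f y + g y)"
  unfolding poly_deg_le_def by (metis degree_add_le poly_add)

lemma poly_deg_le_sum: "(\<And>i. i \<in> I \<Longrightarrow> poly_deg_le l (f i)) \<Longrightarrow> poly_deg_le l (\<lambda>y. \<Sum>i\<in>I. f i y)"
proof (induction I rule: infinite_finite_induct)
  case (insert x F)
  thus ?case using poly_deg_le_add by simp
qed (auto intro: poly_deg_le_const)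

lemma poly_deg_le_mult:
  assumes "poly_deg_le k f" "poly_deg_le l g" "k + l \<le> m"
  shows "poly_deg_le m (\<lambda>y. f y * g y)"
proof -
  obtain p q where "degree p \<le> k" "degree q \<le> l" "\<And>y. f y = poly p (of_real y)" "\<And>y. g y = poly q (of_real y)"
    using assms(1,2) unfolding poly_deg_le_def by blast
  thus ?thesis unfolding poly_deg_le_def
    using degree_mult_le[of p q] assms(3) by (intro exI[of _ "p * q"]) auto
qed

lemma poly_deg_le_measurable: "poly_deg_le l f \<Longrightarrow> f \<in> borel_measurable borel"
proof -
  assume "poly_deg_le l f"
  then obtain p where "\<And>y. f y = poly p (of_real y)" unfolding poly_deg_le_def by blast
  hence "f = (\<lambda>y. \<Sum>i\<le>degree p. coeff p i * of_real y ^ i)" by (auto simp: poly_altdef)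
  moreover have "(\<lambda>y. \<Sum>i\<le>degree p. coeff p i * of_real y ^ i) \<in> borel_measurable borel"
    by (intro borel_measurable_continuous_onI continuous_intros)
  ultimately show ?thesis by simp
qed

context lognormal_fading
begin

text \<open>Truncation of the expansion of \<open>pp z y / gau y\<close> at \<open>z = 0\<close>, which diverges because of the
  moments \<open>mm j\<close>.\<close>
definition SS :: "nat \<Rightarrow> real \<Rightarrow> complex \<Rightarrow> complex" where
  "SS n y z = (\<Sum>j\<le>n. of_real (hh j y * mm j) * z ^ j)"

definition LL :: "nat \<Rightarrow> real \<Rightarrow> complex \<Rightarrow> complex" where "LL n y z = Ln (SS n y z)"

definition TT :: "nat \<Rightarrow> real \<Rightarrow> complex \<Rightarrow> complex" where "TT n y z = SS n y z * Ln (SS n y z)"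

text \<open>Chosen so that \<open>SS K y z\<close> stays within 1 / 2 of 1 for |z| at most rho / (1
  + |y|). The exponential compensates the moments, since \<open>mm j\<close> is at most the
  \<open>j\<close>-th power of exp (2 s2 K) for \<open>j <= K\<close>; truncating at a smaller
  \<open>K\<close> thus enlarges the disc.\<close>

definition rho :: "nat \<Rightarrow> real" where "rho K = exp (- (2 * s2 * real K)) / (4 * Bh)"

definition aa :: "nat \<Rightarrow> real \<Rightarrow> nat \<Rightarrow> complex" where
  "aa n y j = (if j \<le> n then of_real (hh j y * mm j) else 0)"

definition lc :: "nat \<Rightarrow> real \<Rightarrow> nat \<Rightarrow> complex" where
  "lc n y k = (deriv ^^ k) (LL n y) 0 / fact k"

definition ss :: "nat \<Rightarrow> real \<Rightarrow> nat \<Rightarrow> complex" where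
  "ss n y k = (deriv ^^ k) (TT n y) 0 / fact k"

lemma rho_pos [simp]: "rho K > 0" and rho_le: "rho K \<le> 1 / 4"
proof -
  show "rho K > 0" using Bh_ge by (simp add: rho_def)
  have "exp (- (2 * s2 * real K)) \<le> 1" by simp
  moreover have "4 * Bh \<ge> 4" using Bh_ge by simp
  ultimately have "rho K \<le> 1 / 4" unfolding rho_def by (intro frac_le) auto
  thus "rho K \<le> 1 / 4" .
qed

lemma rho_antimono: "K \<le> n \<Longrightarrow> rho n \<le> rho K"
  unfolding rho_def using Bh_ge by (intro divide_right_mono) auto

lemma mm_nonneg [simp]: "0 \<le> mm j"
  by (simp add: mm_def)

lemma mm_le: "j \<le> K \<Longrightarrow> mm j \<le> exp (2 * s2 * real K) ^ j"
proof -
  assume "j \<le> K"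
  hence "real j * real j \<le> real K * real j" by (intro mult_right_mono) auto
  hence "real j ^ 2 - real j \<le> real K * real j" by (simp add: power2_eq_square)
  hence "2 * s2 * (real j ^ 2 - real j) \<le> 2 * s2 * (real K * real j)" by (intro mult_left_mono) auto
  thus ?thesis unfolding mm_def exp_of_nat_mult [symmetric] by (simp add: mult_ac)
qed

lemma SS_near_one:
  assumes z: "norm z \<le> rho K / (1 + \<bar>y\<bar>)"
  shows "norm (SS K y z - 1) \<le> 1 / 2"
proof -
  define q where "q = (1 + \<bar>y\<bar>) * exp (2 * s2 * real K) * norm z"
  have q0: "q \<ge> 0" by (simp add: q_def)
  have q1: "q \<le> 1 / (4 * Bh)"
  proof -
    have "(1 + \<bar>y\<bar>) * norm z \<le> rho K" using z by (subst (asm) pos_le_divide_eq) (auto simp: mult.commute)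
    hence "exp (2 * s2 * real K) * ((1 + \<bar>y\<bar>) * norm z) \<le> exp (2 * s2 * real K) * rho K" by (intro mult_left_mono) auto
    thus ?thesis by (simp add: q_def rho_def exp_minus mult_ac)
  qed
  have q2: "q \<le> 1 / 4"
  proof -
    have "1 / (4 * Bh) \<le> 1 / 4" using Bh_ge by (intro divide_left_mono) auto
    thus ?thesis using q1 by linarith
  qed
  have tm: "norm (of_real (hh j y * mm j) * z ^ j) \<le> Bh * q ^ j" if "j \<le> K" for j
  proof -
    have "norm (of_real (hh j y * mm j) * z ^ j) = \<bar>hh j y\<bar> * mm j * norm z ^ j"
      by (simp add: norm_mult norm_power abs_mult)
    also have "\<dots> \<le> (Bh * (1 + \<bar>y\<bar>) ^ j) * exp (2 * s2 * real K) ^ j * norm z ^ j"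
      using Bh_ge by (intro mult_right_mono mult_mono abs_hh_le mm_le that) auto
    also have "\<dots> = Bh * q ^ j" by (simp add: q_def power_mult_distrib mult_ac)
    finally show ?thesis .
  qed
  have "SS K y z - 1 = (\<Sum>j<K. of_real (hh (Suc j) y * mm (Suc j)) * z ^ Suc j)"
    unfolding SS_def lessThan_Suc_atMost [symmetric] sum.lessThan_Suc_shift by (simp add: hh_0 mm_0)
  also have "norm (\<Sum>j<K. of_real (hh (Suc j) y * mm (Suc j)) * z ^ Suc j) \<le> (\<Sum>j<K. Bh * q ^ Suc j)"
    by (rule order_trans[OF norm_sum], rule sum_mono, rule tm) auto
  finally have "norm (SS K y z - 1) \<le> (\<Sum>j<K. Bh * q ^ Suc j)" .
  also have "\<dots> = (Bh * q) * (\<Sum>j<K. q ^ j)" by (simp add: sum_distrib_left mult_ac)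
  also have "(\<Sum>j<K. q ^ j) \<le> 2"
  proof -
    have "(\<Sum>j<K. q ^ j) \<le> (\<Sum>j. q ^ j)" using q0 q2 by (intro sum_le_suminf summable_geometric) auto
    also have "\<dots> = 1 / (1 - q)" using q0 q2 by (intro suminf_geometric) auto
    also have "\<dots> \<le> 2" using q2 by (simp add: field_simps)
    finally show ?thesis .
  qed
  hence "(Bh * q) * (\<Sum>j<K. q ^ j) \<le> (Bh * q) * 2" using q0 Bh_ge by (intro mult_left_mono) auto
  also have "\<dots> \<le> 1 / 2" using q1 Bh_ge by (simp add: field_simps)
  finally show ?thesis .
qed

lemma radius_pos: "rho K / (1 + \<bar>y\<bar>) > 0"
  by (simp add: add_pos_nonneg)

lemma SS_holomorphic: "SS n y holomorphic_on U"
  unfolding SS_def[abs_def] by (intro holomorphic_intros)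

lemma SS_domain:
  shows open_SS_domain: "open {z. Re (SS n y z) > 0}"
    and cball_SS_domain: "cball 0 (rho n / (1 + \<bar>y\<bar>)) \<subseteq> {z. Re (SS n y z) > 0}"
    and LL_holomorphic: "LL n y holomorphic_on {z. Re (SS n y z) > 0}"
    and TT_holomorphic: "TT n y holomorphic_on {z. Re (SS n y z) > 0}"
proof -
  have "continuous_on UNIV (SS n y)" by (rule holomorphic_on_imp_continuous_on[OF SS_holomorphic])
  thus "open {z. Re (SS n y z) > 0}" by (intro open_Collect_less continuous_on_const continuous_on_Re)
  show "cball 0 (rho n / (1 + \<bar>y\<bar>)) \<subseteq> {z. Re (SS n y z) > 0}"
    using norm_Ln_near_one(1)[OF SS_near_one] by auto
  show "LL n y holomorphic_on {z. Re (SS n y z) > 0}" "TT n y holomorphic_on {z. Re (SS n y z) > 0}"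
    unfolding LL_def[abs_def] TT_def[abs_def]
    by (intro holomorphic_intros SS_holomorphic; auto simp: complex_nonpos_Reals_iff)+
qed

lemma norm_TT_le: "norm z \<le> rho n / (1 + \<bar>y\<bar>) \<Longrightarrow> norm (TT n y z) \<le> 8"
proof -
  assume "norm z \<le> rho n / (1 + \<bar>y\<bar>)"
  note near = norm_Ln_near_one[OF SS_near_one[OF this]]
  have "norm (TT n y z) \<le> 3 / 2 * 5" unfolding TT_def norm_mult using near by (intro mult_mono) auto
  thus ?thesis by simp
qed

lemma norm_ss_le: "norm (ss n y k) \<le> 8 * ((1 + \<bar>y\<bar>) / rho n) ^ k"
proof -
  have "norm (ss n y k) \<le> 8 / (rho n / (1 + \<bar>y\<bar>)) ^ k"
    unfolding ss_def
    by (rule Taylor_coeff_bound[OF TT_holomorphic open_SS_domain cball_SS_domain radius_pos norm_TT_le])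
  thus ?thesis by (simp add: power_divide)
qed

lemma TT_remainder:
  assumes "norm z \<le> rho n / (1 + \<bar>y\<bar>) / 2"
  shows "norm (TT n y z - (\<Sum>k\<le>n. ss n y k * z ^ k)) \<le> 16 * (norm z * (1 + \<bar>y\<bar>) / rho n) ^ (n + 1)"
  using Taylor_remainder_bound[OF TT_holomorphic open_SS_domain cball_SS_domain radius_pos norm_TT_le assms, of n]
  unfolding ss_def by simp

lemma SS_fps: "SS n y has_fps_expansion Abs_fps (aa n y)"
proof -
  have "(\<lambda>z. \<Sum>j\<le>n. complex_of_real (hh j y * mm j) * z ^ j) has_fps_expansion
      (\<Sum>j\<le>n. fps_const (complex_of_real (hh j y * mm j)) * fps_X ^ j)"
    by (intro has_fps_expansion_sum has_fps_expansion_cmult_left has_fps_expansion_fps_X_power)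
  moreover have "(\<Sum>j\<le>n. fps_const (of_real (hh j y * mm j)) * fps_X ^ j) = Abs_fps (aa n y)"
    by (rule fps_ext) (auto simp: fps_sum_nth aa_def if_distrib sum.delta cong: if_cong)
  ultimately show ?thesis unfolding SS_def[abs_def] by simp
qed

lemma zero_in_SS_domain: "0 \<in> {z. Re (SS n y z) > 0}"
proof -
  have "(0::complex) \<in> cball 0 (rho n / (1 + \<bar>y\<bar>))" using radius_pos[of n y] by (simp add: less_imp_le)
  thus ?thesis using cball_SS_domain[of n y] by blast
qed

lemma LL_fps: "LL n y has_fps_expansion Abs_fps (lc n y)"
proof -
  have *: "LL n y has_fps_expansion fps_expansion (LL n y) 0"
    by (rule has_fps_expansion_fps_expansion[OF open_SS_domain zero_in_SS_domain LL_holomorphic])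
  have "fps_expansion (LL n y) 0 = Abs_fps (lc n y)"
    by (rule fps_ext) (simp add: fps_nth_fps_expansion[OF *] lc_def)
  with * show ?thesis by simp
qed

lemma TT_fps: "TT n y has_fps_expansion Abs_fps (aa n y) * Abs_fps (lc n y)"
  using has_fps_expansion_mult[OF SS_fps LL_fps] unfolding TT_def[abs_def] LL_def[abs_def] .

lemma ss_eq: "ss n y k = (\<Sum>i\<le>k. aa n y i * lc n y (k - i))"
  unfolding ss_def fps_nth_fps_expansion[OF TT_fps, symmetric] by (simp add: fps_mult_nth atMost_atLeast0)

lemma aa_0: "aa n y 0 = 1"
  by (simp add: aa_def hh_0 mm_0)

lemma lc_0: "lc n y 0 = 0"
  by (simp add: lc_def LL_def SS_def hh_0 mm_0 power_0_left if_distrib sum.delta cong: if_cong)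

text \<open>Coefficient \<open>l\<close> of the differential equation SS LL' = SS'. It expresses the
  coefficients of the logarithm by sums and products, from which their degree in \<open>y\<close> is
  read off.\<close>

lemma lc_rec: "of_nat (Suc l) * lc n y (Suc l) =
    of_nat (Suc l) * aa n y (Suc l) - (\<Sum>i<l. aa n y (Suc i) * (of_nat (l - i) * lc n y (l - i)))"
proof -
  have e1: "(\<lambda>z. SS n y z * deriv (LL n y) z) has_fps_expansion Abs_fps (aa n y) * fps_deriv (Abs_fps (lc n y))"
    by (intro fps_expansion_intros SS_fps LL_fps)
  have e2: "deriv (SS n y) has_fps_expansion fps_deriv (Abs_fps (aa n y))"
    by (intro fps_expansion_intros SS_fps)
  have e3: "eventually (\<lambda>z. SS n y z * deriv (LL n y) z = deriv (SS n y) z) (nhds 0)"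
    using eventually_nhds_in_open[OF open_SS_domain[of n y] zero_in_SS_domain[of n y]]
  proof eventually_elim
    case (elim z)
    have "(SS n y has_field_derivative deriv (SS n y) z) (at z)"
      by (rule holomorphic_derivI[OF SS_holomorphic[of n y UNIV]]) auto
    moreover have nz: "SS n y z \<notin> \<real>\<^sub>\<le>\<^sub>0" "SS n y z \<noteq> 0" using elim by (auto simp: complex_nonpos_Reals_iff)
    ultimately have "(LL n y has_field_derivative deriv (SS n y) z / SS n y z) (at z)"
      unfolding LL_def[abs_def] by (auto intro!: derivative_eq_intros simp: field_simps)
    thus ?case using nz by (simp add: DERIV_imp_deriv)
  qed
  have "Abs_fps (aa n y) * fps_deriv (Abs_fps (lc n y)) = fps_deriv (Abs_fps (aa n y))"
    by (rule fps_expansion_unique_complex[OF has_fps_expansion_cong[OF e3 refl, THEN iffD1, OF e1] e2])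
  hence "fps_nth (Abs_fps (aa n y) * fps_deriv (Abs_fps (lc n y))) l = fps_nth (fps_deriv (Abs_fps (aa n y))) l" by simp
  hence "(\<Sum>i\<le>l. aa n y i * (of_nat (Suc (l - i)) * lc n y (Suc (l - i)))) = of_nat (Suc l) * aa n y (Suc l)"
    by (simp add: fps_mult_nth atMost_atLeast0)
  moreover have "(\<Sum>i\<le>l. aa n y i * (of_nat (Suc (l - i)) * lc n y (Suc (l - i))))
      = of_nat (Suc l) * lc n y (Suc l) + (\<Sum>i<l. aa n y (Suc i) * (of_nat (Suc (l - Suc i)) * lc n y (Suc (l - Suc i))))"
    unfolding lessThan_Suc_atMost [symmetric] sum.lessThan_Suc_shift by (simp add: aa_0)
  moreover have "(\<Sum>i<l. aa n y (Suc i) * (of_nat (Suc (l - Suc i)) * lc n y (Suc (l - Suc i))))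
      = (\<Sum>i<l. aa n y (Suc i) * (of_nat (l - i) * lc n y (l - i)))"
    by (intro sum.cong refl) (auto simp: Suc_diff_Suc)
  ultimately show ?thesis by (simp add: algebra_simps)
qed

lemma poly_deg_le_hh: "poly_deg_le j (\<lambda>y. of_real (hh j y * c))"
proof -
  obtain p where p: "degree p \<le> j" "\<And>y. hh j y = poly p y" using hh_poly by blast
  define r where "r = (\<Sum>i\<le>degree p. monom (complex_of_real (coeff p i * c)) i)"
  have "degree r \<le> j" unfolding r_def
    by (rule degree_sum_le) (auto intro: order_trans[OF degree_monom_le] order_trans[OF _ p(1)])
  moreover have "of_real (hh j y * c) = poly r (of_real y)" for y
    unfolding p(2) poly_altdef[of p] r_def poly_sum poly_monom by (simp add: sum_distrib_right sum_distrib_left mult_ac)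
  ultimately show ?thesis unfolding poly_deg_le_def by blast
qed

lemma poly_deg_le_aa: "poly_deg_le j (\<lambda>y. aa n y j)"
  unfolding aa_def using poly_deg_le_hh poly_deg_le_const by (cases "j \<le> n") auto

lemma poly_deg_le_lc: "poly_deg_le l (\<lambda>y. lc n y l)"
proof (induction l rule: less_induct)
  case (less l)
  show ?case
  proof (cases l)
    case 0
    thus ?thesis by (simp add: lc_0 poly_deg_le_const)
  next
    case (Suc k)
    have eq: "lc n y l = aa n y l - inverse (of_nat l) * (\<Sum>i<k. aa n y (Suc i) * (of_nat (k - i) * lc n y (k - i)))" for y
    proof -
      have nz: "of_nat l \<noteq> (0::complex)" using Suc by (simp del: of_nat_Suc)
      have "of_nat l * lc n y l = of_nat l * (aa n y l - inverse (of_nat l) * (\<Sum>i<k. aa n y (Suc i) * (of_nat (k - i) * lc n y (k - i))))"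
        using lc_rec[of k n y] unfolding Suc [symmetric]
        by (simp only: right_diff_distrib mult.assoc [symmetric] right_inverse[OF nz] mult_1_left)
      thus ?thesis using nz by simp
    qed
    show ?thesis unfolding eq
    proof (intro poly_deg_le_diff poly_deg_le_aa poly_deg_le_mult[OF poly_deg_le_const[of 0]] poly_deg_le_sum)
      fix i assume i: "i \<in> {..<k}"
      show "poly_deg_le l (\<lambda>y. aa n y (Suc i) * (of_nat (k - i) * lc n y (k - i)))"
      proof (rule poly_deg_le_mult[OF poly_deg_le_aa])
        show "poly_deg_le (k - i) (\<lambda>y. of_nat (k - i) * lc n y (k - i))"
          by (rule poly_deg_le_mult[OF poly_deg_le_const[of 0] less.IH[of "k - i"]]) (use Suc in auto)
        show "Suc i + (k - i) \<le> l" using i Suc by simp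
      qed
    qed simp
  qed
qed

lemma poly_deg_le_ss: "poly_deg_le k (\<lambda>y. ss n y k)"
  unfolding ss_eq
  by (intro poly_deg_le_sum poly_deg_le_mult[OF poly_deg_le_aa poly_deg_le_lc]) auto

lemma ss_measurable [measurable]: "(\<lambda>y. ss n y k) \<in> borel_measurable borel"
  by (rule poly_deg_le_measurable[OF poly_deg_le_ss])

text \<open>The factorial in the growth of the entropy coefficients originates here, from the bound
  of (1 + |y|) ^ k by k! exp (1 + |y|).\<close>

lemma gau_power_integrable: "integrable lborel (\<lambda>y. gau y * (1 + \<bar>y\<bar>) ^ k)"
  and gau_power_integral_le: "(\<integral>y. gau y * (1 + \<bar>y\<bar>) ^ k \<partial>lborel) \<le> fact k * (\<integral>y. exp 1 * (gau y * exp (1 * \<bar>y\<bar>)) \<partial>lborel)"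
proof -
  have le: "gau y * (1 + \<bar>y\<bar>) ^ k \<le> fact k * (exp 1 * (gau y * exp (1 * \<bar>y\<bar>)))" for y
  proof -
    have "(1 + \<bar>y\<bar>) ^ k \<le> fact k * exp (1 + \<bar>y\<bar>)" by (rule power_le_fact_exp) simp
    hence "gau y * (1 + \<bar>y\<bar>) ^ k \<le> gau y * (fact k * exp (1 + \<bar>y\<bar>))" by (intro mult_left_mono) auto
    thus ?thesis by (simp add: exp_add mult_ac)
  qed
  have int: "integrable lborel (\<lambda>y. fact k * (exp 1 * (gau y * exp (1 * \<bar>y\<bar>))))"
    by (intro integrable_mult_right gau_exp_abs_integrable) auto
  show *: "integrable lborel (\<lambda>y. gau y * (1 + \<bar>y\<bar>) ^ k)"
    by (rule Bochner_Integration.integrable_bound[OF int]) (use le in \<open>auto intro!: AE_I2 simp: abs_mult\<close>)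
  have "(\<integral>y. gau y * (1 + \<bar>y\<bar>) ^ k \<partial>lborel) \<le> (\<integral>y. fact k * (exp 1 * (gau y * exp (1 * \<bar>y\<bar>))) \<partial>lborel)"
    by (intro Bochner_Integration.integral_mono * int le)
  thus "(\<integral>y. gau y * (1 + \<bar>y\<bar>) ^ k \<partial>lborel) \<le> fact k * (\<integral>y. exp 1 * (gau y * exp (1 * \<bar>y\<bar>)) \<partial>lborel)"
    by (simp only: integral_mult_right_zero)
qed

lemma norm_gau_ss_le: "norm (of_real (gau y) * ss n y k) \<le> 8 / rho n ^ k * (gau y * (1 + \<bar>y\<bar>) ^ k)"
proof -
  have "norm (of_real (gau y) * ss n y k) = gau y * norm (ss n y k)" by (simp add: norm_mult)
  also have "\<dots> \<le> gau y * (8 * ((1 + \<bar>y\<bar>) / rho n) ^ k)" by (intro mult_left_mono norm_ss_le) auto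
  finally show ?thesis by (simp add: power_divide mult_ac)
qed

lemma gau_ss_integrable: "integrable lborel (\<lambda>y. of_real (gau y) * ss n y k)"
proof (rule Bochner_Integration.integrable_bound)
  show "integrable lborel (\<lambda>y. 8 / rho n ^ k * (gau y * (1 + \<bar>y\<bar>) ^ k))"
    by (intro integrable_mult_right gau_power_integrable)
  show "AE y in lborel. norm (of_real (gau y) * ss n y k) \<le> norm (8 / rho n ^ k * (gau y * (1 + \<bar>y\<bar>) ^ k))"
    using norm_gau_ss_le unfolding real_norm_def by (intro AE_I2 order_trans[OF _ abs_ge_self])
qed measurable

text \<open>Writing \<open>pp\<close> as \<open>gau\<close> times \<open>SS\<close> splits p ln p
  into gau SS ln \<open>gau\<close> and gau \<open>TT\<close>; the two summands are the integrated
  coefficients of order \<open>k\<close>. They depend on the truncation order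
  \<open>n\<close>.\<close>

definition cc :: "nat \<Rightarrow> nat \<Rightarrow> complex" where
  "cc n k = of_real (mm k * psc (\<lambda>y. ln (gau y)) k) + (\<integral>y. of_real (gau y) * ss n y k \<partial>lborel)"

lemma ln_gau: "ln (gau y) = ln (gau 0) + - (y\<^sup>2 / (2 * sg\<^sup>2))"
  unfolding gau_eq[of y] by (subst ln_mult) (auto simp: less_imp_neq[OF gau_pos, symmetric])

lemma abs_ln_gau_le: "\<bar>ln (gau y)\<bar> \<le> (\<bar>ln (gau 0)\<bar> + 1 / (2 * sg\<^sup>2)) * (1 + y\<^sup>2)"
proof -
  have "\<bar>ln (gau y)\<bar> \<le> \<bar>ln (gau 0)\<bar> + 1 / (2 * sg\<^sup>2) * y\<^sup>2"
    unfolding ln_gau[of y] by (rule order_trans[OF abs_triangle_ineq]) simp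
  moreover have "(\<bar>ln (gau 0)\<bar> + 1 / (2 * sg\<^sup>2)) * (1 + y\<^sup>2)
      = \<bar>ln (gau 0)\<bar> + 1 / (2 * sg\<^sup>2) * y\<^sup>2 + \<bar>ln (gau 0)\<bar> * y\<^sup>2 + 1 / (2 * sg\<^sup>2)"
    by (simp add: algebra_simps add_divide_distrib)
  moreover have "0 \<le> \<bar>ln (gau 0)\<bar> * y\<^sup>2" "0 \<le> 1 / (2 * sg\<^sup>2)" by auto
  ultimately show ?thesis by linarith
qed

lemma ln_gau_integrable: "integrable lborel (\<lambda>y. gau y * hh k y * ln (gau y))"
proof (rule psc_integrable)
  fix y
  show "\<bar>ln (gau y)\<bar> \<le> ((\<bar>ln (gau 0)\<bar> + 1 / (2 * sg\<^sup>2)) * 2) * exp \<bar>y\<bar>"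
    using order_trans[OF abs_ln_gau_le[of y] mult_left_mono[OF one_plus_sq_le_exp[of y], of "\<bar>ln (gau 0)\<bar> + 1 / (2 * sg\<^sup>2)"]]
    unfolding mult.assoc by simp
qed measurable

end

context lognormal_fading
begin

text \<open>In this region \<open>SS n y x\<close> is close to 1, so its product with its logarithm
  has a controlled Taylor remainder, and the error of \<open>pp_expansion\<close> enters through the
  near-Lipschitz bound \<open>xlnx_diff_le\<close>. The exponent \<open>2 * n + 6\<close> is tuned
  for the later merging of two regions.\<close>

lemma NN_pointwise_small:
  "\<exists>C>0. \<forall>x y. 0 < x \<longrightarrow> x * (1 + y\<^sup>2) ^ (2 * n + 6) \<le> rho n / 4 \<longrightarrow>
     norm (of_real (pp x y * ln (pp x y))
       - of_real (gau y) * (\<Sum>k\<le>n. (of_real (hh k y * mm k * ln (gau y)) + ss n y k) * of_real x ^ k))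
     \<le> C * (x * (1 + y\<^sup>2)) ^ (n + 1) * (1 + y\<^sup>2)"
proof -
  obtain C1 where C1: "C1 > 0"
    "\<And>x y. x \<ge> 0 \<Longrightarrow> \<bar>pp x y - gau y * (\<Sum>j\<le>n. hh j y * mm j * x ^ j)\<bar> \<le> C1 * (x * (1 + \<bar>y\<bar>)) ^ (n + 1)"
    using pp_expansion[of n] by blast
  obtain D2 where D2: "D2 > 0" "\<And>x y. x \<in> {0..1} \<Longrightarrow> \<bar>ln (pp x y)\<bar> \<le> D2 * (1 + y\<^sup>2)"
    using abs_ln_pp_le[of 1] by auto
  define D3 where "D3 = \<bar>ln (gau 0)\<bar> + 1 / (2 * sg\<^sup>2)"
  have D3: "D3 \<ge> 0" "\<And>y. \<bar>ln (gau y)\<bar> \<le> D3 * (1 + y\<^sup>2)"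
    using abs_ln_gau_le by (auto simp: D3_def)
  define C where "C = C1 * 2 ^ (n + 1) * (2 + D2 + D3) + gau 0 * (16 * (2 / rho n) ^ (n + 1))"
  have C: "C > 0" unfolding C_def
    using C1 D2 D3 by (intro add_pos_nonneg mult_pos_pos mult_nonneg_nonneg) (auto simp: less_imp_le[OF rho_pos])
  have "norm (of_real (pp x y * ln (pp x y))
       - of_real (gau y) * (\<Sum>k\<le>n. (of_real (hh k y * mm k * ln (gau y)) + ss n y k) * of_real x ^ k))
     \<le> C * (x * (1 + y\<^sup>2)) ^ (n + 1) * (1 + y\<^sup>2)"
    if x: "0 < x" and small: "x * (1 + y\<^sup>2) ^ (2 * n + 6) \<le> rho n / 4" for x y
  proof -
    define Q where "Q = 1 + y\<^sup>2"
    have Q1: "Q \<ge> 1" by (simp add: Q_def)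
    have uQ: "1 + \<bar>y\<bar> \<le> 2 * Q"
    proof -
      have "0 \<le> (\<bar>y\<bar> - 1)\<^sup>2" by simp
      hence "2 * \<bar>y\<bar> \<le> 1 + y\<^sup>2" by (simp add: power2_eq_square algebra_simps)
      thus ?thesis unfolding Q_def using zero_le_power2[of y] by (smt (verit))
    qed
    have xQ: "x * Q \<le> rho n / 4"
    proof -
      have "Q ^ 1 \<le> Q ^ (2 * n + 6)" using Q1 by (intro power_increasing) auto
      hence "x * Q \<le> x * Q ^ (2 * n + 6)" using x by simp
      thus ?thesis using small unfolding Q_def by linarith
    qed
    have x1: "x \<in> {0..1}"
    proof -
      have "x * 1 \<le> x * Q" using x Q1 by (intro mult_left_mono) auto
      hence "x \<le> 1" using xQ rho_le[of n] by linarith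
      thus ?thesis using x by simp
    qed
    have xu: "x * (1 + \<bar>y\<bar>) \<le> 2 * (x * Q)" using mult_left_mono[OF uQ, of x] x by simp
    have xu2: "x \<le> rho n / (1 + \<bar>y\<bar>) / 2"
      using xu xQ by (simp add: pos_le_divide_eq mult.assoc) (simp add: algebra_simps pos_le_divide_eq)
    define S where "S = (\<Sum>j\<le>n. hh j y * mm j * x ^ j)"
    have SS_S: "SS n y (of_real x) = of_real S" by (simp add: SS_def S_def)
    define R where "R = rho n / (1 + \<bar>y\<bar>)"
    have "x \<le> R / 2" "0 < R" using xu2 radius_pos[of n y] unfolding R_def .
    hence "x \<le> rho n / (1 + \<bar>y\<bar>)" unfolding R_def [symmetric] by linarith
    hence "norm (complex_of_real x) \<le> rho n / (1 + \<bar>y\<bar>)" using x by simp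
    from SS_near_one[OF this] have "\<bar>S - 1\<bar> \<le> 1 / 2"
      unfolding SS_S by (metis norm_of_real of_real_1 of_real_diff)
    hence S: "1 / 2 \<le> S" "S \<le> 3 / 2" by linarith+
    have lnS: "\<bar>ln S\<bar> \<le> 1"
    proof -
      have "ln (1 / 2) \<le> ln S" "ln S \<le> S - 1" using S by (auto intro: ln_mono ln_le_minus_one)
      moreover have "ln (1 / 2) = - ln (2::real)" by (simp add: ln_div)
      moreover have "ln 2 \<le> (1::real)" using ln_le_minus_one[of "2::real"] by simp
      ultimately show ?thesis using S by linarith
    qed
    have TT_S: "TT n y (of_real x) = of_real (S * ln S)"
      unfolding TT_def SS_S using S by (simp add: Ln_of_real)
    have pwQ: "(x * (1 + \<bar>y\<bar>)) ^ (n + 1) \<le> 2 ^ (n + 1) * (x * Q) ^ (n + 1)"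
      unfolding power_mult_distrib [symmetric] using xu x by (intro power_mono) auto
    have e1: "norm (of_real (S * ln S) - (\<Sum>k\<le>n. ss n y k * of_real x ^ k)) \<le> 16 * (2 / rho n) ^ (n + 1) * (x * Q) ^ (n + 1)"
    proof -
      have "norm (TT n y (of_real x) - (\<Sum>k\<le>n. ss n y k * of_real x ^ k)) \<le> 16 * (norm (complex_of_real x) * (1 + \<bar>y\<bar>) / rho n) ^ (n + 1)"
        using xu2 x by (intro TT_remainder) simp
      also have "\<dots> = 16 * ((x * (1 + \<bar>y\<bar>)) ^ (n + 1) / rho n ^ (n + 1))" using x by (simp only: norm_of_real abs_of_pos power_divide)
      also have "\<dots> \<le> 16 * ((2 ^ (n + 1) * (x * Q) ^ (n + 1)) / rho n ^ (n + 1))"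
        using pwQ by (intro mult_left_mono divide_right_mono) (auto simp: less_imp_le[OF rho_pos])
      finally show ?thesis unfolding TT_S by (simp only: power_divide times_divide_eq_left times_divide_eq_right mult.assoc)
    qed
    have e2: "\<bar>pp x y - gau y * S\<bar> \<le> C1 * 2 ^ (n + 1) * (x * Q) ^ (n + 1)"
      using order_trans[OF C1(2)[of x y] mult_left_mono[OF pwQ, of C1]] x C1(1) by (simp add: S_def mult.assoc)
    have gS: "gau y * S > 0" using S by simp
    have ln_gS: "ln (gau y * S) = ln (gau y) + ln S" using S by (subst ln_mult) (auto simp: less_imp_neq[OF gau_pos, symmetric])
    have e3: "\<bar>pp x y * ln (pp x y) - (gau y * S) * ln (gau y * S)\<bar>
        \<le> (C1 * 2 ^ (n + 1) * (2 + D2 + D3)) * (x * Q) ^ (n + 1) * Q"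
    proof -
      have "1 + \<bar>ln (pp x y)\<bar> + \<bar>ln (gau y * S)\<bar> \<le> (2 + D2 + D3) * Q"
        unfolding ln_gS using D2(2)[OF x1, of y] D3(2)[of y] lnS Q1 abs_triangle_ineq[of "ln (gau y)" "ln S"]
        unfolding Q_def [symmetric] distrib_right by linarith
      hence "\<bar>pp x y - gau y * S\<bar> * (1 + \<bar>ln (pp x y)\<bar> + \<bar>ln (gau y * S)\<bar>)
          \<le> (C1 * 2 ^ (n + 1) * (x * Q) ^ (n + 1)) * ((2 + D2 + D3) * Q)"
        using C1 x Q1 by (intro mult_mono e2) auto
      hence "\<bar>pp x y * ln (pp x y) - (gau y * S) * ln (gau y * S)\<bar> \<le> (C1 * 2 ^ (n + 1) * (x * Q) ^ (n + 1)) * ((2 + D2 + D3) * Q)"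
        by (rule order_trans[OF xlnx_diff_le[OF pp_pos gS]])
      thus ?thesis by (simp only: mult_ac)
    qed
    have split: "of_real (pp x y * ln (pp x y))
       - of_real (gau y) * (\<Sum>k\<le>n. (of_real (hh k y * mm k * ln (gau y)) + ss n y k) * of_real x ^ k)
      = of_real (pp x y * ln (pp x y) - (gau y * S) * ln (gau y * S))
        + of_real (gau y) * (of_real (S * ln S) - (\<Sum>k\<le>n. ss n y k * of_real x ^ k))"
    proof -
      have "(\<Sum>k\<le>n. (of_real (hh k y * mm k * ln (gau y)) + ss n y k) * of_real x ^ k)
          = of_real (S * ln (gau y)) + (\<Sum>k\<le>n. ss n y k * of_real x ^ k)"
      proof -
        have "of_real (S * ln (gau y)) = (\<Sum>k\<le>n. of_real (hh k y * mm k * ln (gau y)) * complex_of_real x ^ k)"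
          by (simp add: S_def sum_distrib_right sum_distrib_left mult_ac)
        thus ?thesis by (simp only: distrib_right sum.distrib)
      qed
      thus ?thesis unfolding ln_gS by (simp add: algebra_simps)
    qed
    have "norm (of_real (pp x y * ln (pp x y))
       - of_real (gau y) * (\<Sum>k\<le>n. (of_real (hh k y * mm k * ln (gau y)) + ss n y k) * of_real x ^ k))
      \<le> norm (complex_of_real (pp x y * ln (pp x y) - (gau y * S) * ln (gau y * S)))
        + norm (of_real (gau y) * (of_real (S * ln S) - (\<Sum>k\<le>n. ss n y k * of_real x ^ k)))"
      unfolding split by (rule norm_triangle_ineq)
    also have "\<dots> \<le> (C1 * 2 ^ (n + 1) * (2 + D2 + D3)) * (x * Q) ^ (n + 1) * Q
        + gau 0 * (16 * (2 / rho n) ^ (n + 1) * (x * Q) ^ (n + 1)) * Q"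
    proof (intro add_mono)
      show "norm (complex_of_real (pp x y * ln (pp x y) - (gau y * S) * ln (gau y * S)))
        \<le> (C1 * 2 ^ (n + 1) * (2 + D2 + D3)) * (x * Q) ^ (n + 1) * Q"
        unfolding norm_of_real by (rule e3)
      have "norm (of_real (gau y) * (of_real (S * ln S) - (\<Sum>k\<le>n. ss n y k * of_real x ^ k)))
          = gau y * norm (of_real (S * ln S) - (\<Sum>k\<le>n. ss n y k * of_real x ^ k))"
        by (simp only: norm_mult norm_of_real abs_of_pos[OF gau_pos])
      also have "\<dots> \<le> gau 0 * (16 * (2 / rho n) ^ (n + 1) * (x * Q) ^ (n + 1))"
        by (intro mult_mono e1 gau_le) auto
      also have "\<dots> \<le> gau 0 * (16 * (2 / rho n) ^ (n + 1) * (x * Q) ^ (n + 1)) * Q"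
      proof -
        have "0 \<le> gau 0 * (16 * (2 / rho n) ^ (n + 1) * (x * Q) ^ (n + 1))"
          using x Q1 by (intro mult_nonneg_nonneg) (auto simp: less_imp_le[OF rho_pos])
        from mult_left_mono[OF Q1 this] show ?thesis by (simp only: mult_1_right)
      qed
      finally show "norm (of_real (gau y) * (of_real (S * ln S) - (\<Sum>k\<le>n. ss n y k * of_real x ^ k)))
          \<le> gau 0 * (16 * (2 / rho n) ^ (n + 1) * (x * Q) ^ (n + 1)) * Q" .
    qed
    also have "\<dots> = C * (x * Q) ^ (n + 1) * Q" by (simp only: C_def distrib_right mult.assoc)
    finally show ?thesis unfolding Q_def .
  qed
  thus ?thesis using C by blast
qed

text \<open>Nothing cancels here: the two terms are bounded separately, each with as many powers of
  1 / (1 + y^2) as desired. This serves the region where \<open>y\<close> is large relative to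
  \<open>x\<close>.\<close>

lemma NN_pointwise_decay:
  "\<exists>C>0. \<forall>x\<in>{0..1}. \<forall>y.
     norm (of_real (pp x y * ln (pp x y))
       - of_real (gau y) * (\<Sum>k\<le>n. (of_real (hh k y * mm k * ln (gau y)) + ss n y k) * of_real x ^ k))
     \<le> C / (1 + y\<^sup>2) ^ N"
proof -
  obtain D2 where D2: "D2 > 0" "\<And>x y. x \<in> {0..1} \<Longrightarrow> \<bar>ln (pp x y)\<bar> \<le> D2 * (1 + y\<^sup>2)"
    using abs_ln_pp_le[of 1] by auto
  define D3 where "D3 = \<bar>ln (gau 0)\<bar> + 1 / (2 * sg\<^sup>2)"
  have D3: "D3 \<ge> 0" "\<And>y. \<bar>ln (gau y)\<bar> \<le> D3 * (1 + y\<^sup>2)"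
    using abs_ln_gau_le by (auto simp: D3_def)
  obtain Ca where Ca: "Ca > 0" "\<And>x y. x \<in> {0..1} \<Longrightarrow> pp x y \<le> Ca / (1 + y\<^sup>2) ^ (N + 1)"
    using pp_upper[of 1 "N + 1"] by auto
  obtain Cg where Cg: "Cg > 0" "\<And>y. gau y \<le> Cg / (1 + y\<^sup>2) ^ (N + n + 1)"
    using normal_density_polynomial_decay[of sg "N + n + 1"] by auto
  define E where "E = (\<Sum>k\<le>n. Bh * 2 ^ k * mm k * D3 + 8 * (2 / rho n) ^ k)"
  have E0: "E \<ge> 0" unfolding E_def using Bh_ge D3(1)
    by (intro sum_nonneg add_nonneg_nonneg mult_nonneg_nonneg) (auto simp: less_imp_le[OF rho_pos])
  have "norm (of_real (pp x y * ln (pp x y))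
       - of_real (gau y) * (\<Sum>k\<le>n. (of_real (hh k y * mm k * ln (gau y)) + ss n y k) * of_real x ^ k))
     \<le> (Ca * D2 + Cg * E) / (1 + y\<^sup>2) ^ N" if x: "x \<in> {0..1}" for x y
  proof -
    define Q where "Q = 1 + y\<^sup>2"
    have Q1: "Q \<ge> 1" by (simp add: Q_def)
    have uQ: "1 + \<bar>y\<bar> \<le> 2 * Q"
    proof -
      have "0 \<le> (\<bar>y\<bar> - 1)\<^sup>2" by simp
      hence "2 * \<bar>y\<bar> \<le> 1 + y\<^sup>2" by (simp add: power2_eq_square algebra_simps)
      thus ?thesis unfolding Q_def using zero_le_power2[of y] by (smt (verit))
    qed
    have a: "norm (complex_of_real (pp x y * ln (pp x y))) \<le> Ca * D2 / Q ^ N"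
    proof -
      have "norm (complex_of_real (pp x y * ln (pp x y))) \<le> (Ca / Q ^ (N + 1)) * (D2 * Q)"
        unfolding norm_of_real abs_mult using Ca(1) Ca(2)[OF x, of y] D2(2)[OF x, of y] Q1
        unfolding Q_def by (intro mult_mono) auto
      also have "\<dots> = Ca * D2 / Q ^ N" using Q1 by (simp add: field_simps)
      finally show ?thesis .
    qed
    have tm: "norm ((of_real (hh k y * mm k * ln (gau y)) + ss n y k) * of_real x ^ k)
        \<le> Q ^ (n + 1) * (Bh * 2 ^ k * mm k * D3 + 8 * (2 / rho n) ^ k)" if k: "k \<le> n" for k
    proof -
      have uk: "(1 + \<bar>y\<bar>) ^ k \<le> 2 ^ k * Q ^ k"
        unfolding power_mult_distrib [symmetric] using uQ by (intro power_mono) auto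
      have Qk: "Q ^ k \<le> Q ^ n" using Q1 k by (intro power_increasing) auto
      have t1: "norm (complex_of_real (hh k y * mm k * ln (gau y))) \<le> Q ^ (n + 1) * (Bh * 2 ^ k * mm k * D3)"
      proof -
        have h: "\<bar>hh k y\<bar> \<le> Bh * (2 ^ k * Q ^ n)"
          using Bh_ge Qk by (intro order_trans[OF abs_hh_le] mult_left_mono order_trans[OF uk]) auto
        have "norm (complex_of_real (hh k y * mm k * ln (gau y))) = \<bar>hh k y\<bar> * mm k * \<bar>ln (gau y)\<bar>"
          by (simp add: abs_mult norm_mult)
        also have "\<dots> \<le> (Bh * (2 ^ k * Q ^ n)) * mm k * (D3 * Q)"
          using h D3(2)[of y] Bh_ge Q1 unfolding Q_def [symmetric] by (intro mult_mono) auto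
        finally show ?thesis by (simp add: mult_ac)
      qed
      have t2: "norm (ss n y k) \<le> Q ^ (n + 1) * (8 * (2 / rho n) ^ k)"
      proof -
        have "norm (ss n y k) \<le> 8 * ((1 + \<bar>y\<bar>) ^ k / rho n ^ k)"
          using norm_ss_le[of n y k] by (simp add: power_divide)
        also have "\<dots> \<le> 8 * ((2 ^ k * Q ^ (n + 1)) / rho n ^ k)"
        proof (intro mult_left_mono divide_right_mono)
          have "Q ^ k \<le> Q ^ (n + 1)" using Q1 k by (intro power_increasing) auto
          thus "(1 + \<bar>y\<bar>) ^ k \<le> 2 ^ k * Q ^ (n + 1)" using uk by (smt (verit) mult_left_mono zero_le_power)
        qed (auto simp: less_imp_le[OF rho_pos])
        finally show ?thesis by (simp add: power_divide mult_ac)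
      qed
      have "norm ((of_real (hh k y * mm k * ln (gau y)) + ss n y k) * of_real x ^ k)
          \<le> (norm (complex_of_real (hh k y * mm k * ln (gau y))) + norm (ss n y k)) * 1"
        unfolding norm_mult norm_power
        using x by (intro mult_mono norm_triangle_ineq power_le_one) auto
      also have "\<dots> \<le> Q ^ (n + 1) * (Bh * 2 ^ k * mm k * D3) + Q ^ (n + 1) * (8 * (2 / rho n) ^ k)"
        using t1 t2 by simp
      finally show ?thesis by (simp only: distrib_left)
    qed
    have b: "norm (of_real (gau y) * (\<Sum>k\<le>n. (of_real (hh k y * mm k * ln (gau y)) + ss n y k) * of_real x ^ k)) \<le> Cg * E / Q ^ N"
    proof -
      have "norm (\<Sum>k\<le>n. (of_real (hh k y * mm k * ln (gau y)) + ss n y k) * of_real x ^ k) \<le> Q ^ (n + 1) * E"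
        unfolding E_def sum_distrib_left by (rule order_trans[OF norm_sum], rule sum_mono, rule tm) auto
      hence "norm (of_real (gau y) * (\<Sum>k\<le>n. (of_real (hh k y * mm k * ln (gau y)) + ss n y k) * of_real x ^ k))
          \<le> (Cg / Q ^ (N + n + 1)) * (Q ^ (n + 1) * E)"
        unfolding norm_mult norm_of_real abs_of_pos[OF gau_pos]
        using Cg Q1 by (intro mult_mono) (auto simp: Q_def)
      also have "\<dots> = Cg * E / Q ^ N" using Q1 by (simp add: power_add field_simps)
      finally show ?thesis .
    qed
    have "norm (of_real (pp x y * ln (pp x y))
       - of_real (gau y) * (\<Sum>k\<le>n. (of_real (hh k y * mm k * ln (gau y)) + ss n y k) * of_real x ^ k))
       \<le> Ca * D2 / Q ^ N + Cg * E / Q ^ N"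
      by (rule order_trans[OF norm_triangle_ineq4 add_mono[OF a b]])
    thus ?thesis by (simp add: Q_def add_divide_distrib)
  qed
  moreover have "Ca * D2 + Cg * E > 0" using Ca D2 Cg E0 by (intro add_pos_nonneg) auto
  ultimately show ?thesis by blast
qed

text \<open>Let Q = 1 + y^2 and cut where x Q^m passes \<open>c0\<close>, with m = 2 (n + 3). Below
  the cut, the error (x Q)^(n + 1) Q equals x^n sqrt(x) / Q times sqrt(x) Q^(n + 3), and the square
  of the last factor is x Q^m. Above it, 1 / Q^m is less than x / c0, so decay of order m (n + 1) +
  1 produces x^(n + 1) / Q. Half a power of \<open>x\<close> pays for integrability in
  \<open>y\<close>.\<close>

lemma NN_pointwise:
  "\<exists>C>0. \<forall>x\<in>{0<..1}. \<forall>y.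
     norm (of_real (pp x y * ln (pp x y))
       - of_real (gau y) * (\<Sum>k\<le>n. (of_real (hh k y * mm k * ln (gau y)) + ss n y k) * of_real x ^ k))
     \<le> C * x ^ n * sqrt x * (1 / (1 + y\<^sup>2))"
proof -
  define m where "m = 2 * n + 6"
  obtain C1 where C1: "C1 > 0" "\<And>x y. 0 < x \<Longrightarrow> x * (1 + y\<^sup>2) ^ m \<le> rho n / 4 \<Longrightarrow>
     norm (of_real (pp x y * ln (pp x y))
       - of_real (gau y) * (\<Sum>k\<le>n. (of_real (hh k y * mm k * ln (gau y)) + ss n y k) * of_real x ^ k))
     \<le> C1 * (x * (1 + y\<^sup>2)) ^ (n + 1) * (1 + y\<^sup>2)"
    using NN_pointwise_small[of n] unfolding m_def by blast
  obtain C2 where C2: "C2 > 0" "\<And>x y. x \<in> {0..1} \<Longrightarrow>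
     norm (of_real (pp x y * ln (pp x y))
       - of_real (gau y) * (\<Sum>k\<le>n. (of_real (hh k y * mm k * ln (gau y)) + ss n y k) * of_real x ^ k))
     \<le> C2 / (1 + y\<^sup>2) ^ (m * (n + 1) + 1)"
    using NN_pointwise_decay[of n "m * (n + 1) + 1"] by blast
  define c0 where "c0 = rho n / 4"
  have c0: "0 < c0" "c0 \<le> 1" using rho_le[of n] by (auto simp: c0_def)
  define C where "C = C1 + C2 / c0 ^ (n + 1)"
  have C: "C \<ge> C1" "C \<ge> C2 / c0 ^ (n + 1)" "C > 0" using C1 C2 c0 by (auto simp: C_def add_pos_nonneg)
  have "norm (of_real (pp x y * ln (pp x y))
       - of_real (gau y) * (\<Sum>k\<le>n. (of_real (hh k y * mm k * ln (gau y)) + ss n y k) * of_real x ^ k))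
     \<le> C * x ^ n * sqrt x * (1 / (1 + y\<^sup>2))" (is "?E \<le> _") if x: "x \<in> {0<..1}" for x y
  proof -
    define Q where "Q = 1 + y\<^sup>2"
    have Q1: "Q \<ge> 1" by (simp add: Q_def)
    have sx: "sqrt x * sqrt x = x" "0 \<le> sqrt x" "sqrt x \<le> 1" using x by auto
    have pos: "0 \<le> x ^ n * sqrt x * (1 / Q)" using x Q1 by auto
    show ?thesis
    proof (cases "x * Q ^ m \<le> c0")
      case True
      have "?E \<le> C1 * (x * Q) ^ (n + 1) * Q" using C1(2)[of x y] True x unfolding Q_def c0_def by auto
      also have "\<dots> = C1 * (x ^ n * sqrt x * (1 / Q)) * (sqrt x * Q ^ (n + 3))"
      proof -
        have "(x ^ n * sqrt x * (1 / Q)) * (sqrt x * Q ^ (n + 3)) = x ^ n * (sqrt x * sqrt x) * (Q ^ (n + 3) / Q)"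
          by (simp add: mult_ac)
        also have "\<dots> = x ^ (n + 1) * Q ^ (n + 2)" using Q1 sx(1) by (simp add: power_add numeral_3_eq_3 mult_ac)
        finally have P: "(x ^ n * sqrt x * (1 / Q)) * (sqrt x * Q ^ (n + 3)) = x ^ (n + 1) * Q ^ (n + 2)" .
        have P2: "(x * Q) ^ (n + 1) * Q = x ^ (n + 1) * Q ^ (n + 2)" by (simp add: power_mult_distrib)
        show ?thesis by (simp only: mult.assoc[of C1] P P2)
      qed
      also have "\<dots> \<le> C1 * (x ^ n * sqrt x * (1 / Q)) * 1"
      proof (intro mult_left_mono)
        have "(sqrt x * Q ^ (n + 3))\<^sup>2 = x * Q ^ m"
          using x by (simp add: power_mult_distrib m_def power_mult [symmetric] mult.commute)
        hence "(sqrt x * Q ^ (n + 3))\<^sup>2 \<le> 1\<^sup>2" using True c0 by simp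
        thus "sqrt x * Q ^ (n + 3) \<le> 1" by (rule power2_le_imp_le) simp
      qed (intro mult_nonneg_nonneg less_imp_le[OF C1(1)] pos)
      also have "\<dots> \<le> C * (x ^ n * sqrt x * (1 / Q)) * 1" using C pos by (intro mult_right_mono) auto
      finally show ?thesis unfolding Q_def by (simp add: mult_ac)
    next
      case False
      have "?E \<le> C2 / Q ^ (m * (n + 1) + 1)" using C2(2)[of x y] x unfolding Q_def by auto
      also have "\<dots> = C2 * (1 / Q ^ m) ^ (n + 1) * (1 / Q)"
        by (simp only: power_add power_one_right power_mult power_divide power_one) simp
      also have "\<dots> \<le> C2 * (x / c0) ^ (n + 1) * (1 / Q)"
      proof (intro mult_right_mono mult_left_mono power_mono)
        show "1 / Q ^ m \<le> x / c0" using False c0 Q1 by (simp add: field_simps)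
      qed (use C2 Q1 in auto)
      also have "\<dots> = C2 / c0 ^ (n + 1) * x ^ n * x * (1 / Q)" by (simp add: power_divide)
      also have "\<dots> \<le> C2 / c0 ^ (n + 1) * x ^ n * sqrt x * (1 / Q)"
      proof (intro mult_right_mono mult_left_mono)
        show "x \<le> sqrt x" using sx mult_left_mono[OF sx(3) sx(2)] by simp
      qed (use x C2 c0 Q1 in auto)
      also have "\<dots> \<le> C * x ^ n * sqrt x * (1 / Q)"
        using C(2) x Q1 by (intro mult_right_mono) auto
      finally show ?thesis unfolding Q_def .
    qed
  qed
  thus ?thesis using C by blast
qed

lemma NN_expansion:
  "\<exists>C. \<forall>x\<in>{0<..1}. norm (of_real (NN x) - (\<Sum>k\<le>n. cc n k * of_real x ^ k)) \<le> C * x ^ n * sqrt x"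
proof -
  obtain C where C: "C > 0" "\<And>x y. x \<in> {0<..1} \<Longrightarrow> norm (of_real (pp x y * ln (pp x y))
       - of_real (gau y) * (\<Sum>k\<le>n. (of_real (hh k y * mm k * ln (gau y)) + ss n y k) * of_real x ^ k))
     \<le> C * x ^ n * sqrt x * (1 / (1 + y\<^sup>2))"
    using NN_pointwise[of n] by blast
  define W where "W = (\<integral>y. 1 / (1 + y\<^sup>2) \<partial>(lborel :: real measure))"
  have "norm (of_real (NN x) - (\<Sum>k\<le>n. cc n k * of_real x ^ k)) \<le> (C * W) * x ^ n * sqrt x" if x: "x \<in> {0<..1}" for x
  proof -
    define f where "f y = (\<Sum>k\<le>n. (of_real (mm k * (gau y * hh k y * ln (gau y))) + of_real (gau y) * ss n y k) * of_real x ^ k)" for y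
    have f_eq: "of_real (gau y) * (\<Sum>k\<le>n. (of_real (hh k y * mm k * ln (gau y)) + ss n y k) * of_real x ^ k) = f y" for y
      unfolding f_def sum_distrib_left by (intro sum.cong refl) (simp add: algebra_simps)
    have i1: "integrable lborel (\<lambda>y. complex_of_real (mm k * (gau y * hh k y * ln (gau y))))" for k
      by (intro integrable_of_real integrable_mult_right ln_gau_integrable)
    have i2: "integrable lborel (\<lambda>y. (of_real (mm k * (gau y * hh k y * ln (gau y))) + of_real (gau y) * ss n y k) * of_real x ^ k)" for k
      by (intro integrable_mult_left Bochner_Integration.integrable_add i1 gau_ss_integrable)
    have f_int: "integrable lborel f" unfolding f_def by (intro Bochner_Integration.integrable_sum i2)
    have c_eq: "(\<integral>y. of_real (mm k * (gau y * hh k y * ln (gau y))) + of_real (gau y) * ss n y k \<partial>lborel) = cc n k" for k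
      unfolding cc_def Bochner_Integration.integral_add[OF i1 gau_ss_integrable] integral_complex_of_real psc_def
        integral_mult_right_zero ..
    have f_integral: "(\<integral>y. f y \<partial>lborel) = (\<Sum>k\<le>n. cc n k * of_real x ^ k)"
    proof -
      have "(\<integral>y. f y \<partial>lborel) = (\<Sum>k\<le>n. \<integral>y. (of_real (mm k * (gau y * hh k y * ln (gau y))) + of_real (gau y) * ss n y k) * of_real x ^ k \<partial>lborel)"
        unfolding f_def by (intro Bochner_Integration.integral_sum i2)
      thus ?thesis by (simp only: integral_mult_left_zero c_eq)
    qed
    have p_int: "integrable lborel (\<lambda>y. complex_of_real (pp x y * ln (pp x y)))"
      using x by (intro integrable_of_real integrable_NN[of 1]) auto
    have NN_eq: "of_real (NN x) = (\<integral>y. complex_of_real (pp x y * ln (pp x y)) \<partial>lborel)"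
      unfolding NN_def integral_complex_of_real ..
    have "norm (of_real (NN x) - (\<Sum>k\<le>n. cc n k * of_real x ^ k))
        = norm (\<integral>y. complex_of_real (pp x y * ln (pp x y)) - f y \<partial>lborel)"
      unfolding Bochner_Integration.integral_diff[OF p_int f_int] f_integral NN_eq ..
    also have "\<dots> \<le> (\<integral>y. norm (complex_of_real (pp x y * ln (pp x y)) - f y) \<partial>lborel)"
      by (rule integral_norm_bound)
    also have "\<dots> \<le> (\<integral>y. (C * x ^ n * sqrt x) * (1 / (1 + y\<^sup>2)) \<partial>lborel)"
    proof (intro Bochner_Integration.integral_mono integrable_norm Bochner_Integration.integrable_diff p_int f_int
        integrable_mult_right integrable_inverse_one_plus_square)
      show "norm (complex_of_real (pp x y * ln (pp x y)) - f y) \<le> (C * x ^ n * sqrt x) * (1 / (1 + y\<^sup>2))" for y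
        using C(2)[OF x, of y] unfolding f_eq .
    qed
    also have "\<dots> = (C * W) * x ^ n * sqrt x" unfolding integral_mult_right_zero W_def by (simp only: mult_ac)
    finally show ?thesis .
  qed
  thus ?thesis by blast
qed

text \<open>\<open>ln (gau y)\<close> is a quadratic polynomial, so it is orthogonal to
  \<open>hh k\<close> once \<open>k\<close> exceeds 2. Otherwise this term would carry the full
  moment \<open>mm k\<close> into the coefficient.\<close>

lemma psc_ln_gau_zero:
  assumes "k \<ge> 3"
  shows "psc (\<lambda>y. ln (gau y)) k = 0"
proof -
  have i: "integrable lborel (\<lambda>y. gau y * hh k y * y ^ i)" for i
    by (rule psc_integrable[OF _ abs_power_le_exp]) measurable
  have "psc (\<lambda>y. ln (gau y)) k = (\<integral>y. ln (gau 0) * (gau y * hh k y * y ^ 0) + (- 1 / (2 * sg\<^sup>2)) * (gau y * hh k y * y ^ 2) \<partial>lborel)"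
    unfolding psc_def by (intro Bochner_Integration.integral_cong refl) (subst ln_gau, simp add: algebra_simps)
  also have "\<dots> = ln (gau 0) * psc (\<lambda>y. y ^ 0) k + (- 1 / (2 * sg\<^sup>2)) * psc (\<lambda>y. y ^ 2) k"
    unfolding psc_def Bochner_Integration.integral_add[OF integrable_mult_right[OF i] integrable_mult_right[OF i]]
      integral_mult_right_zero ..
  also have "\<dots> = 0" using assms psc_power_eq_0[of 0 k] psc_power_eq_0[of 2 k] by simp
  finally show ?thesis .
qed

text \<open>\<open>SS n\<close> differs from \<open>SS K\<close> by a multiple of z^(K + 1), so by
  \<open>xLnx_second_order\<close> linearising w Ln w at \<open>SS K\<close> costs only order z^(2 K
  + 2). As 2 K + 2 is at least n + 1, coefficient \<open>n\<close> does not see this error, and the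
  moments above \<open>K\<close> enter linearly.\<close>

lemma ss_top_split:
  assumes K: "K = n div 2"
  shows "ss n y n = ss K y n + (\<Sum>j\<in>{K<..n}. aa n y j * ((if j = n then 1 else 0) + lc K y (n - j)))"
proof -
  have Kn: "K \<le> n" "n + 1 \<le> 2 * K + 2" using K by auto
  define D where "D z = TT n y z - TT K y z - (SS n y z - SS K y z) * (1 + LL K y z)" for z
  define U where "U = {z. Re (SS n y z) > 0} \<inter> {z. Re (SS K y z) > 0}"
  define r where "r = rho n / (1 + \<bar>y\<bar>)"
  have r: "r > 0" "r \<le> rho K / (1 + \<bar>y\<bar>)" "r \<le> 1"
  proof -
    show "r > 0" unfolding r_def by (rule radius_pos)
    show "r \<le> rho K / (1 + \<bar>y\<bar>)" unfolding r_def using rho_antimono[OF Kn(1)] by (intro divide_right_mono) auto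
    have "rho n \<le> 1 * (1 + \<bar>y\<bar>)" using rho_le[of n] by (smt (verit) divide_le_eq_1 mult_1)
    thus "r \<le> 1" unfolding r_def by (subst pos_divide_le_eq) auto
  qed
  have "open U" unfolding U_def by (intro open_Int open_SS_domain)
  moreover have "cball 0 r \<subseteq> U"
    unfolding U_def
    using cball_SS_domain[of n y, folded r_def] subset_trans[OF subset_cball[OF r(2)] cball_SS_domain[of K y]] by blast
  ultimately have U: "open U" "cball 0 r \<subseteq> U" .
  have D_hol: "D holomorphic_on U"
    unfolding D_def U_def
    by (intro holomorphic_intros SS_holomorphic holomorphic_on_subset[OF TT_holomorphic] holomorphic_on_subset[OF LL_holomorphic]) auto
  define A where "A = (\<Sum>j\<in>{K<..n}. norm (aa n y j))"
  have diff: "norm (SS n y z - SS K y z) \<le> A * norm z ^ (K + 1)" if z: "norm z \<le> r" for z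
  proof -
    have "SS n y z - SS K y z = (\<Sum>j\<in>{..n} - {..K}. of_real (hh j y * mm j) * z ^ j)"
      unfolding SS_def using Kn by (subst sum_diff) auto
    also have "{..n} - {..K} = {K<..n}" by auto
    finally have "norm (SS n y z - SS K y z) \<le> (\<Sum>j\<in>{K<..n}. norm (complex_of_real (hh j y * mm j) * z ^ j))"
      by (simp only: norm_sum)
    also have "\<dots> \<le> (\<Sum>j\<in>{K<..n}. norm (aa n y j) * norm z ^ (K + 1))"
    proof (rule sum_mono)
      fix j assume j: "j \<in> {K<..n}"
      have "norm z ^ j \<le> norm z ^ (K + 1)" using j z r(3) by (intro power_decreasing) auto
      thus "norm (complex_of_real (hh j y * mm j) * z ^ j) \<le> norm (aa n y j) * norm z ^ (K + 1)"
        using j unfolding norm_mult norm_power aa_def by (auto intro!: mult_left_mono)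
    qed
    finally show ?thesis by (simp add: A_def sum_distrib_right)
  qed
  have "(deriv ^^ n) D 0 / fact n = 0"
  proof (rule Taylor_coeff_zero[OF D_hol U r(1)])
    fix z :: complex assume z: "norm z \<le> r"
    have n1: "norm (SS n y z - 1) \<le> 1 / 2" using z by (intro SS_near_one) (simp add: r_def)
    have n2: "norm (SS K y z - 1) \<le> 1 / 2" using z r(2) by (intro SS_near_one) simp
    have "norm (D z) \<le> 2 * norm (SS n y z - SS K y z) ^ 2"
      using xLnx_second_order[OF n2 n1] unfolding D_def TT_def LL_def .
    also have "\<dots> \<le> 2 * (A * norm z ^ (K + 1)) ^ 2" using diff[OF z] by (intro mult_left_mono power_mono) auto
    also have "\<dots> = 2 * A\<^sup>2 * norm z ^ (2 * K + 2)" 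
    proof -
      have "(K + 1) * 2 = 2 * K + 2" by simp
      thus ?thesis by (simp only: power_mult_distrib power_mult [symmetric] mult.assoc)
    qed
    also have "\<dots> \<le> 2 * A\<^sup>2 * norm z ^ (n + 1)" using z r(3) Kn by (intro mult_left_mono power_decreasing) auto
    finally show "norm (D z) \<le> 2 * A\<^sup>2 * norm z ^ (n + 1)" .
  qed
  moreover have D_fps: "D has_fps_expansion (Abs_fps (aa n y) * Abs_fps (lc n y) - Abs_fps (aa K y) * Abs_fps (lc K y)
      - (Abs_fps (aa n y) - Abs_fps (aa K y)) * (1 + Abs_fps (lc K y)))"
    unfolding D_def
    by (intro has_fps_expansion_diff has_fps_expansion_mult has_fps_expansion_add has_fps_expansion_1 TT_fps SS_fps LL_fps)
  ultimately have "fps_nth (Abs_fps (aa n y) * Abs_fps (lc n y) - Abs_fps (aa K y) * Abs_fps (lc K y)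
      - (Abs_fps (aa n y) - Abs_fps (aa K y)) * (1 + Abs_fps (lc K y))) n = 0"
    using fps_nth_fps_expansion[OF D_fps, of n] by simp
  hence "ss n y n - ss K y n - (\<Sum>j\<le>n. (aa n y j - aa K y j) * ((if n - j = 0 then 1 else 0) + lc K y (n - j))) = 0"
    by (simp add: fps_mult_nth ss_eq atMost_atLeast0)
  moreover have "(\<Sum>j\<le>n. (aa n y j - aa K y j) * ((if n - j = 0 then 1 else 0) + lc K y (n - j)))
      = (\<Sum>j\<in>{K<..n}. aa n y j * ((if j = n then 1 else 0) + lc K y (n - j)))"
    using Kn by (intro sum.mono_neutral_cong_right) (auto simp: aa_def)
  ultimately show ?thesis by (simp add: algebra_simps)
qed

text \<open>Only the moments of order at most \<open>n div 2\<close> enter: the others multiply \<open>hh j\<close> with \<open>j > n div 2\<close>,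
  which is orthogonal to the remaining polynomial of degree \<open>n - j\<close>.\<close>

lemma integral_ss_top:
  assumes K: "K = n div 2" and n: "n \<ge> 1"
  shows "(\<integral>y. of_real (gau y) * ss n y n \<partial>lborel) = (\<integral>y. of_real (gau y) * ss K y n \<partial>lborel)"
proof -
  define g where "g j y = of_real (gau y) * (aa n y j * ((if j = n then 1 else 0) + lc K y (n - j)))" for j y
  have zero: "(\<integral>y. g j y \<partial>lborel) = 0" and int: "integrable lborel (g j)" if j: "j \<in> {K<..n}" for j
  proof -
    have "poly_deg_le (n - j) (\<lambda>y. of_real (mm j) * ((if j = n then 1 else 0) + lc K y (n - j)))"
      by (rule poly_deg_le_mult[OF poly_deg_le_const[of 0] poly_deg_le_add[OF poly_deg_le_const poly_deg_le_lc]]) simp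
    then obtain p where p: "degree p \<le> n - j"
      "\<And>y. of_real (mm j) * ((if j = n then 1 else 0) + lc K y (n - j)) = poly p (of_real y)"
      unfolding poly_deg_le_def by blast
    have eq: "g j = (\<lambda>y. of_real (gau y * hh j y) * poly p (of_real y))"
    proof
      fix y
      have "g j y = of_real (gau y * hh j y) * (of_real (mm j) * ((if j = n then 1 else 0) + lc K y (n - j)))"
        using j unfolding g_def aa_def by (simp only: of_real_mult) (simp add: mult_ac)
      thus "g j y = of_real (gau y * hh j y) * poly p (of_real y)" unfolding p(2) .
    qed
    \<comment> \<open>Since \<open>j > n div 2\<close>, the remaining degree \<open>n - j\<close> is
      smaller than \<open>j\<close>.\<close>
    have "degree p < j" using p(1) j K n by auto
    thus "(\<integral>y. g j y \<partial>lborel) = 0" unfolding eq by (rule hh_orthogonal)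
    have i: "integrable lborel (\<lambda>y. gau y * hh j y * y ^ i)" for i
      by (rule psc_integrable[OF _ abs_power_le_exp]) measurable
    have "g j = (\<lambda>y. \<Sum>i\<le>degree p. coeff p i * of_real (gau y * hh j y * y ^ i))"
      unfolding eq by (simp add: poly_altdef sum_distrib_left mult_ac)
    thus "integrable lborel (g j)"
      by (simp only:) (intro Bochner_Integration.integrable_sum integrable_mult_right integrable_of_real i)
  qed
  have "(\<integral>y. of_real (gau y) * ss n y n \<partial>lborel) = (\<integral>y. of_real (gau y) * ss K y n + (\<Sum>j\<in>{K<..n}. g j y) \<partial>lborel)"
    by (intro Bochner_Integration.integral_cong refl) (simp only: ss_top_split[OF K] g_def distrib_left sum_distrib_left)
  also have "\<dots> = (\<integral>y. of_real (gau y) * ss K y n \<partial>lborel) + (\<integral>y. (\<Sum>j\<in>{K<..n}. g j y) \<partial>lborel)"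
    by (intro Bochner_Integration.integral_add gau_ss_integrable Bochner_Integration.integrable_sum int)
  also have "(\<integral>y. (\<Sum>j\<in>{K<..n}. g j y) \<partial>lborel) = (\<Sum>j\<in>{K<..n}. \<integral>y. g j y \<partial>lborel)"
    by (intro Bochner_Integration.integral_sum int)
  also have "\<dots> = 0" by (intro sum.neutral ballI zero)
  finally show ?thesis by simp
qed

text \<open>Only the truncation at K = n div 2 is left, so the Cauchy estimate uses the radius
  \<open>rho K\<close>. Its power - n contributes exp (2 s2 K n), which is at most exp (s2 n^2):
  half the exponent of \<open>mm n\<close>.\<close>

lemma cc_bound:
  "\<exists>C>0. \<forall>n\<ge>3. norm (cc n n) \<le> C ^ (n + 1) * fact n * exp (s2 * real n ^ 2)"
proof -
  define G where "G = (\<integral>y. exp 1 * (gau y * exp (1 * \<bar>y\<bar>)) \<partial>lborel)"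
  have G0: "G \<ge> 0" unfolding G_def by (intro Bochner_Integration.integral_nonneg) auto
  define C where "C = 8 * G + 4 * Bh"
  have C: "C > 0" "8 * G \<le> C" "4 * Bh \<le> C" using G0 Bh_ge by (auto simp: C_def)
  have "norm (cc n n) \<le> C ^ (n + 1) * fact n * exp (s2 * real n ^ 2)" if n: "n \<ge> 3" for n
  proof -
    define K where "K = n div 2"
    have "cc n n = (\<integral>y. of_real (gau y) * ss K y n \<partial>lborel)"
      unfolding cc_def psc_ln_gau_zero[OF n] using integral_ss_top[OF K_def] n by simp
    also have "norm (\<integral>y. of_real (gau y) * ss K y n \<partial>lborel) \<le> (\<integral>y. norm (of_real (gau y) * ss K y n) \<partial>lborel)"
      by (rule integral_norm_bound)
    finally have "norm (cc n n) \<le> (\<integral>y. norm (of_real (gau y) * ss K y n) \<partial>lborel)" .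
    also have "\<dots> \<le> (\<integral>y. 8 / rho K ^ n * (gau y * (1 + \<bar>y\<bar>) ^ n) \<partial>lborel)"
      by (intro Bochner_Integration.integral_mono integrable_norm gau_ss_integrable integrable_mult_right
          gau_power_integrable norm_gau_ss_le)
    also have "\<dots> = 8 / rho K ^ n * (\<integral>y. gau y * (1 + \<bar>y\<bar>) ^ n \<partial>lborel)" by (rule integral_mult_right_zero)
    also have "\<dots> \<le> 8 / rho K ^ n * (fact n * G)"
      unfolding G_def by (intro mult_left_mono gau_power_integral_le) (auto simp: less_imp_le[OF rho_pos])
    also have "\<dots> = (8 * G) * (4 * Bh) ^ n * fact n * exp (2 * s2 * real K) ^ n"
      by (simp add: rho_def power_divide exp_minus power_inverse [symmetric] field_simps)
    also have "\<dots> \<le> C * C ^ n * fact n * exp (s2 * real n ^ 2)"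
    proof (intro mult_mono power_mono C)
      have "2 * real K \<le> real n" unfolding K_def by linarith
      hence "s2 * (2 * real K) * real n \<le> s2 * real n * real n" by (intro mult_right_mono mult_left_mono) auto
      thus "exp (2 * s2 * real K) ^ n \<le> exp (s2 * real n ^ 2)"
        unfolding exp_of_nat_mult [symmetric] by (simp add: power2_eq_square mult_ac)
    qed (use G0 C Bh_ge in auto)
    finally show ?thesis by simp
  qed
  thus ?thesis using C(1) by blast
qed

end

section \<open>Decay of the coefficients of \<open>psi\<close>, and the contradiction\<close>

context lognormal_fading
begin

text \<open>Equating coefficients gives psc L n mm n = l n - cc n n, where \<open>l n\<close>
  belongs to the analytic right-hand side and grows only geometrically. Dividing exp (s2 n^2) by
  \<open>mm n\<close> leaves exp (2 s2 n - s2 n^2).\<close>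

lemma psc_bound_of_zeros:
  assumes L: "L \<in> borel_measurable borel" "\<And>y. \<bar>L y\<bar> \<le> D * (1 + y\<^sup>2)" and c: "c > 0"
    and X: "\<And>i::nat. X i > 0" "X \<longlonglongrightarrow> 0"
    and zeros: "\<And>i. NN (X i) + JJ L (X i) = \<alpha> + \<beta> * X i + \<gamma> * (X i * ln (1 + c * X i))"
  shows "\<exists>M\<ge>1. \<forall>n\<ge>3. \<bar>psc L n\<bar> \<le> M ^ (n + 1) * fact n * exp (2 * s2 * real n - s2 * real n ^ 2)"
proof -
  define f :: "complex \<Rightarrow> complex" where "f z = of_real \<alpha> + of_real \<beta> * z + of_real \<gamma> * (z * Ln (1 + of_real c * z))" for z
  define U where "U = ball (0::complex) (1 / c)"
  \<comment> \<open>Half the distance 1 / c from \<open>0\<close> to the branch point of Ln (1 + c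
    z).\<close>
  define r where "r = 1 / (2 * c)"
  have r: "r > 0" using c by (simp add: r_def)
  have U: "open U" "cball 0 r \<subseteq> U" using c by (auto simp: U_def r_def field_simps)
  have f_hol: "f holomorphic_on U"
  proof -
    have "1 + of_real c * z \<notin> \<real>\<^sub>\<le>\<^sub>0" if "z \<in> U" for z
    proof -
      have "norm (of_real c * z) < 1" using that c by (simp add: U_def norm_mult field_simps)
      hence "\<bar>Re (of_real c * z)\<bar> < 1" using abs_Re_le_cmod[of "of_real c * z"] by linarith
      hence "Re (1 + of_real c * z) > 0" by simp
      thus ?thesis by (auto simp: complex_nonpos_Reals_iff)
    qed
    thus ?thesis unfolding f_def by (intro holomorphic_intros) auto
  qed
  have "continuous_on (cball 0 r) f"
    using f_hol U(2) by (meson holomorphic_on_imp_continuous_on holomorphic_on_subset)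
  hence "bounded (f ` cball 0 r)" by (intro compact_imp_bounded compact_continuous_image) auto
  then obtain B where "\<forall>x\<in>cball 0 r. norm (f x) \<le> B" by (auto simp: bounded_iff)
  hence B: "norm (f z) \<le> B" if "norm z \<le> r" for z using that by simp
  have B0: "B \<ge> 0" using B[of 0] r order_trans[OF norm_ge_zero] by simp
  define l where "l k = (deriv ^^ k) f 0 / fact k" for k
  have l_bound: "norm (l k) \<le> B / r ^ k" for k
    unfolding l_def by (rule Taylor_coeff_bound[OF f_hol U r B])
  have l_rem: "norm (f z - (\<Sum>k\<le>n. l k * z ^ k)) \<le> 2 * B * (norm z / r) ^ (n + 1)" if "norm z \<le> r / 2" for z n
    unfolding l_def by (rule Taylor_remainder_bound[OF f_hol U r B that])
  have f_real: "f (of_real x) = of_real (\<alpha> + \<beta> * x + \<gamma> * (x * ln (1 + c * x)))" if "x > 0" for x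
  proof -
    have "1 + c * x > 0" using c that by (intro add_pos_pos mult_pos_pos) auto
    from Ln_of_real[OF this] show ?thesis by (simp add: f_def)
  qed
  have e_zero: "psc L n * mm n \<le> norm (l n) + norm (cc n n) \<and> - (psc L n * mm n) \<le> norm (l n) + norm (cc n n)" for n
  proof -
    obtain C1 where C1: "\<And>x. x \<in> {0<..1} \<Longrightarrow> norm (of_real (NN x) - (\<Sum>k\<le>n. cc n k * of_real x ^ k)) \<le> C1 * x ^ n * sqrt x"
      using NN_expansion[of n] by blast
    obtain C2 where C2: "\<And>x. x \<in> {0..1} \<Longrightarrow> \<bar>JJ L x - (\<Sum>j\<le>n. psc L j * mm j * x ^ j)\<bar> \<le> C2 * x ^ (n + 1)"
      using JJ_expansion[OF L, of n] by blast
    define e where "e k = cc n k + of_real (psc L k * mm k) - l k" for k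
    define C where "C = \<bar>C1\<bar> + \<bar>C2\<bar> + 2 * B / r ^ (n + 1)"
    have small: "norm (\<Sum>k\<le>n. e k * of_real x ^ k) \<le> C * x ^ n * sqrt x"
      if x: "0 < x" "x \<le> 1" "x \<le> r / 2" and z: "NN x + JJ L x = \<alpha> + \<beta> * x + \<gamma> * (x * ln (1 + c * x))" for x
    proof -
      have xs: "x \<le> sqrt x" using x real_sqrt_le_1_iff[of x] mult_left_mono[of "sqrt x" 1 "sqrt x"] by simp
      have xn: "x ^ (n + 1) \<le> x ^ n * sqrt x" using x xs by (simp add: mult.commute)
      have tri: "norm (u - v - complex_of_real w) \<le> norm u + norm v + \<bar>w\<bar>" for u v w
        using norm_triangle_ineq4[of "u - v" "of_real w"] norm_triangle_ineq4[of u v] by (simp only: norm_of_real)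
      have "(\<Sum>k\<le>n. e k * of_real x ^ k) = (\<Sum>k\<le>n. cc n k * of_real x ^ k)
          + of_real (\<Sum>j\<le>n. psc L j * mm j * x ^ j) - (\<Sum>k\<le>n. l k * of_real x ^ k)"
        unfolding e_def by (simp add: sum.distrib sum_subtractf algebra_simps)
      hence eq: "(\<Sum>k\<le>n. e k * of_real x ^ k)
          = (f (of_real x) - (\<Sum>k\<le>n. l k * of_real x ^ k)) - (of_real (NN x) - (\<Sum>k\<le>n. cc n k * of_real x ^ k))
            - of_real (JJ L x - (\<Sum>j\<le>n. psc L j * mm j * x ^ j))"
        unfolding f_real[OF x(1)] z [symmetric] by simp
      have "norm (\<Sum>k\<le>n. e k * of_real x ^ k) \<le> norm (f (of_real x) - (\<Sum>k\<le>n. l k * of_real x ^ k))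
          + norm (of_real (NN x) - (\<Sum>k\<le>n. cc n k * of_real x ^ k)) + \<bar>JJ L x - (\<Sum>j\<le>n. psc L j * mm j * x ^ j)\<bar>"
        unfolding eq by (rule tri)
      also have "\<dots> \<le> 2 * B / r ^ (n + 1) * (x ^ n * sqrt x) + \<bar>C1\<bar> * (x ^ n * sqrt x) + \<bar>C2\<bar> * (x ^ n * sqrt x)"
      proof (intro add_mono)
        have "norm (f (of_real x) - (\<Sum>k\<le>n. l k * of_real x ^ k)) \<le> 2 * B * (norm (complex_of_real x) / r) ^ (n + 1)"
          using x by (intro l_rem) simp
        also have "\<dots> = 2 * B / r ^ (n + 1) * x ^ (n + 1)" using x by (simp only: norm_of_real abs_of_pos power_divide) simp
        also have "\<dots> \<le> 2 * B / r ^ (n + 1) * (x ^ n * sqrt x)" using xn B0 r by (intro mult_left_mono) auto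
        finally show "norm (f (of_real x) - (\<Sum>k\<le>n. l k * of_real x ^ k)) \<le> 2 * B / r ^ (n + 1) * (x ^ n * sqrt x)" .
        have "C1 * (x ^ n * sqrt x) \<le> \<bar>C1\<bar> * (x ^ n * sqrt x)" using x by (intro mult_right_mono) auto
        moreover have "norm (of_real (NN x) - (\<Sum>k\<le>n. cc n k * of_real x ^ k)) \<le> C1 * x ^ n * sqrt x"
          by (rule C1) (use x in simp)
        ultimately show "norm (of_real (NN x) - (\<Sum>k\<le>n. cc n k * of_real x ^ k)) \<le> \<bar>C1\<bar> * (x ^ n * sqrt x)"
          unfolding mult.assoc by linarith
        have "C2 * x ^ (n + 1) \<le> \<bar>C2\<bar> * (x ^ n * sqrt x)" using x xn by (intro mult_mono) auto
        thus "\<bar>JJ L x - (\<Sum>j\<le>n. psc L j * mm j * x ^ j)\<bar> \<le> \<bar>C2\<bar> * (x ^ n * sqrt x)"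
          using C2[of x] x by (intro order_trans[OF C2]) auto
      qed
      also have "\<dots> = C * x ^ n * sqrt x" by (simp add: C_def algebra_simps)
      finally show ?thesis .
    qed
    have "\<forall>\<^sub>F i in sequentially. X i < min 1 (r / 2)"
      using X(2) r by (intro order_tendstoD) auto
    then obtain N where N: "\<And>i. i \<ge> N \<Longrightarrow> X i < min 1 (r / 2)" by (auto simp: eventually_sequentially)
    \<comment> \<open>The expansion is taken anew for every order \<open>n\<close>, and only its top
      coefficient is used, as \<open>cc n k\<close> is bounded for \<open>k = n\<close>
      only.\<close>
    have "e n = 0"
    proof (rule coeffs_zero_of_small[of "\<lambda>i. X (i + N)"])
      show "(\<lambda>i. X (i + N)) \<longlonglongrightarrow> 0" using X(2) by (rule LIMSEQ_ignore_initial_segment)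
      show "norm (\<Sum>k\<le>n. e k * of_real (X (i + N)) ^ k) \<le> C * X (i + N) ^ n * sqrt (X (i + N))" for i
        using N[of "i + N"] X(1)[of "i + N"] zeros[of "i + N"] by (intro small) auto
    qed (use X in auto)
    hence "complex_of_real (psc L n * mm n) = l n - cc n n" by (simp add: e_def algebra_simps)
    hence "\<bar>psc L n * mm n\<bar> \<le> norm (l n) + norm (cc n n)"
      by (metis norm_of_real norm_triangle_ineq4)
    thus ?thesis by linarith
  qed
  obtain C where C: "C > 0" "\<And>n. n \<ge> 3 \<Longrightarrow> norm (cc n n) \<le> C ^ (n + 1) * fact n * exp (s2 * real n ^ 2)"
    using cc_bound by blast
  define M where "M = 1 + B + 1 / r + C"
  have M: "M \<ge> 1" "B \<le> M" "1 / r \<le> M" "C \<le> M" using B0 r C(1) by (auto simp: M_def)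
  have "\<bar>psc L n\<bar> \<le> (2 * M) ^ (n + 1) * fact n * exp (2 * s2 * real n - s2 * real n ^ 2)" if n: "n \<ge> 3" for n
  proof -
    have E1: "1 \<le> fact n * exp (s2 * real n ^ 2)"
    proof -
      have "1 * 1 \<le> fact n * exp (s2 * real n ^ 2)" by (intro mult_mono) (auto simp: fact_ge_1)
      thus ?thesis by simp
    qed
    have "norm (l n) \<le> B * (1 / r) ^ n" using l_bound[of n] by (simp add: power_divide)
    also have "\<dots> \<le> M * M ^ n" using M B0 r by (intro mult_mono power_mono) auto
    also have "\<dots> \<le> M ^ (n + 1) * (fact n * exp (s2 * real n ^ 2))" using M mult_left_mono[OF E1, of "M * M ^ n"] by simp
    finally have 1: "norm (l n) \<le> M ^ (n + 1) * (fact n * exp (s2 * real n ^ 2))" .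
    have "norm (cc n n) \<le> M ^ (n + 1) * (fact n * exp (s2 * real n ^ 2))"
    proof -
      have "C ^ (n + 1) \<le> M ^ (n + 1)" using M C(1) by (intro power_mono) auto
      hence "C ^ (n + 1) * (fact n * exp (s2 * real n ^ 2)) \<le> M ^ (n + 1) * (fact n * exp (s2 * real n ^ 2))"
        by (intro mult_right_mono) auto
      thus ?thesis using C(2)[OF n] by (simp only: mult.assoc)
    qed
    hence "\<bar>psc L n * mm n\<bar> \<le> 2 * (M ^ (n + 1) * (fact n * exp (s2 * real n ^ 2)))"
      using 1 e_zero[of n] by linarith
    also have "\<dots> \<le> (2 * M) ^ (n + 1) * (fact n * exp (s2 * real n ^ 2))"
    proof -
      have "(2::real) ^ 1 \<le> 2 ^ (n + 1)" by (intro power_increasing) auto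
      hence "2 * (M ^ (n + 1) * (fact n * exp (s2 * real n ^ 2))) \<le> 2 ^ (n + 1) * (M ^ (n + 1) * (fact n * exp (s2 * real n ^ 2)))"
        using M by (intro mult_right_mono) auto
      thus ?thesis by (simp only: power_mult_distrib mult.assoc)
    qed
    finally have "\<bar>psc L n\<bar> * mm n \<le> (2 * M) ^ (n + 1) * (fact n * exp (s2 * real n ^ 2))" by (simp add: abs_mult)
    hence "\<bar>psc L n\<bar> \<le> (2 * M) ^ (n + 1) * (fact n * exp (s2 * real n ^ 2)) / mm n"
      by (subst pos_le_divide_eq) auto
    also have "\<dots> = (2 * M) ^ (n + 1) * fact n * (exp (s2 * real n ^ 2) / mm n)" by simp
    also have "exp (s2 * real n ^ 2) / mm n = exp (2 * s2 * real n - s2 * real n ^ 2)"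
      unfolding mm_def exp_diff [symmetric] by (simp add: algebra_simps)
    finally show ?thesis .
  qed
  thus ?thesis using M(1) by (intro exI[of _ "2 * M"]) auto
qed

text \<open>The quadratic exponent - s2 n^2 beats all terms of order n ln n. The factorial of 4 n is
  aimed at the order 1 / 4 in \<open>affine_of_small_order\<close>.\<close>

lemma fact_growth:
  assumes M: "M \<ge> (1::real)"
  shows "\<exists>C>0. \<forall>n. M ^ (n + 1) * fact n * exp (2 * s2 * real n - s2 * real n ^ 2) \<le> C / fact (4 * n)"
proof -
  define a where "a n = M ^ (n + 1) * fact n * exp (2 * s2 * real n - s2 * real n ^ 2) * fact (4 * n)" for n :: nat
  define b where "b x = exp ((x + 1) * ln M + x * ln x + 4 * x * ln (4 * x) + 2 * s2 * x - s2 * x ^ 2)" for x :: real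
  have "(b \<longlongrightarrow> 0) at_top" unfolding b_def using s2_pos by real_asymp
  hence "(\<lambda>n. b (real n)) \<longlonglongrightarrow> 0" by (rule filterlim_compose[OF _ filterlim_real_sequentially])
  hence "Bseq (\<lambda>n. b (real n))" by (intro convergent_imp_Bseq) (auto simp: convergent_def)
  then obtain K where K: "K > 0" "\<And>n. norm (b (real n)) \<le> K" by (auto simp: Bseq_def)
  have a_le: "a n \<le> b (real n)" if n: "n \<ge> 1" for n
  proof -
    \<comment> \<open>Replacing factorials by k ^ k turns the sequence into an elementary function
      of a real variable, whose limit is computed asymptotically.\<close>
    have pw: "fact k \<le> exp (real k * ln (real k))" if "k \<ge> 1" for k :: nat
    proof -
      have "fact k \<le> real (k ^ k)" by (rule fact_le_power)
      also have "\<dots> = exp (real k * ln (real k))" using that by (simp add: exp_of_nat_mult)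
      finally show ?thesis .
    qed
    have Mp: "M ^ (n + 1) = exp ((real n + 1) * ln M)"
      using M exp_of_nat_mult[of "n + 1" "ln M"] by (simp add: add.commute)
    have "a n \<le> exp ((real n + 1) * ln M) * exp (real n * ln (real n)) * exp (2 * s2 * real n - s2 * real n ^ 2)
        * exp (real (4 * n) * ln (real (4 * n)))"
      unfolding a_def Mp using n by (intro mult_mono pw) auto
    also have "\<dots> = b (real n)" unfolding b_def exp_add [symmetric] by (simp add: algebra_simps)
    finally show ?thesis .
  qed
  have "a n \<le> K + a 0" for n
  proof (cases "n = 0")
    case False
    have "0 \<le> a 0" using M by (simp add: a_def)
    thus ?thesis using a_le[of n] K(2)[of n] False by (auto simp: b_def)
  qed (use K in auto)
  moreover have "K + a 0 > 0" using K M by (auto simp: a_def intro!: add_pos_nonneg)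
  ultimately show ?thesis
    by (intro exI[of _ "K + a 0"]) (auto simp: a_def pos_le_divide_eq)
qed

text \<open>With \<open>v\<close> the fourth root of \<open>w\<close>, these are every fourth term
  of the series of exp \<open>v\<close>.\<close>

lemma sum_power_fact4_le:
  fixes w :: real assumes "w \<ge> 0"
  shows "(\<Sum>n<N. w ^ n / fact (4 * n)) \<le> exp (w powr (1 / 4))"
proof -
  define v where "v = w powr (1 / 4)"
  have v0: "v \<ge> 0" by (simp add: v_def)
  have v4: "v ^ 4 = w"
  proof (cases "w = 0")
    case False
    hence "v ^ 4 = v powr (real 4)" using assms by (subst powr_realpow) (auto simp: v_def)
    thus ?thesis using assms by (simp add: v_def powr_powr)
  qed (simp add: v_def)
  have "(\<Sum>n<N. w ^ n / fact (4 * n)) = (\<Sum>k\<in>(\<lambda>n. 4 * n) ` {..<N}. v ^ k / fact k)"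
    unfolding v4 [symmetric] by (subst sum.reindex) (auto simp: inj_on_def power_mult)
  also have "\<dots> \<le> (\<Sum>k. v ^ k / fact k)"
    using v0 summable_exp_generic[of v] by (intro sum_le_suminf) (auto simp: divide_inverse mult.commute)
  also have "\<dots> = exp v" by (simp add: exp_def divide_inverse mult.commute)
  finally show ?thesis unfolding v_def .
qed

text \<open>\<open>L\<close> may grow quadratically at negative outputs, but for
  \<open>v >= 0\<close> a negative \<open>y\<close> satisfies |y| \<le> |y - v|. That growth is then
  measured in \<open>y - v\<close>, and the Gaussian averages it to a constant.\<close>

lemma psi_linear_bound:
  assumes L: "L \<in> borel_measurable borel" "\<And>y. \<bar>L y\<bar> \<le> D * (1 + y\<^sup>2)"
    and right: "\<And>y. y \<ge> 0 \<Longrightarrow> \<bar>L y\<bar> \<le> C1 * (1 + y)"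
  shows "\<exists>C. \<forall>v\<ge>0. \<bar>psi L v\<bar> \<le> C * (1 + v)"
proof -
  have D0: "D \<ge> 0" and C0: "C1 \<ge> 0" using L(2)[of 0] right[of 0] by auto
  have LD: "\<bar>L y\<bar> \<le> (2 * D) * exp \<bar>y\<bar>" for y
    using order_trans[OF L(2) mult_left_mono[OF one_plus_sq_le_exp D0]] by (simp add: mult_ac)
  define M2 where "M2 = (\<integral>u. gau u * (1 + u\<^sup>2) \<partial>lborel)"
  have M2: "M2 \<ge> 0" unfolding M2_def by (intro Bochner_Integration.integral_nonneg) auto
  have i0: "integrable lborel (\<lambda>u. gau (u - 0) * (1 + u\<^sup>2))"
    by (rule psi_integrable[where D = 2]) (use one_plus_sq_le_exp in auto)
  have i2: "integrable lborel (\<lambda>y. gau (y - v) * (1 + (y - v)\<^sup>2))" for v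
    using lborel_integrable_real_affine[of "\<lambda>u. gau u * (1 + u\<^sup>2)" 1 "- v"] i0 by simp
  have e2: "(\<integral>y. gau (y - v) * (1 + (y - v)\<^sup>2) \<partial>lborel) = M2" for v
    unfolding M2_def using lborel_integral_real_affine[of 1 "\<lambda>u. gau u * (1 + u\<^sup>2)" "- v"] by simp
  have "\<bar>psi L v\<bar> \<le> (C1 + (C1 + D) * M2) * (1 + v)" if v: "v \<ge> 0" for v
  proof -
    have L_le: "\<bar>L y\<bar> \<le> C1 * (1 + v) + (C1 + D) * (1 + (y - v)\<^sup>2)" for y
    proof (cases "y \<ge> 0")
      case True
      have "0 \<le> (\<bar>y - v\<bar> - 1)\<^sup>2" by simp
      hence "2 * \<bar>y - v\<bar> \<le> 1 + (y - v)\<^sup>2" by (simp add: power2_eq_square algebra_simps abs_mult_self_eq)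
      hence "1 + y \<le> (1 + v) + (1 + (y - v)\<^sup>2)" by (smt (verit) zero_le_power2)
      hence "C1 * (1 + y) \<le> C1 * ((1 + v) + (1 + (y - v)\<^sup>2))" using C0 by (intro mult_left_mono) auto
      moreover have "0 \<le> D * (1 + (y - v)\<^sup>2)" using D0 by simp
      ultimately show ?thesis using right[OF True] by (simp only: distrib_left distrib_right)
    next
      case False
      have "\<bar>y\<bar> \<le> \<bar>y - v\<bar>" using False v by auto
      hence "y\<^sup>2 \<le> (y - v)\<^sup>2" by (simp add: abs_le_square_iff)
      hence "D * (1 + y\<^sup>2) \<le> D * (1 + (y - v)\<^sup>2)" using D0 by (intro mult_left_mono) auto
      moreover have "0 \<le> C1 * (1 + v)" "0 \<le> C1 * (1 + (y - v)\<^sup>2)" using C0 v by auto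
      moreover have "(C1 + D) * (1 + (y - v)\<^sup>2) = C1 * (1 + (y - v)\<^sup>2) + D * (1 + (y - v)\<^sup>2)" by (rule distrib_right)
      ultimately show ?thesis using L(2)[of y] by linarith
    qed
    have "\<bar>psi L v\<bar> \<le> (\<integral>y. \<bar>gau (y - v) * L y\<bar> \<partial>lborel)" unfolding psi_def by (rule integral_abs_bound)
    also have "\<dots> \<le> (\<integral>y. (C1 * (1 + v)) * gau (y - v) + (C1 + D) * (gau (y - v) * (1 + (y - v)\<^sup>2)) \<partial>lborel)"
    proof (intro Bochner_Integration.integral_mono integrable_abs psi_integrable[OF L(1) LD]
        Bochner_Integration.integrable_add integrable_mult_right gau_shift_integrable i2)
      show "\<bar>gau (y - v) * L y\<bar> \<le> (C1 * (1 + v)) * gau (y - v) + (C1 + D) * (gau (y - v) * (1 + (y - v)\<^sup>2))" for y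
      proof -
        have dist: "g * (a + b * p) = a * g + b * (g * p)" for g a b p :: real by (simp add: algebra_simps)
        have "\<bar>gau (y - v) * L y\<bar> = gau (y - v) * \<bar>L y\<bar>" by (simp add: abs_mult)
        also have "\<dots> \<le> gau (y - v) * (C1 * (1 + v) + (C1 + D) * (1 + (y - v)\<^sup>2))"
          by (rule mult_left_mono[OF L_le]) simp
        also have "\<dots> = (C1 * (1 + v)) * gau (y - v) + (C1 + D) * (gau (y - v) * (1 + (y - v)\<^sup>2))" by (rule dist)
        finally show ?thesis .
      qed
    qed
    also have "\<dots> = (C1 * (1 + v)) * 1 + (C1 + D) * M2"
      using i2[of v] e2[of v] by (subst Bochner_Integration.integral_add) (auto intro!: integrable_mult_right)
    also have "\<dots> \<le> (C1 + (C1 + D) * M2) * (1 + v)"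
    proof -
      have "0 \<le> (C1 + D) * M2 * v" using C0 D0 M2 v by auto
      thus ?thesis by (simp add: algebra_simps)
    qed
    finally show ?thesis .
  qed
  thus ?thesis by blast
qed

text \<open>The logarithm is kept only within distance 1 of \<open>v\<close>, where |y| is at least
  |v| - 1 and the Gaussian is at least \<open>gau 1\<close>; elsewhere it is nonnegative and
  dropped.\<close>

lemma psi_log_lower_bound:
  assumes L: "L \<in> borel_measurable borel" "\<And>y. \<bar>L y\<bar> \<le> D * (1 + y\<^sup>2)"
    and low: "\<And>y. ln (1 + y\<^sup>2) - C0 \<le> L y" and v: "1 \<le> \<bar>v\<bar>"
  shows "2 * gau 1 * ln (1 + (\<bar>v\<bar> - 1)\<^sup>2) - C0 \<le> psi L v"
proof -
  have D0: "D \<ge> 0" using L(2)[of 0] by auto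
  have LD: "\<bar>L y\<bar> \<le> (2 * D) * exp \<bar>y\<bar>" for y
    using order_trans[OF L(2) mult_left_mono[OF one_plus_sq_le_exp D0]] by (simp add: mult_ac)
  define h where "h = ln (1 + (\<bar>v\<bar> - 1)\<^sup>2)"
  have h0: "h \<ge> 0" by (simp add: h_def)
  have i1: "integrable lborel (\<lambda>y. gau 1 * h * indicator {v - 1..v + 1} y)"
    by (intro integrable_mult_right) (auto intro!: integrable_real_indicator)
  have i2: "integrable lborel (\<lambda>y. C0 * gau (y - v))" by simp
  have "(\<integral>y. gau 1 * h * indicator {v - 1..v + 1} y - C0 * gau (y - v) \<partial>lborel) \<le> psi L v"
    unfolding psi_def
  proof (intro Bochner_Integration.integral_mono Bochner_Integration.integrable_diff i1 i2 psi_integrable[OF L(1) LD])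
    fix y
    have "gau 1 * h * indicator {v - 1..v + 1} y \<le> gau (y - v) * ln (1 + y\<^sup>2)"
    proof (cases "y \<in> {v - 1..v + 1}")
      case True
      hence d: "\<bar>y - v\<bar> \<le> \<bar>1\<bar>" by auto
      hence "(y - v)\<^sup>2 \<le> 1\<^sup>2" by (simp only: abs_le_square_iff)
      hence "(y - v)\<^sup>2 / (2 * sg\<^sup>2) \<le> 1\<^sup>2 / (2 * sg\<^sup>2)" by (intro divide_right_mono) auto
      hence g: "gau 1 \<le> gau (y - v)"
        by (subst (1 2) gau_eq) (auto intro!: mult_left_mono)
      have "\<bar>\<bar>v\<bar> - 1\<bar> \<le> \<bar>y\<bar>" using d v by auto
      hence "(\<bar>v\<bar> - 1)\<^sup>2 \<le> y\<^sup>2" by (simp only: abs_le_square_iff)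
      hence "h \<le> ln (1 + y\<^sup>2)" unfolding h_def by (intro ln_mono) (auto intro: add_pos_nonneg)
      thus ?thesis using True g h0 by (auto intro!: mult_mono)
    qed auto
    moreover have "gau (y - v) * (ln (1 + y\<^sup>2) - C0) \<le> gau (y - v) * L y" by (intro mult_left_mono low) auto
    ultimately show "gau 1 * h * indicator {v - 1..v + 1} y - C0 * gau (y - v) \<le> gau (y - v) * L y"
      by (simp add: algebra_simps)
  qed
  also have "(\<integral>y. gau 1 * h * indicator {v - 1..v + 1} y - C0 * gau (y - v) \<partial>lborel) = 2 * gau 1 * h - C0"
    unfolding Bochner_Integration.integral_diff[OF i1 i2] by simp
  finally show ?thesis by (simp add: h_def)
qed

theorem zeros_do_not_accumulate_at_0:
  assumes L: "L \<in> borel_measurable borel" "\<And>y. \<bar>L y\<bar> \<le> D * (1 + y\<^sup>2)" and c: "c > 0"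
    and low: "\<And>y. ln (1 + y\<^sup>2) - C0 \<le> L y"
    and right: "\<And>y. y \<ge> 0 \<Longrightarrow> \<bar>L y\<bar> \<le> C1 * (1 + y)"
    and X: "\<And>i::nat. X i > 0" "X \<longlonglongrightarrow> 0"
    and zeros: "\<And>i. NN (X i) + JJ L (X i) = \<alpha> + \<beta> * X i + \<gamma> * (X i * ln (1 + c * X i))"
  shows False
proof -
  have D0: "D \<ge> 0" using L(2)[of 0] by auto
  have LD: "\<bar>L y\<bar> \<le> (2 * D) * exp \<bar>y\<bar>" for y
    using order_trans[OF L(2) mult_left_mono[OF one_plus_sq_le_exp D0]] by (simp add: mult_ac)
  obtain M where M: "M \<ge> 1" "\<And>n. n \<ge> 3 \<Longrightarrow> \<bar>psc L n\<bar> \<le> M ^ (n + 1) * fact n * exp (2 * s2 * real n - s2 * real n ^ 2)"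
    using psc_bound_of_zeros[OF L c X zeros] by blast
  obtain K where K: "K > 0" "\<And>n. M ^ (n + 1) * fact n * exp (2 * s2 * real n - s2 * real n ^ 2) \<le> K / fact (4 * n)"
    using fact_growth[OF M(1)] by blast
  \<comment> \<open>The coefficient bound starts at order 3, so the first three coefficients are
    added by hand.\<close>
  define C where "C = K + (\<Sum>n<3. \<bar>psc L n\<bar> * fact (4 * n))"
  have C: "C \<ge> K" "C > 0" using K(1) by (auto simp: C_def sum_nonneg add_pos_nonneg)
  have psc_le: "\<bar>psc L n\<bar> \<le> C / fact (4 * n)" for n
  proof (cases "n \<ge> 3")
    case True
    have "\<bar>psc L n\<bar> \<le> K / fact (4 * n)" using M(2)[OF True] K(2)[of n] by linarith
    also have "\<dots> \<le> C / fact (4 * n)" using C by (intro divide_right_mono) auto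
    finally show ?thesis .
  next
    case False
    hence "\<bar>psc L n\<bar> * fact (4 * n) \<le> (\<Sum>n<3. \<bar>psc L n\<bar> * fact (4 * n))"
      by (intro member_le_sum) auto
    thus ?thesis using K(1) by (simp add: C_def pos_le_divide_eq)
  qed
  define \<Psi> where "\<Psi> z = (\<Sum>n. complex_of_real (psc L n) * z ^ n)" for z
  have part: "(\<Sum>n<N. norm (complex_of_real (psc L n) * z ^ n)) \<le> C * exp (norm z powr (1 / 4))" for z N
  proof -
    have "(\<Sum>n<N. norm (complex_of_real (psc L n) * z ^ n)) \<le> (\<Sum>n<N. C * (norm z ^ n / fact (4 * n)))"
    proof (rule sum_mono)
      fix n
      have "norm (complex_of_real (psc L n) * z ^ n) = \<bar>psc L n\<bar> * norm z ^ n" by (simp add: norm_mult norm_power)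
      also have "\<dots> \<le> C / fact (4 * n) * norm z ^ n" by (intro mult_right_mono psc_le) auto
      finally show "norm (complex_of_real (psc L n) * z ^ n) \<le> C * (norm z ^ n / fact (4 * n))" by simp
    qed
    also have "\<dots> = C * (\<Sum>n<N. norm z ^ n / fact (4 * n))" by (rule sum_distrib_left [symmetric])
    also have "\<dots> \<le> C * exp (norm z powr (1 / 4))" using C by (intro mult_left_mono sum_power_fact4_le) auto
    finally show ?thesis .
  qed
  have summ: "summable (\<lambda>n. norm (complex_of_real (psc L n) * z ^ n))" for z
    by (rule summableI_nonneg_bounded[OF _ part]) auto
  have sums: "(\<lambda>n. complex_of_real (psc L n) * z ^ n) sums \<Psi> z" for z
    unfolding \<Psi>_def by (intro summable_sums summable_norm_cancel[OF summ])
  have hol: "\<Psi> holomorphic_on UNIV"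
  proof (rule holomorphic_onI, rule field_differentiable_at_within)
    fix z :: complex
    have "\<Psi> holomorphic_on ball 0 (norm z + 1)"
      by (rule power_series_holomorphic) (use sums in simp)
    thus "\<Psi> field_differentiable at z" by (rule holomorphic_on_imp_differentiable_at) auto
  qed
  have order: "norm (\<Psi> z) \<le> C * exp (norm z powr (1 / 4))" for z
  proof -
    have "norm (\<Psi> z) \<le> (\<Sum>n. norm (complex_of_real (psc L n) * z ^ n))"
      unfolding \<Psi>_def by (rule summable_norm[OF summ])
    also have "\<dots> \<le> C * exp (norm z powr (1 / 4))" by (rule suminf_le_const[OF summ part])
    finally show ?thesis .
  qed
  have \<Psi>_real: "\<Psi> (of_real v) = of_real (psi L v)" for v
  proof -
    have "(\<lambda>n. complex_of_real (psc L n * v ^ n)) sums of_real (psi L v)"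
      by (intro sums_of_real psi_sums[OF L(1) LD])
    thus ?thesis using sums[of "of_real v"] by (simp add: sums_iff)
  qed
  obtain C' where C': "\<And>v. v \<ge> 0 \<Longrightarrow> \<bar>psi L v\<bar> \<le> C' * (1 + v)"
    using psi_linear_bound[OF L right] by blast
  obtain c0 c1 where aff: "\<And>z. \<Psi> z = c0 + c1 * z"
    using affine_of_small_order[OF hol order, of C'] C' by (auto simp: \<Psi>_real)
  \<comment> \<open>The linear part of an affine function is odd, so the symmetrised function is
    constant.\<close>
  have sym: "psi L v + psi L (- v) = 2 * Re c0" for v
  proof -
    have "complex_of_real (psi L v + psi L (- v)) = \<Psi> (of_real v) + \<Psi> (of_real (- v))"
      by (simp only: \<Psi>_real of_real_add)
    also have "\<dots> = 2 * c0" by (simp add: aff algebra_simps)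
    finally show ?thesis by (metis Re_complex_of_real mult_2 plus_complex.sel(1))
  qed
  \<comment> \<open>The choice \<open>v = 1 + exp t\<close> makes |v| - 1 equal to
    \<open>exp t\<close>, so the logarithmic lower bound becomes linear in \<open>t\<close>.\<close>
  have grow: "4 * gau 1 * (2 * t) - 2 * C0 \<le> psi L (1 + exp t) + psi L (- (1 + exp t))" for t
  proof -
    have l: "2 * t \<le> ln (1 + (exp t)\<^sup>2)"
    proof -
      have "2 * t = ln ((exp t)\<^sup>2)" by (simp add: ln_realpow)
      also have "\<dots> \<le> ln (1 + (exp t)\<^sup>2)" by (intro ln_mono) (auto intro: add_pos_nonneg)
      finally show ?thesis .
    qed
    have "4 * gau 1 * (2 * t) \<le> 4 * gau 1 * ln (1 + (exp t)\<^sup>2)" by (intro mult_left_mono l) auto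
    moreover have "2 * gau 1 * ln (1 + (exp t)\<^sup>2) - C0 \<le> psi L (1 + exp t)"
      using psi_log_lower_bound[OF L low, of "1 + exp t"] by simp
    moreover have "2 * gau 1 * ln (1 + (exp t)\<^sup>2) - C0 \<le> psi L (- (1 + exp t))"
    proof -
      have "\<bar>- (1 + exp t)\<bar> = 1 + exp t" using exp_gt_zero[of t] by linarith
      thus ?thesis using psi_log_lower_bound[OF L low, of "- (1 + exp t)"] by (simp only: add_diff_cancel_left') simp
    qed
    ultimately show ?thesis by linarith
  qed
  define g where "g = gau 1"
  have g: "g > 0" by (simp only: g_def gau_pos)
  have bd: "8 * (g * t) \<le> 2 * Re c0 + 2 * C0" for t
    using grow[of t] unfolding sym g_def by simp
  \<comment> \<open>At this value of \<open>t\<close> the left side of \<open>bd\<close> exceeds its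
    bound by \<open>8 * g\<close>.\<close>
  have "8 * (g * ((2 * Re c0 + 2 * C0) / (8 * g) + 1)) = 2 * Re c0 + 2 * C0 + 8 * g"
    using g by (simp add: field_simps)
  with bd[of "(2 * Re c0 + 2 * C0) / (8 * g) + 1"] g show False by linarith
qed

end

section \<open>Finiteness of the support\<close>

text \<open>Decay of order one in \<open>1 + y^2\<close> is all that is taken from
  \<open>pp_upper\<close>: any lower bound for \<open>L\<close> that is unbounded in both directions
  contradicts an affine \<open>psi\<close>.\<close>

lemma (in fading_input) neg_ln_q_lower: "\<exists>C. \<forall>y. ln (1 + y\<^sup>2) - C \<le> L y"
proof -
  obtain C where C: "C > 0" "\<And>x y. x \<in> {0..kappa * A} \<Longrightarrow> pp x y \<le> C / (1 + y\<^sup>2) ^ 1"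
    using pp_upper[OF kappa_A_nonneg, of 1] by blast
  have "ln (1 + y\<^sup>2) - ln C \<le> L y" for y
  proof -
    have p: "1 + y\<^sup>2 > 0" by (intro add_pos_nonneg) auto
    have "q y \<le> C / (1 + y\<^sup>2)" using q_le[OF C(2), of y] by simp
    hence "ln (q y) \<le> ln (C / (1 + y\<^sup>2))" by (rule ln_mono[OF _ q_pos])
    also have "\<dots> = ln C - ln (1 + y\<^sup>2)" using C(1) p by (intro ln_divide_pos) auto
    finally show ?thesis by (simp add: L_def)
  qed
  thus ?thesis by blast
qed

text \<open>Any mass away from \<open>0\<close> makes the right tail of the output density decay at most
  exponentially, because the fading gain is lognormal.\<close>

lemma (in fading_input) abs_L_right:
  assumes x1: "x1 \<in> supp F" "x1 > 0"
  shows "\<exists>C. \<forall>y\<ge>0. \<bar>L y\<bar> \<le> C * (1 + y)"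
proof -
  define m where "m = measure F {x1 / 2<..}"
  have "open {x1 / 2<..}" "x1 \<in> {x1 / 2<..}" using x1(2) by auto
  hence "emeasure F {x1 / 2<..} > 0" using x1(1) unfolding supp_def by blast
  hence m: "m > 0" unfolding m_def by (simp add: emeasure_eq_measure)
  have x1A: "x1 \<le> A" using supp_subset[OF sets_F supported_F] x1(1) by auto
  have le: "kappa * (x1 / 2) \<le> kappa * A" using kappa_pos x1 x1A by (intro mult_left_mono) auto
  have pos: "0 < kappa * (x1 / 2)" using kappa_pos x1 by simp
  obtain C where C: "C > 0"
    "\<And>x y. x \<in> {kappa * (x1 / 2)..kappa * A} \<Longrightarrow> y \<ge> 0 \<Longrightarrow> exp (- C * (1 + y)) \<le> pp x y"
    using pp_lower_right[OF pos le] by blast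
  obtain C0 where C0: "\<And>y. ln (1 + y\<^sup>2) - C0 \<le> L y" using neg_ln_q_lower by blast
  have "\<bar>L y\<bar> \<le> (C + \<bar>ln m\<bar> + \<bar>C0\<bar>) * (1 + y)" if y: "y \<ge> 0" for y
  proof -
    have "(\<integral>x. exp (- C * (1 + y)) * indicator {x1 / 2<..} x \<partial>F) \<le> q y"
      unfolding q_def
    proof (rule integral_mono_AE)
      show "AE x in F. exp (- C * (1 + y)) * indicator {x1 / 2<..} x \<le> pp (kappa * x) y"
      proof (rule eventually_mono[OF supported_F])
        fix x assume x: "x \<in> {0..A}"
        show "exp (- C * (1 + y)) * indicator {x1 / 2<..} x \<le> pp (kappa * x) y"
        proof (cases "x > x1 / 2")
          case True
          hence "kappa * x \<in> {kappa * (x1 / 2)..kappa * A}"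
            using x kappa_pos by (auto intro: mult_left_mono)
          from C(2)[OF this y] show ?thesis using True by simp
        qed simp
      qed
    qed (auto simp: emeasure_eq_measure intro!: integrable_real_indicator)
    hence "exp (- C * (1 + y)) * m \<le> q y" by (simp add: m_def)
    hence "ln (exp (- C * (1 + y)) * m) \<le> ln (q y)" using m by (intro ln_mono) auto
    hence "L y \<le> C * (1 + y) - ln m" using m by (simp add: L_def ln_mult algebra_simps)
    moreover have "- \<bar>C0\<bar> \<le> L y"
    proof -
      have "0 \<le> ln (1 + y\<^sup>2)" by (rule ln_ge_zero) simp
      thus ?thesis using C0[of y] by linarith
    qed
    moreover have "\<bar>ln m\<bar> * 1 \<le> \<bar>ln m\<bar> * (1 + y)" by (rule mult_left_mono) (use y in auto)
    moreover have "\<bar>C0\<bar> * 1 \<le> \<bar>C0\<bar> * (1 + y)" by (rule mult_left_mono) (use y in auto)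
    moreover have "0 \<le> C * (1 + y)" using y C(1) by auto
    moreover have "(C + \<bar>ln m\<bar> + \<bar>C0\<bar>) * (1 + y) = C * (1 + y) + \<bar>ln m\<bar> * (1 + y) + \<bar>C0\<bar> * (1 + y)"
      by (simp only: distrib_right)
    ultimately show ?thesis by linarith
  qed
  thus ?thesis by blast
qed

theorem (in fading_input) optimal_supp_finite:
  assumes c: "c > 0"
    and adm: "admissible A eps Eth b c F"
    and opt: "\<And>G. admissible A eps Eth b c G \<Longrightarrow> mutual_info kappa s2 sg G \<le> mutual_info kappa s2 sg F"
  shows "finite (supp F)"
proof (rule ccontr)
  assume inf: "infinite (supp F)"
  have sub: "supp F \<subseteq> {0..A}" by (rule supp_subset[OF sets_F supported_F])
  obtain x0 where x0: "x0 \<in> {0..A}" "x0 islimpt supp F"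
    using inf sub compact_Icc[of 0 A] unfolding compact_eq_Bolzano_Weierstrass by blast
  obtain \<alpha> \<beta> \<gamma> where aff: "\<And>x. x \<in> supp F \<Longrightarrow>
      NN (kappa * x) + JJ L (kappa * x) = \<alpha> + \<beta> * x + \<gamma> * energy b c x"
    using optimal_affine_on_supp[OF c adm opt] by blast
  \<comment> \<open>The support condition in the rescaled variable kappa x, which accounts for the
    divisions by \<open>kappa\<close> in the multipliers and in \<open>c\<close>.\<close>
  define Z where "Z = {x. NN x + JJ L x = \<alpha> + \<beta> / kappa * x + \<gamma> * b / kappa * (x * ln (1 + c / kappa * x))}"
  have Z: "kappa * x \<in> Z" if "x \<in> supp F" for x
    using aff[OF that] kappa_pos by (simp add: Z_def energy_def)
  have c': "c / kappa > 0" using c kappa_pos by simp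
  obtain D where D: "\<And>y. \<bar>L y\<bar> \<le> D * (1 + y\<^sup>2)" using abs_L_le by blast
  \<comment> \<open>An infinite support has a point other than \<open>0\<close>; the mass near it is
    what makes the right tail of the output density heavy.\<close>
  obtain x1 where x1: "x1 \<in> supp F" "x1 > 0"
  proof -
    have "infinite (supp F - {0})" using inf by simp
    then obtain x where "x \<in> supp F - {0}" using infinite_imp_nonempty by blast
    thus ?thesis using that[of x] sub by force
  qed
  obtain C0 where C0: "\<And>y. ln (1 + y\<^sup>2) - C0 \<le> L y" using neg_ln_q_lower by blast
  obtain C1 where C1: "\<And>y. y \<ge> 0 \<Longrightarrow> \<bar>L y\<bar> \<le> C1 * (1 + y)" using abs_L_right[OF x1] by blast
  have "\<exists>X. (\<forall>i::nat. X i > 0 \<and> X i \<in> Z) \<and> X \<longlonglongrightarrow> 0"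
  proof (cases "x0 = 0")
    case True
    then obtain s where s: "\<And>i. s i \<in> supp F - {0}" "s \<longlonglongrightarrow> 0"
      using x0(2) unfolding islimpt_sequential by blast
    have "s i > 0" for i using s(1)[of i] sub by force
    moreover have "(\<lambda>i. kappa * s i) \<longlonglongrightarrow> kappa * 0" by (intro tendsto_intros s(2))
    ultimately show ?thesis using s(1) Z kappa_pos
      by (intro exI[of _ "\<lambda>i. kappa * s i"]) auto
  next
    case False
    obtain s where s: "\<And>i. s i \<in> supp F - {x0}" "s \<longlonglongrightarrow> x0"
      using x0(2) unfolding islimpt_sequential by blast
    have "(\<lambda>i. kappa * s i) \<longlonglongrightarrow> kappa * x0" by (intro tendsto_intros s(2))
    moreover have "kappa * s i \<in> Z - {kappa * x0}" for i using s(1)[of i] Z kappa_pos by auto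
    ultimately have "(kappa * x0) islimpt Z"
      unfolding islimpt_sequential by (intro exI[of _ "\<lambda>i. kappa * s i"]) auto
    hence lim: "(kappa * x0) islimpt {x. NN x + JJ L x = \<alpha> + \<beta> / kappa * x + \<gamma> * b / kappa * (x * ln (1 + c / kappa * x))}"
      unfolding Z_def .
    have "kappa * x0 > 0" using False x0(1) kappa_pos by simp
    from zeros_accumulate_at_pos[OF L_measurable D c' this lim] have "x \<in> Z" if "x > 0" for x
      using that unfolding Z_def by (intro CollectI)
    thus ?thesis using LIMSEQ_inverse_real_of_nat
      by (intro exI[of _ "\<lambda>i. inverse (real (Suc i))"]) auto
  qed
  then obtain X where X: "\<And>i::nat. X i > 0" "\<And>i. X i \<in> Z" "X \<longlonglongrightarrow> 0" by blast
  show False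
    by (rule zeros_do_not_accumulate_at_0[OF L_measurable D c' C0 C1 X(1,3) X(2)[unfolded Z_def mem_Collect_eq]])
qed

theorem theorem3:
  fixes A eps Eth b c kappa s2l sg :: real
  assumes "A > 0" and "eps > 0" and "Eth \<ge> 0" and "b > 0" and "c > 0"
    and "kappa > 0" and "s2l > 0" and "sg > 0"
    and "\<exists>F. admissible A eps Eth b c F"
  shows "(\<exists>F. admissible A eps Eth b c F \<and>
            (\<forall>G. admissible A eps Eth b c G \<longrightarrow> mutual_info kappa s2l sg G \<le> mutual_info kappa s2l sg F))
       \<and> (\<forall>F. admissible A eps Eth b c F \<and>
            (\<forall>G. admissible A eps Eth b c G \<longrightarrow> mutual_info kappa s2l sg G \<le> mutual_info kappa s2l sg F)
            \<longrightarrow> finite (supp F) \<and> supp F \<subseteq> {0..A})"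
proof (intro conjI allI impI)
  interpret lognormal_fading s2l sg by unfold_locales (use assms in auto)
  show "\<exists>F. admissible A eps Eth b c F \<and>
      (\<forall>G. admissible A eps Eth b c G \<longrightarrow> mutual_info kappa s2l sg G \<le> mutual_info kappa s2l sg F)"
    using assms by (intro optimum_exists)
  fix F
  assume F: "admissible A eps Eth b c F \<and>
      (\<forall>G. admissible A eps Eth b c G \<longrightarrow> mutual_info kappa s2l sg G \<le> mutual_info kappa s2l sg F)"
  then interpret fading_input s2l sg kappa A F
    using admissible_iff_fading_input[OF lognormal_fading_axioms \<open>kappa > 0\<close> \<open>A > 0\<close>] by blast
  show "finite (supp F)" using F by (intro optimal_supp_finite[OF \<open>c > 0\<close>, of eps Eth b]) auto
  show "supp F \<subseteq> {0..A}" by (rule supp_subset[OF sets_F supported_F])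
qed

end
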